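(* Let $0<p\le q<\infty$, $1<q<\infty$ and $\omega,\nu\in\mathcal{D}$. Then there exists $N=N(\omega,\nu,p,q)\in\mathbb{N}$ (depending only on $\omega,\nu,p,q$) such that the following holds for every $f\in A^1_{\nu_{\log}}$. The small Hankel operator $h^\nu_f:A^p_\omega\to A^q_\nu$ is bounded if and only if $$\sup_{z\in\mathbb{D}}\left|f^{(n)}(z)\right|(1-|z|)^n\frac{\left(\widehat{\nu}(z)(1-|z|)\right)^{\frac1q}}{\left(\widehat{\omega}(z)(1-|z|)\right)^{\frac1p}}<\infty$$ for some (equivalently for all) $n\ge N$. Moreover, $$\|h^\nu_f\|_{A^p_\omega\to A^q_\nu}\asymp\sup_{z\in\mathbb{D}}\left|f^{(n)}(z)\right|(1-|z|)^n\frac{\left(\widehat{\nu}(z)(1-|z|)\right)^{\frac1q}}{\left(\widehat{\omega}(z)(1-|z|)\right)^{\frac1p}}+\sum_{j=0}^{n-1}|f^{(j)}(0)|$$ for each fixed $n\ge N$.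
   Context: $\mathbb{D}$ is the open unit disc in $\mathbb{C}$, $\mathcal{H}(\mathbb{D})$ the space of analytic functions on $\mathbb{D}$, $H^\infty$ the bounded ones, and $dA=\frac{dx\,dy}{\pi}$ normalized area measure. A radial weight is a non-negative $\omega\in L^1(\mathbb{D},dA)$ with $\omega(z)=\omega(|z|)$. Write $\widehat{\omega}(z)=\int_{|z|}^1\omega(s)\,ds$; all radial weights are assumed to satisfy $\widehat{\omega}(z)>0$ for all $z\in\mathbb{D}$. For $0<p<\infty$, $\|f\|_{L^p_\omega}^p=\int_{\mathbb{D}}|f|^p\omega\,dA$ and $A^p_\omega=L^p_\omega\cap\mathcal{H}(\mathbb{D})$. A radial weight $\omega$ belongs to $\widehat{\mathcal{D}}$ if there is $C\ge1$ with $\widehat{\omega}(r)\le C\,\widehat{\omega}(\frac{1+r}{2})$ for all $0\le r<1$; it belongs to $\check{\mathcal{D}}$ if there are $K>1$ and $C>1$ with $\widehat{\omega}(r)\ge C\,\widehat{\omega}(1-\frac{1-r}{K})$ for all $0\le r<1$. Set $\mathcal{D}=\widehat{\mathcal{D}}\cap\check{\mathcal{D}}$. For a radial weight $\nu$, $A^1_{\nu_{\log}}$ is the set of $f\in\mathcal{H}(\mathbb{D})$ with $\int_{\mathbb{D}}|f(z)|\left(\log\frac{e}{1-|z|}\right)\nu(z)\,dA(z)<\infty$. $B^\nu_z$ denotes the reproducing kernel of the Hilbert space $A^2_\nu$ at $z\in\mathbb{D}$, with inner product $\int_{\mathbb{D}}f\overline{g}\,\nu\,dA$. The small Hankel operator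 is $$h_f^\nu(g)(z)=\int_{\mathbb{D}}f(\zeta)\overline{g(\zeta)B^\nu_z(\zeta)}\,\nu(\zeta)\,dA(\zeta),\quad z\in\mathbb{D},$$ which is defined for $g\in H^\infty$ when $f\in A^1_{\nu_{\log}}$. Since $H^\infty$ is dense in $A^p_\omega$, $h^\nu_f:A^p_\omega\to A^q_\nu$ is called bounded if $\|h^\nu_f(g)\|_{L^q_\nu}\le C\|g\|_{L^p_\omega}$ for all $g\in H^\infty$ and some $C>0$; the least such $C$ is $\|h^\nu_f\|_{A^p_\omega\to A^q_\nu}$. $a\asymp b$ means $C^{-1}a\le b\le Ca$ with a constant $C>0$ independent of $f$ (it may depend on $\omega,\nu,p,q,n$). *)

theory Defs
  imports "HOL-Analysis.Analysis"
begin

definition disc_area :: "complex measure" where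
  "disc_area = density (lebesgue_on (ball 0 1)) (\<lambda>_. ennreal (1 / pi))"

text \<open>
  Functions on the disc are total functions on the complex plane of which only the values on
  the unit disc matter.
\<close>

definition hat :: "(complex \<Rightarrow> real) \<Rightarrow> complex \<Rightarrow> real" where
  "hat w z = (LINT s:{cmod z..<1}|lebesgue. w (complex_of_real s))"

text \<open>
  An integrable radial function on the disc has an integrable profile on every interval
  \<open>[r, 1)\<close> with \<open>r > 0\<close>, but not necessarily on \<open>[0, 1)\<close>. As the Bochner integral of a
  non-integrable function is \<open>0\<close>, the positivity of \<^const>\<open>hat\<close> at the origin below also demands
  integrability of the profile on \<open>[0, 1)\<close>. The doubling condition defining \<open>D_hat\<close> at \<open>r = 0\<close>,
  read in the extended reals, demands this as well.
\<close>

definition radial_weight :: "(complex \<Rightarrow> real) \<Rightarrow> bool" where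
  "radial_weight w \<longleftrightarrow>
     integrable disc_area w \<and>
     (\<forall>z\<in>ball 0 1. w z \<ge> 0) \<and>
     (\<forall>z\<in>ball 0 1. w z = w (complex_of_real (cmod z))) \<and>
     (\<forall>z\<in>ball 0 1. hat w z > 0)"

definition D_hat :: "(complex \<Rightarrow> real) set" where
  "D_hat = {w. radial_weight w \<and>
     (\<exists>C\<ge>1. \<forall>r. 0 \<le> r \<and> r < 1 \<longrightarrow>
        hat w (complex_of_real r) \<le> C * hat w (complex_of_real ((1 + r) / 2)))}"

definition D_check :: "(complex \<Rightarrow> real) set" where
  "D_check = {w. radial_weight w \<and>
     (\<exists>K>1. \<exists>C>1. \<forall>r. 0 \<le> r \<and> r < 1 \<longrightarrow>
        hat w (complex_of_real r) \<ge> C * hat w (complex_of_real (1 - (1 - r) / K)))}"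

definition class_D :: "(complex \<Rightarrow> real) set" where
  "class_D = D_hat \<inter> D_check"

definition ennreal_root :: "real \<Rightarrow> ennreal \<Rightarrow> ennreal" where
  "ennreal_root p x = (if x = \<infinity> then \<infinity> else ennreal (enn2real x powr (1 / p)))"

definition Lp_norm :: "real \<Rightarrow> (complex \<Rightarrow> real) \<Rightarrow> (complex \<Rightarrow> complex) \<Rightarrow> ennreal" where
  "Lp_norm p w f = ennreal_root p (\<integral>\<^sup>+ z. ennreal (cmod (f z) powr p * w z) \<partial>disc_area)"

definition bergman :: "real \<Rightarrow> (complex \<Rightarrow> real) \<Rightarrow> (complex \<Rightarrow> complex) set" where
  "bergman p w = {f. f holomorphic_on ball 0 1 \<and> Lp_norm p w f < \<infinity>}"

definition H_infinity :: "(complex \<Rightarrow> complex) set" where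
  "H_infinity = {g. g holomorphic_on ball 0 1 \<and> bounded (g ` ball 0 1)}"

definition bergman1_log :: "(complex \<Rightarrow> real) \<Rightarrow> (complex \<Rightarrow> complex) set" where
  "bergman1_log v = {f. f holomorphic_on ball 0 1 \<and>
     (\<integral>\<^sup>+ z. ennreal (cmod (f z) * ln (exp 1 / (1 - cmod z)) * v z) \<partial>disc_area) < \<infinity>}"

definition inner_L2 ::
    "(complex \<Rightarrow> real) \<Rightarrow> (complex \<Rightarrow> complex) \<Rightarrow> (complex \<Rightarrow> complex) \<Rightarrow> complex" where
  "inner_L2 v f g = (LINT \<zeta>|disc_area. f \<zeta> * cnj (g \<zeta>) * complex_of_real (v \<zeta>))"

definition is_reproducing_kernel ::
    "(complex \<Rightarrow> real) \<Rightarrow> complex \<Rightarrow> (complex \<Rightarrow> complex) \<Rightarrow> bool" where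
  "is_reproducing_kernel v z B \<longleftrightarrow>
     B \<in> bergman 2 v \<and> (\<forall>f\<in>bergman 2 v. f z = inner_L2 v f B)"

text \<open>The reproducing kernel is unique on the disc; its values off the disc are irrelevant.\<close>

definition kernel :: "(complex \<Rightarrow> real) \<Rightarrow> complex \<Rightarrow> complex \<Rightarrow> complex" where
  "kernel v z = (SOME B. is_reproducing_kernel v z B)"

definition small_hankel ::
    "(complex \<Rightarrow> real) \<Rightarrow> (complex \<Rightarrow> complex) \<Rightarrow> (complex \<Rightarrow> complex) \<Rightarrow> complex \<Rightarrow> complex" where
  "small_hankel v f g z =
     (LINT \<zeta>|disc_area. f \<zeta> * cnj (g \<zeta> * kernel v z \<zeta>) * complex_of_real (v \<zeta>))"

definition hankel_bounded ::
    "real \<Rightarrow> (complex \<Rightarrow> real) \<Rightarrow> real \<Rightarrow> (complex \<Rightarrow> real) \<Rightarrow> (complex \<Rightarrow> complex) \<Rightarrow> bool" where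
  "hankel_bounded p w q v f \<longleftrightarrow>
     (\<exists>C>0. \<forall>g\<in>H_infinity. Lp_norm q v (small_hankel v f g) \<le> ennreal C * Lp_norm p w g)"

text \<open>The operator norm is \<open>\<infinity>\<close> exactly when the operator is unbounded.\<close>

definition hankel_norm ::
    "real \<Rightarrow> (complex \<Rightarrow> real) \<Rightarrow> real \<Rightarrow> (complex \<Rightarrow> real) \<Rightarrow> (complex \<Rightarrow> complex) \<Rightarrow> ennreal" where
  "hankel_norm p w q v f =
     Inf {ennreal C | C. C > 0 \<and>
       (\<forall>g\<in>H_infinity. Lp_norm q v (small_hankel v f g) \<le> ennreal C * Lp_norm p w g)}"

definition deriv_sup ::
    "real \<Rightarrow> (complex \<Rightarrow> real) \<Rightarrow> real \<Rightarrow> (complex \<Rightarrow> real) \<Rightarrow> nat \<Rightarrow> (complex \<Rightarrow> complex) \<Rightarrow> ennreal" where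
  "deriv_sup p w q v n f =
     (SUP z\<in>ball 0 1. ennreal (cmod ((deriv ^^ n) f z) * (1 - cmod z) ^ n *
        ((hat v z * (1 - cmod z)) powr (1 / q) / (hat w z * (1 - cmod z)) powr (1 / p))))"

definition comparable_on :: "'a set \<Rightarrow> ('a \<Rightarrow> ennreal) \<Rightarrow> ('a \<Rightarrow> ennreal) \<Rightarrow> bool" where
  "comparable_on S a b \<longleftrightarrow>
     (\<exists>C>0. \<forall>x\<in>S. ennreal (1 / C) * a x \<le> b x \<and> b x \<le> ennreal C * a x)"

end

theory Submission
  imports Defs "HOL-Complex_Analysis.Complex_Analysis"
begin

text \<open>
  Write \<open>W\<close> and \<open>V\<close> for the tails of \<open>\<omega>\<close> and \<open>\<nu>\<close>, \<open>X(r) = (W(r)(1-r))\<^sup>1\<^sup>/\<^sup>p / (V(r)(1-r))\<^sup>1\<^sup>/\<^sup>q\<close>, and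
  \<open>\<Phi>\<^sub>n(cnj z \<zeta>)\<close> for the \<open>n\<close>-th derivative of the kernel of \<open>A\<^sup>2\<^sub>\<nu>\<close> in the conjugate of \<open>z\<close>, up to the
  factor \<open>\<zeta>\<^sup>n\<close>. The Taylor coefficients of \<open>\<Phi>\<^sub>n\<close> are quotients by the moments of \<open>\<nu>\<close>; their differences
  of all orders decay like those of a power of the index divided by \<open>V(1 - 1/(k+1))\<close>, so repeated
  summation by parts bounds \<open>\<Phi>\<^sub>n(w)\<close> by a multiple of
  \<open>\<bar>1-w\<bar>\<^sup>-\<^sup>n\<^sup>-\<^sup>1 ((1-\<bar>w\<bar>)/\<bar>1-w\<bar>)\<^sup>\<alpha> / V(\<bar>w\<bar>)\<close>.

  Necessity: the pairing of \<open>h\<^sub>f(g)\<close> with \<open>h\<close> is that of \<open>f\<close> with \<open>gh\<close>. For \<open>g(\<zeta>) = (1 - cnj z \<zeta>)\<^sup>-\<^sup>M\<close> and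
  \<open>h(\<zeta>) = \<zeta>\<^sup>n (1 - cnj z \<zeta>)\<^sup>M \<Phi>\<^sub>n(cnj z \<zeta>)\<close> it equals the \<open>n\<close>-th derivative of \<open>f\<close> at \<open>z\<close>, and Hoelder's
  inequality gives the estimate; for \<open>g = 1\<close> and \<open>h(\<zeta>) = \<zeta>\<^sup>j\<close> it gives the Taylor coefficients of \<open>f\<close>.

  Sufficiency: since \<open>n\<close>-fold integration of the weight divides its \<open>k\<close>-th moment by \<open>(k+1)\<^sup>n\<close>, the
  pairing of \<open>f\<close> with \<open>G\<close> with respect to \<open>\<nu>\<close> equals that of \<open>((z \<cdot>)')\<^sup>n f\<close> with \<open>G\<close> with respect to a
  weight of size \<open>V(r)(1-r)\<^sup>n\<^sup>-\<^sup>1\<close>. Hence \<open>h\<^sub>f(g)\<close> is dominated by the maximal Bergman projection of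
  \<open>\<bar>g\<bar> X\<close> with respect to \<open>V(r)/(1-r)\<close>, which Schur's test controls. Finally the \<open>q\<close>-th power of
  \<open>\<bar>g\<bar> X\<close> integrates to at most a multiple of the \<open>q\<close>-th power of the norm of \<open>g\<close>, because
  \<open>\<bar>g(z)\<bar>\<^sup>p W(\<bar>z\<bar>)(1-\<bar>z\<bar>)\<close> is bounded by a multiple of the \<open>p\<close>-th power of that norm and \<open>p \<le> q\<close>.
\<close>

section \<open>Polar coordinates on the disc\<close>

text \<open>A weight of the class need not be comparable pointwise with its smoothed form
  \<open>V r / (1 - r)\<close>: it may vanish on whole annuli. The two are exchangeable only under
  integrals of functions that increase with the radius. Hence circular means of |g|^p have to be
  shown to increase, also for p < 1, and the radial estimates for the weight itself are derived from
  those for the smoothed form. The factor with exponent \<alpha> in the kernel bound comes from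
  \<open>D_check\<close>. Without it the mean of |1 - w|^(-1) over a circle would produce a
  logarithm, which the powers used in Schur's test do not absorb; with it the mean of |\<Phi> 0|
  over the circle of radius |w| is at most a constant divided by V(|w|). Two integrability
  conditions fix the threshold for n. The test function g requires M p > 1 + \<beta> with the
  exponent \<beta> of \<omega>, and the n + 1 - M powers of 1 / |1 - cnj z \<zeta>| left in h
  suffice once n is at least M plus the exponent \<beta> of \<nu>. For such n the factor (1 -
  r)^(-n) also outweighs the decay of X, so that the lower derivatives can be recovered from the
  n-th one and the values at 0.\<close>

definition circ :: "real \<Rightarrow> complex" where
  "circ x = cis (2 * pi * x)"

definition unit_interval :: "real measure" where
  "unit_interval = restrict_space lborel {0..1}"

text \<open>The measure v r dr dx in polar coordinates with the angle measured in turns, on the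
  Borel sets of the disc. The Jacobian belongs to v: a weight with profile u gives
  \<open>rad\<close> of the density 2 r u r.\<close>

definition rad :: "(real \<Rightarrow> ennreal) \<Rightarrow> complex measure" where
  "rad v = distr (density (restrict_space lborel {0<..<1}) v \<Otimes>\<^sub>M unit_interval)
     (restrict_space borel (ball 0 1)) (\<lambda>(r, x). of_real r * circ x)"

lemma norm_circ [simp]: "cmod (circ x) = 1"
  by (simp add: circ_def)

lemma circ_add: "circ (x + y) = circ x * circ y"
  by (simp add: circ_def cis_mult ring_distribs)

lemma circ_periodic: "circ (x + 1) = circ x"
  by (simp add: circ_def ring_distribs cis_mult[symmetric])

lemma continuous_on_circ [continuous_intros]: "continuous_on S f \<Longrightarrow> continuous_on S (\<lambda>x. circ (f x))"
  unfolding circ_def by (intro continuous_intros)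

lemma borel_measurable_circ [measurable]: "circ \<in> borel_measurable borel"
  by (intro borel_measurable_continuous_onI continuous_on_circ continuous_on_id)

lemma ex_circ: "\<exists>x. z = of_real (cmod z) * circ x"
proof -
  have "z = of_real (cmod z) * circ (Arg z / (2 * pi))"
    by (simp add: circ_def) (metis rcis_cmod_Arg rcis_def)
  then show ?thesis by blast
qed

lemma space_unit_interval [simp]: "space unit_interval = {0..1}"
  by (simp add: unit_interval_def space_restrict_space)

lemma emeasure_unit_interval [simp]: "emeasure unit_interval {0..1} = 1"
  by (simp add: unit_interval_def emeasure_restrict_space)

interpretation unit_interval: finite_measure unit_interval
  by (rule finite_measureI) simp

lemma measurable_unit_intervalI [measurable (raw)]:
  "f \<in> measurable borel M \<Longrightarrow> f \<in> measurable unit_interval M"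
  unfolding unit_interval_def by (rule measurable_restrict_space1) simp

lemma nn_integral_unit_interval:
  "(\<integral>\<^sup>+x. f x \<partial>unit_interval) = (\<integral>\<^sup>+x. f x * indicator {0..1} x \<partial>lborel)"
  unfolding unit_interval_def by (rule nn_integral_restrict_space) simp

lemma nn_integral_circ_shift_aux:
  fixes F :: "complex \<Rightarrow> ennreal"
  assumes [measurable]: "F \<in> borel_measurable borel" and a: "0 \<le> a" "a \<le> 1"
  shows "(\<integral>\<^sup>+x. F (circ (x + a)) \<partial>unit_interval) = (\<integral>\<^sup>+x. F (circ x) \<partial>unit_interval)"
proof -
  have "(\<integral>\<^sup>+x. F (circ (x + a)) \<partial>unit_interval)
    = (\<integral>\<^sup>+x. F (circ (a + 1 * x)) * indicator {a..a+1} (a + 1 * x) \<partial>lborel)"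
    unfolding nn_integral_unit_interval
    by (intro nn_integral_cong) (auto simp: indicator_def add.commute)
  also have "\<dots> = (\<integral>\<^sup>+y. F (circ y) * indicator {a..a+1} y \<partial>lborel)"
    using nn_integral_real_affine[of "\<lambda>y. F (circ y) * indicator {a..a+1} y" 1 a] by simp
  also have "\<dots> = (\<integral>\<^sup>+y. F (circ y) * indicator {a..1} y + F (circ y) * indicator {1<..a+1} y \<partial>lborel)"
    using a by (intro nn_integral_cong) (auto simp: indicator_def)
  also have "\<dots> = (\<integral>\<^sup>+y. F (circ y) * indicator {a..1} y \<partial>lborel) + (\<integral>\<^sup>+y. F (circ y) * indicator {1<..a+1} y \<partial>lborel)"
    by (rule nn_integral_add) auto
  also have "(\<integral>\<^sup>+y. F (circ y) * indicator {1<..a+1} y \<partial>lborel)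
     = (\<integral>\<^sup>+y. F (circ (1 + 1 * y)) * indicator {1<..a+1} (1 + 1 * y) \<partial>lborel)"
    using nn_integral_real_affine[of "\<lambda>y. F (circ y) * indicator {1<..a+1} y" 1 1] by simp
  also have "\<dots> = (\<integral>\<^sup>+y. F (circ y) * indicator {0<..a} y \<partial>lborel)"
    using circ_periodic by (intro nn_integral_cong) (auto simp: indicator_def add.commute)
  also have "(\<integral>\<^sup>+y. F (circ y) * indicator {a..1} y \<partial>lborel) + \<dots>
     = (\<integral>\<^sup>+y. F (circ y) * indicator {a..1} y + F (circ y) * indicator {0<..a} y \<partial>lborel)"
    by (rule nn_integral_add[symmetric]) auto
  also have "\<dots> = (\<integral>\<^sup>+x. F (circ x) \<partial>unit_interval)"
    unfolding nn_integral_unit_interval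
    using AE_lborel_singleton[of a] AE_lborel_singleton[of 0] a
    by (intro nn_integral_cong_AE) (auto simp: indicator_def)
  finally show ?thesis .
qed

lemma nn_integral_circ_shift:
  fixes F :: "complex \<Rightarrow> ennreal"
  assumes [measurable]: "F \<in> borel_measurable borel"
  shows "(\<integral>\<^sup>+x. F (circ (x + a)) \<partial>unit_interval) = (\<integral>\<^sup>+x. F (circ x) \<partial>unit_interval)"
proof -
  have "circ (x + a) = circ (x + frac a)" for x
  proof -
    have "circ (x + a) = circ (x + frac a) * circ (of_int \<lfloor>a\<rfloor>)"
      by (simp add: circ_add[symmetric] frac_def)
    also have "circ (of_int \<lfloor>a\<rfloor>) = 1"
      by (simp add: circ_def cis_multiple_2pi)
    finally show ?thesis by simp
  qed
  then show ?thesis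
    using nn_integral_circ_shift_aux[OF assms, of "frac a"] by (simp add: frac_lt_1 less_imp_le)
qed

lemma nn_integral_circle_rotate:
  fixes F :: "complex \<Rightarrow> ennreal"
  assumes [measurable]: "F \<in> borel_measurable borel"
  shows "(\<integral>\<^sup>+x. F (z * circ x) \<partial>unit_interval) = (\<integral>\<^sup>+x. F (of_real (cmod z) * circ x) \<partial>unit_interval)"
proof -
  obtain a where a: "z = of_real (cmod z) * circ a" using ex_circ by blast
  have "(\<integral>\<^sup>+x. F (z * circ x) \<partial>unit_interval) = (\<integral>\<^sup>+x. (\<lambda>w. F (of_real (cmod z) * w)) (circ (x + a)) \<partial>unit_interval)"
    by (subst a) (simp add: circ_add mult_ac)
  also have "\<dots> = (\<integral>\<^sup>+x. F (of_real (cmod z) * circ x) \<partial>unit_interval)"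
    by (rule nn_integral_circ_shift) simp
  finally show ?thesis .
qed

section \<open>Rotation invariance of planar Lebesgue measure and polar integration\<close>

lemma measurable_Complex [measurable (raw)]:
  assumes "f \<in> borel_measurable M" "g \<in> borel_measurable M"
  shows "(\<lambda>x. Complex (f x) (g x)) \<in> borel_measurable M"
  using assms unfolding Complex_eq by measurable

lemma lborel_complex_eq:
  "lborel = distr (lborel \<Otimes>\<^sub>M lborel) borel (\<lambda>(x, y). Complex x y)"
proof (rule lborel_eqI)
  have [measurable]: "(\<lambda>(x, y). Complex x y) \<in> borel_measurable (lborel \<Otimes>\<^sub>M lborel)"
    unfolding Complex_eq case_prod_unfold by measurable
  fix l u :: complex assume le: "\<And>b. b \<in> Basis \<Longrightarrow> l \<bullet> b \<le> u \<bullet> b"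
  have *: "Re l \<le> Re u" "Im l \<le> Im u"
    using le[of 1] le[of \<i>] by (auto simp: Basis_complex_def)
  have "(\<lambda>(x, y). Complex x y) -` box l u = {Re l<..<Re u} \<times> {Im l<..<Im u}"
    by (auto simp: box_def Basis_complex_def)
  then have "emeasure (distr (lborel \<Otimes>\<^sub>M lborel) borel (\<lambda>(x, y). Complex x y)) (box l u)
    = emeasure (lborel \<Otimes>\<^sub>M lborel) ({Re l<..<Re u} \<times> {Im l<..<Im u})"
    by (subst emeasure_distr) (auto simp: space_pair_measure)
  also have "\<dots> = ennreal (Re u - Re l) * ennreal (Im u - Im l)"
    using * by (subst lborel.emeasure_pair_measure_Times) auto
  also have "\<dots> = ennreal (\<Prod>b\<in>Basis. (u - l) \<bullet> b)"
    using * by (simp add: Basis_complex_def ennreal_mult[symmetric])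
  finally show "emeasure (distr (lborel \<Otimes>\<^sub>M lborel) borel (\<lambda>(x, y). Complex x y)) (box l u) = ennreal (\<Prod>b\<in>Basis. (u - l) \<bullet> b)" .
qed simp

lemma nn_integral_complex_iterated:
  fixes F :: "complex \<Rightarrow> ennreal"
  assumes [measurable]: "F \<in> borel_measurable borel"
  shows "(\<integral>\<^sup>+z. F z \<partial>lborel) = (\<integral>\<^sup>+x. \<integral>\<^sup>+y. F (Complex x y) \<partial>lborel \<partial>lborel)"
proof -
  have [measurable]: "(\<lambda>(x, y). Complex x y) \<in> borel_measurable (lborel \<Otimes>\<^sub>M lborel)"
    unfolding case_prod_unfold by measurable
  have "(\<integral>\<^sup>+z. F z \<partial>lborel) = (\<integral>\<^sup>+p. F (Complex (fst p) (snd p)) \<partial>(lborel \<Otimes>\<^sub>M lborel))"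
    by (subst lborel_complex_eq, subst nn_integral_distr) (auto simp: case_prod_unfold)
  also have "\<dots> = (\<integral>\<^sup>+x. \<integral>\<^sup>+y. F (Complex x y) \<partial>lborel \<partial>lborel)"
    using lborel.nn_integral_fst[of "\<lambda>p. F (Complex (fst p) (snd p))" lborel] by simp
  finally show ?thesis .
qed

text \<open>The rotation is carried out one variable at a time: the ordinate is replaced at fixed
  abscissa x, then the abscissa at fixed new ordinate. The Jacobian factors 1 / |c| and |c| with c =
  Re w cancel. This needs c nonzero, which by \<open>AE_Re_circ\<close> excludes only a null set of
  angles.\<close>

lemma nn_integral_rotate:
  fixes F :: "complex \<Rightarrow> ennreal"
  assumes [measurable]: "F \<in> borel_measurable borel" and w: "cmod w = 1" "Re w \<noteq> 0"
  shows "(\<integral>\<^sup>+z. F (w * z) \<partial>lborel) = (\<integral>\<^sup>+z. F z \<partial>lborel)"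
proof -
  define c s where "c = Re w" and "s = Im w"
  have cs: "c\<^sup>2 + s\<^sup>2 = 1" using w(1) by (simp add: c_def s_def cmod_power2[symmetric])
  have c0: "c \<noteq> 0" using w(2) by (simp add: c_def)
  have w_eq: "w = Complex c s" by (simp add: c_def s_def)
  have "(\<integral>\<^sup>+z. F (w * z) \<partial>lborel) = (\<integral>\<^sup>+x. \<integral>\<^sup>+y. F (Complex (c * x - s * y) (s * x + c * y)) \<partial>lborel \<partial>lborel)"
    by (subst nn_integral_complex_iterated) (auto simp: w_eq complex_mult algebra_simps)
  also have "\<dots> = (\<integral>\<^sup>+x. \<integral>\<^sup>+y. ennreal (1/\<bar>c\<bar>) * F (Complex ((x - s * y) / c) y) \<partial>lborel \<partial>lborel)"
  proof (rule nn_integral_cong)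
    fix x :: real
    have "(c * x - s * y) = (x - s * (s * x + c * y)) / c" for y
      using cs c0 by (simp add: field_simps power2_eq_square) algebra
    then have "(\<integral>\<^sup>+y. F (Complex (c * x - s * y) (s * x + c * y)) \<partial>lborel)
       = ennreal (1/\<bar>c\<bar>) * (ennreal \<bar>c\<bar> * (\<integral>\<^sup>+y. F (Complex ((x - s * (s * x + c * y)) / c) (s * x + c * y)) \<partial>lborel))"
      using c0 by (simp add: mult.assoc[symmetric] ennreal_mult[symmetric])
    also have "ennreal \<bar>c\<bar> * (\<integral>\<^sup>+y. F (Complex ((x - s * (s * x + c * y)) / c) (s * x + c * y)) \<partial>lborel) = (\<integral>\<^sup>+y. F (Complex ((x - s * y) / c) y) \<partial>lborel)"
      using nn_integral_real_affine[of "\<lambda>y. F (Complex ((x - s * y) / c) y)" c "s * x"] c0 by simp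
    finally show "(\<integral>\<^sup>+y. F (Complex (c * x - s * y) (s * x + c * y)) \<partial>lborel) =
       (\<integral>\<^sup>+y. ennreal (1/\<bar>c\<bar>) * F (Complex ((x - s * y) / c) y) \<partial>lborel)"
      by (simp add: nn_integral_cmult)
  qed
  also have "\<dots> = (\<integral>\<^sup>+y. \<integral>\<^sup>+x. ennreal (1/\<bar>c\<bar>) * F (Complex ((x - s * y) / c) y) \<partial>lborel \<partial>lborel)"
    by (rule lborel_pair.Fubini') simp
  also have "\<dots> = (\<integral>\<^sup>+y. \<integral>\<^sup>+x. F (Complex x y) \<partial>lborel \<partial>lborel)"
  proof (rule nn_integral_cong)
    fix y :: real
    have "(\<integral>\<^sup>+x. F (Complex x y) \<partial>lborel) = ennreal \<bar>1/c\<bar> * (\<integral>\<^sup>+x. F (Complex (- s * y / c + (1/c) * x) y) \<partial>lborel)"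
      using nn_integral_real_affine[of "\<lambda>x. F (Complex x y)" "1/c" "- s * y / c"] c0 by simp
    also have "(\<lambda>x. - s * y / c + (1/c) * x) = (\<lambda>x. (x - s * y) / c)"
      by (simp add: diff_divide_distrib)
    finally show "(\<integral>\<^sup>+x. ennreal (1/\<bar>c\<bar>) * F (Complex ((x - s * y) / c) y) \<partial>lborel) = (\<integral>\<^sup>+x. F (Complex x y) \<partial>lborel)"
      by (simp add: nn_integral_cmult fun_eq_iff)
  qed
  also have "\<dots> = (\<integral>\<^sup>+z. F z \<partial>lborel)"
    by (subst nn_integral_complex_iterated, simp, rule lborel_pair.Fubini') simp
  finally show ?thesis .
qed

lemma AE_Re_circ: "AE x in unit_interval. Re (circ x) \<noteq> 0"
proof -
  have fin: "finite {x\<in>{0..1}. cos (2 * pi * x) = 0}"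
  proof -
    have "{x\<in>{0..1}. cos (2 * pi * x) = 0} \<subseteq> (\<lambda>i. real_of_int i / 4) ` {0..4}"
    proof
      fix x :: real assume x: "x \<in> {x\<in>{0..1}. cos (2 * pi * x) = 0}"
      then obtain i where "2 * pi * x = of_int i * (pi / 2)"
        by (auto simp: cos_zero_iff_int)
      then have "x = of_int i / 4" by (simp add: field_simps)
      moreover have "i \<in> {0..4}" using x \<open>x = of_int i / 4\<close> by auto
      ultimately show "x \<in> (\<lambda>i. real_of_int i / 4) ` {0..4}" by blast
    qed
    then show ?thesis by (rule finite_subset) simp
  qed
  have "{x\<in>{0..1}. cos (2 * pi * x) = 0} \<in> null_sets lborel"
    by (rule finite_imp_null_set_lborel[OF fin])
  then have "AE x in lborel. x \<notin> {x\<in>{0..1}. cos (2 * pi * x) = 0}" by (rule AE_not_in)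
  then show ?thesis
    unfolding unit_interval_def by (subst AE_restrict_space_iff) (auto simp: circ_def)
qed

text \<open>Both measures give a half-line {..a} the area pi a^2 of the disc of radius a, and these
  half-lines form a generating system stable under intersection.\<close>

lemma distr_cmod_lborel:
  "density lborel (\<lambda>r. ennreal (2 * pi * r) * indicator {0..} r) = distr lborel borel cmod"
proof (rule measure_eqI_generator_eq[where E = "range (\<lambda>a. {..a::real})" and \<Omega> = UNIV and A = "\<lambda>n. {..real n}"])
  show "Int_stable (range (\<lambda>a. {..a::real}))"
    by (rule Int_stableI) (auto simp: min_def)
  show "sets (density lborel (\<lambda>r. ennreal (2 * pi * r) * indicator {0..} r)) = sigma_sets UNIV (range (\<lambda>a. {..a::real}))"
    by (simp add: borel_eq_atMost sets_measure_of)
  show "sets (distr lborel borel cmod) = sigma_sets UNIV (range (\<lambda>a. {..a::real}))"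
    by (simp add: borel_eq_atMost sets_measure_of)
  show "(\<Union>i. {..real i}) = UNIV" by (auto simp: real_arch_simple)
  have main: "emeasure (density lborel (\<lambda>r. ennreal (2 * pi * r) * indicator {0..} r)) {..a} = emeasure (distr lborel borel cmod) {..a}
      \<and> emeasure (density lborel (\<lambda>r. ennreal (2 * pi * r) * indicator {0..} r)) {..a} \<noteq> \<infinity>" for a :: real
  proof (cases "a \<ge> 0")
    case True
    have "emeasure (density lborel (\<lambda>r. ennreal (2 * pi * r) * indicator {0..} r)) {..a}
      = (\<integral>\<^sup>+r. ennreal (2 * pi * r) * indicator {0..a} r \<partial>lborel)"
      by (subst emeasure_density) (auto intro!: nn_integral_cong simp: indicator_def)
    also have "\<dots> = ennreal (pi * a\<^sup>2 - pi * 0\<^sup>2)"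
    proof (rule nn_integral_FTC_Icc)
      show "((\<lambda>x. pi * x\<^sup>2) has_real_derivative 2 * pi * x) (at x)" for x
        by (auto intro!: derivative_eq_intros)
    qed (use True in auto)
    finally have 1: "emeasure (density lborel (\<lambda>r. ennreal (2 * pi * r) * indicator {0..} r)) {..a} = ennreal (pi * a\<^sup>2)" by simp
    have "emeasure (distr lborel borel cmod) {..a} = emeasure lborel (cball (0::complex) a)"
      by (subst emeasure_distr) (auto intro!: arg_cong[where f = "emeasure lborel"])
    also have "\<dots> = ennreal (pi * a\<^sup>2)"
      using True by (simp add: emeasure_cball eval_unit_ball_vol)
    finally show ?thesis using 1 by simp
  next
    case False
    then have "emeasure (density lborel (\<lambda>r. ennreal (2 * pi * r) * indicator {0..} r)) {..a} = 0"
      by (subst emeasure_density) (auto intro!: nn_integral_0_iff_AE[THEN iffD2] simp: indicator_def)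
    moreover have "{z::complex. cmod z \<le> a} = {}"
      using False by (auto intro: order_trans[OF norm_ge_zero])
    then have "emeasure (distr lborel borel cmod) {..a} = 0"
      by (subst emeasure_distr) (auto simp: vimage_def)
    ultimately show ?thesis by simp
  qed
  show "\<And>X. X \<in> range atMost \<Longrightarrow> emeasure (density lborel (\<lambda>r. ennreal (2 * pi * r) * indicator {0..} r)) X = emeasure (distr lborel borel cmod) X"
    using main by auto
  show "emeasure (density lborel (\<lambda>r. ennreal (2 * pi * r) * indicator {0..} r)) {..real i} \<noteq> \<infinity>" for i
    using main[of "real i"] by blast
qed auto

text \<open>No planar change of variables is involved. Averaging over all rotations makes the
  integrand radial without changing its integral, and a radial integrand sees only the distribution
  of the modulus.\<close>

lemma nn_integral_polar:
  fixes F :: "complex \<Rightarrow> ennreal"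
  assumes [measurable]: "F \<in> borel_measurable borel"
  shows "(\<integral>\<^sup>+z. F z \<partial>lborel) =
     (\<integral>\<^sup>+r. ennreal (2 * pi * r) * indicator {0..} r * (\<integral>\<^sup>+x. F (of_real r * circ x) \<partial>unit_interval) \<partial>lborel)"
proof -
  interpret P: pair_sigma_finite lborel unit_interval
    ..
  have mc [measurable]: "circ \<in> measurable unit_interval borel"
    by (intro measurable_unit_intervalI) simp
  have "(\<integral>\<^sup>+z. F z \<partial>lborel) = (\<integral>\<^sup>+x. (\<integral>\<^sup>+z. F z \<partial>lborel) \<partial>unit_interval)"
    by simp
  also have "\<dots> = (\<integral>\<^sup>+x. (\<integral>\<^sup>+z. F (circ x * z) \<partial>lborel) \<partial>unit_interval)"
    by (rule nn_integral_cong_AE) (use AE_Re_circ in \<open>auto simp: nn_integral_rotate\<close>)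
  also have "\<dots> = (\<integral>\<^sup>+z. (\<integral>\<^sup>+x. F (circ x * z) \<partial>unit_interval) \<partial>lborel)"
    by (rule P.Fubini') measurable
  also have "\<dots> = (\<integral>\<^sup>+z. (\<lambda>r. \<integral>\<^sup>+x. F (of_real r * circ x) \<partial>unit_interval) (cmod z) \<partial>lborel)"
    using nn_integral_circle_rotate[OF assms]
    by (intro nn_integral_cong[of lborel]) (simp only: mult.commute[of "circ _"])
  also have "\<dots> = (\<integral>\<^sup>+r. (\<integral>\<^sup>+x. F (of_real r * circ x) \<partial>unit_interval) \<partial>distr lborel borel cmod)"
    by (rule nn_integral_distr[symmetric]) measurable
  also have "\<dots> = (\<integral>\<^sup>+r. ennreal (2 * pi * r) * indicator {0..} r * (\<integral>\<^sup>+x. F (of_real r * circ x) \<partial>unit_interval) \<partial>lborel)"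
    unfolding distr_cmod_lborel[symmetric] by (rule nn_integral_density) measurable
  finally show ?thesis .
qed

section \<open>Radial measures and the Borel profile of a radial weight\<close>

lemma sets_rad [simp, measurable_cong]: "sets (rad v) = sets (restrict_space borel (ball 0 1))"
  by (simp add: rad_def)

lemma space_rad [simp]: "space (rad v) = ball 0 1"
  by (simp add: rad_def space_restrict_space)

lemma measurable_polar:
  "(\<lambda>(r, x). of_real r * circ x) \<in>
     density (restrict_space lborel {0<..<1}) v \<Otimes>\<^sub>M unit_interval \<rightarrow>\<^sub>M restrict_space borel (ball 0 1)"
proof (rule measurable_restrict_space2)
  show "(\<lambda>(r, x). of_real r * circ x) \<in> space (density (restrict_space lborel {0<..<1}) v \<Otimes>\<^sub>M unit_interval) \<rightarrow> ball 0 1"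
    by (auto simp: space_pair_measure space_restrict_space norm_mult)
  have "(\<lambda>p. of_real (fst p) * circ (snd p)) \<in> borel_measurable (restrict_space lborel {0<..<1} \<Otimes>\<^sub>M unit_interval)"
  proof -
    have 1: "(\<lambda>r. complex_of_real r) \<in> borel_measurable (restrict_space lborel {0<..<1})"
      by (rule measurable_restrict_space1) simp
    have 2: "circ \<in> borel_measurable unit_interval"
      by (intro measurable_unit_intervalI) simp
    show ?thesis
      by (intro borel_measurable_times measurable_compose[OF measurable_fst 1] measurable_compose[OF measurable_snd 2])
  qed
  then show "(\<lambda>(r, x). of_real r * circ x) \<in> borel_measurable (density (restrict_space lborel {0<..<1}) v \<Otimes>\<^sub>M unit_interval)"
    by (simp add: case_prod_unfold cong: measurable_cong_sets sets_pair_measure_cong)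
qed

lemma nn_integral_rad:
  fixes F :: "complex \<Rightarrow> ennreal"
  assumes F: "F \<in> borel_measurable (restrict_space borel (ball 0 1))" and v [measurable]: "v \<in> borel_measurable borel"
  shows "(\<integral>\<^sup>+z. F z \<partial>rad v) =
     (\<integral>\<^sup>+r. v r * indicator {0<..<1} r * (\<integral>\<^sup>+x. F (of_real r * circ x) \<partial>unit_interval) \<partial>lborel)"
proof -
  let ?M = "density (restrict_space lborel {0<..<1}) v"
  let ?f = "\<lambda>p. F (case p of (r, x) \<Rightarrow> of_real r * circ x)"
  have vm: "v \<in> borel_measurable (restrict_space lborel {0<..<1})"
    by (rule measurable_restrict_space1) simp
  have m: "?f \<in> borel_measurable (?M \<Otimes>\<^sub>M unit_interval)"
    by (rule measurable_compose[OF measurable_polar F])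
  have m': "(\<lambda>r. \<integral>\<^sup>+x. F (of_real r * circ x) \<partial>unit_interval) \<in> borel_measurable (restrict_space lborel {0<..<1})"
    using unit_interval.borel_measurable_nn_integral_fst[OF m] by simp
  have "(\<integral>\<^sup>+z. F z \<partial>rad v) = (\<integral>\<^sup>+p. ?f p \<partial>(?M \<Otimes>\<^sub>M unit_interval))"
    unfolding rad_def by (rule nn_integral_distr[OF measurable_polar]) (simp add: F)
  also have "\<dots> = (\<integral>\<^sup>+r. \<integral>\<^sup>+x. F (of_real r * circ x) \<partial>unit_interval \<partial>?M)"
    using unit_interval.nn_integral_fst[OF m] by simp
  also have "\<dots> = (\<integral>\<^sup>+r. v r * (\<integral>\<^sup>+x. F (of_real r * circ x) \<partial>unit_interval) \<partial>restrict_space lborel {0<..<1})"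
    by (rule nn_integral_density[OF vm m'])
  also have "\<dots> = (\<integral>\<^sup>+r. v r * (\<integral>\<^sup>+x. F (of_real r * circ x) \<partial>unit_interval) * indicator {0<..<1} r \<partial>lborel)"
    by (rule nn_integral_restrict_space) simp
  finally show ?thesis by (simp add: mult_ac)
qed

text \<open>The weight is only Lebesgue measurable. It is exchanged for a Borel profile u that
  agrees with it at almost every radius; the measure w dA is unchanged, and from then on all product
  and image measures can be formed from Borel functions.\<close>

lemma radial_weight_profile:
  assumes w: "radial_weight w"
  obtains u :: "real \<Rightarrow> real" where
    "u \<in> borel_measurable borel" "\<And>s. 0 \<le> u s"
    "\<And>r. 0 \<le> r \<Longrightarrow> r < 1 \<Longrightarrow> (\<integral>\<^sup>+s. ennreal (u s) * indicator {r..<1} s \<partial>lborel) = ennreal (hat w (of_real r))"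
    "distr (density disc_area (\<lambda>z. ennreal (w z))) (restrict_space borel (ball 0 1)) (\<lambda>z. z)
       = rad (\<lambda>r. ennreal (2 * r * u r))"
proof -
  from w have wi: "integrable disc_area w" and wnn: "\<And>z. z \<in> ball 0 1 \<Longrightarrow> w z \<ge> 0"
    and wr: "\<And>z. z \<in> ball 0 1 \<Longrightarrow> w z = w (complex_of_real (cmod z))"
    and wh: "\<And>z. z \<in> ball 0 1 \<Longrightarrow> hat w z > 0"
    unfolding radial_weight_def by blast+
  have hpos: "hat w (of_real r) > 0" if "0 \<le> r" "r < 1" for r :: real
    using that by (intro wh) simp
  have wpos: "w (of_real r) \<ge> 0" if "0 \<le> r" "r < 1" for r :: real
    using that by (intro wnn) simp
  have wint: "integrable lebesgue (\<lambda>s. indicator {r..<1} s *\<^sub>R w (of_real s))" if "0 \<le> r" "r < 1" for r :: real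
  proof (rule ccontr)
    assume "\<not> integrable lebesgue (\<lambda>s. indicator {r..<1} s *\<^sub>R w (of_real s))"
    from not_integrable_integral_eq[OF this] have "hat w (of_real r) = 0"
      using that(1) by (simp add: hat_def set_lebesgue_integral_def)
    then show False using hpos[OF that] by simp
  qed
  define g where "g = (\<lambda>s::real. indicator {0..<1} s *\<^sub>R w (of_real s))"
  have "g \<in> borel_measurable (completion lborel)"
    unfolding g_def by (rule borel_measurable_integrable[OF wint]) simp_all
  from completion_ex_borel_measurable_real[OF this]
  obtain g' where g' [measurable]: "g' \<in> borel_measurable borel" and gg': "AE s in lborel. g s = g' s"
    by auto
  \<comment> \<open>The truncation makes u nonnegative at every radius, also on the null set where
    the Borel version g' differs from the weight.\<close>
  define u where "u = (\<lambda>s. max 0 (g' s))"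
  have um [measurable]: "u \<in> borel_measurable borel" by (simp add: u_def)
  have u0: "0 \<le> u s" for s by (simp add: u_def)
  have uw: "AE s in lborel. 0 \<le> s \<longrightarrow> s < 1 \<longrightarrow> w (of_real s) = u s"
    using gg'
  proof eventually_elim
    case (elim s)
    then show ?case using wpos[of s] by (auto simp: g_def u_def)
  qed
  have 1: "(\<integral>\<^sup>+s. ennreal (u s) * indicator {r..<1} s \<partial>lborel) = ennreal (hat w (of_real r))" if r: "0 \<le> r" "r < 1" for r
  proof -
    have "ennreal (hat w (of_real r)) = (\<integral>\<^sup>+s. ennreal (indicator {r..<1} s *\<^sub>R w (of_real s)) \<partial>lebesgue)"
      unfolding hat_def set_lebesgue_integral_def using r wpos
      by (subst nn_integral_eq_integral[OF wint[OF r]]) (auto simp: indicator_def)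
    also have "\<dots> = (\<integral>\<^sup>+s. ennreal (u s) * indicator {r..<1} s \<partial>lebesgue)"
    proof (rule nn_integral_cong_AE)
      show "AE s in lebesgue. ennreal (indicator {r..<1} s *\<^sub>R w (of_real s)) = ennreal (u s) * indicator {r..<1} s"
        using AE_completion[OF uw] by eventually_elim (use r in \<open>simp add: indicator_def\<close>)
    qed
    also have "\<dots> = (\<integral>\<^sup>+s. ennreal (u s) * indicator {r..<1} s \<partial>lborel)"
      by (rule nn_integral_completion)
    finally show ?thesis by simp
  qed
  \<comment> \<open>An exceptional null set of radii fills a null set of the plane, because the
    distribution of the modulus has a density.\<close>
  have uw2: "AE z in lebesgue. z \<in> ball 0 1 \<longrightarrow> w z = u (cmod z)"
  proof -
    from uw obtain N where N: "{s \<in> space lborel. \<not> (0 \<le> s \<longrightarrow> s < 1 \<longrightarrow> w (of_real s) = u s)} \<subseteq> N"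
      and N0: "emeasure lborel N = 0" and Nm: "N \<in> sets lborel"
      by (rule AE_E)
    have "N \<in> null_sets lborel" using N0 Nm by auto
    then have "AE r in lborel. r \<notin> N" by (rule AE_not_in)
    then have "AE r in distr lborel borel cmod. r \<notin> N"
      unfolding distr_cmod_lborel[symmetric] by (subst AE_density) (simp, erule eventually_mono, simp)
    then have "AE z in lborel. cmod z \<notin> N"
      using Nm by (subst (asm) AE_distr_iff) auto
    then have "AE z in lborel. z \<in> ball 0 1 \<longrightarrow> w (of_real (cmod z)) = u (cmod z)"
    proof eventually_elim
      case (elim z)
      then show ?case using subsetD[OF N, of "cmod z"] by auto
    qed
    then have "AE z in lborel. z \<in> ball 0 1 \<longrightarrow> w z = u (cmod z)"
      by eventually_elim (metis wr)
    then show ?thesis by (rule AE_completion)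
  qed
  have wm: "w \<in> borel_measurable disc_area"
    using wi by (rule borel_measurable_integrable)
  have sp: "space disc_area = ball 0 1" by (simp add: disc_area_def space_restrict_space)
  have idm: "(\<lambda>z. z) \<in> density disc_area (\<lambda>z. ennreal (w z)) \<rightarrow>\<^sub>M restrict_space borel (ball 0 1)"
  proof (rule measurable_restrict_space2)
    show "(\<lambda>z. z) \<in> space (density disc_area (\<lambda>z. ennreal (w z))) \<rightarrow> ball 0 1" by (simp add: sp)
    have "(\<lambda>z. z) \<in> borel_measurable (lebesgue_on (ball (0::complex) 1))"
      using id_borel_measurable_lebesgue_on unfolding id_def .
    then show "(\<lambda>z. z) \<in> borel_measurable (density disc_area (\<lambda>z. ennreal (w z)))"
      by (simp add: disc_area_def)
  qed
  have 2: "distr (density disc_area (\<lambda>z. ennreal (w z))) (restrict_space borel (ball 0 1)) (\<lambda>z. z)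
       = rad (\<lambda>r. ennreal (2 * r * u r))" (is "?L = ?R")
  proof (rule measure_eqI)
    show "sets ?L = sets ?R" by simp
    fix A assume "A \<in> sets ?L"
    then have AR: "A \<in> sets (restrict_space borel (ball (0::complex) 1))" by simp
    then have A: "A \<subseteq> ball 0 1" and Ab [measurable]: "A \<in> sets borel"
      by (auto simp: sets_restrict_space_iff)
    have AL: "A \<in> sets disc_area"
      using A Ab by (simp add: disc_area_def sets_restrict_space_iff)
    have "emeasure ?L A = emeasure (density disc_area (\<lambda>z. ennreal (w z))) A"
      using A by (subst emeasure_distr[OF idm AR]) (auto simp: sp intro!: arg_cong2[where f = emeasure])
    also have "\<dots> = (\<integral>\<^sup>+z. ennreal (w z) * indicator A z \<partial>disc_area)"
      using AL wm by (intro emeasure_density) auto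
    also have "\<dots> = (\<integral>\<^sup>+z. ennreal (1/pi) * (ennreal (w z) * indicator A z) \<partial>lebesgue_on (ball 0 1))"
      unfolding disc_area_def
      using AL wm by (intro nn_integral_density) (auto simp: disc_area_def)
    also have "\<dots> = (\<integral>\<^sup>+z. ennreal (1/pi) * (ennreal (w z) * indicator A z) * indicator (ball 0 1) z \<partial>lebesgue)"
      by (rule nn_integral_restrict_space) simp
    also have "\<dots> = (\<integral>\<^sup>+z. ennreal (1/pi) * (ennreal (u (cmod z)) * indicator A z) \<partial>lebesgue)"
    proof (rule nn_integral_cong_AE)
      show "AE z in lebesgue. ennreal (1/pi) * (ennreal (w z) * indicator A z) * indicator (ball 0 1) z
         = ennreal (1/pi) * (ennreal (u (cmod z)) * indicator A z)"
        using uw2 by eventually_elim (use A in \<open>auto simp: indicator_def\<close>)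
    qed
    also have "\<dots> = (\<integral>\<^sup>+z. ennreal (1/pi) * (ennreal (u (cmod z)) * indicator A z) \<partial>lborel)"
      by (rule nn_integral_completion)
    also have "\<dots> = (\<integral>\<^sup>+r. ennreal (2 * pi * r) * indicator {0..} r * (\<integral>\<^sup>+x. ennreal (1/pi) * (ennreal (u (cmod (of_real r * circ x))) * indicator A (of_real r * circ x)) \<partial>unit_interval) \<partial>lborel)"
      by (rule nn_integral_polar) measurable
    also have "\<dots> = (\<integral>\<^sup>+r. ennreal (2 * r * u r) * indicator {0<..<1} r * (\<integral>\<^sup>+x. indicator A (of_real r * circ x) \<partial>unit_interval) \<partial>lborel)"
    proof (rule nn_integral_cong)
      fix r :: real
      consider "r \<le> 0" | "0 < r" "r < 1" | "1 \<le> r" by linarith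
      then show "ennreal (2 * pi * r) * indicator {0..} r * (\<integral>\<^sup>+x. ennreal (1/pi) * (ennreal (u (cmod (of_real r * circ x))) * indicator A (of_real r * circ x)) \<partial>unit_interval)
         = ennreal (2 * r * u r) * indicator {0<..<1} r * (\<integral>\<^sup>+x. indicator A (of_real r * circ x) \<partial>unit_interval)"
      proof cases
        case 1
        then show ?thesis by (cases "r = 0") (auto simp: indicator_def)
      next
        case 2
        have "(\<integral>\<^sup>+x. ennreal (1/pi) * (ennreal (u (cmod (of_real r * circ x))) * indicator A (of_real r * circ x)) \<partial>unit_interval)
          = (\<integral>\<^sup>+x. ennreal (1/pi * u r) * indicator A (of_real r * circ x) \<partial>unit_interval)"
          using 2 u0 by (intro nn_integral_cong) (auto simp: norm_mult ennreal_mult[symmetric] indicator_def)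
        also have "\<dots> = ennreal (1/pi * u r) * (\<integral>\<^sup>+x. indicator A (of_real r * circ x) \<partial>unit_interval)"
          by (rule nn_integral_cmult) measurable
        finally show ?thesis using 2 u0
          by (simp add: mult.assoc[symmetric] ennreal_mult[symmetric])
      next
        case 3
        have "of_real r * circ x \<notin> A" for x
          using A 3 by (auto simp: norm_mult dest!: subsetD)
        then show ?thesis using 3 by (simp add: indicator_def)
      qed
    qed
    also have "\<dots> = (\<integral>\<^sup>+z. indicator A z \<partial>?R)"
      by (rule nn_integral_rad[symmetric]) (use AR in \<open>simp_all, measurable\<close>)
    also have "\<dots> = emeasure ?R A" using AR by simp
    finally show "emeasure ?L A = emeasure ?R A" .
  qed
  show ?thesis by (rule that[OF um u0 1 2])
qed

section \<open>Circular means\<close>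

lemma continuous_on_circle:
  "continuous_on (cball a (norm r)) f \<Longrightarrow> continuous_on A (\<lambda>x. f (a + r * circ x))"
  by (rule continuous_on_compose2[where g = f and f = "\<lambda>x. a + r * circ x"])
     (auto intro!: continuous_intros simp: dist_norm norm_mult)

lemma unit_interval_continuous:
  fixes f :: "real \<Rightarrow> 'a::euclidean_space"
  assumes "continuous_on {0..1} f"
  shows integrable_unit_interval: "integrable unit_interval f"
    and integral_unit_interval: "integral\<^sup>L unit_interval f = integral {0..1} f"
proof -
  have i: "set_integrable lborel {0..1} f"
    unfolding set_integrable_def by (rule borel_integrable_compact[OF compact_Icc assms])
  show "integrable unit_interval f"
    using i unfolding unit_interval_def by (subst integrable_restrict_space) (auto simp: set_integrable_def)
  have "integral\<^sup>L unit_interval f = set_lebesgue_integral lborel {0..1} f"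
    unfolding unit_interval_def set_lebesgue_integral_def by (rule integral_restrict_space) simp
  also have "\<dots> = integral {0..1} f"
    by (rule set_borel_integral_eq_integral(2)[OF i])
  finally show "integral\<^sup>L unit_interval f = integral {0..1} f" .
qed

lemma circle_coefficient:
  assumes f: "f holomorphic_on ball a R" and r: "0 < r" "r < R"
  shows "(LINT x|unit_interval. f (a + of_real r * circ x) * cnj (circ x) ^ k)
     = of_real r ^ k * (deriv ^^ k) f a / fact k"
proof -
  have hol: "f holomorphic_on ball a r" and cont: "continuous_on (cball a r) f"
    using r by (auto intro!: holomorphic_on_subset[OF f] holomorphic_on_imp_continuous_on)
  have circ_eq: "circ x = exp (2 * of_real pi * \<i> * of_real x)" for x
    by (simp add: circ_def cis_conv_exp mult_ac)
  have "((\<lambda>u. f u / (u - a) ^ Suc k) has_contour_integral (2 * pi * \<i>) / fact k * (deriv ^^ k) f a) (circlepath a r)"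
    by (rule Cauchy_has_contour_integral_higher_derivative_circlepath[OF cont hol]) (use r in auto)
  then have "((\<lambda>x. f (circlepath a r x) / (circlepath a r x - a) ^ Suc k *
      vector_derivative (circlepath a r) (at x within {0..1})) has_integral (2 * pi * \<i>) / fact k * (deriv ^^ k) f a) {0..1}"
    by (simp add: has_contour_integral_def)
  then have "((\<lambda>x. (2 * pi * \<i>) / of_real r ^ k * (f (a + of_real r * circ x) * cnj (circ x) ^ k)) has_integral (2 * pi * \<i>) / fact k * (deriv ^^ k) f a) {0..1}"
  proof (rule has_integral_eq[rotated])
    fix x :: real assume x: "x \<in> {0..1}"
    have "cnj (circ x) * circ x = 1"
      by (simp add: circ_def cis_cnj cis_mult)
    then have "cnj (circ x) = 1 / circ x"
      by (metis nonzero_eq_divide_eq norm_circ norm_zero zero_neq_one)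
    moreover have "circ x \<noteq> 0" by (metis norm_circ norm_zero zero_neq_one)
    moreover have "vector_derivative (circlepath a r) (at x within {0..1}) = 2 * pi * \<i> * r * circ x"
      using x by (simp add: vector_derivative_circlepath01 circ_eq)
    moreover have "circlepath a r x = a + of_real r * circ x"
      by (simp add: circlepath circ_eq)
    ultimately show "f (circlepath a r x) / (circlepath a r x - a) ^ Suc k *
      vector_derivative (circlepath a r) (at x within {0..1}) = (2 * pi * \<i>) / of_real r ^ k * (f (a + of_real r * circ x) * cnj (circ x) ^ k)"
      using r power_mult_distrib[of "circ x" "cnj (circ x)" k] by (simp add: field_simps)
  qed
  then have "((\<lambda>x. (of_real r ^ k / (2 * pi * \<i>)) * ((2 * pi * \<i>) / of_real r ^ k * (f (a + of_real r * circ x) * cnj (circ x) ^ k)))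
     has_integral (of_real r ^ k / (2 * pi * \<i>)) * ((2 * pi * \<i>) / fact k * (deriv ^^ k) f a)) {0..1}"
    by (rule has_integral_mult_right)
  then have "((\<lambda>x. f (a + of_real r * circ x) * cnj (circ x) ^ k) has_integral (of_real r ^ k * (deriv ^^ k) f a / fact k)) {0..1}"
    using r by (simp add: field_simps)
  moreover have "continuous_on {0..1} (\<lambda>x. f (a + of_real r * circ x) * cnj (circ x) ^ k)"
    using cont r by (intro continuous_intros continuous_on_circle) auto
  ultimately show ?thesis
    by (subst integral_unit_interval) (auto simp: integral_unique)
qed

lemma circle_mean_value:
  assumes f: "f holomorphic_on ball a R" and r: "0 \<le> r" "r < R"
  shows "(LINT x|unit_interval. f (a + of_real r * circ x)) = f a"
proof (cases "r = 0")
  case True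
  then show ?thesis by (simp add: measure_def)
next
  case False
  then show ?thesis using circle_coefficient[OF f, of r 0] r by simp
qed

section \<open>Subharmonicity of |g|^p and growth of its circular means\<close>

lemma continuous_on_norm_powr [continuous_intros]:
  fixes f :: "'a::topological_space \<Rightarrow> complex"
  assumes "continuous_on A f" "0 < p"
  shows "continuous_on A (\<lambda>x. cmod (f x) powr p)"
  using assms by (intro continuous_on_powr') (auto intro!: continuous_intros)

text \<open>Where g has no zero, |g|^p is the modulus of the analytic function exp(p h) with h a
  local logarithm of g, so that every p > 0 is covered by the mean value property. At a zero of g
  the left side vanishes.\<close>

lemma local_submean_powr:
  assumes g: "g holomorphic_on ball b R" and R: "R > 0" and p: "p > 0"
  shows "\<exists>s0>0. \<forall>s. 0 < s \<and> s < s0 \<longrightarrow>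
    cmod (g b) powr p \<le> (LINT x|unit_interval. cmod (g (b + of_real s * circ x)) powr p)"
proof (cases "g b = 0")
  case True
  then show ?thesis using p R by (intro exI[of _ 1]) (auto intro!: integral_nonneg)
next
  case False
  have "isCont g b"
    using holomorphic_on_imp_continuous_on[OF g] R by (auto simp: continuous_on_eq_continuous_at)
  then obtain e where e: "e > 0" "\<And>z. dist z b < e \<Longrightarrow> g z \<noteq> 0"
    using False continuous_at_avoid[of b g 0] by (auto simp: dist_commute)
  define t where "t = min e R"
  have t: "t > 0" "ball b t \<subseteq> ball b R" "\<And>z. z \<in> ball b t \<Longrightarrow> g z \<noteq> 0"
    using e R by (auto simp: t_def dist_commute)
  obtain h where h: "h holomorphic_on ball b t" "\<And>x. x \<in> ball b t \<Longrightarrow> exp (h x) = g x"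
    by (rule holomorphic_logarithm_exists[of "ball b t" g b]) (use t holomorphic_on_subset[OF g] in auto)
  have powr_eq: "cmod (g z) powr p = cmod (exp (p * h z))" if "z \<in> ball b t" for z
    unfolding h(2)[OF that, symmetric] by (simp add: norm_exp_eq_Re exp_powr_real mult.commute)
  show ?thesis
  proof (intro exI[of _ t] conjI allI impI)
    fix s assume s: "0 < s \<and> s < t"
    have "exp (p * h b) = (LINT x|unit_interval. exp (p * h (b + of_real s * circ x)))"
      by (rule circle_mean_value[symmetric, where R = t]) (use s h in \<open>auto intro!: holomorphic_intros\<close>)
    then have "cmod (g b) powr p = cmod (LINT x|unit_interval. exp (p * h (b + of_real s * circ x)))"
      using powr_eq[of b] t by simp
    also have "\<dots> \<le> (LINT x|unit_interval. cmod (exp (p * h (b + of_real s * circ x))))"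
      by (rule integral_norm_bound)
    also have "\<dots> = (LINT x|unit_interval. cmod (g (b + of_real s * circ x)) powr p)"
      using s by (intro Bochner_Integration.integral_cong) (auto simp: powr_eq dist_norm norm_mult)
    finally show "cmod (g b) powr p \<le> (LINT x|unit_interval. cmod (g (b + of_real s * circ x)) powr p)" .
  qed (use t in auto)
qed

lemma ex_circ_unit: "\<exists>x\<in>{0..1}. z = of_real (cmod z) * circ x"
proof -
  obtain a where a: "z = of_real (cmod z) * circ a" using ex_circ by blast
  have "circ a = circ (frac a)"
  proof -
    have "circ a = circ (frac a) * circ (of_int \<lfloor>a\<rfloor>)"
      by (simp add: circ_add[symmetric] frac_def)
    also have "circ (of_int \<lfloor>a\<rfloor>) = 1"
      by (simp add: circ_def cis_multiple_2pi)
    finally show ?thesis by simp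
  qed
  then show ?thesis using a frac_lt_1[of a] frac_ge_0[of a] by (intro bexI[of _ "frac a"]) auto
qed

text \<open>If the maximum were positive, take among the points where it is attained one, z0, that
  is farthest from 0. It is interior, so the sub-mean inequality forces a whole small circle around
  z0 to consist of maximum points, including the one in the direction of z0, which is farther
  out.\<close>

lemma submean_max_principle:
  fixes \<psi> :: "complex \<Rightarrow> real"
  assumes cont: "continuous_on (cball 0 \<rho>) \<psi>" and \<rho>: "\<rho> > 0"
    and sub: "\<And>b. b \<in> ball 0 \<rho> \<Longrightarrow> \<exists>s0>0. \<forall>s. 0 < s \<and> s < s0 \<longrightarrow> \<psi> b \<le> (LINT x|unit_interval. \<psi> (b + of_real s * circ x))"
    and bd: "\<And>z. cmod z = \<rho> \<Longrightarrow> \<psi> z \<le> 0" and z: "cmod z \<le> \<rho>"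
  shows "\<psi> z \<le> 0"
proof (rule ccontr)
  assume neg: "\<not> \<psi> z \<le> 0"
  obtain m where m: "m \<in> cball 0 \<rho>" "\<And>y. y \<in> cball 0 \<rho> \<Longrightarrow> \<psi> y \<le> \<psi> m"
    using continuous_attains_sup[OF compact_cball _ cont] \<rho> by force
  have Mpos: "\<psi> m > 0" using neg m(2)[of z] z by auto
  define Z where "Z = {y \<in> cball 0 \<rho>. \<psi> y = \<psi> m}"
  have "closed Z"
    unfolding Z_def by (rule continuous_closed_preimage_constant[OF cont closed_cball])
  then have "compact (cball 0 \<rho> \<inter> Z)" by (rule compact_Int_closed[OF compact_cball])
  moreover have "cball 0 \<rho> \<inter> Z = Z" by (auto simp: Z_def)
  ultimately have "compact Z" by simp
  moreover have "Z \<noteq> {}" using m by (auto simp: Z_def)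
  ultimately obtain z0 where z0: "z0 \<in> Z" "\<And>y. y \<in> Z \<Longrightarrow> cmod y \<le> cmod z0"
    using continuous_attains_sup[of Z cmod] by (auto intro: continuous_intros)
  have z0r: "cmod z0 < \<rho>"
    using z0(1) bd[of z0] Mpos by (force simp: Z_def)
  obtain s0 where s0: "s0 > 0" "\<And>s. 0 < s \<Longrightarrow> s < s0 \<Longrightarrow> \<psi> z0 \<le> (LINT x|unit_interval. \<psi> (z0 + of_real s * circ x))"
    using sub[of z0] z0r by auto
  define s where "s = min (s0 / 2) ((\<rho> - cmod z0) / 2)"
  have s: "0 < s" "s < s0" "s \<le> \<rho> - cmod z0" using s0 z0r by (auto simp: s_def min_def field_simps)
  have inb: "z0 + of_real s * circ x \<in> cball 0 \<rho>" for x
    using s norm_triangle_ineq[of z0 "of_real s * circ x"] by (simp add: norm_mult)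
  have c1: "continuous_on {0..1} (\<lambda>x. \<psi> (z0 + of_real s * circ x))"
    using inb by (intro continuous_on_compose2[OF cont]) (auto intro!: continuous_intros)
  then have c: "continuous_on {0..1} (\<lambda>x. \<psi> m - \<psi> (z0 + of_real s * circ x))"
    by (intro continuous_intros)
  have nn: "0 \<le> \<psi> m - \<psi> (z0 + of_real s * circ x)" for x
    using m(2)[OF inb] by simp
  have "(LINT x|unit_interval. \<psi> m - \<psi> (z0 + of_real s * circ x)) = \<psi> m - (LINT x|unit_interval. \<psi> (z0 + of_real s * circ x))"
    using integrable_unit_interval[OF c1] by (simp add: measure_def)
  also have "\<dots> \<le> 0" using s0(2)[OF s(1,2)] z0(1) by (simp add: Z_def)
  finally have "integral {0..1} (\<lambda>x. \<psi> m - \<psi> (z0 + of_real s * circ x)) \<le> 0"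
    by (simp add: integral_unit_interval[OF c])
  moreover have "0 \<le> integral {0..1} (\<lambda>x. \<psi> m - \<psi> (z0 + of_real s * circ x))"
    using nn by (intro integral_nonneg integrable_continuous_real c) auto
  ultimately have zero: "integral {0..1} (\<lambda>x. \<psi> m - \<psi> (z0 + of_real s * circ x)) = 0" by simp
  have eq: "\<psi> m = \<psi> (z0 + of_real s * circ x)" if "x \<in> {0..1}" for x
  proof -
    have "\<psi> m - \<psi> (z0 + of_real s * circ x) = 0"
      using integral_eq_0_iff[OF c, of] zero nn that by auto
    then show ?thesis by simp
  qed
  obtain x where x: "x \<in> {0..1}" "z0 = of_real (cmod z0) * circ x" using ex_circ_unit by blast
  have "z0 + of_real s * circ x \<in> Z" using eq[OF x(1)] inb by (simp add: Z_def)
  then have "cmod (z0 + of_real s * circ x) \<le> cmod z0" by (rule z0(2))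
  moreover have "z0 + of_real s * circ x = of_real (cmod z0 + s) * circ x"
    by (subst x(2)) (simp add: ring_distribs norm_mult)
  ultimately show False using s(1) by (simp add: norm_mult del: of_real_add)
qed

text \<open>Takes the place of the Poisson integral: the real part of a polynomial is harmonic in
  the whole disc. On the circle these real parts form an algebra that separates points, since cnj z
  = \<rho>^2 / z there reduces every z^i cnj z^j to a multiple of a power of z or of cnj z;
  Stone-Weierstrass then applies.\<close>

lemma circle_harmonic_approx:
  fixes \<phi> :: "complex \<Rightarrow> real"
  assumes cont: "continuous_on (sphere 0 \<rho>) \<phi>" and e: "e > 0"
  obtains Q :: "complex poly" where "\<And>z. cmod z = \<rho> \<Longrightarrow> \<bar>\<phi> z - Re (poly Q z)\<bar> < e"
proof -
  define P where "P = (\<lambda>f. \<exists>Q :: complex poly. \<forall>z\<in>sphere 0 \<rho>. f z = Re (poly Q z))"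
  have Padd: "P (\<lambda>z. f z + g z)" if fg: "P f" "P g" for f g
  proof -
    obtain Q1 Q2 where "\<forall>z\<in>sphere 0 \<rho>. f z = Re (poly Q1 z)" "\<forall>z\<in>sphere 0 \<rho>. g z = Re (poly Q2 z)"
      using fg unfolding P_def by blast
    then show ?thesis unfolding P_def by (intro exI[of _ "Q1 + Q2"]) simp
  qed
  have Pconst: "P (\<lambda>z. c)" for c unfolding P_def by (intro exI[of _ "[:of_real c:]"]) simp
  have Psum: "P (\<lambda>z. \<Sum>i\<in>I. f i z)" if "finite I" "\<And>i. P (f i)" for I :: "nat set" and f
    using that(1) by induction (auto intro: Padd Pconst that(2))
  have Pscale: "P (\<lambda>z. c * f z)" if fg: "P f" for c :: real and f
  proof -
    obtain Q where "\<forall>z\<in>sphere 0 \<rho>. f z = Re (poly Q z)" using fg unfolding P_def by blast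
    then show ?thesis unfolding P_def by (intro exI[of _ "smult (of_real c) Q"]) simp
  qed
  have Pmono: "P (\<lambda>z. Re (c * z ^ i * cnj z ^ j))" for c i j
  proof -
    have zz: "z ^ k * cnj z ^ k = of_real (\<rho> ^ (2 * k))" if "cmod z = \<rho>" for z k
    proof -
      have "z * cnj z = of_real (\<rho>\<^sup>2)" using that complex_norm_square[of z] by simp
      then have "(z * cnj z) ^ k = of_real (\<rho>\<^sup>2) ^ k" by simp
      then show ?thesis by (simp add: power_mult_distrib power_mult)
    qed
    show ?thesis
    proof (cases "j \<le> i")
      case True
      have "Re (c * z ^ i * cnj z ^ j) = Re (poly (monom (c * of_real (\<rho> ^ (2 * j))) (i - j)) z)" if "cmod z = \<rho>" for z
      proof -
        have "z ^ i * cnj z ^ j = z ^ (i - j) * (z ^ j * cnj z ^ j)"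
          using True by (simp add: mult.assoc[symmetric] power_add[symmetric])
        then show ?thesis unfolding zz[OF that] by (simp add: poly_monom mult_ac)
      qed
      then show ?thesis unfolding P_def by (intro exI) auto
    next
      case False
      have "Re (c * z ^ i * cnj z ^ j) = Re (poly (monom (cnj c * of_real (\<rho> ^ (2 * i))) (j - i)) z)" if "cmod z = \<rho>" for z
      proof -
        have "cnj z ^ j * z ^ i = cnj z ^ (j - i) * (cnj z ^ i * z ^ i)"
          using False by (simp add: mult.assoc[symmetric] power_add[symmetric])
        also have "cnj z ^ i * z ^ i = of_real (\<rho> ^ (2 * i))" using zz[OF that, of i] by (simp add: mult.commute)
        finally have "c * z ^ i * cnj z ^ j = cnj (poly (monom (cnj c * of_real (\<rho> ^ (2 * i))) (j - i)) z)"
          by (simp add: poly_monom mult_ac)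
        then show ?thesis by simp
      qed
      then show ?thesis unfolding P_def by (intro exI) auto
    qed
  qed
  have Pmult: "P (\<lambda>z. f z * g z)" if fg: "P f" "P g" for f g
  proof -
    obtain Q1 Q2 where Q: "\<forall>z\<in>sphere 0 \<rho>. f z = Re (poly Q1 z)" "\<forall>z\<in>sphere 0 \<rho>. g z = Re (poly Q2 z)"
      using fg unfolding P_def by blast
    have 1: "P (\<lambda>z. Re (poly (Q1 * Q2) z))" unfolding P_def by blast
    have "P (\<lambda>z. \<Sum>i\<le>degree Q1. \<Sum>j\<le>degree Q2. Re (coeff Q1 i * cnj (coeff Q2 j) * z ^ i * cnj z ^ j))"
      by (intro Psum Pmono) auto
    also have "(\<lambda>z. \<Sum>i\<le>degree Q1. \<Sum>j\<le>degree Q2. Re (coeff Q1 i * cnj (coeff Q2 j) * z ^ i * cnj z ^ j))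
      = (\<lambda>z. Re (poly Q1 z * cnj (poly Q2 z)))"
    proof
      fix z
      have "poly Q1 z * cnj (poly Q2 z) = (\<Sum>i\<le>degree Q1. \<Sum>j\<le>degree Q2. coeff Q1 i * cnj (coeff Q2 j) * z ^ i * cnj z ^ j)"
        unfolding poly_altdef cnj_sum sum_product complex_cnj_mult complex_cnj_power
        by (intro sum.cong refl) (simp only: mult_ac)
      then show "(\<Sum>i\<le>degree Q1. \<Sum>j\<le>degree Q2. Re (coeff Q1 i * cnj (coeff Q2 j) * z ^ i * cnj z ^ j))
         = Re (poly Q1 z * cnj (poly Q2 z))" by (simp only: Re_sum)
    qed
    finally have 2: "P (\<lambda>z. Re (poly Q1 z * cnj (poly Q2 z)))" .
    \<comment> \<open>Closure under products rests on Re a Re b = (Re (a b) + Re (a cnj b)) /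
      2.\<close>
    have 3: "P (\<lambda>z. (1/2) * Re (poly (Q1 * Q2) z) + (1/2) * Re (poly Q1 z * cnj (poly Q2 z)))"
      by (intro Padd Pscale 1 2)
    have "f z * g z = (1/2) * Re (poly (Q1 * Q2) z) + (1/2) * Re (poly Q1 z * cnj (poly Q2 z))" if "z \<in> sphere 0 \<rho>" for z
      using Q that by (simp add: field_simps)
    with 3 show ?thesis unfolding P_def by force
  qed
  have "\<exists>f. P f \<and> (\<forall>x\<in>sphere 0 \<rho>. \<bar>\<phi> x - f x\<bar> < e)"
  proof -
    define P' where "P' = (\<lambda>f. P f \<and> continuous_on (sphere 0 \<rho>) f)"
    have P'I: "P f \<Longrightarrow> P' f" for f
    proof -
      assume "P f"
      then obtain Q where Q: "\<forall>z\<in>sphere 0 \<rho>. f z = Re (poly Q z)" unfolding P_def by blast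
      have "continuous_on (sphere 0 \<rho>) (\<lambda>z. Re (poly Q z))" by (intro continuous_intros)
      then have "continuous_on (sphere 0 \<rho>) f" by (rule continuous_on_eq) (use Q in auto)
      then show "P' f" using \<open>P f\<close> by (simp add: P'_def)
    qed
    have "\<exists>f. P' f \<and> (\<forall>x\<in>sphere 0 \<rho>. \<bar>\<phi> x - f x\<bar> < e)"
    proof (rule Stone_Weierstrass_HOL)
      show "\<exists>f. P' f \<and> f x \<noteq> f y" if "x \<in> sphere 0 \<rho> \<and> y \<in> sphere 0 \<rho> \<and> x \<noteq> y" for x y :: complex
      proof (cases "Re x = Re y")
        case True
        then have "Im x \<noteq> Im y" using that by (auto simp: complex_eq_iff)
        moreover have "P Im" unfolding P_def by (intro exI[of _ "[:0, -\<i>:]"]) simp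
        ultimately show ?thesis using P'I by blast
      next
        case False
        moreover have "P Re" unfolding P_def by (intro exI[of _ "[:0, 1:]"]) simp
        ultimately show ?thesis using P'I by blast
      qed
      show "P' (\<lambda>x. f x + g x)" if "P' f \<and> P' g" for f g
        using that by (intro P'I Padd) (auto simp: P'_def)
      show "P' (\<lambda>x. f x * g x)" if "P' f \<and> P' g" for f g
        using that by (intro P'I Pmult) (auto simp: P'_def)
      show "continuous_on (sphere 0 \<rho>) f" if "P' f" for f
        using that by (simp add: P'_def)
    qed (use cont e P'I[OF Pconst] in auto)
    then show ?thesis by (auto simp: P'_def)
  qed
  then obtain Q :: "complex poly" where "\<forall>z\<in>sphere 0 \<rho>. \<bar>\<phi> z - Re (poly Q z)\<bar> < e"
    unfolding P_def by force
  then show ?thesis by (intro that) auto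
qed

text \<open>Let Re Q be harmonic and within e / 2 of |g|^p on the outer circle. By the maximum
  principle |g|^p is at most Re Q + e / 2 inside, and the mean of Re Q is its value at the centre on
  both circles.\<close>

lemma circle_means_mono:
  assumes g: "g holomorphic_on ball a R" and p: "p > 0" and r: "0 \<le> r" "r \<le> \<rho>" "\<rho> < R"
  shows "(LINT x|unit_interval. cmod (g (a + of_real r * circ x)) powr p)
      \<le> (LINT x|unit_interval. cmod (g (a + of_real \<rho> * circ x)) powr p)"
proof (cases "\<rho> = 0")
  case True
  then show ?thesis using r by simp
next
  case False
  then have \<rho>: "\<rho> > 0" using r by simp
  define \<phi> where "\<phi> = (\<lambda>z. cmod (g (a + z)) powr p)"
  have g': "(\<lambda>z. g (a + z)) holomorphic_on ball 0 R"
    by (rule holomorphic_on_compose_gen[OF _ g, unfolded o_def]) (auto intro!: holomorphic_intros simp: dist_norm)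
  have cont: "continuous_on (cball 0 \<rho>) \<phi>"
    unfolding \<phi>_def using r p
    by (intro continuous_intros holomorphic_on_imp_continuous_on holomorphic_on_subset[OF g']) auto
  show ?thesis
  proof (rule field_le_epsilon)
    fix e :: real assume e: "e > 0"
    obtain Q where Q: "\<And>z. cmod z = \<rho> \<Longrightarrow> \<bar>\<phi> z - Re (poly Q z)\<bar> < e / 2"
      using circle_harmonic_approx[OF continuous_on_subset[OF cont], of \<rho> "e / 2"] e by auto
    have Qmean: "(LINT x|unit_interval. Re (poly Q (b + of_real s * circ x))) = Re (poly Q b)" if "s \<ge> 0" for b s
    proof -
      have "(LINT x|unit_interval. poly Q (b + of_real s * circ x)) = poly Q b"
        by (rule circle_mean_value[where R = "s + 1"]) (use that in \<open>auto intro!: holomorphic_intros\<close>)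
      moreover have "integrable unit_interval (\<lambda>x. poly Q (b + of_real s * circ x))"
        by (intro integrable_unit_interval continuous_intros)
      ultimately show ?thesis by (metis integral_Re)
    qed
    have Qc: "integrable unit_interval (\<lambda>x. Re (poly Q (b + of_real s * circ x)))" for b s
      by (intro integrable_unit_interval continuous_intros)
    have \<phi>i: "integrable unit_interval (\<lambda>x. \<phi> (b + of_real s * circ x))" if "s \<ge> 0" "cmod b + s \<le> \<rho>" for b s
    proof (rule integrable_unit_interval, rule continuous_on_compose2[OF cont])
      show "continuous_on {0..1} (\<lambda>x. b + of_real s * circ x)" by (intro continuous_intros)
      show "(\<lambda>x. b + complex_of_real s * circ x) ` {0..1} \<subseteq> cball 0 \<rho>"
        using that by (auto intro!: order_trans[OF norm_triangle_ineq] simp: norm_mult)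
    qed
    have main: "\<phi> z - Re (poly Q z) - e / 2 \<le> 0" if "cmod z \<le> \<rho>" for z
    proof (rule submean_max_principle[OF _ \<rho> _ _ that])
      show "continuous_on (cball 0 \<rho>) (\<lambda>z. \<phi> z - Re (poly Q z) - e / 2)"
        by (intro continuous_intros cont)
      show "\<phi> z - Re (poly Q z) - e / 2 \<le> 0" if "cmod z = \<rho>" for z
        using Q[OF that] by linarith
      fix b :: complex assume b: "b \<in> ball 0 \<rho>"
      have "(\<lambda>z. g (a + z)) holomorphic_on ball b (\<rho> - cmod b)"
      proof (rule holomorphic_on_subset[OF g'], rule subsetI)
        fix z assume "z \<in> ball b (\<rho> - cmod b)"
        then show "z \<in> ball 0 R" using r norm_triangle_sub[of z b] by (simp add: dist_norm norm_minus_commute)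
      qed
      from local_submean_powr[OF this _ p] b
      obtain s0 where s0: "s0 > 0" "\<And>s. 0 < s \<Longrightarrow> s < s0 \<Longrightarrow> \<phi> b \<le> (LINT x|unit_interval. \<phi> (b + of_real s * circ x))"
        by (auto simp: \<phi>_def)
      show "\<exists>s0>0. \<forall>s. 0 < s \<and> s < s0 \<longrightarrow> \<phi> b - Re (poly Q b) - e / 2 \<le>
        (LINT x|unit_interval. \<phi> (b + of_real s * circ x) - Re (poly Q (b + of_real s * circ x)) - e / 2)"
      proof (intro exI[of _ "min s0 (\<rho> - cmod b)"] conjI allI impI)
        show "0 < min s0 (\<rho> - cmod b)" using s0 b by simp
        fix s assume s: "0 < s \<and> s < min s0 (\<rho> - cmod b)"
        then show "\<phi> b - Re (poly Q b) - e / 2 \<le>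
          (LINT x|unit_interval. \<phi> (b + of_real s * circ x) - Re (poly Q (b + of_real s * circ x)) - e / 2)"
          using s0(2)[of s] \<phi>i[of s b] Qc[of b s] Qmean[of s b] by (simp add: measure_def)
      qed
    qed
    have i1: "integrable unit_interval (\<lambda>x. \<phi> (of_real r * circ x))" and i2: "integrable unit_interval (\<lambda>x. \<phi> (of_real \<rho> * circ x))"
      using \<phi>i[of r 0] \<phi>i[of \<rho> 0] r by auto
    have q1: "integrable unit_interval (\<lambda>x. Re (poly Q (of_real r * circ x)))" and q2: "integrable unit_interval (\<lambda>x. Re (poly Q (of_real \<rho> * circ x)))"
      using Qc[of 0 r] Qc[of 0 \<rho>] by auto
    have "(LINT x|unit_interval. \<phi> (of_real r * circ x)) \<le> (LINT x|unit_interval. Re (poly Q (of_real r * circ x)) + e / 2)"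
    proof (rule integral_mono[OF i1])
      show "integrable unit_interval (\<lambda>x. Re (poly Q (of_real r * circ x)) + e / 2)" using q1 by simp
      fix x show "\<phi> (of_real r * circ x) \<le> Re (poly Q (of_real r * circ x)) + e / 2"
        using main[of "of_real r * circ x"] r by (simp add: norm_mult)
    qed
    also have "\<dots> = Re (poly Q 0) + e / 2" using q1 Qmean[of r 0] r by (simp add: measure_def)
    also have "\<dots> = (LINT x|unit_interval. Re (poly Q (of_real \<rho> * circ x)) - e / 2) + e"
      using q2 Qmean[of \<rho> 0] r by (simp add: measure_def)
    also have "(LINT x|unit_interval. Re (poly Q (of_real \<rho> * circ x)) - e / 2) \<le> (LINT x|unit_interval. \<phi> (of_real \<rho> * circ x))"
    proof (rule integral_mono[OF _ i2])
      show "integrable unit_interval (\<lambda>x. Re (poly Q (of_real \<rho> * circ x)) - e / 2)" using q2 by simp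
      fix x show "Re (poly Q (of_real \<rho> * circ x)) - e / 2 \<le> \<phi> (of_real \<rho> * circ x)"
      proof -
        have "\<bar>\<phi> (of_real \<rho> * circ x) - Re (poly Q (of_real \<rho> * circ x))\<bar> < e / 2"
          using \<rho> by (intro Q) (simp add: norm_mult)
        then show ?thesis by linarith
      qed
    qed
    finally show "(LINT x|unit_interval. cmod (g (a + of_real r * circ x)) powr p)
      \<le> (LINT x|unit_interval. cmod (g (a + of_real \<rho> * circ x)) powr p) + e"
      by (simp add: \<phi>_def)
  qed
qed

lemma nn_circle_means_mono:
  assumes g: "g holomorphic_on ball a R" and p: "p > 0" and r: "0 \<le> r" "r \<le> \<rho>" "\<rho> < R"
  shows "(\<integral>\<^sup>+x. ennreal (cmod (g (a + of_real r * circ x)) powr p) \<partial>unit_interval)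
      \<le> (\<integral>\<^sup>+x. ennreal (cmod (g (a + of_real \<rho> * circ x)) powr p) \<partial>unit_interval)"
proof -
  have i: "integrable unit_interval (\<lambda>x. cmod (g (a + of_real s * circ x)) powr p)" if "0 \<le> s" "s < R" for s
    using that p
    by (intro integrable_unit_interval continuous_intros continuous_on_circle
          holomorphic_on_imp_continuous_on holomorphic_on_subset[OF g]) auto
  show ?thesis
    using circle_means_mono[OF assms] r i[of r] i[of \<rho>]
    by (simp add: nn_integral_eq_integral ennreal_leI)
qed

section \<open>Radial weights of class D\<close>

definition tail :: "(real \<Rightarrow> real) \<Rightarrow> real \<Rightarrow> real" where
  "tail u r = enn2real (\<integral>\<^sup>+s. ennreal (u s) * indicator {r..<1} s \<partial>lborel)"

lemma tail_measurable [measurable (raw)]: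
  assumes [measurable]: "u \<in> borel_measurable borel"
  shows "tail u \<in> borel_measurable borel"
proof -
  have "tail u = (\<lambda>r. enn2real (\<integral>\<^sup>+s. (if r \<le> s \<and> s < 1 then ennreal (u s) else 0) \<partial>lborel))"
    unfolding tail_def by (intro ext arg_cong[where f = enn2real] nn_integral_cong) (auto simp: indicator_def)
  also have "\<dots> \<in> borel_measurable borel" by measurable
  finally show ?thesis .
qed

section \<open>Integrals of powers of 1 - r\<close>

lemma nn_integral_one_minus_powr:
  assumes a: "a > 0" and t: "0 \<le> t" "t < 1"
  shows "(\<integral>\<^sup>+r. ennreal ((1 - r) powr (a - 1)) * indicator {t..<1} r \<partial>lborel) = ennreal ((1 - t) powr a / a)"
proof -
  have "((\<lambda>r. (1 - r) powr (a - 1)) has_integral (- ((1 - 1) powr a / a) - - ((1 - t) powr a / a))) {t..1}"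
  proof (rule fundamental_theorem_of_calculus_interior)
    show "continuous_on {t..1} (\<lambda>r. - ((1 - r) powr a / a))"
      using a by (intro continuous_intros continuous_on_powr') auto
    fix r assume "r \<in> {t<..<1}"
    then have "((\<lambda>r. - ((1 - r) powr a / a)) has_real_derivative (1 - r) powr (a - 1)) (at r)"
      using a by (auto intro!: derivative_eq_intros)
    then show "((\<lambda>r. - ((1 - r) powr a / a)) has_vector_derivative (1 - r) powr (a - 1)) (at r)"
      by (simp add: has_real_derivative_iff_has_vector_derivative)
  qed (use t in auto)
  then have "((\<lambda>r. (1 - r) powr (a - 1)) has_integral ((1 - t) powr a / a)) {t..1}" by simp
  then have "((\<lambda>r. if r \<in> {t..1} then (1 - r) powr (a - 1) else 0) has_integral ((1 - t) powr a / a)) UNIV"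
    by (subst has_integral_restrict_UNIV)
  moreover have "(\<lambda>r. if r \<in> {t..1} then (1 - r) powr (a - 1) else 0) = (\<lambda>r. indicator {t..1} r * (1 - r) powr (a - 1))"
    by (auto simp: indicator_def)
  ultimately have "((\<lambda>r. indicator {t..1} r * (1 - r) powr (a - 1)) has_integral ((1 - t) powr a / a)) UNIV"
    by simp
  then have "(\<integral>\<^sup>+r. ennreal (indicator {t..1} r * (1 - r) powr (a - 1)) \<partial>lborel) = ennreal ((1 - t) powr a / a)"
    by (intro nn_integral_has_integral_lborel) auto
  also have "(\<integral>\<^sup>+r. ennreal (indicator {t..1} r * (1 - r) powr (a - 1)) \<partial>lborel)
      = (\<integral>\<^sup>+r. ennreal ((1 - r) powr (a - 1)) * indicator {t..<1} r \<partial>lborel)"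
    by (intro nn_integral_cong) (auto simp: indicator_def)
  finally show ?thesis .
qed

lemma nn_integral_one_minus_powr_neg:
  assumes a: "a > 0" and t: "0 \<le> t" "t < 1"
  shows "(\<integral>\<^sup>+r. ennreal ((1 - r) powr (- a - 1)) * indicator {0<..<t} r \<partial>lborel) \<le> ennreal ((1 - t) powr (- a) / a)"
proof -
  have "(\<integral>\<^sup>+r. ennreal ((1 - r) powr (- a - 1)) * indicator {0<..<t} r \<partial>lborel)
    \<le> (\<integral>\<^sup>+r. ennreal ((1 - r) powr (- a - 1)) * indicator {0..t} r \<partial>lborel)"
    by (intro nn_integral_mono) (auto simp: indicator_def)
  also have "\<dots> = ennreal ((1 - t) powr (- a) / a - (1 - 0) powr (- a) / a)"
  proof (rule nn_integral_FTC_Icc)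
    fix r assume "r \<in> {0..t}"
    then show "((\<lambda>r. (1 - r) powr (- a) / a) has_real_derivative (1 - r) powr (- a - 1)) (at r)"
      using a t by (auto intro!: derivative_eq_intros)
  qed (use t in auto)
  also have "\<dots> \<le> ennreal ((1 - t) powr (- a) / a)"
    using a by (intro ennreal_leI) simp
  finally show ?thesis .
qed

text \<open>The pattern of all radial estimates below: below t the exponent of 1 - r lies under -1,
  above t it lies over -1, so both pieces are governed by the value at t.\<close>

lemma nn_integral_split_bound:
  fixes f :: "real \<Rightarrow> real"
  assumes t: "0 \<le> t" "t < 1" and pq: "p > 0" "q > 0" and ab: "a \<ge> 0" "b \<ge> 0"
    and l: "\<And>r. 0 < r \<Longrightarrow> r < t \<Longrightarrow> f r \<le> a * (1 - r) powr (- p - 1)"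
    and h: "\<And>r. 0 < r \<Longrightarrow> t \<le> r \<Longrightarrow> r < 1 \<Longrightarrow> f r \<le> b * (1 - r) powr (q - 1)"
  shows "(\<integral>\<^sup>+r. ennreal (f r) * indicator {0<..<1} r \<partial>lborel) \<le> ennreal (a * (1 - t) powr (- p) / p + b * (1 - t) powr q / q)"
proof -
  have "(\<integral>\<^sup>+r. ennreal (f r) * indicator {0<..<1} r \<partial>lborel)
    \<le> (\<integral>\<^sup>+r. ennreal a * (ennreal ((1 - r) powr (- p - 1)) * indicator {0<..<t} r)
       + ennreal b * (ennreal ((1 - r) powr (q - 1)) * indicator {t..<1} r) \<partial>lborel)"
    using l h ab t
    by (intro nn_integral_mono)
       (auto simp: indicator_def ennreal_mult[symmetric] intro!: ennreal_leI)
  also have "\<dots> = ennreal a * (\<integral>\<^sup>+r. ennreal ((1 - r) powr (- p - 1)) * indicator {0<..<t} r \<partial>lborel)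
       + ennreal b * (\<integral>\<^sup>+r. ennreal ((1 - r) powr (q - 1)) * indicator {t..<1} r \<partial>lborel)"
    by (subst nn_integral_add) (auto simp: nn_integral_cmult)
  also have "\<dots> \<le> ennreal a * ennreal ((1 - t) powr (- p) / p) + ennreal b * ennreal ((1 - t) powr q / q)"
    using t pq
    by (intro add_mono mult_left_mono nn_integral_one_minus_powr_neg) (auto simp: nn_integral_one_minus_powr)
  also have "\<dots> = ennreal (a * (1 - t) powr (- p) / p + b * (1 - t) powr q / q)"
    using ab pq by (simp add: ennreal_mult[symmetric] ennreal_plus[symmetric] del: ennreal_plus)
  finally show ?thesis .
qed

text \<open>The exponents \<open>\<alpha>\<close> and \<open>\<beta>\<close> come from iterating the defining inequalities of
  \<^const>\<open>D_check\<close> and \<^const>\<open>D_hat\<close> respectively.\<close>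

locale D_profile =
  fixes u :: "real \<Rightarrow> real" and C \<alpha> \<beta> :: real
  assumes u_measurable [measurable]: "u \<in> borel_measurable borel"
    and u_nonneg [simp]: "0 \<le> u s"
    and u_finite: "(\<integral>\<^sup>+s. ennreal (u s) * indicator {0..<1} s \<partial>lborel) < \<infinity>"
    and tail_pos: "0 \<le> r \<Longrightarrow> r < 1 \<Longrightarrow> 0 < tail u r"
    and C_ge_1: "1 \<le> C" and \<alpha>_pos: "0 < \<alpha>" and \<beta>_ge_1: "1 \<le> \<beta>"
    and upper: "0 \<le> t \<Longrightarrow> t \<le> r \<Longrightarrow> r < 1 \<Longrightarrow> tail u r \<le> C * ((1 - r) / (1 - t)) powr \<alpha> * tail u t"
    and lower: "0 \<le> t \<Longrightarrow> t \<le> r \<Longrightarrow> r < 1 \<Longrightarrow> tail u t \<le> C * ((1 - t) / (1 - r)) powr \<beta> * tail u r"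
begin

abbreviation V :: "real \<Rightarrow> real" where "V \<equiv> tail u"

lemma V_measurable [measurable]: "V \<in> borel_measurable borel"
  by measurable

lemma V_nonneg [simp]: "0 \<le> V r"
  by (simp add: tail_def)

lemma V_nn: "0 \<le> r \<Longrightarrow> (\<integral>\<^sup>+s. ennreal (u s) * indicator {r..<1} s \<partial>lborel) = ennreal (V r)"
proof -
  assume r: "0 \<le> r"
  have "(\<integral>\<^sup>+s. ennreal (u s) * indicator {r..<1} s \<partial>lborel) \<le> (\<integral>\<^sup>+s. ennreal (u s) * indicator {0..<1} s \<partial>lborel)"
    using r by (intro nn_integral_mono) (auto simp: indicator_def)
  then have "(\<integral>\<^sup>+s. ennreal (u s) * indicator {r..<1} s \<partial>lborel) < \<infinity>"
    using u_finite by (rule le_less_trans)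
  then show ?thesis by (simp add: tail_def less_top)
qed

lemma V_antimono: "0 \<le> r \<Longrightarrow> r \<le> s \<Longrightarrow> V s \<le> V r"
proof -
  assume rs: "0 \<le> r" "r \<le> s"
  have "ennreal (V s) \<le> ennreal (V r)"
    using rs by (subst (1 2) V_nn[symmetric]) (auto intro!: nn_integral_mono simp: indicator_def)
  then show ?thesis by simp
qed

section \<open>Comparison of a weight with its smoothed form\<close>

lemma V_half: "0 \<le> x \<Longrightarrow> x < 1 \<Longrightarrow> V (max 0 (2 * x - 1)) \<le> C * 2 powr \<beta> * V x"
proof -
  assume x: "0 \<le> x" "x < 1"
  define y where "y = max 0 (2 * x - 1)"
  have y: "0 \<le> y" "y \<le> x" "1 - y \<le> 2 * (1 - x)" using x by (auto simp: y_def max_def)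
  have "V y \<le> C * ((1 - y) / (1 - x)) powr \<beta> * V x"
    using x y by (intro lower) auto
  also have "\<dots> \<le> C * 2 powr \<beta> * V x"
    using x y \<beta>_ge_1 C_ge_1 by (intro mult_right_mono mult_left_mono powr_mono2) (auto simp: field_simps)
  finally show ?thesis by (simp add: y_def)
qed

text \<open>For increasing G the value G r is at most its average over [r, (1 + r) / 2]. After
  exchanging the integrals, the mass of u collected at x is the tail from 2 x - 1, which doubling
  bounds by a multiple of V x.\<close>

lemma u_le_tail:
  fixes G :: "real \<Rightarrow> ennreal"
  assumes [measurable]: "G \<in> borel_measurable borel"
    and mono: "\<And>r s. 0 < r \<Longrightarrow> r \<le> s \<Longrightarrow> s < 1 \<Longrightarrow> G r \<le> G s"
  shows "(\<integral>\<^sup>+r. G r * ennreal (u r) * indicator {0<..<1} r \<partial>lborel)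
    \<le> ennreal (2 * C * 2 powr \<beta>) * (\<integral>\<^sup>+r. G r * ennreal (V r / (1 - r)) * indicator {0<..<1} r \<partial>lborel)"
proof -
  define H where "H = (\<lambda>r x. if 0 < r \<and> r < 1 \<and> r \<le> x \<and> x \<le> (1 + r) / 2 then G x * ennreal (u r) * ennreal (2 / (1 - x)) else 0)"
  have [measurable]: "(\<lambda>(r, x). H r x) \<in> borel_measurable (borel \<Otimes>\<^sub>M borel)"
    unfolding H_def by measurable
  have "(\<integral>\<^sup>+r. G r * ennreal (u r) * indicator {0<..<1} r \<partial>lborel) \<le> (\<integral>\<^sup>+r. \<integral>\<^sup>+x. H r x \<partial>lborel \<partial>lborel)"
  proof (rule nn_integral_mono)
    fix r :: real
    show "G r * ennreal (u r) * indicator {0<..<1} r \<le> (\<integral>\<^sup>+x. H r x \<partial>lborel)"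
    proof (cases "0 < r \<and> r < 1")
      case True
      have "G r * ennreal (u r) = G r * ennreal (u r) * (ennreal (2 / (1 - r)) * ennreal ((1 + r) / 2 - r))"
        using True by (subst ennreal_mult[symmetric]) (auto simp: field_simps)
      also have "\<dots> = (\<integral>\<^sup>+x. (G r * ennreal (u r) * ennreal (2 / (1 - r))) * indicator {r..(1+r)/2} x \<partial>lborel)"
        using True by (subst nn_integral_cmult_indicator) (auto simp: mult.assoc)
      also have "\<dots> \<le> (\<integral>\<^sup>+x. H r x \<partial>lborel)"
        using True by (intro nn_integral_mono)
          (auto simp: H_def indicator_def intro!: mult_mono mono ennreal_leI divide_left_mono)
      finally show ?thesis using True by simp
    qed auto
  qed
  also have "\<dots> = (\<integral>\<^sup>+x. \<integral>\<^sup>+r. H r x \<partial>lborel \<partial>lborel)"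
    by (rule lborel_pair.Fubini') simp
  also have "\<dots> \<le> (\<integral>\<^sup>+x. ennreal (2 * C * 2 powr \<beta>) * (G x * ennreal (V x / (1 - x)) * indicator {0<..<1} x) \<partial>lborel)"
  proof (rule nn_integral_mono)
    fix x :: real
    show "(\<integral>\<^sup>+r. H r x \<partial>lborel) \<le> ennreal (2 * C * 2 powr \<beta>) * (G x * ennreal (V x / (1 - x)) * indicator {0<..<1} x)"
    proof (cases "0 < x \<and> x < 1")
      case True
      have "(\<integral>\<^sup>+r. H r x \<partial>lborel) \<le> (\<integral>\<^sup>+r. (G x * ennreal (2 / (1 - x))) * (ennreal (u r) * indicator {max 0 (2*x-1)..<1} r) \<partial>lborel)"
        by (intro nn_integral_mono) (auto simp: H_def indicator_def mult_ac)
      also have "\<dots> = (G x * ennreal (2 / (1 - x))) * ennreal (V (max 0 (2*x-1)))"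
        by (subst nn_integral_cmult) (auto simp: V_nn)
      also have "\<dots> \<le> (G x * ennreal (2 / (1 - x))) * ennreal (C * 2 powr \<beta> * V x)"
        using True by (intro mult_left_mono ennreal_leI V_half) auto
      also have "\<dots> = G x * ennreal ((2 * C * 2 powr \<beta>) * (V x / (1 - x)))"
        using True C_ge_1 by (simp add: mult.assoc ennreal_mult[symmetric] field_simps)
      also have "\<dots> = ennreal (2 * C * 2 powr \<beta>) * (G x * ennreal (V x / (1 - x)))"
        using True C_ge_1 by (subst ennreal_mult) (auto simp: mult_ac)
      finally show ?thesis using True by simp
    next
      case False
      then have "H r x = 0" for r by (auto simp: H_def)
      then show ?thesis by simp
    qed
  qed
  also have "\<dots> = ennreal (2 * C * 2 powr \<beta>) * (\<integral>\<^sup>+r. G r * ennreal (V r / (1 - r)) * indicator {0<..<1} r \<partial>lborel)"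
    by (rule nn_integral_cmult) measurable
  finally show ?thesis .
qed

text \<open>The converse comparison uses the exponent \<alpha>: at least half of the tail V x lies
  between x and 1 - (1 - x) / K. There G is at least G x, and a given s is reached only from an
  interval of points x of length (K - 1) (1 - s).\<close>

lemma tail_le_u:
  obtains K where "K > 0" "\<And>G :: real \<Rightarrow> ennreal. G \<in> borel_measurable borel \<Longrightarrow>
      (\<And>r s. 0 < r \<Longrightarrow> r \<le> s \<Longrightarrow> s < 1 \<Longrightarrow> G r \<le> G s) \<Longrightarrow>
      (\<integral>\<^sup>+r. G r * ennreal (V r / (1 - r)) * indicator {0<..<1} r \<partial>lborel)
        \<le> ennreal K * (\<integral>\<^sup>+r. G r * ennreal (u r) * indicator {0<..<1} r \<partial>lborel)"
proof -
  \<comment> \<open>Chosen so that C K^(-\<alpha>) = 1 / 2, which makes \<open>upper\<close> halve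
    the tail from x to 1 - (1 - x) / K.\<close>
  define K where "K = (2 * C) powr (1 / \<alpha>)"
  have "(2 * C) powr 0 < K" unfolding K_def using C_ge_1 \<alpha>_pos by (intro powr_less_mono) auto
  then have K1: "K > 1" using C_ge_1 by simp
  have K\<alpha>: "C * (1 / K) powr \<alpha> = 1 / 2"
    using C_ge_1 \<alpha>_pos K1 by (simp add: K_def powr_divide powr_powr)
  have gap: "ennreal (V x) \<le> 2 * (\<integral>\<^sup>+s. ennreal (u s) * indicator {x..<1 - (1 - x) / K} s \<partial>lborel)" if x: "0 \<le> x" "x < 1" for x
  proof -
    define y where "y = 1 - (1 - x) / K"
    have "(1 - x) / K \<le> (1 - x) / 1" using x K1 by (intro divide_left_mono) auto
    then have y: "x \<le> y" "y < 1" "(1 - y) / (1 - x) = 1 / K" using x K1 by (auto simp: y_def)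
    have Vy: "V y \<le> V x / 2" using upper[of x y] y x K\<alpha> by simp
    let ?I = "\<integral>\<^sup>+s. ennreal (u s) * indicator {x..<y} s \<partial>lborel"
    have "ennreal (V x) = (\<integral>\<^sup>+s. ennreal (u s) * indicator {x..<y} s + ennreal (u s) * indicator {y..<1} s \<partial>lborel)"
      using x y by (subst V_nn[symmetric]) (auto intro!: nn_integral_cong simp: indicator_def)
    also have "\<dots> = ?I + ennreal (V y)"
      using x y by (subst nn_integral_add) (auto simp: V_nn)
    finally have eq: "ennreal (V x) = ?I + ennreal (V y)" .
    have "?I \<noteq> \<infinity>" using eq by (metis ennreal_neq_top ennreal_add_eq_top infinity_ennreal_def)
    then obtain i where i: "?I = ennreal i" "i \<ge> 0" by (cases ?I) auto
    have "V x = i + V y" using eq i by (simp add: ennreal_plus[symmetric] del: ennreal_plus)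
    then have "V x \<le> 2 * i" using Vy by simp
    then have "ennreal (V x) \<le> ennreal (2 * i)" by (rule ennreal_leI)
    then show ?thesis using i by (simp add: ennreal_mult y_def)
  qed
  show ?thesis
  proof (rule that[of "2 * (K - 1)"])
    show "2 * (K - 1) > 0" using K1 by simp
    fix G :: "real \<Rightarrow> ennreal"
    assume [measurable]: "G \<in> borel_measurable borel" and mono: "\<And>r s. 0 < r \<Longrightarrow> r \<le> s \<Longrightarrow> s < 1 \<Longrightarrow> G r \<le> G s"
    define H where "H = (\<lambda>x s. if 0 < x \<and> x < 1 \<and> x \<le> s \<and> s < 1 - (1 - x) / K then G x * ennreal (2 / (1 - x)) * ennreal (u s) else 0)"
    have [measurable]: "(\<lambda>(x, s). H x s) \<in> borel_measurable (borel \<Otimes>\<^sub>M borel)"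
      unfolding H_def by measurable
    have "(\<integral>\<^sup>+r. G r * ennreal (V r / (1 - r)) * indicator {0<..<1} r \<partial>lborel) \<le> (\<integral>\<^sup>+x. \<integral>\<^sup>+s. H x s \<partial>lborel \<partial>lborel)"
    proof (rule nn_integral_mono)
      fix x :: real
      show "G x * ennreal (V x / (1 - x)) * indicator {0<..<1} x \<le> (\<integral>\<^sup>+s. H x s \<partial>lborel)"
      proof (cases "0 < x \<and> x < 1")
        case True
        have "G x * ennreal (V x / (1 - x)) = G x * (ennreal (1 / (1 - x)) * ennreal (V x))"
          using True by (subst ennreal_mult[symmetric]) auto
        also have "\<dots> \<le> G x * (ennreal (1 / (1 - x)) * (2 * (\<integral>\<^sup>+s. ennreal (u s) * indicator {x..<1 - (1 - x) / K} s \<partial>lborel)))"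
          using True by (intro mult_left_mono gap) auto
        also have "\<dots> = G x * (ennreal (2 / (1 - x)) * (\<integral>\<^sup>+s. ennreal (u s) * indicator {x..<1 - (1 - x) / K} s \<partial>lborel))"
        proof -
          have "ennreal (2 / (1 - x)) = ennreal (1 / (1 - x)) * 2"
            using True by (subst ennreal_numeral[symmetric], subst ennreal_mult[symmetric]) auto
          then show ?thesis by (simp add: mult.assoc)
        qed
        also have "\<dots> = (\<integral>\<^sup>+s. G x * ennreal (2 / (1 - x)) * (ennreal (u s) * indicator {x..<1 - (1 - x) / K} s) \<partial>lborel)"
          by (subst nn_integral_cmult) (auto simp: mult.assoc)
        also have "\<dots> = (\<integral>\<^sup>+s. H x s \<partial>lborel)"
          using True by (intro nn_integral_cong) (auto simp: H_def indicator_def)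
        finally show ?thesis using True by simp
      qed auto
    qed
    also have "\<dots> = (\<integral>\<^sup>+s. \<integral>\<^sup>+x. H x s \<partial>lborel \<partial>lborel)"
      by (rule lborel_pair.Fubini') simp
    also have "\<dots> \<le> (\<integral>\<^sup>+s. ennreal (2 * (K - 1)) * (G s * ennreal (u s) * indicator {0<..<1} s) \<partial>lborel)"
    proof (rule nn_integral_mono)
      fix s :: real
      show "(\<integral>\<^sup>+x. H x s \<partial>lborel) \<le> ennreal (2 * (K - 1)) * (G s * ennreal (u s) * indicator {0<..<1} s)"
      proof (cases "0 < s \<and> s < 1")
        case True
        have "(\<integral>\<^sup>+x. H x s \<partial>lborel) \<le> (\<integral>\<^sup>+x. (G s * ennreal (u s) * ennreal (2 / (1 - s))) * indicator {1 - K * (1 - s)..s} x \<partial>lborel)"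
        proof (rule nn_integral_mono)
          fix x :: real
          show "H x s \<le> (G s * ennreal (u s) * ennreal (2 / (1 - s))) * indicator {1 - K * (1 - s)..s} x"
          proof (cases "0 < x \<and> x < 1 \<and> x \<le> s \<and> s < 1 - (1 - x) / K")
            case c: True
            then have "1 - K * (1 - s) \<le> x" using K1 by (simp add: field_simps)
            moreover have "G x * ennreal (2 / (1 - x)) \<le> G s * ennreal (2 / (1 - s))"
              using c True by (intro mult_mono mono ennreal_leI divide_left_mono) auto
            then have "ennreal (u s) * (G x * ennreal (2 / (1 - x))) \<le> ennreal (u s) * (G s * ennreal (2 / (1 - s)))"
              by (rule mult_left_mono) simp
            ultimately show ?thesis using c by (simp add: H_def mult_ac)
          next
            case False
            then show ?thesis unfolding H_def by (subst if_not_P) simp_all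
          qed
        qed
        also have "\<dots> = (G s * ennreal (u s) * ennreal (2 / (1 - s))) * ennreal (s - (1 - K * (1 - s)))"
        proof -
          have "1 * (1 - s) \<le> K * (1 - s)" using True K1 by (intro mult_right_mono) auto
          then have "1 - K * (1 - s) \<le> s" by (simp add: algebra_simps)
          then show ?thesis by (subst nn_integral_cmult_indicator) auto
        qed
        also have "\<dots> = G s * ennreal (u s) * ennreal (2 / (1 - s) * (s - (1 - K * (1 - s))))"
          using True by (subst ennreal_mult') (auto simp: mult.assoc)
        also have "2 / (1 - s) * (s - (1 - K * (1 - s))) = 2 * (K - 1)"
          using True by (simp add: field_simps)
        finally show ?thesis using True by (simp add: mult_ac)
      next
        case False
        have "H x s = 0" for x
        proof (rule ccontr)
          assume "H x s \<noteq> 0"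
          then have "0 < x" "x < 1" "x \<le> s" "s < 1 - (1 - x) / K" by (auto simp: H_def split: if_splits)
          moreover have "(1 - x) / K > 0" using \<open>x < 1\<close> K1 by simp
          ultimately show False using False by simp
        qed
        then show ?thesis by simp
      qed
    qed
    also have "\<dots> = ennreal (2 * (K - 1)) * (\<integral>\<^sup>+r. G r * ennreal (u r) * indicator {0<..<1} r \<partial>lborel)"
      by (rule nn_integral_cmult) measurable
    finally show "(\<integral>\<^sup>+r. G r * ennreal (V r / (1 - r)) * indicator {0<..<1} r \<partial>lborel)
        \<le> ennreal (2 * (K - 1)) * (\<integral>\<^sup>+r. G r * ennreal (u r) * indicator {0<..<1} r \<partial>lborel)" .
  qed
qed

text \<open>The Jacobian 2 r is at least 1 only for r \<ge> 1/2. The part below 1/2 is at most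
  G(1/2) V(0), and doubling charges it to the mass of u beyond 1/2, where G is larger still.\<close>

lemma u_le_area:
  fixes G :: "real \<Rightarrow> ennreal"
  assumes [measurable]: "G \<in> borel_measurable borel"
    and mono: "\<And>r s. 0 < r \<Longrightarrow> r \<le> s \<Longrightarrow> s < 1 \<Longrightarrow> G r \<le> G s"
  shows "(\<integral>\<^sup>+r. G r * ennreal (u r) * indicator {0<..<1} r \<partial>lborel)
    \<le> ennreal (1 + C * 2 powr \<beta>) * (\<integral>\<^sup>+r. G r * ennreal (2 * r * u r) * indicator {0<..<1} r \<partial>lborel)"
proof -
  let ?J = "\<integral>\<^sup>+r. G r * ennreal (2 * r * u r) * indicator {0<..<1} r \<partial>lborel"
  have J: "(\<integral>\<^sup>+r. G r * ennreal (u r) * indicator {1/2..<1} r \<partial>lborel) \<le> ?J"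
    using u_nonneg mult_right_mono[of 1 "2 * _" "u _"]
    by (intro nn_integral_mono) (auto simp: indicator_def intro!: mult_left_mono ennreal_leI)
  have "(\<integral>\<^sup>+r. G r * ennreal (u r) * indicator {0<..<1} r \<partial>lborel)
    \<le> (\<integral>\<^sup>+r. G (1/2) * (ennreal (u r) * indicator {0..<1} r) + G r * ennreal (u r) * indicator {1/2..<1} r \<partial>lborel)"
  proof (rule nn_integral_mono)
    fix r :: real
    show "G r * ennreal (u r) * indicator {0<..<1} r \<le> G (1/2) * (ennreal (u r) * indicator {0..<1} r) + G r * ennreal (u r) * indicator {1/2..<1} r"
      using mono[of r "1/2"] by (cases "r < 1/2") (auto simp: indicator_def intro!: mult_right_mono)
  qed
  also have "\<dots> = G (1/2) * ennreal (V 0) + (\<integral>\<^sup>+r. G r * ennreal (u r) * indicator {1/2..<1} r \<partial>lborel)"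
    by (subst nn_integral_add) (auto simp: nn_integral_cmult V_nn)
  also have "G (1/2) * ennreal (V 0) \<le> G (1/2) * ennreal (C * 2 powr \<beta> * V (1/2))"
    using V_half[of "1/2"] by (intro mult_left_mono ennreal_leI) auto
  also have "\<dots> = ennreal (C * 2 powr \<beta>) * (\<integral>\<^sup>+r. G (1/2) * (ennreal (u r) * indicator {1/2..<1} r) \<partial>lborel)"
    using C_ge_1 by (subst nn_integral_cmult) (auto simp: V_nn ennreal_mult mult_ac)
  also have "(\<integral>\<^sup>+r. G (1/2) * (ennreal (u r) * indicator {1/2..<1} r) \<partial>lborel)
     \<le> (\<integral>\<^sup>+r. G r * ennreal (u r) * indicator {1/2..<1} r \<partial>lborel)"
    by (intro nn_integral_mono) (auto simp: indicator_def intro!: mult_right_mono mono)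
  also have "ennreal (C * 2 powr \<beta>) * (\<integral>\<^sup>+r. G r * ennreal (u r) * indicator {1/2..<1} r \<partial>lborel) + (\<integral>\<^sup>+r. G r * ennreal (u r) * indicator {1/2..<1} r \<partial>lborel)
    = ennreal (1 + C * 2 powr \<beta>) * (\<integral>\<^sup>+r. G r * ennreal (u r) * indicator {1/2..<1} r \<partial>lborel)"
    using C_ge_1 by (subst ennreal_plus) (auto simp: ring_distribs add.commute)
  also have "\<dots> \<le> ennreal (1 + C * 2 powr \<beta>) * ?J"
    by (intro mult_left_mono J) simp
  finally show ?thesis by (simp add: add_mono mult_left_mono)
qed

text \<open>The integral is split at r = t. Below t the factor 1 - r t is at least 1 - r and
  \<open>lower\<close> costs the exponent \<beta>, so \<kappa> > \<beta> keeps the integral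
  concentrated near t. Above t the factor is at least 1 - t, and \<open>upper\<close> makes V r / (1
  - r) integrable up to 1.\<close>

lemma int_tail_bound:
  assumes \<kappa>: "\<kappa> > \<beta>"
  shows "\<exists>K>0. \<forall>t. 0 \<le> t \<and> t < 1 \<longrightarrow>
    (\<integral>\<^sup>+r. ennreal ((1 - r * t) powr (- \<kappa>)) * ennreal (V r / (1 - r)) * indicator {0<..<1} r \<partial>lborel)
      \<le> ennreal (K * (V t * (1 - t) powr (- \<kappa>)))"
proof (intro exI[of _ "C / (\<kappa> - \<beta>) + C / \<alpha>"] conjI allI impI)
  show "0 < C / (\<kappa> - \<beta>) + C / \<alpha>" using C_ge_1 \<alpha>_pos \<kappa> by (auto intro!: add_pos_pos)
  fix t :: real assume t: "0 \<le> t \<and> t < 1"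
  have "(\<integral>\<^sup>+r. ennreal ((1 - r * t) powr (- \<kappa>)) * ennreal (V r / (1 - r)) * indicator {0<..<1} r \<partial>lborel)
    = (\<integral>\<^sup>+r. ennreal ((1 - r * t) powr (- \<kappa>) * (V r / (1 - r))) * indicator {0<..<1} r \<partial>lborel)"
    by (intro nn_integral_cong) (auto simp: indicator_def ennreal_mult[symmetric])
  also have "\<dots> \<le> ennreal ((C * V t * (1 - t) powr (- \<beta>)) * (1 - t) powr (- (\<kappa> - \<beta>)) / (\<kappa> - \<beta>)
      + (C * V t * (1 - t) powr (- \<kappa> - \<alpha>)) * (1 - t) powr \<alpha> / \<alpha>)"
  proof (rule nn_integral_split_bound)
    fix r assume r: "0 < r" "r < t"
    have "1 - r \<le> 1 - r * t" using r t by (simp add: mult_left_le)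
    then have "(1 - r * t) powr (- \<kappa>) \<le> (1 - r) powr (- \<kappa>)" using \<kappa> \<beta>_ge_1 r t by (intro powr_mono2') auto
    moreover have "V r \<le> C * ((1 - r) / (1 - t)) powr \<beta> * V t" using r t by (intro lower) auto
    ultimately have "(1 - r * t) powr (- \<kappa>) * (V r / (1 - r)) \<le> (1 - r) powr (- \<kappa>) * ((C * ((1 - r) / (1 - t)) powr \<beta> * V t) / (1 - r))"
      using r t by (intro mult_mono divide_right_mono) auto
    also have "\<dots> = C * V t * (1 - t) powr (- \<beta>) * (1 - r) powr (- (\<kappa> - \<beta>) - 1)"
      using r t by (simp add: powr_divide powr_diff powr_minus powr_add field_simps)
    finally show "(1 - r * t) powr (- \<kappa>) * (V r / (1 - r)) \<le> C * V t * (1 - t) powr (- \<beta>) * (1 - r) powr (- (\<kappa> - \<beta>) - 1)" .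
  next
    fix r assume r: "0 < r" "t \<le> r" "r < 1"
    have "1 - t \<le> 1 - r * t" using r t mult_right_mono[of r 1 t] by simp
    then have "(1 - r * t) powr (- \<kappa>) \<le> (1 - t) powr (- \<kappa>)" using \<kappa> \<beta>_ge_1 r t by (intro powr_mono2') auto
    moreover have "V r \<le> C * ((1 - r) / (1 - t)) powr \<alpha> * V t" using r t by (intro upper) auto
    ultimately have "(1 - r * t) powr (- \<kappa>) * (V r / (1 - r)) \<le> (1 - t) powr (- \<kappa>) * ((C * ((1 - r) / (1 - t)) powr \<alpha> * V t) / (1 - r))"
      using r t by (intro mult_mono divide_right_mono) auto
    also have "\<dots> = C * V t * (1 - t) powr (- \<kappa> - \<alpha>) * (1 - r) powr (\<alpha> - 1)"
      using r t by (simp add: powr_divide powr_diff powr_minus powr_add field_simps)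
    finally show "(1 - r * t) powr (- \<kappa>) * (V r / (1 - r)) \<le> C * V t * (1 - t) powr (- \<kappa> - \<alpha>) * (1 - r) powr (\<alpha> - 1)" .
  qed (use t \<kappa> \<alpha>_pos C_ge_1 in auto)
  also have "(C * V t * (1 - t) powr (- \<beta>)) * (1 - t) powr (- (\<kappa> - \<beta>)) / (\<kappa> - \<beta>)
      + (C * V t * (1 - t) powr (- \<kappa> - \<alpha>)) * (1 - t) powr \<alpha> / \<alpha> = (C / (\<kappa> - \<beta>) + C / \<alpha>) * (V t * (1 - t) powr (- \<kappa>))"
  proof -
    have "(1 - t) powr (- \<beta>) * (1 - t) powr (- (\<kappa> - \<beta>)) = (1 - t) powr (- \<kappa>)"
      "(1 - t) powr (- \<kappa> - \<alpha>) * (1 - t) powr \<alpha> = (1 - t) powr (- \<kappa>)"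
      by (simp_all add: powr_add[symmetric])
    then show ?thesis by (simp add: mult.assoc ring_distribs)
  qed
  finally show "(\<integral>\<^sup>+r. ennreal ((1 - r * t) powr (- \<kappa>)) * ennreal (V r / (1 - r)) * indicator {0<..<1} r \<partial>lborel)
      \<le> ennreal ((C / (\<kappa> - \<beta>) + C / \<alpha>) * (V t * (1 - t) powr (- \<kappa>)))" .
qed

text \<open>The power of 1 - r t increases with r, so \<open>u_le_tail\<close> carries the estimate
  over from the smoothed weight.\<close>

lemma int_u_bound:
  assumes \<kappa>: "\<kappa> > \<beta>"
  shows "\<exists>K>0. \<forall>t. 0 \<le> t \<and> t < 1 \<longrightarrow>
    (\<integral>\<^sup>+r. ennreal ((1 - r * t) powr (- \<kappa>)) * ennreal (u r) * indicator {0<..<1} r \<partial>lborel)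
      \<le> ennreal (K * (V t * (1 - t) powr (- \<kappa>)))"
proof -
  obtain K where K: "K > 0" "\<And>t. 0 \<le> t \<Longrightarrow> t < 1 \<Longrightarrow>
    (\<integral>\<^sup>+r. ennreal ((1 - r * t) powr (- \<kappa>)) * ennreal (V r / (1 - r)) * indicator {0<..<1} r \<partial>lborel)
      \<le> ennreal (K * (V t * (1 - t) powr (- \<kappa>)))"
    using int_tail_bound[OF \<kappa>] by blast
  show ?thesis
  proof (intro exI[of _ "(2 * C * 2 powr \<beta>) * K"] conjI allI impI)
    fix t :: real assume t: "0 \<le> t \<and> t < 1"
    have "(\<integral>\<^sup>+r. ennreal ((1 - r * t) powr (- \<kappa>)) * ennreal (u r) * indicator {0<..<1} r \<partial>lborel)
      \<le> ennreal (2 * C * 2 powr \<beta>) * (\<integral>\<^sup>+r. ennreal ((1 - r * t) powr (- \<kappa>)) * ennreal (V r / (1 - r)) * indicator {0<..<1} r \<partial>lborel)"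
    proof (rule u_le_tail)
      fix r s :: real assume rs: "0 < r" "r \<le> s" "s < 1"
      have "r * t \<le> s * t" using rs t by (intro mult_right_mono) auto
      moreover have "s * t < 1" using rs t mult_left_le[of t s] by linarith
      ultimately show "ennreal ((1 - r * t) powr (- \<kappa>)) \<le> ennreal ((1 - s * t) powr (- \<kappa>))"
        using \<kappa> \<beta>_ge_1 by (intro ennreal_leI powr_mono2') auto
    qed measurable
    also have "\<dots> \<le> ennreal (2 * C * 2 powr \<beta>) * ennreal (K * (V t * (1 - t) powr (- \<kappa>)))"
      using t by (intro mult_left_mono K) auto
    also have "\<dots> = ennreal ((2 * C * 2 powr \<beta>) * K * (V t * (1 - t) powr (- \<kappa>)))"
      using C_ge_1 K by (simp add: ennreal_mult[symmetric] mult.assoc)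
    finally show "(\<integral>\<^sup>+r. ennreal ((1 - r * t) powr (- \<kappa>)) * ennreal (u r) * indicator {0<..<1} r \<partial>lborel)
      \<le> ennreal ((2 * C * 2 powr \<beta>) * K * (V t * (1 - t) powr (- \<kappa>)))" .
  qed (use C_ge_1 K in auto)
qed

text \<open>The radial half of Schur's test, with 1 / V(r t) standing for the circular mean of the
  kernel. Below t monotonicity gives V r \<le> V(r t); above t the decay of order \<alpha> supplied
  by \<open>upper\<close> beats the growth of order \<delta> of the test function.\<close>

lemma int_tail_test:
  assumes \<delta>: "0 < \<delta>" "\<delta> < \<alpha>"
  shows "\<exists>K>0. \<forall>t. 0 \<le> t \<and> t < 1 \<longrightarrow>
    (\<integral>\<^sup>+r. ennreal ((1 - r) powr (- \<delta>) / V (r * t)) * ennreal (V r / (1 - r)) * indicator {0<..<1} r \<partial>lborel)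
      \<le> ennreal (K * (1 - t) powr (- \<delta>))"
proof (intro exI[of _ "1 / \<delta> + C / (\<alpha> - \<delta>)"] conjI allI impI)
  show "0 < 1 / \<delta> + C / (\<alpha> - \<delta>)" using C_ge_1 \<delta> by (auto intro!: add_pos_pos)
  fix t :: real assume t: "0 \<le> t \<and> t < 1"
  have "(\<integral>\<^sup>+r. ennreal ((1 - r) powr (- \<delta>) / V (r * t)) * ennreal (V r / (1 - r)) * indicator {0<..<1} r \<partial>lborel)
    = (\<integral>\<^sup>+r. ennreal ((1 - r) powr (- \<delta>) / V (r * t) * (V r / (1 - r))) * indicator {0<..<1} r \<partial>lborel)"
    by (intro nn_integral_cong) (auto simp: indicator_def ennreal_mult[symmetric])
  also have "\<dots> \<le> ennreal (1 * (1 - t) powr (- \<delta>) / \<delta> + (C * (1 - t) powr (- \<alpha>)) * (1 - t) powr (\<alpha> - \<delta>) / (\<alpha> - \<delta>))"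
  proof (rule nn_integral_split_bound)
    fix r assume r: "0 < r" "r < t"
    have rt: "0 \<le> r * t" "r * t \<le> r" using r t by (auto simp: mult_left_le)
    have "V r / V (r * t) \<le> 1" using V_antimono[OF rt] tail_pos[of "r * t"] rt r t by simp
    then have "((1 - r) powr (- \<delta>) / (1 - r)) * (V r / V (r * t)) \<le> ((1 - r) powr (- \<delta>) / (1 - r)) * 1"
      using r t by (intro mult_left_mono) auto
    then show "(1 - r) powr (- \<delta>) / V (r * t) * (V r / (1 - r)) \<le> 1 * (1 - r) powr (- \<delta> - 1)"
      using r t by (simp add: powr_diff field_simps)
  next
    fix r assume r: "0 < r" "t \<le> r" "r < 1"
    have rt: "0 \<le> r * t" "r * t \<le> t" using r t mult_right_mono[of r 1 t] by auto
    have "V r / V (r * t) \<le> V r / V t" using V_antimono[OF rt] tail_pos[of t] t by (intro divide_left_mono) auto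
    also have "\<dots> \<le> (C * ((1 - r) / (1 - t)) powr \<alpha> * V t) / V t"
      using r t by (intro divide_right_mono upper) auto
    also have "\<dots> = C * (1 - t) powr (- \<alpha>) * (1 - r) powr \<alpha>"
      using r t tail_pos[of t] by (simp add: powr_divide powr_minus field_simps)
    finally have "((1 - r) powr (- \<delta>) / (1 - r)) * (V r / V (r * t)) \<le> ((1 - r) powr (- \<delta>) / (1 - r)) * (C * (1 - t) powr (- \<alpha>) * (1 - r) powr \<alpha>)"
      using r t by (intro mult_left_mono) auto
    moreover have "(1 - r) powr (\<alpha> - \<delta> - 1) = (1 - r) powr (- \<delta>) / (1 - r) * (1 - r) powr \<alpha>"
    proof -
      have "(1 - r) powr (\<alpha> - \<delta> - 1) = (1 - r) powr (- \<delta> + - 1 + \<alpha>)" by (simp add: algebra_simps)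
      also have "\<dots> = (1 - r) powr (- \<delta>) * (1 - r) powr (- 1) * (1 - r) powr \<alpha>" by (simp only: powr_add)
      finally show ?thesis using r by (simp add: powr_minus divide_inverse)
    qed
    ultimately show "(1 - r) powr (- \<delta>) / V (r * t) * (V r / (1 - r)) \<le> C * (1 - t) powr (- \<alpha>) * (1 - r) powr (\<alpha> - \<delta> - 1)"
      by (simp add: mult_ac)
  qed (use t \<delta> C_ge_1 in auto)
  also have "1 * (1 - t) powr (- \<delta>) / \<delta> + (C * (1 - t) powr (- \<alpha>)) * (1 - t) powr (\<alpha> - \<delta>) / (\<alpha> - \<delta>)
     = (1 / \<delta> + C / (\<alpha> - \<delta>)) * (1 - t) powr (- \<delta>)"
  proof -
    have "(1 - t) powr (- \<alpha>) * (1 - t) powr (\<alpha> - \<delta>) = (1 - t) powr (- \<delta>)"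
      by (simp add: powr_add[symmetric])
    then show ?thesis by (simp add: mult.assoc ring_distribs)
  qed
  finally show "(\<integral>\<^sup>+r. ennreal ((1 - r) powr (- \<delta>) / V (r * t)) * ennreal (V r / (1 - r)) * indicator {0<..<1} r \<partial>lborel)
      \<le> ennreal ((1 / \<delta> + C / (\<alpha> - \<delta>)) * (1 - t) powr (- \<delta>))" .
qed

text \<open>Both factors (1 - r)^(-\<delta>) and 1 / V(r t) increase with r, so
  \<open>u_le_tail\<close> applies again.\<close>

lemma int_u_test:
  assumes \<delta>: "0 < \<delta>" "\<delta> < \<alpha>"
  shows "\<exists>K>0. \<forall>t. 0 \<le> t \<and> t < 1 \<longrightarrow>
    (\<integral>\<^sup>+r. ennreal ((1 - r) powr (- \<delta>) / V (r * t)) * ennreal (u r) * indicator {0<..<1} r \<partial>lborel)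
      \<le> ennreal (K * (1 - t) powr (- \<delta>))"
proof -
  obtain K where K: "K > 0" "\<And>t. 0 \<le> t \<Longrightarrow> t < 1 \<Longrightarrow>
    (\<integral>\<^sup>+r. ennreal ((1 - r) powr (- \<delta>) / V (r * t)) * ennreal (V r / (1 - r)) * indicator {0<..<1} r \<partial>lborel)
      \<le> ennreal (K * (1 - t) powr (- \<delta>))"
    using int_tail_test[OF \<delta>] by blast
  show ?thesis
  proof (intro exI[of _ "(2 * C * 2 powr \<beta>) * K"] conjI allI impI)
    fix t :: real assume t: "0 \<le> t \<and> t < 1"
    have "(\<integral>\<^sup>+r. ennreal ((1 - r) powr (- \<delta>) / V (r * t)) * ennreal (u r) * indicator {0<..<1} r \<partial>lborel)
      \<le> ennreal (2 * C * 2 powr \<beta>) * (\<integral>\<^sup>+r. ennreal ((1 - r) powr (- \<delta>) / V (r * t)) * ennreal (V r / (1 - r)) * indicator {0<..<1} r \<partial>lborel)"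
    proof (rule u_le_tail)
      fix r s :: real assume rs: "0 < r" "r \<le> s" "s < 1"
      have "r * t \<le> s * t" "0 \<le> r * t" "0 \<le> s * t" using rs t by (auto intro: mult_right_mono)
      moreover have "s * t < 1" using rs t mult_left_le[of t s] by linarith
      ultimately have "V (s * t) \<le> V (r * t)" "0 < V (s * t)" by (auto intro: V_antimono tail_pos)
      moreover have "(1 - r) powr (- \<delta>) \<le> (1 - s) powr (- \<delta>)" using rs \<delta> by (intro powr_mono2') auto
      ultimately show "ennreal ((1 - r) powr (- \<delta>) / V (r * t)) \<le> ennreal ((1 - s) powr (- \<delta>) / V (s * t))"
        by (intro ennreal_leI frac_le) auto
    qed measurable
    also have "\<dots> \<le> ennreal (2 * C * 2 powr \<beta>) * ennreal (K * (1 - t) powr (- \<delta>))"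
      using t by (intro mult_left_mono K) auto
    also have "\<dots> = ennreal ((2 * C * 2 powr \<beta>) * K * (1 - t) powr (- \<delta>))"
      using C_ge_1 K by (simp add: ennreal_mult[symmetric] mult.assoc)
    finally show "(\<integral>\<^sup>+r. ennreal ((1 - r) powr (- \<delta>) / V (r * t)) * ennreal (u r) * indicator {0<..<1} r \<partial>lborel)
      \<le> ennreal ((2 * C * 2 powr \<beta>) * K * (1 - t) powr (- \<delta>))" .
  qed (use C_ge_1 K in auto)
qed

end

text \<open>The one-step inequality is used n times, n being the integer part of the logarithm to
  base K of (1 - t) / (1 - r). Rounding down costs the additional factor c.\<close>

lemma D_check_iterate:
  fixes V :: "real \<Rightarrow> real"
  assumes K: "K > 1" and c: "c > 1"
    and anti: "\<And>r s. 0 \<le> r \<Longrightarrow> r \<le> s \<Longrightarrow> s < 1 \<Longrightarrow> V s \<le> V r" and nn: "\<And>r. 0 \<le> r \<Longrightarrow> r < 1 \<Longrightarrow> 0 \<le> V r"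
    and D: "\<And>r. 0 \<le> r \<Longrightarrow> r < 1 \<Longrightarrow> V r \<ge> c * V (1 - (1 - r) / K)"
    and t: "0 \<le> t" "t \<le> r" "r < 1"
  shows "V r \<le> c * ((1 - r) / (1 - t)) powr (ln c / ln K) * V t"
proof -
  have le1: "(1 - t) / K ^ n \<le> 1 - t" for n
    using K t one_le_power[of K n] by (simp add: divide_le_eq mult_le_cancel_left1)
  have it: "V (1 - (1 - t) / K ^ n) \<le> V t / c ^ n" for n
  proof (induction n)
    case (Suc n)
    have "c * V (1 - (1 - (1 - (1 - t) / K ^ n)) / K) \<le> V (1 - (1 - t) / K ^ n)"
    proof (rule D)
      show "0 \<le> 1 - (1 - t) / K ^ n" using le1[of n] t by linarith
      show "1 - (1 - t) / K ^ n < 1" using t K by simp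
    qed
    with Suc have "c * V (1 - (1 - t) / K ^ Suc n) \<le> V t / c ^ n" by (simp add: mult.commute)
    then show ?case using c by (simp add: field_simps)
  qed (use t in simp)
  define q where "q = (1 - t) / (1 - r)"
  have q: "q \<ge> 1" using t by (simp add: q_def)
  define n where "n = nat \<lfloor>log K q\<rfloor>"
  have lq: "0 \<le> log K q" using q K by simp
  have n1: "real n \<le> log K q" "log K q < real n + 1" using lq by (auto simp: n_def)
  have "K ^ n \<le> q" using n1(1) K q by (simp add: le_log_iff powr_realpow)
  then have "1 - r \<le> (1 - t) / K ^ n" using K t by (simp add: q_def field_simps)
  moreover have "0 \<le> 1 - (1 - t) / K ^ n" using le1[of n] t by linarith
  ultimately have "V r \<le> V (1 - (1 - t) / K ^ n)" using t by (intro anti) linarith+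
  also have "\<dots> \<le> V t / c ^ n" by (rule it)
  also have "\<dots> \<le> V t * (c * (1 / q) powr (ln c / ln K))"
  proof -
    have "q powr (ln c / ln K) = c powr (log K q)"
      using K c q by (simp add: powr_def log_def)
    also have "\<dots> \<le> c powr (real n + 1)" using n1 c by (intro powr_mono) auto
    also have "\<dots> = c * c ^ n" using c by (simp add: powr_add powr_realpow)
    finally have "1 / c ^ n \<le> c * (1 / q) powr (ln c / ln K)"
      using c q by (simp add: powr_divide field_simps)
    then have "V t * (1 / c ^ n) \<le> V t * (c * (1 / q) powr (ln c / ln K))" using nn t by (intro mult_left_mono) auto
    then show ?thesis by simp
  qed
  also have "1 / q = (1 - r) / (1 - t)" by (simp add: q_def)
  finally show ?thesis by (simp add: mult_ac)
qed

text \<open>Here the number of halvings is rounded up, which again costs one factor c. The exponent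
  may exceed ln c / ln 2, so that \<beta> can be taken at least 1.\<close>

lemma D_hat_iterate:
  fixes V :: "real \<Rightarrow> real"
  assumes c: "c \<ge> 1"
    and anti: "\<And>r s. 0 \<le> r \<Longrightarrow> r \<le> s \<Longrightarrow> s < 1 \<Longrightarrow> V s \<le> V r" and nn: "\<And>r. 0 \<le> r \<Longrightarrow> r < 1 \<Longrightarrow> 0 \<le> V r"
    and D: "\<And>r. 0 \<le> r \<Longrightarrow> r < 1 \<Longrightarrow> V r \<le> c * V ((1 + r) / 2)"
    and t: "0 \<le> t" "t \<le> r" "r < 1" and b: "b \<ge> ln c / ln 2"
  shows "V t \<le> c * ((1 - t) / (1 - r)) powr b * V r"
proof -
  have le1: "(1 - t) / 2 ^ n \<le> 1 - t" for n :: nat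
    using t one_le_power[of "2::real" n] by (simp add: divide_le_eq mult_le_cancel_left1)
  have it: "V t \<le> c ^ n * V (1 - (1 - t) / 2 ^ n)" for n
  proof (induction n)
    case (Suc n)
    have "V (1 - (1 - t) / 2 ^ n) \<le> c * V ((1 + (1 - (1 - t) / 2 ^ n)) / 2)"
    proof (rule D)
      show "0 \<le> 1 - (1 - t) / 2 ^ n" using le1[of n] t by linarith
      show "1 - (1 - t) / 2 ^ n < 1" using t by simp
    qed
    also have "(1 + (1 - (1 - t) / 2 ^ n)) / 2 = 1 - (1 - t) / 2 ^ Suc n" by (simp add: field_simps)
    finally have "c ^ n * V (1 - (1 - t) / 2 ^ n) \<le> c ^ n * (c * V (1 - (1 - t) / 2 ^ Suc n))"
      using c by (intro mult_left_mono) auto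
    with Suc show ?case by (simp add: mult_ac)
  qed (use t in simp)
  define q where "q = (1 - t) / (1 - r)"
  have q: "q \<ge> 1" using t by (simp add: q_def)
  define n where "n = nat \<lceil>log 2 q\<rceil>"
  have lq: "0 \<le> log 2 q" using q by simp
  have n1: "log 2 q \<le> real n" "real n < log 2 q + 1" using lq by (auto simp: n_def) linarith+
  have "q \<le> 2 ^ n" using n1(1) q by (simp add: log_le_iff powr_realpow)
  then have "(1 - t) / 2 ^ n \<le> 1 - r" using t by (simp add: q_def field_simps)
  then have "r \<le> 1 - (1 - t) / 2 ^ n" "1 - (1 - t) / 2 ^ n < 1" using t by auto
  then have "V (1 - (1 - t) / 2 ^ n) \<le> V r" using t by (intro anti) linarith+
  then have "V t \<le> c ^ n * V r" using it[of n] c mult_left_mono[of _ _ "c ^ n"] by (meson order_trans zero_le_power zero_le_one)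
  also have "\<dots> \<le> c * q powr b * V r"
  proof (rule mult_right_mono)
    have "c ^ n = c powr (real n)" using c by (simp add: powr_realpow)
    also have "\<dots> \<le> c powr (1 + log 2 q)" using n1 c by (intro powr_mono) auto
    also have "c powr (1 + log 2 q) = c powr 1 * c powr (log 2 q)" by (rule powr_add)
    also have "\<dots> = c * q powr (ln c / ln 2)" using c q by (simp add: powr_def log_def)
    also have "\<dots> \<le> c * q powr b" using c q b by (intro mult_left_mono powr_mono) auto
    finally show "c ^ n \<le> c * q powr b" .
  qed (use nn t in auto)
  finally show ?thesis by (simp add: q_def)
qed

lemma class_D_profile:
  assumes w: "w \<in> class_D"
  obtains u C \<alpha> \<beta> where "D_profile u C \<alpha> \<beta>"
    "\<And>r. 0 \<le> r \<Longrightarrow> r < 1 \<Longrightarrow> hat w (complex_of_real r) = tail u r"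
    "distr (density disc_area (\<lambda>z. ennreal (w z))) (restrict_space borel (ball 0 1)) (\<lambda>z. z)
       = rad (\<lambda>r. ennreal (2 * r * u r))"
proof -
  from w have rw: "radial_weight w"
    and h: "\<exists>C\<ge>1. \<forall>r. 0 \<le> r \<and> r < 1 \<longrightarrow> hat w (complex_of_real r) \<le> C * hat w (complex_of_real ((1 + r) / 2))"
    and c: "\<exists>K>1. \<exists>C>1. \<forall>r. 0 \<le> r \<and> r < 1 \<longrightarrow> hat w (complex_of_real r) \<ge> C * hat w (complex_of_real (1 - (1 - r) / K))"
    unfolding class_D_def D_hat_def D_check_def by blast+
  have hp: "\<And>z. z \<in> ball 0 1 \<Longrightarrow> hat w z > 0" using rw unfolding radial_weight_def by blast
  obtain u :: "real \<Rightarrow> real" where u [measurable]: "u \<in> borel_measurable borel" and u0: "\<And>s. 0 \<le> u s"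
    and V: "\<And>r. 0 \<le> r \<Longrightarrow> r < 1 \<Longrightarrow> (\<integral>\<^sup>+s. ennreal (u s) * indicator {r..<1} s \<partial>lborel) = ennreal (hat w (of_real r))"
    and d: "distr (density disc_area (\<lambda>z. ennreal (w z))) (restrict_space borel (ball 0 1)) (\<lambda>z. z)
       = rad (\<lambda>r. ennreal (2 * r * u r))"
    by (rule radial_weight_profile[OF rw]) blast
  have ht: "hat w (complex_of_real r) = tail u r" if "0 \<le> r" "r < 1" for r
    using V[OF that] hp[of "of_real r"] that by (simp add: tail_def)
  have pos: "tail u r > 0" if "0 \<le> r" "r < 1" for r
    using ht[OF that] hp[of "of_real r"] that by simp
  have anti: "tail u s \<le> tail u r" if "0 \<le> r" "r \<le> s" "s < 1" for r s
  proof -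
    have "(\<integral>\<^sup>+x. ennreal (u x) * indicator {s..<1} x \<partial>lborel) \<le> (\<integral>\<^sup>+x. ennreal (u x) * indicator {r..<1} x \<partial>lborel)"
      using that by (intro nn_integral_mono) (auto simp: indicator_def)
    then have "ennreal (tail u s) \<le> ennreal (tail u r)"
      using that by (simp only: V ht order_trans[of 0 r s] le_less_trans[of r s 1])
    then show ?thesis using pos[of r] that by simp
  qed
  obtain c1 where c1: "c1 \<ge> 1" "\<And>r. 0 \<le> r \<Longrightarrow> r < 1 \<Longrightarrow> tail u r \<le> c1 * tail u ((1 + r) / 2)"
  proof -
    obtain C where C: "C \<ge> 1" "\<And>r. 0 \<le> r \<Longrightarrow> r < 1 \<Longrightarrow> hat w (complex_of_real r) \<le> C * hat w (complex_of_real ((1 + r) / 2))"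
      using h by blast
    show ?thesis
    proof (rule that[OF C(1)])
      fix r :: real assume r: "0 \<le> r" "r < 1"
      show "tail u r \<le> C * tail u ((1 + r) / 2)"
        using C(2)[OF r] ht[of r] ht[of "(1 + r) / 2"] r by simp
    qed
  qed
  obtain K c2 where c2: "K > 1" "c2 > 1" "\<And>r. 0 \<le> r \<Longrightarrow> r < 1 \<Longrightarrow> tail u r \<ge> c2 * tail u (1 - (1 - r) / K)"
  proof -
    obtain K C where C: "K > 1" "C > 1" "\<And>r. 0 \<le> r \<Longrightarrow> r < 1 \<Longrightarrow> hat w (complex_of_real r) \<ge> C * hat w (complex_of_real (1 - (1 - r) / K))"
      using c by blast
    show ?thesis
    proof (rule that[OF C(1,2)])
      fix r :: real assume r: "0 \<le> r" "r < 1"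
      have "0 \<le> 1 - (1 - r) / K" "1 - (1 - r) / K < 1" using r C(1) by (auto simp: field_simps)
      from ht[OF this] show "tail u r \<ge> C * tail u (1 - (1 - r) / K)"
        using C(3)[OF r] ht[of r] r by simp
    qed
  qed
  define CC where "CC = max c1 c2"
  define \<alpha> where "\<alpha> = ln c2 / ln K"
  define \<beta> where "\<beta> = max 1 (ln c1 / ln 2)"
  have "D_profile u CC \<alpha> \<beta>"
  proof
    show "(\<integral>\<^sup>+s. ennreal (u s) * indicator {0..<1} s \<partial>lborel) < \<infinity>"
      using V[of 0] by simp
    show "1 \<le> CC" "0 < \<alpha>" "1 \<le> \<beta>" using c1 c2 by (auto simp: CC_def \<alpha>_def \<beta>_def)
    fix r t :: real assume t: "0 \<le> t" "t \<le> r" "r < 1"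
    have "tail u r \<le> c2 * ((1 - r) / (1 - t)) powr \<alpha> * tail u t"
      unfolding \<alpha>_def by (rule D_check_iterate[where V = "tail u", OF c2(1,2) anti _ c2(3) t]) (auto intro: less_imp_le pos)
    also have "\<dots> \<le> CC * ((1 - r) / (1 - t)) powr \<alpha> * tail u t"
      using pos[of t] t by (intro mult_right_mono) (auto simp: CC_def)
    finally show "tail u r \<le> CC * ((1 - r) / (1 - t)) powr \<alpha> * tail u t" .
    have "tail u t \<le> c1 * ((1 - t) / (1 - r)) powr \<beta> * tail u r"
      by (rule D_hat_iterate[where V = "tail u", OF c1(1) anti _ c1(2) t]) (auto intro: less_imp_le pos simp: \<beta>_def)
    also have "\<dots> \<le> CC * ((1 - t) / (1 - r)) powr \<beta> * tail u r"
      using pos[of r] t by (intro mult_right_mono) (auto simp: CC_def)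
    finally show "tail u t \<le> CC * ((1 - t) / (1 - r)) powr \<beta> * tail u r" .
  qed (use u u0 pos in auto)
  then show ?thesis using ht d by (rule that)
qed

section \<open>Symbols and summation by parts\<close>

text \<open>Sequences whose \<open>j\<close>-th differences, \<open>j \<le> J\<close>, are of size \<open>A k / (k + 1) ^ j\<close>: the discrete
  analogue of a symbol of type \<open>(1, 0)\<close> with weight \<open>A\<close>.\<close>

primrec symb :: "nat \<Rightarrow> (nat \<Rightarrow> real) \<Rightarrow> (nat \<Rightarrow> real) \<Rightarrow> bool" where
  "symb 0 A a \<longleftrightarrow> (\<exists>C. \<forall>k. \<bar>a k\<bar> \<le> C * A k)"
| "symb (Suc J) A a \<longleftrightarrow> (\<exists>C. \<forall>k. \<bar>a k\<bar> \<le> C * A k) \<and> symb J (\<lambda>k. A k / real (Suc k)) (\<lambda>k. a (Suc k) - a k)"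

lemma symb_bound:
  assumes "symb J A a" "\<And>k. 0 \<le> A k"
  obtains C where "C \<ge> 0" "\<And>k. \<bar>a k\<bar> \<le> C * A k"
proof -
  from assms(1) obtain C where C: "\<And>k. \<bar>a k\<bar> \<le> C * A k" by (cases J) auto
  show ?thesis
  proof (rule that[of "\<bar>C\<bar>"])
    fix k show "\<bar>a k\<bar> \<le> \<bar>C\<bar> * A k"
      using C[of k] mult_right_mono[of C "\<bar>C\<bar>" "A k"] assms(2)[of k] by linarith
  qed simp
qed

lemma symb_less_order: "symb (Suc J) A a \<Longrightarrow> symb J A a"
proof (induction J arbitrary: A a)
  case (Suc J)
  from Suc.prems have "symb (Suc J) (\<lambda>k. A k / real (Suc k)) (\<lambda>k. a (Suc k) - a k)" by (simp only: symb.simps)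
  then have "symb J (\<lambda>k. A k / real (Suc k)) (\<lambda>k. a (Suc k) - a k)" by (rule Suc.IH)
  with Suc.prems show ?case by (simp only: symb.simps)
qed simp

lemma symb_weight_mono:
  assumes "symb J A a" "\<And>k. 0 \<le> A k" "\<And>k. A k \<le> c * B k"
  shows "symb J B a"
  using assms
proof (induction J arbitrary: A B a)
  case 0
  obtain C where C: "C \<ge> 0" "\<And>k. \<bar>a k\<bar> \<le> C * A k" using symb_bound[OF 0(1,2)] by blast
  have "\<bar>a k\<bar> \<le> (C * c) * B k" for k
    using C(2)[of k] mult_left_mono[OF 0(3)[of k] C(1)] by (simp add: mult.assoc)
  then show ?case by auto
next
  case (Suc J)
  obtain C where C: "C \<ge> 0" "\<And>k. \<bar>a k\<bar> \<le> C * A k" using symb_bound[OF Suc.prems(1,2)] by blast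
  have "\<bar>a k\<bar> \<le> (C * c) * B k" for k
    using C(2)[of k] mult_left_mono[OF Suc.prems(3)[of k] C(1)] by (simp add: mult.assoc)
  moreover have "symb J (\<lambda>k. B k / real (Suc k)) (\<lambda>k. a (Suc k) - a k)"
  proof (rule Suc.IH)
    show "symb J (\<lambda>k. A k / real (Suc k)) (\<lambda>k. a (Suc k) - a k)" using Suc.prems(1) by simp
    show "0 \<le> A k / real (Suc k)" for k using Suc.prems(2) by simp
    show "A k / real (Suc k) \<le> c * (B k / real (Suc k))" for k
      using Suc.prems(3)[of k] by (simp add: divide_right_mono del: of_nat_Suc)
  qed
  ultimately show ?case by auto
qed

lemma symb_add:
  assumes "symb J A a" "symb J A b"
  shows "symb J A (\<lambda>k. a k + b k)"
  using assms
proof (induction J arbitrary: A a b)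
  case 0
  then obtain C C' where C: "\<And>k. \<bar>a k\<bar> \<le> C * A k" "\<And>k. \<bar>b k\<bar> \<le> C' * A k" by auto
  have *: "\<bar>a k + b k\<bar> \<le> (C + C') * A k" for k
    unfolding distrib_right using abs_triangle_ineq[of "a k" "b k"] C(1)[of k] C(2)[of k] by linarith
  then show ?case by (simp only: symb.simps) blast
next
  case (Suc J)
  then obtain C C' where C: "\<And>k. \<bar>a k\<bar> \<le> C * A k" "\<And>k. \<bar>b k\<bar> \<le> C' * A k" by auto
  have *: "\<bar>a k + b k\<bar> \<le> (C + C') * A k" for k
    unfolding distrib_right using abs_triangle_ineq[of "a k" "b k"] C(1)[of k] C(2)[of k] by linarith
  have "symb J (\<lambda>k. A k / real (Suc k)) (\<lambda>k. (a (Suc k) - a k) + (b (Suc k) - b k))"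
    using Suc.prems by (intro Suc.IH) auto
  moreover have "(\<lambda>k. (a (Suc k) - a k) + (b (Suc k) - b k)) = (\<lambda>k. (a (Suc k) + b (Suc k)) - (a k + b k))"
    by auto
  ultimately show ?case using * by auto
qed

lemma symb_uminus: "symb J A a \<Longrightarrow> symb J A (\<lambda>k. - a k)"
proof (induction J arbitrary: A a)
  case (Suc J)
  from Suc.prems have "symb J (\<lambda>k. A k / real (Suc k)) (\<lambda>k. - (a (Suc k) - a k))"
    by (intro Suc.IH) simp
  moreover have "(\<lambda>k. - (a (Suc k) - a k)) = (\<lambda>k. - a (Suc k) - - a k)" by auto
  ultimately show ?case using Suc.prems by simp
qed simp

text \<open>Discrete Leibniz rule. Besides the two usual terms it contains the product of both
  differences, whose weight has one factor 1 / (k + 1) more than required.\<close>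

lemma symb_mult:
  assumes "symb J A a" "symb J B b" "\<And>k. 0 \<le> A k" "\<And>k. 0 \<le> B k"
  shows "symb J (\<lambda>k. A k * B k) (\<lambda>k. a k * b k)"
  using assms
proof (induction J arbitrary: A a B b)
  case (0 A a B b)
  obtain C where C: "C \<ge> 0" "\<And>k. \<bar>a k\<bar> \<le> C * A k" using symb_bound[OF 0(1,3)] by blast
  obtain C' where C': "C' \<ge> 0" "\<And>k. \<bar>b k\<bar> \<le> C' * B k" using symb_bound[OF 0(2,4)] by blast
  have "\<bar>a k * b k\<bar> \<le> (C * C') * (A k * B k)" for k
    using mult_mono[OF C(2)[of k] C'(2)[of k]] C C' 0(3)[of k] by (simp add: abs_mult mult_ac)
  then show ?case by auto
next
  case (Suc J A a B b)
  obtain C where C: "C \<ge> 0" "\<And>k. \<bar>a k\<bar> \<le> C * A k" using symb_bound[OF Suc.prems(1,3)] by blast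
  obtain C' where C': "C' \<ge> 0" "\<And>k. \<bar>b k\<bar> \<le> C' * B k" using symb_bound[OF Suc.prems(2,4)] by blast
  have 0: "\<bar>a k * b k\<bar> \<le> (C * C') * (A k * B k)" for k
    using mult_mono[OF C(2)[of k] C'(2)[of k]] C C' Suc.prems(3)[of k] by (simp add: abs_mult mult_ac)
  let ?da = "\<lambda>k. a (Suc k) - a k" and ?db = "\<lambda>k. b (Suc k) - b k"
  let ?A = "\<lambda>k. A k / real (Suc k)" and ?B = "\<lambda>k. B k / real (Suc k)"
  note nn = Suc.prems(3,4)
  have da: "symb J ?A ?da" and db: "symb J ?B ?db" using Suc.prems by auto
  have nn': "\<And>k. 0 \<le> ?A k" "\<And>k. 0 \<le> ?B k" using nn by simp_all
  have a: "symb J A a" and b: "symb J B b" using Suc.prems(1,2) symb_less_order by blast+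
  have AB: "(\<lambda>k. ?A k * B k) = (\<lambda>k. A k * B k / real (Suc k))" "(\<lambda>k. A k * ?B k) = (\<lambda>k. A k * B k / real (Suc k))"
    by auto
  have 1: "symb J (\<lambda>k. A k * B k / real (Suc k)) (\<lambda>k. ?da k * b k)"
    using Suc.IH[OF da b nn'(1) nn(2)] unfolding AB .
  have 2: "symb J (\<lambda>k. A k * B k / real (Suc k)) (\<lambda>k. a k * ?db k)"
    using Suc.IH[OF a db nn(1) nn'(2)] unfolding AB .
  have 3: "symb J (\<lambda>k. A k * B k / real (Suc k)) (\<lambda>k. ?da k * ?db k)"
  proof (rule symb_weight_mono[where c = 1, OF Suc.IH[OF da db nn']])
    fix k
    show "0 \<le> ?A k * ?B k" using nn'[of k] by (rule mult_nonneg_nonneg)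
    have "?A k * ?B k = A k * B k / real (Suc k) * (1 / real (Suc k))" by simp
    also have "\<dots> \<le> A k * B k / real (Suc k) * 1" using nn by (intro mult_left_mono) auto
    finally show "?A k * ?B k \<le> 1 * (A k * B k / real (Suc k))" by simp
  qed
  have "symb J (\<lambda>k. A k * B k / real (Suc k)) (\<lambda>k. ?da k * b k + a k * ?db k + ?da k * ?db k)"
    by (intro symb_add 1 2 3)
  moreover have "(\<lambda>k. ?da k * b k + a k * ?db k + ?da k * ?db k) = (\<lambda>k. a (Suc k) * b (Suc k) - a k * b k)"
    by (auto simp: algebra_simps)
  ultimately show ?case using 0 by auto
qed

lemma symb_shift:
  assumes "symb J A a" "\<And>k. 0 \<le> A k" "\<And>k. A (Suc k) \<le> c * A k" "c \<ge> 0"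
  shows "symb J A (\<lambda>k. a (Suc k))"
  using assms
proof (induction J arbitrary: A a)
  case 0
  obtain C where C: "C \<ge> 0" "\<And>k. \<bar>a k\<bar> \<le> C * A k" using symb_bound[OF 0(1,2)] by blast
  have "\<bar>a (Suc k)\<bar> \<le> (C * c) * A k" for k
    using C(2)[of "Suc k"] mult_left_mono[OF 0(3)[of k] C(1)] by (simp add: mult.assoc)
  then show ?case by auto
next
  case (Suc J)
  obtain C where C: "C \<ge> 0" "\<And>k. \<bar>a k\<bar> \<le> C * A k" using symb_bound[OF Suc.prems(1,2)] by blast
  have "\<bar>a (Suc k)\<bar> \<le> (C * c) * A k" for k
    using C(2)[of "Suc k"] mult_left_mono[OF Suc.prems(3)[of k] C(1)] by (simp add: mult.assoc)
  moreover have "symb J (\<lambda>k. A k / real (Suc k)) (\<lambda>k. a (Suc (Suc k)) - a (Suc k))"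
  proof (rule Suc.IH[where a = "\<lambda>k. a (Suc k) - a k"])
    show "symb J (\<lambda>k. A k / real (Suc k)) (\<lambda>k. a (Suc k) - a k)" using Suc.prems(1) by simp
    show "0 \<le> A k / real (Suc k)" for k using Suc.prems(2) by simp
    show "A (Suc k) / real (Suc (Suc k)) \<le> c * (A k / real (Suc k))" for k
    proof -
      have "A (Suc k) / real (Suc (Suc k)) \<le> A (Suc k) / real (Suc k)"
        using Suc.prems(2) by (intro divide_left_mono) auto
      also have "\<dots> \<le> c * A k / real (Suc k)" using Suc.prems(3) by (intro divide_right_mono) auto
      finally show ?thesis by simp
    qed
  qed (rule Suc.prems(4))
  ultimately show ?case by auto
qed

text \<open>The difference of 1 / \<mu> is minus the difference of \<mu> divided by \<mu>(k) \<mu>(k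
  + 1). Hence one order for the reciprocal follows from the previous order by the product rule; the
  constant c' pays for the shifted factor.\<close>

lemma symb_inverse:
  assumes "symb J M \<mu>" and M: "\<And>k. 0 < M k" and \<mu>: "\<And>k. 0 < \<mu> k" "\<And>k. M k \<le> c * \<mu> k"
    and M': "\<And>k. M k \<le> c' * M (Suc k)" and c': "c' \<ge> 0"
  shows "symb J (\<lambda>k. 1 / M k) (\<lambda>k. 1 / \<mu> k)"
  using assms(1)
proof (induction J)
  case 0
  have "\<bar>1 / \<mu> k\<bar> \<le> c * (1 / M k)" for k
    using \<mu>[of k] M[of k] by (simp add: field_simps)
  then show ?case by auto
next
  case (Suc J)
  have 0: "\<bar>1 / \<mu> k\<bar> \<le> c * (1 / M k)" for k
    using \<mu>[of k] M[of k] by (simp add: field_simps)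
  have nn: "0 \<le> 1 / M k" "0 \<le> M k / real (Suc k)" "0 \<le> 1 / M k * (1 / M k)" for k using M[of k] by simp_all
  have 1: "symb J (\<lambda>k. 1 / M k) (\<lambda>k. 1 / \<mu> k)"
    by (rule Suc.IH[OF symb_less_order[OF Suc.prems]])
  have 2: "symb J (\<lambda>k. 1 / M k) (\<lambda>k. 1 / \<mu> (Suc k))"
  proof (rule symb_shift[OF 1 nn(1) _ c'])
    show "1 / M (Suc k) \<le> c' * (1 / M k)" for k
      using M'[of k] M[of k] M[of "Suc k"] by (simp add: field_simps)
  qed
  have 3: "symb J (\<lambda>k. M k / real (Suc k)) (\<lambda>k. \<mu> (Suc k) - \<mu> k)"
    using Suc.prems by simp
  have "symb J (\<lambda>k. M k / real (Suc k) * (1 / M k * (1 / M k))) (\<lambda>k. (\<mu> (Suc k) - \<mu> k) * (1 / \<mu> k * (1 / \<mu> (Suc k))))"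
    by (intro symb_mult 1 2 3 nn)
  then have "symb J (\<lambda>k. M k / real (Suc k) * (1 / M k * (1 / M k))) (\<lambda>k. - ((\<mu> (Suc k) - \<mu> k) * (1 / \<mu> k * (1 / \<mu> (Suc k)))))"
    by (rule symb_uminus)
  moreover have "(\<lambda>k. M k / real (Suc k) * (1 / M k * (1 / M k))) = (\<lambda>k. 1 / M k / real (Suc k))"
    by (rule ext) (use M in \<open>simp add: less_imp_neq[symmetric]\<close>)
  moreover have "(\<lambda>k. - ((\<mu> (Suc k) - \<mu> k) * (1 / \<mu> k * (1 / \<mu> (Suc k))))) = (\<lambda>k. 1 / \<mu> (Suc k) - 1 / \<mu> k)"
  proof
    fix k show "- ((\<mu> (Suc k) - \<mu> k) * (1 / \<mu> k * (1 / \<mu> (Suc k)))) = 1 / \<mu> (Suc k) - 1 / \<mu> k"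
      using \<mu>(1)[of k] \<mu>(1)[of "Suc k"] by (simp add: field_simps)
  qed
  ultimately show ?case using 0 by auto
qed

lemma symb_zero: "(\<And>k. 0 \<le> A k) \<Longrightarrow> symb J A (\<lambda>k. 0)"
proof (induction J arbitrary: A)
  case 0
  then show ?case by (auto intro!: exI[of _ 0])
next
  case (Suc J)
  then have "symb J (\<lambda>k. A k / real (Suc k)) (\<lambda>k. 0)" by (intro Suc.IH) simp
  then show ?case using Suc.prems by (auto intro!: exI[of _ 0])
qed

lemma symb_one: "symb J (\<lambda>k. 1) (\<lambda>k. 1)"
proof (cases J)
  case (Suc I)
  have "symb I (\<lambda>k. 1 / real (Suc k)) (\<lambda>k. 0)" by (rule symb_zero) simp
  then show ?thesis using Suc by (auto intro!: exI[of _ 1])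
qed (auto intro!: exI[of _ 1])

lemma symb_linear: "symb J (\<lambda>k. real (Suc k)) (\<lambda>k. real k + c)"
proof (cases J)
  have b: "\<bar>real k + c\<bar> \<le> (1 + \<bar>c\<bar>) * real (Suc k)" for k
  proof -
    have "\<bar>real k + c\<bar> \<le> real (Suc k) + \<bar>c\<bar>" by simp
    also have "\<dots> \<le> real (Suc k) + \<bar>c\<bar> * real (Suc k)" by (simp add: algebra_simps)
    finally show ?thesis by (simp add: algebra_simps)
  qed
  then show ?thesis if "J = 0" using that by auto
  show ?thesis if "J = Suc I" for I
  proof -
    have "(\<lambda>k. real (Suc k) / real (Suc k)) = (\<lambda>k. 1)" "(\<lambda>k. real (Suc k) + c - (real k + c)) = (\<lambda>k. 1)" by auto
    then show ?thesis using b symb_one that by auto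
  qed
qed

lemma symb_pochhammer: "symb J (\<lambda>k. real (Suc k) ^ n) (\<lambda>k. pochhammer (real k + 1) n)"
proof (induction n)
  case 0
  then show ?case using symb_one by simp
next
  case (Suc n)
  have "symb J (\<lambda>k. real (Suc k) ^ n * real (Suc k)) (\<lambda>k. pochhammer (real k + 1) n * (real k + (1 + real n)))"
    by (intro symb_mult Suc symb_linear) auto
  then show ?case by (simp add: pochhammer_Suc add.assoc mult_ac)
qed

section \<open>Power series whose coefficients are symbols\<close>

lemma suminf_inverse_squares_le:
  assumes "L \<ge> (1::nat)"
  shows "summable (\<lambda>k. 1 / (real (k + L) + 1)\<^sup>2)" "(\<Sum>k. 1 / (real (k + L) + 1)\<^sup>2) \<le> 1 / real L"
proof -
  have s: "(\<lambda>k. 1 / (real k + L) - 1 / (real (Suc k) + L)) sums (1 / (real 0 + L) - 0)"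
  proof (rule telescope_sums')
    show "(\<lambda>k. 1 / (real k + real L)) \<longlonglongrightarrow> 0"
      using LIMSEQ_ignore_initial_segment[OF lim_1_over_n[where 'a = real], of L] by simp
  qed
  have le: "1 / (real (k + L) + 1)\<^sup>2 \<le> 1 / (real k + L) - 1 / (real (Suc k) + L)" for k
  proof -
    have "1 / (real k + L) - 1 / (real (Suc k) + L) = 1 / ((real k + L) * (real (k + L) + 1))"
      using assms by (simp add: field_simps)
    also have "\<dots> \<ge> 1 / ((real (k + L) + 1) * (real (k + L) + 1))"
      using assms by (intro divide_left_mono mult_right_mono) auto
    finally show ?thesis by (simp add: power2_eq_square)
  qed
  show su: "summable (\<lambda>k. 1 / (real (k + L) + 1)\<^sup>2)"
    by (rule summable_comparison_test'[OF sums_summable[OF s]]) (use le in auto)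
  have "(\<Sum>k. 1 / (real (k + L) + 1)\<^sup>2) \<le> (\<Sum>k. 1 / (real k + L) - 1 / (real (Suc k) + L))"
    by (intro suminf_le le su sums_summable[OF s])
  also have "\<dots> = 1 / real L" using sums_unique[OF s] by simp
  finally show "(\<Sum>k. 1 / (real (k + L) + 1)\<^sup>2) \<le> 1 / real L" .
qed

lemma power_le_exp:
  fixes x :: real
  assumes "0 \<le> x"
  shows "x ^ n \<le> fact n * exp x"
proof -
  have "(\<Sum>i\<in>{n}. x ^ i /\<^sub>R fact i) \<le> (\<Sum>i. x ^ i /\<^sub>R fact i)"
    using assms by (intro sum_le_suminf summable_exp_generic) auto
  then show ?thesis by (simp add: exp_def field_simps)
qed

lemma summable_polynomial_powers:
  fixes a :: "nat \<Rightarrow> real" and w :: complex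
  assumes a: "\<And>k. \<bar>a k\<bar> \<le> C * real (Suc k) ^ e" and w: "cmod w < 1"
  shows "summable (\<lambda>k. cmod (of_real (a k) * w ^ k))"
proof -
  define c where "c = max (cmod w) (1/2)"
  have c: "0 < c" "c < 1" "cmod w \<le> c" using w by (auto simp: c_def)
  \<comment> \<open>With this s, exp(s) c is the square root of c and still less than 1: half of the
    geometric decay pays for the polynomial growth.\<close>
  define s where "s = - ln c / 2"
  have s: "s > 0" using c by (simp add: s_def)
  have C: "C \<ge> 0" using a[of 0] by simp
  have ec: "exp s * c < 1"
  proof -
    have "exp s * c = exp (s + ln c)" using c by (simp add: exp_add)
    also have "\<dots> = exp (ln c / 2)" by (simp add: s_def)
    also have "\<dots> < 1" using c by simp
    finally show ?thesis .
  qed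
  show ?thesis
  proof (rule summable_comparison_test'[where N = 0])
    show "summable (\<lambda>k. (C * (fact e / s ^ e * exp s)) * (exp s * c) ^ k)"
      using ec c by (intro summable_mult summable_geometric) auto
    fix k :: nat
    have "(s * real (Suc k)) ^ e \<le> fact e * exp (s * real (Suc k))"
      using s by (intro power_le_exp) simp
    then have "real (Suc k) ^ e \<le> fact e / s ^ e * exp (s * real (Suc k))"
      using s by (simp add: power_mult_distrib field_simps del: of_nat_Suc)
    also have "exp (s * real (Suc k)) = exp s * exp s ^ k"
      by (simp add: exp_of_nat_mult[symmetric] exp_add[symmetric] algebra_simps)
    finally have p: "real (Suc k) ^ e \<le> fact e / s ^ e * exp s * exp s ^ k" by simp
    have "norm (cmod (of_real (a k) * w ^ k)) = \<bar>a k\<bar> * cmod w ^ k" by (simp add: norm_mult norm_power)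
    also have "\<dots> \<le> (C * (fact e / s ^ e * exp s * exp s ^ k)) * c ^ k"
    proof (rule mult_mono)
      show "\<bar>a k\<bar> \<le> C * (fact e / s ^ e * exp s * exp s ^ k)"
        using a[of k] mult_left_mono[OF p C] by linarith
    qed (use c C s in \<open>auto intro: power_mono\<close>)
    finally show "norm (cmod (of_real (a k) * w ^ k)) \<le> (C * (fact e / s ^ e * exp s)) * (exp s * c) ^ k"
      by (simp add: power_mult_distrib mult_ac)
  qed
qed

text \<open>Repeated summation by parts; each step costs a factor \<open>1 / \<bar>1 - w\<bar> \<le> L\<close> and gains \<open>1 / (k + 1)\<close>.\<close>

lemma symb_tail_sum_bound:
  assumes "symb J A a" "\<And>k. 0 \<le> A k" "\<And>k. A k \<le> B * real (Suc k) ^ e" "c \<ge> 0"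
  shows "\<exists>K\<ge>0. \<forall>L\<ge>1. \<forall>P\<ge>0. \<forall>w. cmod w < 1 \<and> 1 / real L \<le> cmod (1 - w) \<and>
      (\<forall>k\<ge>L. A k * real L ^ J * real (Suc k) ^ 2 \<le> c * P * real (Suc k) ^ J * real L ^ 2) \<longrightarrow>
      cmod (\<Sum>k. of_real (a (k + L)) * w ^ (k + L)) \<le> K * real L * P"
  using assms
proof (induction J arbitrary: A a)
  case (0 A a)
  obtain C where C: "C \<ge> 0" "\<And>k. \<bar>a k\<bar> \<le> C * A k" using symb_bound[OF 0(1,2)] by blast
  show ?case
  proof (intro exI[of _ "C * c"] conjI allI impI)
    show "0 \<le> C * c" using C 0 by simp
    fix L :: nat and P :: real and w :: complex
    assume L: "L \<ge> 1" and P: "P \<ge> 0" and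
      as: "cmod w < 1 \<and> 1 / real L \<le> cmod (1 - w) \<and>
      (\<forall>k\<ge>L. A k * real L ^ 0 * real (Suc k) ^ 2 \<le> c * P * real (Suc k) ^ 0 * real L ^ 2)"
    \<comment> \<open>For general J the hypothesis reads A k \<le> c P ((k + 1) / L)^(J - 2). At J =
      0 this is decay like ((k + 1) / L)^(-2), whose tail from L on sums to order L P.\<close>
    have le: "cmod (of_real (a (k + L)) * w ^ (k + L)) \<le> (C * (c * P * real L ^ 2)) * (1 / (real (k + L) + 1)\<^sup>2)" for k
    proof -
      have "A (k + L) * (real (k + L) + 1)\<^sup>2 \<le> c * P * real L ^ 2"
        using as[THEN conjunct2, THEN conjunct2, rule_format, of "k + L"] by (simp add: add.commute)
      then have Ak: "A (k + L) \<le> c * P * real L ^ 2 / (real (k + L) + 1)\<^sup>2"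
        by (subst pos_le_divide_eq) auto
      have "cmod (of_real (a (k + L)) * w ^ (k + L)) \<le> \<bar>a (k + L)\<bar> * 1"
        using as by (simp add: norm_mult norm_power mult_left_le power_le_one)
      also have "\<dots> \<le> C * A (k + L)" using C by simp
      also have "\<dots> \<le> C * (c * P * real L ^ 2 / (real (k + L) + 1)\<^sup>2)" using C Ak by (intro mult_left_mono)
      finally show ?thesis by simp
    qed
    have s: "summable (\<lambda>k. (C * (c * P * real L ^ 2)) * (1 / (real (k + L) + 1)\<^sup>2))"
      by (intro summable_mult suminf_inverse_squares_le L)
    have "cmod (\<Sum>k. of_real (a (k + L)) * w ^ (k + L)) \<le> (\<Sum>k. (C * (c * P * real L ^ 2)) * (1 / (real (k + L) + 1)\<^sup>2))"
      by (rule norm_suminf_le[OF le s])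
    also have "\<dots> = (C * (c * P * real L ^ 2)) * (\<Sum>k. 1 / (real (k + L) + 1)\<^sup>2)"
      by (intro suminf_mult suminf_inverse_squares_le L)
    also have "\<dots> \<le> (C * (c * P * real L ^ 2)) * (1 / real L)"
      using C P 0 by (intro mult_left_mono suminf_inverse_squares_le L) auto
    also have "\<dots> = C * c * real L * P" using L by (simp add: power2_eq_square)
    finally show "cmod (\<Sum>k. of_real (a (k + L)) * w ^ (k + L)) \<le> C * c * real L * P" .
  qed
next
  case (Suc J A a)
  let ?da = "\<lambda>k. a (Suc k) - a k"
  let ?A = "\<lambda>k. A k / real (Suc k)"
  obtain C where C: "C \<ge> 0" "\<And>k. \<bar>a k\<bar> \<le> C * A k" using symb_bound[OF Suc.prems(1,2)] by blast
  have da: "symb J ?A ?da" using Suc.prems by simp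
  have nn: "\<And>k. 0 \<le> ?A k" using Suc.prems by simp
  have A': "?A k \<le> B * real (Suc k) ^ e" for k
  proof -
    have "?A k \<le> A k / 1" using Suc.prems(2) by (intro divide_left_mono) auto
    then show ?thesis using Suc.prems(3)[of k] by simp
  qed
  obtain K where K: "K \<ge> 0" "\<And>L P w. L \<ge> 1 \<Longrightarrow> P \<ge> 0 \<Longrightarrow> cmod w < 1 \<Longrightarrow> 1 / real L \<le> cmod (1 - w) \<Longrightarrow>
      (\<And>k. k \<ge> L \<Longrightarrow> ?A k * real L ^ J * real (Suc k) ^ 2 \<le> c * P * real (Suc k) ^ J * real L ^ 2) \<Longrightarrow>
      cmod (\<Sum>k. of_real (?da (k + L)) * w ^ (k + L)) \<le> K * real L * P"
    using Suc.IH[OF da nn A' Suc.prems(4)] by blast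
  have poly: "\<bar>a k\<bar> \<le> (C * B) * real (Suc k) ^ e" for k
    using C(2)[of k] mult_left_mono[OF Suc.prems(3)[of k] C(1)] by (simp add: mult.assoc del: of_nat_Suc)
  show ?case
  proof (intro exI[of _ "C * c * 2 ^ Suc J + K"] conjI allI impI)
    show "0 \<le> C * c * 2 ^ Suc J + K" using C K Suc.prems by simp
    fix L :: nat and P :: real and w :: complex
    assume L: "L \<ge> 1" and P: "P \<ge> 0" and
      as: "cmod w < 1 \<and> 1 / real L \<le> cmod (1 - w) \<and>
      (\<forall>k\<ge>L. A k * real L ^ Suc J * real (Suc k) ^ 2 \<le> c * P * real (Suc k) ^ Suc J * real L ^ 2)"
    then have w: "cmod w < 1" "1 / real L \<le> cmod (1 - w)"
      and G: "\<And>k. k \<ge> L \<Longrightarrow> A k * real L ^ Suc J * real (Suc k) ^ 2 \<le> c * P * real (Suc k) ^ Suc J * real L ^ 2" by auto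
    have L0: "real L > 0" using L by simp
    let ?s = "\<lambda>k. of_real (a (k + L)) * w ^ (k + L)"
    have sa: "summable (\<lambda>k. of_real (a k) * w ^ k)"
      using summable_polynomial_powers[OF poly w(1)] by (rule summable_norm_cancel)
    have s1: "summable ?s" using summable_ignore_initial_segment[OF sa, of L] .
    have s2: "summable (\<lambda>k. ?s (Suc k))" using s1 by (subst summable_Suc_iff)
    define S where "S = suminf ?s"
    have "(\<Sum>k. of_real (?da (k + L)) * w ^ (k + L)) * w = (\<Sum>k. of_real (?da (k + L)) * w ^ (k + L) * w)"
    proof (rule suminf_mult2)
      have "summable (\<lambda>k. of_real (?da k) * w ^ k)"
      proof -
        obtain D where D: "D \<ge> 0" "\<And>k. \<bar>?da k\<bar> \<le> D * ?A k" using symb_bound[OF da nn] by blast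
        have "\<bar>?da k\<bar> \<le> (D * B) * real (Suc k) ^ e" for k
          using D(2)[of k] mult_left_mono[OF A'[of k] D(1)] by (simp only: mult.assoc order_trans)
        from summable_polynomial_powers[OF this w(1)] show ?thesis by (rule summable_norm_cancel)
      qed
      then show "summable (\<lambda>k. of_real (?da (k + L)) * w ^ (k + L))"
        using summable_ignore_initial_segment[of "\<lambda>k. of_real (?da k) * w ^ k" L] by blast
    qed
    also have "\<dots> = (\<Sum>k. ?s (Suc k) - ?s k * w)"
      by (intro suminf_cong) (simp add: algebra_simps)
    also have "\<dots> = (\<Sum>k. ?s (Suc k)) - (\<Sum>k. ?s k * w)"
      by (intro suminf_diff[symmetric] s2 summable_mult2 s1)
    also have "(\<Sum>k. ?s k * w) = S * w" unfolding S_def by (rule suminf_mult2[symmetric, OF s1])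
    also have "(\<Sum>k. ?s (Suc k)) = S - ?s 0" unfolding S_def by (rule suminf_split_head[OF s1])
    finally have eq: "(1 - w) * S = of_real (a L) * w ^ L + (\<Sum>k. of_real (?da (k + L)) * w ^ (k + L)) * w"
      by (simp add: algebra_simps)
    have aL: "\<bar>a L\<bar> \<le> C * (c * P * 2 ^ Suc J)"
    proof -
      have "A L * real L ^ Suc J * real (Suc L) ^ 2 \<le> c * P * real (Suc L) ^ Suc J * real L ^ 2" by (rule G) simp
      also have "\<dots> \<le> c * P * (2 * real L) ^ Suc J * real (Suc L) ^ 2"
        using L P Suc.prems(4) by (intro mult_mono power_mono) auto
      also have "\<dots> = (c * P * 2 ^ Suc J) * (real L ^ Suc J * real (Suc L) ^ 2)" by (simp add: power_mult_distrib)
      finally have "A L * (real L ^ Suc J * real (Suc L) ^ 2) \<le> (c * P * 2 ^ Suc J) * (real L ^ Suc J * real (Suc L) ^ 2)"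
        by (simp only: mult.assoc)
      then have "A L \<le> c * P * 2 ^ Suc J"
        by (rule mult_right_le_imp_le) (use L0 in simp)
      then show ?thesis using C(2)[of L] mult_left_mono[of "A L" _ C] C(1) by fastforce
    qed
    \<comment> \<open>The difference sequence has weight A k / (k + 1), so it satisfies the
      hypothesis for J with P / L in place of P. The boundary term is of size P, and dividing by |1
      - w| \<ge> 1 / L restores the bound L P.\<close>
    have dS: "cmod (\<Sum>k. of_real (?da (k + L)) * w ^ (k + L)) \<le> K * real L * (P / real L)"
    proof (rule K(2)[OF L _ w])
      fix k assume k: "k \<ge> L"
      have "(?A k * real L ^ J * real (Suc k) ^ 2) * (real L * real (Suc k)) = A k * real L ^ Suc J * real (Suc k) ^ 2"
        by simp
      also have "\<dots> \<le> c * P * real (Suc k) ^ Suc J * real L ^ 2" by (rule G[OF k])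
      also have "\<dots> = (c * (P / real L) * real (Suc k) ^ J * real L ^ 2) * (real L * real (Suc k))"
        using L0 by simp
      finally show "?A k * real L ^ J * real (Suc k) ^ 2 \<le> c * (P / real L) * real (Suc k) ^ J * real L ^ 2"
        by (rule mult_right_le_imp_le) (use L0 in simp)
    qed (use P in simp)
    have "cmod (1 - w) * cmod S = cmod (of_real (a L) * w ^ L + (\<Sum>k. of_real (?da (k + L)) * w ^ (k + L)) * w)"
      using eq by (metis norm_mult)
    also have "\<dots> \<le> \<bar>a L\<bar> * cmod w ^ L + cmod (\<Sum>k. of_real (?da (k + L)) * w ^ (k + L)) * cmod w"
      by (rule order_trans[OF norm_triangle_ineq]) (simp add: norm_mult norm_power)
    also have "\<dots> \<le> (C * (c * P * 2 ^ Suc J)) * 1 + (K * real L * (P / real L)) * 1"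
    proof (rule add_mono)
      have "\<bar>a L\<bar> * cmod w ^ L \<le> \<bar>a L\<bar> * 1" using w by (intro mult_left_mono power_le_one) auto
      then show "\<bar>a L\<bar> * cmod w ^ L \<le> (C * (c * P * 2 ^ Suc J)) * 1" using aL by linarith
      let ?T = "\<Sum>k. of_real (?da (k + L)) * w ^ (k + L)"
      have "cmod ?T * cmod w \<le> cmod ?T * 1" using w by (intro mult_left_mono) auto
      then show "cmod ?T * cmod w \<le> (K * real L * (P / real L)) * 1" using dS by linarith
    qed
    also have "\<dots> = (C * c * 2 ^ Suc J + K) * P" using L0 by (simp add: algebra_simps)
    finally have 1: "cmod (1 - w) * cmod S \<le> (C * c * 2 ^ Suc J + K) * P" .
    have "cmod S = real L * (1 / real L * cmod S)" using L0 by simp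
    also have "\<dots> \<le> real L * (cmod (1 - w) * cmod S)" using w L0 by (intro mult_left_mono mult_right_mono) auto
    also have "\<dots> \<le> real L * ((C * c * 2 ^ Suc J + K) * P)" using 1 by (intro mult_left_mono) auto
    finally show "cmod (\<Sum>k. of_real (a (k + L)) * w ^ (k + L)) \<le> (C * c * 2 ^ Suc J + K) * real L * P"
      unfolding S_def by (simp add: mult_ac)
  qed
qed

text \<open>The sum is cut at L. The first L terms are estimated one by one through the monotonicity
  of A; the rest is summed by parts e + 2 times, e times to undo the growth of A and twice more for
  convergence.\<close>

lemma symb_sum_bound:
  assumes a: "symb (e + 2) A a" and nn: "\<And>k. 0 \<le> A k" and poly: "\<And>k. A k \<le> B * real (Suc k) ^ e" and c: "c \<ge> 1"
    and mono: "\<And>j k. j \<le> k \<Longrightarrow> A j \<le> c * A k"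
    and growth: "\<And>k L. 1 \<le> L \<Longrightarrow> L \<le> k \<Longrightarrow> A k \<le> c * (real (Suc k) / real L) ^ e * A (L - 1)"
  shows "\<exists>K>0. \<forall>L\<ge>1. \<forall>w. cmod w < 1 \<and> 1 / real L \<le> cmod (1 - w) \<longrightarrow>
      cmod (\<Sum>k. of_real (a k) * w ^ k) \<le> K * real L * A (L - 1)"
proof -
  obtain C where C: "C \<ge> 0" "\<And>k. \<bar>a k\<bar> \<le> C * A k" using symb_bound[OF a nn] by blast
  obtain K where K: "K \<ge> 0" "\<And>L P w. L \<ge> 1 \<Longrightarrow> P \<ge> 0 \<Longrightarrow> cmod w < 1 \<Longrightarrow> 1 / real L \<le> cmod (1 - w) \<Longrightarrow>
      (\<And>k. k \<ge> L \<Longrightarrow> A k * real L ^ (e + 2) * real (Suc k) ^ 2 \<le> c * P * real (Suc k) ^ (e + 2) * real L ^ 2) \<Longrightarrow>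
      cmod (\<Sum>k. of_real (a (k + L)) * w ^ (k + L)) \<le> K * real L * P"
    using symb_tail_sum_bound[OF a nn poly, of c] c by (force intro: that)
  have poly': "\<bar>a k\<bar> \<le> (C * B) * real (Suc k) ^ e" for k
    using C(2)[of k] mult_left_mono[OF poly[of k] C(1)] by (simp add: mult.assoc del: of_nat_Suc)
  show ?thesis
  proof (intro exI[of _ "C * c + K + 1"] conjI allI impI)
    show "0 < C * c + K + 1" using C c K by (simp add: add_nonneg_pos)
    fix L :: nat and w :: complex
    assume L: "L \<ge> 1" and as: "cmod w < 1 \<and> 1 / real L \<le> cmod (1 - w)"
    then have w: "cmod w < 1" "1 / real L \<le> cmod (1 - w)" by auto
    have sa: "summable (\<lambda>k. of_real (a k) * w ^ k)"
      using summable_polynomial_powers[OF poly' w(1)] by (rule summable_norm_cancel)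
    have "(\<Sum>k. of_real (a k) * w ^ k) = (\<Sum>k. of_real (a (k + L)) * w ^ (k + L)) + (\<Sum>k<L. of_real (a k) * w ^ k)"
      by (rule suminf_split_initial_segment[OF sa])
    then have "cmod (\<Sum>k. of_real (a k) * w ^ k) \<le> cmod (\<Sum>k. of_real (a (k + L)) * w ^ (k + L)) + cmod (\<Sum>k<L. of_real (a k) * w ^ k)"
      by (metis norm_triangle_ineq)
    also have "cmod (\<Sum>k<L. of_real (a k) * w ^ k) \<le> (\<Sum>k<L. C * (c * A (L - 1)))"
    proof (rule sum_norm_le)
      fix k assume "k \<in> {..<L}"
      then have "A k \<le> c * A (L - 1)" by (intro mono) auto
      moreover have "cmod (of_real (a k) * w ^ k) \<le> \<bar>a k\<bar> * 1"
        using w by (simp add: norm_mult norm_power mult_left_le power_le_one)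
      ultimately show "cmod (of_real (a k) * w ^ k) \<le> C * (c * A (L - 1))"
        using C(2)[of k] mult_left_mono[OF _ C(1), of "A k" "c * A (L - 1)"] by linarith
    qed
    also have "\<dots> = C * c * real L * A (L - 1)" by simp
    also have "cmod (\<Sum>k. of_real (a (k + L)) * w ^ (k + L)) \<le> K * real L * A (L - 1)"
    proof (rule K(2)[OF L nn w])
      fix k assume k: "k \<ge> L"
      have "A k * real L ^ (e + 2) * real (Suc k) ^ 2 \<le> (c * (real (Suc k) / real L) ^ e * A (L - 1)) * real L ^ (e + 2) * real (Suc k) ^ 2"
        by (intro mult_right_mono growth L k) auto
      also have "\<dots> = c * A (L - 1) * real (Suc k) ^ (e + 2) * real L ^ 2"
        using L by (simp add: power_divide power_add power2_eq_square del: of_nat_Suc)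
      finally show "A k * real L ^ (e + 2) * real (Suc k) ^ 2 \<le> c * A (L - 1) * real (Suc k) ^ (e + 2) * real L ^ 2" .
    qed
    finally have "cmod (\<Sum>k. of_real (a k) * w ^ k) \<le> (C * c + K) * (real L * A (L - 1))"
      by (simp add: algebra_simps)
    also have "\<dots> \<le> (C * c + K + 1) * (real L * A (L - 1))" using nn by (intro mult_right_mono) auto
    finally show "cmod (\<Sum>k. of_real (a k) * w ^ k) \<le> (C * c + K + 1) * real L * A (L - 1)" by simp
  qed
qed

section \<open>Moments and the kernel series\<close>

definition moment :: "(real \<Rightarrow> ennreal) \<Rightarrow> nat \<Rightarrow> real" where
  "moment v k = enn2real (\<integral>\<^sup>+r. ennreal (r ^ (2 * k)) * v r * indicator {0<..<1} r \<partial>lborel)"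

section \<open>Integrals of powers of |1 - w| over a circle\<close>

lemma sin_pi_ge:
  assumes "0 \<le> x" "x \<le> 1/2"
  shows "x \<le> sin (pi * x)"
proof -
  define y where "y = pi * x"
  have y: "0 \<le> y" "y \<le> 2" "3 * x \<le> y"
  proof -
    have 1: "pi * x \<le> pi * (1/2)" using assms by (intro mult_left_mono) auto
    have 2: "pi * (1/2) \<le> 2" using pi_half_less_two by simp
    show "y \<le> 2" using order_trans[OF 1 2] by (simp only: y_def)
    show "3 * x \<le> y" unfolding y_def using assms pi_gt3 by (intro mult_right_mono) auto
  qed (use assms in \<open>simp add: y_def\<close>)
  have "\<bar>sin y - (\<Sum>m<3. sin_coeff m * y ^ m)\<bar> \<le> inverse (fact 3) * \<bar>y\<bar> ^ 3"
    by (rule Maclaurin_sin_bound)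
  then have "\<bar>sin y - y\<bar> \<le> y ^ 3 / 6"
    using y by (simp add: sin_coeff_def eval_nat_numeral fact_numeral)
  then have "y - y ^ 3 / 6 \<le> sin y" using abs_ge_minus_self[of "sin y - y"] by linarith
  moreover have "y ^ 3 \<le> 4 * y"
  proof -
    have "y\<^sup>2 \<le> 2\<^sup>2" using y by (intro power_mono) auto
    then have "y\<^sup>2 * y \<le> 4 * y" using y by (intro mult_right_mono) auto
    then show ?thesis by (simp add: eval_nat_numeral)
  qed
  ultimately show ?thesis using y by (simp add: y_def)
qed

text \<open>From |1 - \<rho> circ x|^2 = (1 - \<rho>)^2 + 4 \<rho> sin(pi x)^2. For \<rho> \<ge> 1/2
  the second term dominates the square of the distance of x to the endpoints, that is, to the angle
  0; for smaller \<rho> the term 1 - \<rho> alone is large enough.\<close>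

lemma norm_one_minus_circ_ge:
  assumes \<rho>: "0 \<le> \<rho>" "\<rho> < 1" and x: "0 \<le> x" "x \<le> 1"
  shows "((1 - \<rho>) + min x (1 - x)) / 3 \<le> cmod (1 - of_real \<rho> * circ x)"
proof -
  define d where "d = min x (1 - x)"
  have d: "0 \<le> d" "d \<le> 1/2" using x by (auto simp: d_def min_def)
  show ?thesis
  proof (cases "\<rho> \<ge> 1/2")
    case False
    have "1 - \<rho> \<le> cmod (1 - of_real \<rho> * circ x)"
      using norm_triangle_ineq2[of 1 "of_real \<rho> * circ x"] \<rho> by (simp add: norm_mult)
    then show ?thesis using False d unfolding d_def[symmetric] by simp
  next
    case True
    have sd: "d \<le> sin (pi * x)"
    proof (cases "x \<le> 1/2")
      case True
      then show ?thesis using sin_pi_ge[of x] x by (simp add: d_def)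
    next
      case False
      have "sin (pi * x) = sin (pi * (1 - x))" by (simp add: right_diff_distrib)
      then show ?thesis using False sin_pi_ge[of "1 - x"] x by (simp add: d_def)
    qed
    have "(cmod (1 - of_real \<rho> * circ x))\<^sup>2 = (1 - \<rho> * cos (2 * pi * x))\<^sup>2 + (\<rho> * sin (2 * pi * x))\<^sup>2"
      by (simp add: cmod_power2 circ_def)
    also have "\<dots> = 1 - 2 * \<rho> * cos (2 * pi * x) + \<rho>\<^sup>2 * ((sin (2 * pi * x))\<^sup>2 + (cos (2 * pi * x))\<^sup>2)"
    proof -
      have "(1 - \<rho> * c)\<^sup>2 + (\<rho> * S)\<^sup>2 = 1 - 2 * \<rho> * c + \<rho>\<^sup>2 * (S\<^sup>2 + c\<^sup>2)" for c S :: real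
        by (simp add: power2_eq_square algebra_simps)
      then show ?thesis .
    qed
    also have "\<dots> = 1 - 2 * \<rho> * cos (2 * pi * x) + \<rho>\<^sup>2" by simp
    also have "cos (2 * pi * x) = 1 - 2 * (sin (pi * x))\<^sup>2"
      using cos_double_sin[of "pi * x"] by (simp add: mult.assoc)
    finally have eq: "(cmod (1 - of_real \<rho> * circ x))\<^sup>2 = (1 - \<rho>)\<^sup>2 + 4 * \<rho> * (sin (pi * x))\<^sup>2"
      by (simp add: power2_eq_square algebra_simps)
    have "d\<^sup>2 \<le> (sin (pi * x))\<^sup>2" using d sd by (intro power_mono) auto
    then have "2 * d\<^sup>2 \<le> 4 * \<rho> * (sin (pi * x))\<^sup>2" using True by (intro mult_mono) auto
    moreover have "(((1 - \<rho>) + d) / 3)\<^sup>2 \<le> (1 - \<rho>)\<^sup>2 + d\<^sup>2"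
    proof -
      have "((1 - \<rho>) + d)\<^sup>2 \<le> 2 * ((1 - \<rho>)\<^sup>2 + d\<^sup>2)"
        using sum_squares_bound[of "1 - \<rho>" d] by (simp add: power2_sum)
      also have "\<dots> \<le> 9 * ((1 - \<rho>)\<^sup>2 + d\<^sup>2)" by (intro mult_right_mono) auto
      finally show ?thesis by (simp add: power_divide)
    qed
    ultimately have "(((1 - \<rho>) + d) / 3)\<^sup>2 \<le> (cmod (1 - of_real \<rho> * circ x))\<^sup>2"
      unfolding eq using zero_le_power2[of d] by linarith
    then show ?thesis unfolding d_def[symmetric] by (rule power2_le_imp_le) simp
  qed
qed

text \<open>Rotation reduces w to |w|. The distance min x (1 - x) is then handled by adding the
  integrals belonging to the two endpoints, each of which is elementary.\<close>

lemma nn_circle_integral_powr: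
  assumes a: "a > 1"
  shows "\<exists>K>0. \<forall>w. cmod w < 1 \<longrightarrow>
    (\<integral>\<^sup>+x. ennreal (cmod (1 - w * circ x) powr (- a)) \<partial>unit_interval) \<le> ennreal (K * (1 - cmod w) powr (1 - a))"
proof (intro exI[of _ "3 powr a * (2 / (a - 1))"] conjI allI impI)
  show "0 < 3 powr a * (2 / (a - 1))" using a by simp
  fix w :: complex assume w: "cmod w < 1"
  define s where "s = 1 - cmod w"
  have s: "s > 0" using w by (simp add: s_def)
  have I: "(\<integral>\<^sup>+x. ennreal ((s + x) powr (- a)) * indicator {0..1} x \<partial>lborel) \<le> ennreal (s powr (1 - a) / (a - 1))"
  proof -
    have "(\<integral>\<^sup>+x. ennreal ((s + x) powr (- a)) * indicator {0..1} x \<partial>lborel)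
        = ennreal ((- ((s + 1) powr (1 - a) / (a - 1))) - (- ((s + 0) powr (1 - a) / (a - 1))))"
    proof (rule nn_integral_FTC_Icc)
      fix x :: real assume "x \<in> {0..1}"
      then have "((\<lambda>x. (s + x) powr (1 - a)) has_real_derivative (1 - a) * (s + x) powr (- a)) (at x)"
        using s by (auto intro!: derivative_eq_intros)
      from DERIV_cmult[OF this, of "- 1 / (a - 1)"]
      have "((\<lambda>x. - ((s + x) powr (1 - a) / (a - 1))) has_real_derivative - 1 / (a - 1) * ((1 - a) * (s + x) powr (- a))) (at x)"
        by simp
      then show "((\<lambda>x. - ((s + x) powr (1 - a) / (a - 1))) has_real_derivative (s + x) powr (- a)) (at x)"
      proof (rule DERIV_cong)
        have "- 1 / (a - 1) * (1 - a) = 1" using a by (simp add: field_simps)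
        then show "- 1 / (a - 1) * ((1 - a) * (s + x) powr (- a)) = (s + x) powr (- a)"
          by (simp only: mult.assoc[symmetric] mult_1_left)
      qed
    qed auto
    also have "\<dots> \<le> ennreal (s powr (1 - a) / (a - 1))" using a by (intro ennreal_leI) simp
    finally show ?thesis .
  qed
  have I': "(\<integral>\<^sup>+x. ennreal ((s + (1 - x)) powr (- a)) * indicator {0..1} x \<partial>lborel) \<le> ennreal (s powr (1 - a) / (a - 1))"
  proof -
    have "(\<integral>\<^sup>+x. ennreal ((s + (1 - x)) powr (- a)) * indicator {0..1} x \<partial>lborel)
        = ennreal ((s + (1 - 1)) powr (1 - a) / (a - 1) - (s + (1 - 0)) powr (1 - a) / (a - 1))"
    proof (rule nn_integral_FTC_Icc)
      fix x :: real assume "x \<in> {0..1}"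
      then have "((\<lambda>x. (s + (1 - x)) powr (1 - a)) has_real_derivative (a - 1) * (s + (1 - x)) powr (- a)) (at x)"
        using s by (auto intro!: derivative_eq_intros simp: algebra_simps)
      from DERIV_cmult[OF this, of "1 / (a - 1)"]
      show "((\<lambda>x. (s + (1 - x)) powr (1 - a) / (a - 1)) has_real_derivative (s + (1 - x)) powr (- a)) (at x)"
        using a by simp
    qed auto
    also have "\<dots> \<le> ennreal (s powr (1 - a) / (a - 1))" using a by (intro ennreal_leI) simp
    finally show ?thesis .
  qed
  have "(\<integral>\<^sup>+x. ennreal (cmod (1 - w * circ x) powr (- a)) \<partial>unit_interval)
      = (\<integral>\<^sup>+x. ennreal (cmod (1 - of_real (cmod w) * circ x) powr (- a)) \<partial>unit_interval)"
    by (rule nn_integral_circle_rotate[where F = "\<lambda>z. ennreal (cmod (1 - z) powr (- a))"]) measurable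
  also have "\<dots> = (\<integral>\<^sup>+x. ennreal (cmod (1 - of_real (cmod w) * circ x) powr (- a)) * indicator {0..1} x \<partial>lborel)"
    by (rule nn_integral_unit_interval)
  also have "\<dots> \<le> (\<integral>\<^sup>+x. ennreal (3 powr a) * (ennreal ((s + x) powr (- a)) * indicator {0..1} x + ennreal ((s + (1 - x)) powr (- a)) * indicator {0..1} x) \<partial>lborel)"
  proof (rule nn_integral_mono)
    fix x :: real
    show "ennreal (cmod (1 - of_real (cmod w) * circ x) powr (- a)) * indicator {0..1} x
      \<le> ennreal (3 powr a) * (ennreal ((s + x) powr (- a)) * indicator {0..1} x + ennreal ((s + (1 - x)) powr (- a)) * indicator {0..1} x)"
    proof (cases "x \<in> {0..1}")
      case True
      then have x: "0 \<le> x" "x \<le> 1" by auto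
      define d where "d = min x (1 - x)"
      have d: "0 \<le> d" using x by (simp add: d_def)
      have "cmod (1 - of_real (cmod w) * circ x) powr (- a) \<le> ((s + d) / 3) powr (- a)"
        using norm_one_minus_circ_ge[of "cmod w" x] w x s d a unfolding s_def d_def by (intro powr_mono2') auto
      also have "\<dots> = 3 powr a * (s + d) powr (- a)"
        using s d by (simp add: powr_divide powr_minus field_simps)
      also have "(s + d) powr (- a) \<le> (s + x) powr (- a) + (s + (1 - x)) powr (- a)"
        by (auto simp: d_def min_def)
      finally have "cmod (1 - of_real (cmod w) * circ x) powr (- a) \<le> 3 powr a * ((s + x) powr (- a) + (s + (1 - x)) powr (- a))"
        by simp
      then have "ennreal (cmod (1 - of_real (cmod w) * circ x) powr (- a)) \<le> ennreal (3 powr a * ((s + x) powr (- a) + (s + (1 - x)) powr (- a)))"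
        by (rule ennreal_leI)
      then show ?thesis using True by (simp add: ennreal_mult)
    qed simp
  qed
  also have "\<dots> = ennreal (3 powr a) * ((\<integral>\<^sup>+x. ennreal ((s + x) powr (- a)) * indicator {0..1} x \<partial>lborel) + (\<integral>\<^sup>+x. ennreal ((s + (1 - x)) powr (- a)) * indicator {0..1} x \<partial>lborel))"
    by (subst nn_integral_cmult) (auto simp: nn_integral_add)
  also have "\<dots> \<le> ennreal (3 powr a) * (ennreal (s powr (1 - a) / (a - 1)) + ennreal (s powr (1 - a) / (a - 1)))"
    by (intro mult_left_mono add_mono I I') auto
  also have "\<dots> = ennreal (3 powr a * (2 / (a - 1)) * s powr (1 - a))"
    using a by (simp add: ennreal_plus[symmetric] ennreal_mult[symmetric] del: ennreal_plus)
  finally show "(\<integral>\<^sup>+x. ennreal (cmod (1 - w * circ x) powr (- a)) \<partial>unit_interval) \<le> ennreal (3 powr a * (2 / (a - 1)) * (1 - cmod w) powr (1 - a))"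
    by (simp add: s_def)
qed

section \<open>Moments of a weight and the kernel series\<close>

context D_profile
begin

abbreviation area :: "real \<Rightarrow> ennreal" where "area \<equiv> \<lambda>r. ennreal (2 * r * u r)"

text \<open>Up to sign these are the i-th differences in k of the moments: each difference
  contributes one factor 1 - r^2. Differences of every order are thus integrals of nonnegative
  functions and can be estimated in the same way.\<close>

definition mixed_moment :: "nat \<Rightarrow> nat \<Rightarrow> real" where
  "mixed_moment i k = enn2real (\<integral>\<^sup>+r. ennreal (r ^ (2 * k) * (1 - r\<^sup>2) ^ i * (2 * r * u r)) * indicator {0<..<1} r \<partial>lborel)"

abbreviation \<mu> :: "nat \<Rightarrow> real" where "\<mu> \<equiv> mixed_moment 0"

text \<open>\<open>M k\<close> is the common size of the moments of order \<open>2 k\<close>.\<close>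

definition M :: "nat \<Rightarrow> real" where "M k = V (1 - 1 / real (Suc k))"

lemma \<mu>_eq_moment: "\<mu> k = moment area k"
  unfolding mixed_moment_def moment_def
  by (intro arg_cong[where f = enn2real] nn_integral_cong) (auto simp: indicator_def ennreal_mult[symmetric])

lemma mixed_moment_nn:
  "(\<integral>\<^sup>+r. ennreal (r ^ (2 * k) * (1 - r\<^sup>2) ^ i * (2 * r * u r)) * indicator {0<..<1} r \<partial>lborel) = ennreal (mixed_moment i k)"
proof -
  have "(\<integral>\<^sup>+r. ennreal (r ^ (2 * k) * (1 - r\<^sup>2) ^ i * (2 * r * u r)) * indicator {0<..<1} r \<partial>lborel)
    \<le> (\<integral>\<^sup>+r. ennreal 2 * (ennreal (u r) * indicator {0..<1} r) \<partial>lborel)"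
  proof (rule nn_integral_mono)
    fix r :: real
    show "ennreal (r ^ (2 * k) * (1 - r\<^sup>2) ^ i * (2 * r * u r)) * indicator {0<..<1} r \<le> ennreal 2 * (ennreal (u r) * indicator {0..<1} r)"
    proof (cases "0 < r \<and> r < 1")
      case True
      have "r ^ (2 * k) * (1 - r\<^sup>2) ^ i * (2 * r * u r) \<le> 1 * 1 * (2 * 1 * u r)"
        using True by (intro mult_mono power_le_one mult_nonneg_nonneg zero_le_power) (auto simp: power_le_one)
      then show ?thesis using True by (simp add: ennreal_mult[symmetric] ennreal_leI del: ennreal_numeral)
    qed auto
  qed
  also have "\<dots> = ennreal 2 * ennreal (V 0)"
    by (subst nn_integral_cmult) (auto simp: V_nn)
  also have "\<dots> < \<infinity>" by (simp add: ennreal_mult_less_top)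
  finally show ?thesis by (simp add: mixed_moment_def less_top)
qed

lemma mixed_moment_nonneg [simp]: "0 \<le> mixed_moment i k"
  by (simp add: mixed_moment_def)

lemma mixed_moment_diff: "mixed_moment i (Suc k) - mixed_moment i k = - mixed_moment (Suc i) k"
proof -
  have "ennreal (mixed_moment i k) = (\<integral>\<^sup>+r. ennreal (r ^ (2 * Suc k) * (1 - r\<^sup>2) ^ i * (2 * r * u r)) * indicator {0<..<1} r
      + ennreal (r ^ (2 * k) * (1 - r\<^sup>2) ^ Suc i * (2 * r * u r)) * indicator {0<..<1} r \<partial>lborel)"
    unfolding mixed_moment_nn[symmetric]
  proof (rule nn_integral_cong)
    fix r :: real
    show "ennreal (r ^ (2 * k) * (1 - r\<^sup>2) ^ i * (2 * r * u r)) * indicator {0<..<1} r =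
      ennreal (r ^ (2 * Suc k) * (1 - r\<^sup>2) ^ i * (2 * r * u r)) * indicator {0<..<1} r
      + ennreal (r ^ (2 * k) * (1 - r\<^sup>2) ^ Suc i * (2 * r * u r)) * indicator {0<..<1} r"
    proof (cases "0 < r \<and> r < 1")
      case True
      then have nn: "0 \<le> 1 - r\<^sup>2" by (simp add: power_le_one)
      have "r ^ (2 * k) * (1 - r\<^sup>2) ^ i * (2 * r * u r) = r ^ (2 * Suc k) * (1 - r\<^sup>2) ^ i * (2 * r * u r) + r ^ (2 * k) * (1 - r\<^sup>2) ^ Suc i * (2 * r * u r)"
        by (simp add: algebra_simps power2_eq_square)
      then show ?thesis using True nn by (simp only:) (simp add: ennreal_plus)
    qed auto
  qed
  also have "\<dots> = ennreal (mixed_moment i (Suc k)) + ennreal (mixed_moment (Suc i) k)"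
    unfolding mixed_moment_nn[symmetric] by (rule nn_integral_add) auto
  finally have "mixed_moment i k = mixed_moment i (Suc k) + mixed_moment (Suc i) k"
    by (simp add: ennreal_plus[symmetric] del: ennreal_plus)
  then show ?thesis by simp
qed

lemma M_pos: "0 < M k"
  unfolding M_def by (intro tail_pos) auto

lemma M_lower: "j \<le> k \<Longrightarrow> M j \<le> C * (real (Suc k) / real (Suc j)) powr \<beta> * M k"
proof -
  assume jk: "j \<le> k"
  have "V (1 - 1 / real (Suc j)) \<le> C * ((1 - (1 - 1 / real (Suc j))) / (1 - (1 - 1 / real (Suc k)))) powr \<beta> * V (1 - 1 / real (Suc k))"
    using jk by (intro lower) (auto simp: field_simps)
  also have "(1 - (1 - 1 / real (Suc j))) / (1 - (1 - 1 / real (Suc k))) = real (Suc k) / real (Suc j)" by simp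
  finally show ?thesis by (simp only: M_def)
qed

lemma M_Suc: "M k \<le> C * 2 powr \<beta> * M (Suc k)"
proof -
  have "M k \<le> C * (real (Suc (Suc k)) / real (Suc k)) powr \<beta> * M (Suc k)" by (intro M_lower) simp
  also have "\<dots> \<le> C * 2 powr \<beta> * M (Suc k)"
    using C_ge_1 \<beta>_ge_1 M_pos[of "Suc k"]
    by (intro mult_right_mono mult_left_mono powr_mono2) (auto simp: divide_le_eq)
  finally show ?thesis .
qed

lemma M_antimono: "j \<le> k \<Longrightarrow> M k \<le> M j"
  unfolding M_def by (intro V_antimono) (auto simp: field_simps)

text \<open>With n = k + 1 and t = 1 - 1 / n, the factor r^(2 k) decays like exp(-2 y) in the
  variable y = n (1 - r) and absorbs every power of 1 + y. Since n (1 - r t) \<le> 1 + y, the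
  integrand is at most a multiple of n^(-i - \<kappa>) (1 - r t)^(-\<kappa>) u r, and
  \<open>int_u_bound\<close> applies.\<close>

lemma mixed_moment_bound:
  "\<exists>K. \<forall>k. \<bar>mixed_moment i k\<bar> \<le> K * (M k / real (Suc k) ^ i)"
proof -
  define \<kappa> where "\<kappa> = nat \<lceil>\<beta>\<rceil> + 1"
  have \<kappa>: "real \<kappa> > \<beta>" using \<beta>_ge_1 by (simp add: \<kappa>_def) linarith
  obtain K where K: "K > 0" "\<And>t. 0 \<le> t \<Longrightarrow> t < 1 \<Longrightarrow>
     (\<integral>\<^sup>+r. ennreal ((1 - r * t) powr (- real \<kappa>)) * ennreal (u r) * indicator {0<..<1} r \<partial>lborel)
      \<le> ennreal (K * (V t * (1 - t) powr (- real \<kappa>)))"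
    using int_u_bound[OF \<kappa>] by blast
  \<comment> \<open>A factor 2 for each 1 - r^2 \<le> 2 (1 - r) and one for 2 r; the factorial from
    bounding a power by an exponential; exp 3 from exp(2 - 2 y) exp(1 + y) with y \<ge> 0.\<close>
  define D :: real where "D = 2 ^ Suc i * fact (i + \<kappa>) * exp 3"
  have D: "D > 0" by (simp add: D_def)
  show ?thesis
  proof (intro exI allI)
    fix k
    define n where "n = real (Suc k)"
    have n: "n \<ge> 1" by (simp add: n_def)
    define t where "t = 1 - 1 / n"
    have t: "0 \<le> t" "t < 1" "1 - t = 1 / n" using n by (auto simp: t_def field_simps)
    have pt: "r ^ (2 * k) * (1 - r\<^sup>2) ^ i * (2 * r * u r) \<le> (D / n ^ (i + \<kappa>)) * ((1 - r * t) powr (- real \<kappa>) * u r)"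
      if r: "0 < r" "r < 1" for r
    proof -
      define y where "y = n * (1 - r)"
      have y: "0 \<le> y" using r n by (simp add: y_def)
      have rt: "0 < 1 - r * t" using r t mult_left_le[of t r] by (smt (verit) mult_left_le)
      have nrt: "n * (1 - r * t) \<le> 1 + y" using r n by (simp add: t_def y_def field_simps)
      have "r \<le> exp (r - 1)" using exp_ge_add_one_self[of "r - 1"] by simp
      then have "r ^ (2 * k) \<le> exp (r - 1) ^ (2 * k)" using r by (intro power_mono) auto
      also have "\<dots> = exp (real (2 * k) * (r - 1))" by (rule exp_of_nat_mult[symmetric])
      also have "\<dots> \<le> exp (2 - 2 * y)" using r by (simp add: y_def n_def algebra_simps)
      finally have 1: "r ^ (2 * k) \<le> exp (2 - 2 * y)" .
      have "1 - r\<^sup>2 = (1 - r) * (1 + r)" by (simp add: power2_eq_square algebra_simps)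
      also have "\<dots> \<le> (1 - r) * 2" using r by (intro mult_left_mono) auto
      finally have "1 - r\<^sup>2 \<le> 2 * (y / n)" using n by (simp add: y_def)
      then have "(1 - r\<^sup>2) ^ i \<le> (2 * (y / n)) ^ i" using r by (intro power_mono) (auto simp: power_le_one)
      then have 2: "(1 - r\<^sup>2) ^ i \<le> 2 ^ i * y ^ i / n ^ i" by (simp add: power_mult_distrib power_divide)
      have 3: "(n * (1 - r * t)) ^ \<kappa> \<le> (1 + y) ^ \<kappa>" using nrt n rt by (intro power_mono) auto
      have "y ^ i * (1 + y) ^ \<kappa> \<le> (1 + y) ^ i * (1 + y) ^ \<kappa>" using y by (intro mult_right_mono power_mono) auto
      also have "\<dots> \<le> fact (i + \<kappa>) * exp (1 + y)" unfolding power_add[symmetric] using y by (intro power_le_exp) simp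
      finally have 4: "y ^ i * (1 + y) ^ \<kappa> \<le> fact (i + \<kappa>) * exp (1 + y)" .
      have "(r ^ (2 * k) * (1 - r\<^sup>2) ^ i * (2 * r)) * (n * (1 - r * t)) ^ \<kappa>
         \<le> (exp (2 - 2 * y) * (2 ^ i * y ^ i / n ^ i) * (2 * 1)) * (1 + y) ^ \<kappa>"
        using r rt n y by (intro mult_mono 1 2 3 mult_nonneg_nonneg zero_le_power) (auto simp: power_le_one)
      also have "\<dots> = (2 ^ Suc i / n ^ i) * exp (2 - 2 * y) * (y ^ i * (1 + y) ^ \<kappa>)" by simp
      also have "\<dots> \<le> (2 ^ Suc i / n ^ i) * exp (2 - 2 * y) * (fact (i + \<kappa>) * exp (1 + y))"
        using n by (intro mult_left_mono 4) auto
      also have "\<dots> = (2 ^ Suc i / n ^ i) * fact (i + \<kappa>) * exp (3 - y)" by (simp add: exp_add[symmetric])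
      also have "\<dots> \<le> (2 ^ Suc i / n ^ i) * fact (i + \<kappa>) * exp 3"
        using n y by (intro mult_left_mono) auto
      also have "\<dots> = D / n ^ i" by (simp add: D_def)
      finally have "(r ^ (2 * k) * (1 - r\<^sup>2) ^ i * (2 * r)) * (n * (1 - r * t)) ^ \<kappa> \<le> D / n ^ i" .
      then have "r ^ (2 * k) * (1 - r\<^sup>2) ^ i * (2 * r) \<le> D / n ^ i / (n * (1 - r * t)) ^ \<kappa>"
        using n rt by (subst pos_le_divide_eq) auto
      also have "\<dots> = D / n ^ (i + \<kappa>) * (1 - r * t) powr (- real \<kappa>)"
      proof -
        have "(1 - r * t) powr (- real \<kappa>) = 1 / (1 - r * t) ^ \<kappa>"
          using rt by (simp add: powr_minus powr_realpow divide_inverse)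
        then show ?thesis by (simp add: power_mult_distrib power_add mult_ac)
      qed
      finally have "(r ^ (2 * k) * (1 - r\<^sup>2) ^ i * (2 * r)) * u r \<le> (D / n ^ (i + \<kappa>) * (1 - r * t) powr (- real \<kappa>)) * u r"
        by (rule mult_right_mono) simp
      then show ?thesis by (simp add: mult_ac)
    qed
    have "ennreal (mixed_moment i k) \<le> (\<integral>\<^sup>+r. ennreal (D / n ^ (i + \<kappa>)) * (ennreal ((1 - r * t) powr (- real \<kappa>)) * ennreal (u r) * indicator {0<..<1} r) \<partial>lborel)"
      unfolding mixed_moment_nn[symmetric] using pt n D
      by (intro nn_integral_mono) (auto simp: indicator_def ennreal_mult[symmetric] mult.assoc intro!: ennreal_leI)
    also have "\<dots> = ennreal (D / n ^ (i + \<kappa>)) * (\<integral>\<^sup>+r. ennreal ((1 - r * t) powr (- real \<kappa>)) * ennreal (u r) * indicator {0<..<1} r \<partial>lborel)"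
      by (rule nn_integral_cmult) measurable
    also have "\<dots> \<le> ennreal (D / n ^ (i + \<kappa>)) * ennreal (K * (V t * (1 - t) powr (- real \<kappa>)))"
      by (intro mult_left_mono K t) auto
    also have "\<dots> = ennreal (D * K * (V t / n ^ i))"
    proof -
      have "(1 - t) powr (- real \<kappa>) = n ^ \<kappa>"
        using n by (simp add: t(3) powr_minus powr_divide powr_realpow)
      then show ?thesis
        using n D K(1) by (simp add: ennreal_mult[symmetric] power_add mult_ac)
    qed
    finally have "mixed_moment i k \<le> D * K * (V t / n ^ i)"
      using D K n by (subst (asm) ennreal_le_iff) auto
    then show "\<bar>mixed_moment i k\<bar> \<le> (D * K) * (M k / real (Suc k) ^ i)"
      by (simp add: M_def t_def n_def)
  qed
qed

text \<open>Only radii beyond t are kept. There r^(2 k + 1) is bounded below by exp(-4), so the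
  moment is at least a multiple of the tail V t.\<close>

lemma \<mu>_lower: "M k \<le> (C * 2 powr \<beta> * exp 4) * \<mu> k"
proof -
  define m where "m = real (Suc k)"
  have m: "m \<ge> 1" by (simp add: m_def)
  \<comment> \<open>This is 1 - 1 / (k + 2) rather than 1 - 1 / (k + 1): it stays positive for k =
    0, and V t = M (k + 1) is compared with M k by \<open>M_Suc\<close>.\<close>
  define t where "t = 1 - 1 / (m + 1)"
  have t: "0 < t" "t < 1" "t = 1 / (1 + 1 / m)" using m by (auto simp: t_def field_simps)
  have tp: "exp (- 2) \<le> t ^ (k + 2)"
  proof -
    have "(1 + 1 / m) ^ (k + 2) \<le> exp (1 / m) ^ (k + 2)"
      using exp_ge_add_one_self[of "1 / m"] m by (intro power_mono) auto
    also have "\<dots> = exp (real (k + 2) * (1 / m))" by (rule exp_of_nat_mult[symmetric])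
    also have "\<dots> \<le> exp 2" by (simp add: m_def field_simps)
    finally have "1 / exp 2 \<le> 1 / (1 + 1 / m) ^ (k + 2)" using m by (intro divide_left_mono) (auto intro!: mult_pos_pos add_pos_pos zero_less_power)
    then show ?thesis using t by (simp add: exp_minus power_divide inverse_eq_divide)
  qed
  have "(exp (- 2))\<^sup>2 \<le> (t ^ (k + 2))\<^sup>2" using tp by (intro power_mono) auto
  also have "(exp (- 2 :: real))\<^sup>2 = exp (- 4)" by (simp add: exp_of_nat_mult[symmetric])
  also have "(t ^ (k + 2))\<^sup>2 = t ^ (2 * k + 4)"
  proof -
    have "(k + 2) * 2 = 2 * k + 4" by simp
    then show ?thesis by (simp only: power_mult[symmetric])
  qed
  also have "\<dots> \<le> t ^ (2 * k + 1)" using t by (intro power_decreasing) auto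
  finally have tp': "exp (- 4) \<le> t ^ (2 * k + 1)" .
  have "ennreal (exp (- 4) * V t) = (\<integral>\<^sup>+r. ennreal (exp (- 4)) * (ennreal (u r) * indicator {t..<1} r) \<partial>lborel)"
    using t by (subst nn_integral_cmult) (auto simp: V_nn ennreal_mult)
  also have "\<dots> \<le> ennreal (\<mu> k)"
    unfolding mixed_moment_nn[symmetric]
  proof (rule nn_integral_mono)
    fix r :: real
    show "ennreal (exp (- 4)) * (ennreal (u r) * indicator {t..<1} r) \<le> ennreal (r ^ (2 * k) * (1 - r\<^sup>2) ^ 0 * (2 * r * u r)) * indicator {0<..<1} r"
    proof (cases "t \<le> r \<and> r < 1")
      case True
      have "t ^ (2 * k + 1) \<le> r ^ (2 * k + 1)" using True t by (intro power_mono) auto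
      then have "exp (- 4) \<le> 2 * r ^ (2 * k + 1)" using tp' True t by (smt (verit) zero_le_power)
      then have "exp (- 4) * u r \<le> 2 * r ^ (2 * k + 1) * u r" by (intro mult_right_mono) auto
      moreover have "0 < r" using True t(1) by linarith
      ultimately show ?thesis using True by (simp add: ennreal_mult[symmetric] mult_ac ennreal_leI)
    qed simp
  qed
  finally have 1: "exp (- 4) * V t \<le> \<mu> k" by simp
  have "V t = M (Suc k)" by (simp add: M_def t_def m_def add.commute)
  then have "M k \<le> C * 2 powr \<beta> * (exp 4 * (exp (- 4) * V t))"
    using M_Suc[of k] by (simp add: mult.assoc[of "exp 4", symmetric] exp_add[symmetric])
  also have "\<dots> \<le> C * 2 powr \<beta> * (exp 4 * \<mu> k)"
    using 1 C_ge_1 by (intro mult_left_mono) auto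
  finally show ?thesis by (simp add: mult.assoc)
qed

lemma \<mu>_pos: "0 < \<mu> k"
proof (rule ccontr)
  assume "\<not> 0 < \<mu> k"
  then have "\<mu> k = 0" using mixed_moment_nonneg[of 0 k] by simp
  then show False using \<mu>_lower[of k] M_pos[of k] by simp
qed

lemma symb_mixed_moment: "symb J (\<lambda>k. M k / real (Suc k) ^ i) (mixed_moment i)"
proof (induction J arbitrary: i)
  case 0
  then show ?case using mixed_moment_bound by simp
next
  case (Suc J)
  have "symb J (\<lambda>k. M k / real (Suc k) ^ Suc i) (\<lambda>k. - mixed_moment (Suc i) k)"
    by (rule symb_uminus[OF Suc])
  moreover have "(\<lambda>k. M k / real (Suc k) ^ Suc i) = (\<lambda>k. M k / real (Suc k) ^ i / real (Suc k))"
    by (rule ext) (simp add: mult.commute)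
  ultimately show ?case using mixed_moment_bound[of i] by (simp only: symb.simps mixed_moment_diff)
qed

definition coeff_\<Phi> :: "nat \<Rightarrow> nat \<Rightarrow> real" where
  "coeff_\<Phi> n k = pochhammer (real k + 1) n * (1 / \<mu> (k + n))"

text \<open>\<open>\<Phi> n\<close> is the \<open>n\<close>-th derivative of the function \<open>\<Phi> 0\<close> for which the reproducing kernel
  at \<open>z\<close> is \<open>\<zeta> \<mapsto> \<Phi> 0 (cnj z * \<zeta>)\<close>.\<close>

definition \<Phi> :: "nat \<Rightarrow> complex \<Rightarrow> complex" where
  "\<Phi> n w = (\<Sum>k. of_real (coeff_\<Phi> n k) * w ^ k)"

lemma symb_coeff_\<Phi>: "symb J (\<lambda>k. real (Suc k) ^ n * (1 / M k)) (coeff_\<Phi> n)"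
proof -
  have c: "0 \<le> C * 2 powr \<beta>" using C_ge_1 by simp
  have nn: "0 \<le> 1 / M k" for k using M_pos[of k] by simp
  have 0: "symb J (\<lambda>k. 1 / M k) (\<lambda>k. 1 / \<mu> k)"
    by (rule symb_inverse[where M = M and \<mu> = \<mu>, OF _ M_pos \<mu>_pos \<mu>_lower M_Suc c]) (use symb_mixed_moment[of J 0] in simp)
  have "symb J (\<lambda>k. 1 / M k) (\<lambda>k. 1 / \<mu> (k + n))"
  proof (induction n)
    case 0
    then show ?case using \<open>symb J (\<lambda>k. 1 / M k) (\<lambda>k. 1 / \<mu> k)\<close> by simp
  next
    case (Suc n)
    have "symb J (\<lambda>k. 1 / M k) (\<lambda>k. 1 / \<mu> (Suc k + n))"
    proof (rule symb_shift[OF Suc nn _ c])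
      show "1 / M (Suc k) \<le> C * 2 powr \<beta> * (1 / M k)" for k
        using M_Suc[of k] M_pos[of k] M_pos[of "Suc k"] by (simp add: field_simps)
    qed
    then show ?case by simp
  qed
  then have "symb J (\<lambda>k. real (Suc k) ^ n * (1 / M k)) (\<lambda>k. pochhammer (real k + 1) n * (1 / \<mu> (k + n)))"
    by (intro symb_mult symb_pochhammer nn) auto
  then show ?thesis by (simp only: coeff_\<Phi>_def[abs_def])
qed

definition e\<beta> :: nat where "e\<beta> = nat \<lceil>\<beta>\<rceil>"

lemma M_growth: "j \<le> k \<Longrightarrow> 1 / M k \<le> C * (real (Suc k) / real (Suc j)) ^ e\<beta> * (1 / M j)"
proof -
  assume jk: "j \<le> k"
  have q: "1 \<le> real (Suc k) / real (Suc j)" using jk by simp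
  have "(real (Suc k) / real (Suc j)) powr \<beta> \<le> (real (Suc k) / real (Suc j)) powr real e\<beta>"
    using q real_nat_ceiling_ge[of \<beta>] by (intro powr_mono) (auto simp: e\<beta>_def)
  also have "\<dots> = (real (Suc k) / real (Suc j)) ^ e\<beta>" using q by (intro powr_realpow) linarith
  finally have "C * (real (Suc k) / real (Suc j)) powr \<beta> * M k \<le> C * (real (Suc k) / real (Suc j)) ^ e\<beta> * M k"
    using C_ge_1 M_pos[of k] by (intro mult_right_mono mult_left_mono) auto
  with M_lower[OF jk] have "M j \<le> C * (real (Suc k) / real (Suc j)) ^ e\<beta> * M k" by linarith
  then show ?thesis using M_pos[of k] M_pos[of j] by (simp add: divide_le_eq le_divide_eq mult_ac del: of_nat_Suc)
qed

lemma \<Phi>_weight_growth: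
  assumes "j \<le> k"
  shows "real (Suc k) ^ n * (1 / M k) \<le> C * (real (Suc k) / real (Suc j)) ^ (n + e\<beta>) * (real (Suc j) ^ n * (1 / M j))"
proof -
  have "real (Suc k) ^ n * (1 / M k) \<le> real (Suc k) ^ n * (C * (real (Suc k) / real (Suc j)) ^ e\<beta> * (1 / M j))"
    using M_growth[OF assms] by (intro mult_left_mono) auto
  also have "\<dots> = C * (real (Suc k) / real (Suc j)) ^ (n + e\<beta>) * (real (Suc j) ^ n * (1 / M j))"
    by (simp add: power_add power_divide del: of_nat_Suc)
  finally show ?thesis .
qed

lemma coeff_\<Phi>_poly: "\<exists>B e. \<forall>k. \<bar>coeff_\<Phi> n k\<bar> \<le> B * real (Suc k) ^ e"
proof -
  have nn: "0 \<le> real (Suc k) ^ n * (1 / M k)" for k using M_pos[of k] by simp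
  obtain D where D: "D \<ge> 0" "\<And>k. \<bar>coeff_\<Phi> n k\<bar> \<le> D * (real (Suc k) ^ n * (1 / M k))"
    using symb_bound[OF symb_coeff_\<Phi>[of 0] nn] by blast
  have "\<bar>coeff_\<Phi> n k\<bar> \<le> (D * C * (1 / M 0)) * real (Suc k) ^ (n + e\<beta>)" for k
    using D(2)[of k] mult_left_mono[OF \<Phi>_weight_growth[of 0 k n] D(1)] by (simp add: mult_ac of_nat_Suc[of 0] del: of_nat_Suc)
  then show ?thesis by blast
qed

lemma summable_\<Phi>: "cmod w < 1 \<Longrightarrow> summable (\<lambda>k. cmod (of_real (coeff_\<Phi> n k) * w ^ k))"
  using coeff_\<Phi>_poly[of n] summable_polynomial_powers by blast

lemma \<Phi>_sums: "cmod w < 1 \<Longrightarrow> (\<lambda>k. of_real (coeff_\<Phi> n k) * w ^ k) sums \<Phi> n w"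
  unfolding \<Phi>_def by (intro summable_sums summable_norm_cancel[OF summable_\<Phi>])

lemma \<Phi>_holomorphic: "\<Phi> n holomorphic_on ball 0 1"
  by (rule power_series_holomorphic[where a = "\<lambda>k. of_real (coeff_\<Phi> n k)"]) (use \<Phi>_sums in auto)

lemma \<Phi>_cnj: "cmod w < 1 \<Longrightarrow> \<Phi> n (cnj w) = cnj (\<Phi> n w)"
proof -
  assume w: "cmod w < 1"
  have "(\<lambda>k. cnj (of_real (coeff_\<Phi> n k) * w ^ k)) sums cnj (\<Phi> n w)"
    using \<Phi>_sums[OF w] by (subst sums_cnj)
  then have "(\<lambda>k. of_real (coeff_\<Phi> n k) * cnj w ^ k) sums cnj (\<Phi> n w)" by simp
  moreover have "(\<lambda>k. of_real (coeff_\<Phi> n k) * cnj w ^ k) sums \<Phi> n (cnj w)" using w by (intro \<Phi>_sums) simp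
  ultimately show ?thesis by (metis sums_unique2)
qed

text \<open>For L of order 1 / |1 - w| the summation by parts gives L^(n + 1) / V(1 - 1 / L). If |w|
  lies beyond 1 - 1 / L, passing from V(1 - 1 / L) to V(|w|) by \<open>upper\<close> yields the
  power of (1 - |w|) / |1 - w|; otherwise that quotient is bounded below and \<open>lower\<close>
  suffices.\<close>

lemma \<Phi>_bound:
  "\<exists>K>0. \<forall>w. cmod w < 1 \<longrightarrow>
    cmod (\<Phi> n w) \<le> K * cmod (1 - w) powr (- real (Suc n)) * ((1 - cmod w) / cmod (1 - w)) powr \<alpha> / V (cmod w)"
proof -
  let ?A = "\<lambda>k. real (Suc k) ^ n * (1 / M k)"
  have nn: "0 \<le> ?A k" for k using M_pos[of k] by simp
  have poly: "?A k \<le> (C * ?A 0) * real (Suc k) ^ (n + e\<beta>)" for k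
    using \<Phi>_weight_growth[of 0 k n] by (simp add: mult_ac of_nat_Suc[of 0] del: of_nat_Suc)
  have mono: "?A j \<le> C * ?A k" if "j \<le> k" for j k
  proof -
    have "?A j \<le> ?A k"
      using that M_antimono[OF that] M_pos[of k] M_pos[of j] by (intro mult_mono power_mono divide_left_mono) auto
    also have "\<dots> \<le> C * ?A k" using mult_right_mono[OF C_ge_1 nn[of k]] by simp
    finally show ?thesis .
  qed
  have growth: "?A k \<le> C * (real (Suc k) / real L) ^ (n + e\<beta>) * ?A (L - 1)" if "1 \<le> L" "L \<le> k" for k L
    using \<Phi>_weight_growth[of "L - 1" k n] that by simp
  obtain K where K: "K > 0" "\<And>L w. L \<ge> 1 \<Longrightarrow> cmod w < 1 \<Longrightarrow> 1 / real L \<le> cmod (1 - w) \<Longrightarrow>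
      cmod (\<Sum>k. of_real (coeff_\<Phi> n k) * w ^ k) \<le> K * real L * ?A (L - 1)"
    using symb_sum_bound[OF symb_coeff_\<Phi> nn poly C_ge_1 mono growth] by blast
  define K' where "K' = K * 3 ^ Suc n * C * 3 powr (\<alpha> + \<beta>)"
  show ?thesis
  proof (intro exI[of _ K'] conjI allI impI)
    show "K' > 0" using K C_ge_1 by (simp add: K'_def)
    fix w :: complex assume w: "cmod w < 1"
    define \<tau> where "\<tau> = cmod (1 - w)"
    define s where "s = 1 - cmod w"
    have s: "0 < s" "s \<le> \<tau>" using w norm_triangle_ineq2[of 1 w] by (auto simp: s_def \<tau>_def)
    have \<tau>: "0 < \<tau>" "\<tau> \<le> 2" using s norm_triangle_ineq4[of 1 w] w by (auto simp: \<tau>_def)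
    define L where "L = nat \<lceil>1 / \<tau>\<rceil>"
    have "0 < 1 / \<tau>" using \<tau> by simp
    then have "0 < \<lceil>1 / \<tau>\<rceil>" by (simp only: zero_less_ceiling)
    then have L: "1 / \<tau> \<le> real L" "real L < 1 / \<tau> + 1" "L \<ge> 1"
      unfolding L_def using ceiling_correct[of "1 / \<tau>"] by (auto simp del: zero_less_ceiling)
    have L3: "real L \<le> 3 / \<tau>" using L \<tau> by (simp add: field_simps)
    have L1: "1 / real L \<le> \<tau>" using L \<tau> by (simp add: field_simps)
    have M_L: "M (L - 1) = V (1 - 1 / real L)" using L(3) by (simp add: M_def)
    have VL: "0 < V (1 - 1 / real L)" unfolding M_L[symmetric] by (rule M_pos)
    have Vw: "0 < V (cmod w)" using w by (intro tail_pos) auto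
    have sL: "s * real L \<le> 3 * (s / \<tau>)" using s mult_left_mono[OF L3, of s] by (simp add: mult_ac)
    have main: "V (cmod w) \<le> C * 3 powr (\<alpha> + \<beta>) * (s / \<tau>) powr \<alpha> * V (1 - 1 / real L)"
    proof (cases "1 - 1 / real L \<le> cmod w")
      case True
      have "V (cmod w) \<le> C * ((1 - cmod w) / (1 - (1 - 1 / real L))) powr \<alpha> * V (1 - 1 / real L)"
        using True w L by (intro upper) auto
      also have "(1 - cmod w) / (1 - (1 - 1 / real L)) = s * real L" by (simp add: s_def)
      also have "C * (s * real L) powr \<alpha> * V (1 - 1 / real L) \<le> C * (3 * (s / \<tau>)) powr \<alpha> * V (1 - 1 / real L)"
        using C_ge_1 \<alpha>_pos sL s VL by (intro mult_right_mono mult_left_mono powr_mono2) auto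
      also have "\<dots> = C * 3 powr \<alpha> * (s / \<tau>) powr \<alpha> * V (1 - 1 / real L)"
        using s \<tau> by (subst powr_mult) (auto simp: mult_ac)
      also have "\<dots> \<le> C * 3 powr (\<alpha> + \<beta>) * (s / \<tau>) powr \<alpha> * V (1 - 1 / real L)"
        using C_ge_1 \<beta>_ge_1 VL by (intro mult_right_mono mult_left_mono powr_mono) auto
      finally show ?thesis .
    next
      case False
      have "V (cmod w) \<le> C * ((1 - cmod w) / (1 - (1 - 1 / real L))) powr \<beta> * V (1 - 1 / real L)"
        using False w L by (intro lower) auto
      also have "(1 - cmod w) / (1 - (1 - 1 / real L)) = s * real L" by (simp add: s_def)
      also have "C * (s * real L) powr \<beta> * V (1 - 1 / real L) \<le> C * 3 powr \<beta> * V (1 - 1 / real L)"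
      proof -
        have "s / \<tau> \<le> 1" using s \<tau> by simp
        then have "s * real L \<le> 3" using sL by linarith
        then show ?thesis using C_ge_1 \<beta>_ge_1 s VL by (intro mult_right_mono mult_left_mono powr_mono2) auto
      qed
      also have "\<dots> \<le> C * 3 powr \<beta> * (3 powr \<alpha> * (s / \<tau>) powr \<alpha>) * V (1 - 1 / real L)"
      proof -
        have "1 / real L < s" using False by (simp add: s_def)
        then have "1 < s * real L" using L by (simp add: field_simps)
        then have "1 \<le> 3 * (s / \<tau>)" using sL by linarith
        then have "1 \<le> (3 * (s / \<tau>)) powr \<alpha>" using \<alpha>_pos by (intro ge_one_powr_ge_zero) auto
        then have "1 \<le> 3 powr \<alpha> * (s / \<tau>) powr \<alpha>" using s \<tau> by (subst (asm) powr_mult) auto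
        then have "C * 3 powr \<beta> * 1 \<le> C * 3 powr \<beta> * (3 powr \<alpha> * (s / \<tau>) powr \<alpha>)" using C_ge_1 by (intro mult_left_mono) auto
        then show ?thesis using VL by (intro mult_right_mono) auto
      qed
      finally show ?thesis by (simp add: powr_add mult_ac)
    qed
    have "cmod (\<Phi> n w) \<le> K * real L * ?A (L - 1)"
      unfolding \<Phi>_def using L1 by (intro K(2) L(3) w) (simp add: \<tau>_def)
    also have "\<dots> = K * real L ^ Suc n * (1 / V (1 - 1 / real L))" using M_L L(3) by simp
    also have "\<dots> \<le> K * (3 / \<tau>) ^ Suc n * (C * 3 powr (\<alpha> + \<beta>) * (s / \<tau>) powr \<alpha> / V (cmod w))"
    proof (intro mult_mono mult_left_mono power_mono L3)
      show "1 / V (1 - 1 / real L) \<le> C * 3 powr (\<alpha> + \<beta>) * (s / \<tau>) powr \<alpha> / V (cmod w)"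
        using main VL Vw by (simp add: field_simps)
    qed (use K \<tau> VL in auto)
    also have "(3 / \<tau>) ^ Suc n = 3 ^ Suc n * \<tau> powr (- real (Suc n))"
    proof -
      have "\<tau> powr (- real (Suc n)) = 1 / \<tau> ^ Suc n"
        using \<tau> by (subst powr_minus) (simp add: powr_realpow inverse_eq_divide del: of_nat_Suc power_Suc)
      then show ?thesis by (simp add: power_divide)
    qed
    finally show "cmod (\<Phi> n w) \<le> K' * cmod (1 - w) powr (- real (Suc n)) * ((1 - cmod w) / cmod (1 - w)) powr \<alpha> / V (cmod w)"
      by (simp add: K'_def \<tau>_def s_def mult_ac)
  qed
qed

end

section \<open>Integral estimates on the disc\<close>

lemma measurable_on_ball:
  fixes f :: "complex \<Rightarrow> 'a::topological_space"
  shows "continuous_on (ball 0 1) f \<Longrightarrow> f \<in> borel_measurable (restrict_space borel (ball 0 1))"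
  by (rule borel_measurable_continuous_on_restrict)

lemma measurable_circle_integral:
  fixes F :: "complex \<Rightarrow> ennreal"
  assumes "F \<in> borel_measurable (restrict_space borel (ball 0 1))"
  shows "(\<lambda>r. \<integral>\<^sup>+x. F (of_real r * circ x) * indicator (ball 0 1) (of_real r * circ x) \<partial>unit_interval) \<in> borel_measurable borel"
proof -
  define F' where "F' = (\<lambda>z. F z * indicator (ball 0 1) z)"
  have F': "F' \<in> borel_measurable borel"
    using assms unfolding F'_def by (subst (asm) borel_measurable_restrict_space_iff_ennreal) auto
  have 2: "circ \<in> borel_measurable unit_interval"
    by (intro measurable_unit_intervalI) simp
  have 1: "(\<lambda>r. complex_of_real r) \<in> borel_measurable borel" by simp
  have "(\<lambda>p. of_real (fst p) * circ (snd p)) \<in> borel_measurable (borel \<Otimes>\<^sub>M unit_interval)"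
    by (intro borel_measurable_times measurable_compose[OF measurable_snd 2] measurable_compose[OF measurable_fst 1])
  from measurable_compose[OF this F']
  have "(\<lambda>p. F' (of_real (fst p) * circ (snd p))) \<in> borel_measurable (borel \<Otimes>\<^sub>M unit_interval)" .
  from unit_interval.borel_measurable_nn_integral_fst[OF this]
  show ?thesis by (simp add: F'_def)
qed

text \<open>Circular means increase with the radius, so integrating \<open>\<bar>g\<bar>\<^sup>p\<close> against a weight over the
  disc is integrating an increasing function of the radius.\<close>

lemma holomorphic_means:
  assumes g: "g holomorphic_on ball 0 1" and p: "p > 0"
  obtains G :: "real \<Rightarrow> ennreal" where "G \<in> borel_measurable borel"
    "\<And>r s. 0 < r \<Longrightarrow> r \<le> s \<Longrightarrow> s < 1 \<Longrightarrow> G r \<le> G s"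
    "\<And>v. v \<in> borel_measurable borel \<Longrightarrow>
      (\<integral>\<^sup>+z. ennreal (cmod (g z) powr p) \<partial>rad v) = (\<integral>\<^sup>+r. G r * v r * indicator {0<..<1} r \<partial>lborel)"
proof -
  have m: "(\<lambda>z. ennreal (cmod (g z) powr p)) \<in> borel_measurable (restrict_space borel (ball 0 1))"
    by (intro measurable_compose[OF measurable_on_ball measurable_ennreal] continuous_intros holomorphic_on_imp_continuous_on g p)
  define G where "G = (\<lambda>r::real. \<integral>\<^sup>+x. ennreal (cmod (g (of_real r * circ x)) powr p) * indicator (ball 0 1) (of_real r * circ x) \<partial>unit_interval)"
  have G: "G \<in> borel_measurable borel"
    "\<And>r. 0 < r \<Longrightarrow> r < 1 \<Longrightarrow> G r = (\<integral>\<^sup>+x. ennreal (cmod (g (of_real r * circ x)) powr p) \<partial>unit_interval)"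
    unfolding G_def by (rule measurable_circle_integral[OF m]) (auto intro!: nn_integral_cong simp: norm_mult)
  show ?thesis
  proof (rule that[OF G(1)])
    fix r s :: real assume rs: "0 < r" "r \<le> s" "s < 1"
    then show "G r \<le> G s" using nn_circle_means_mono[OF g p, of r s] by (simp add: G(2))
  next
    fix v :: "real \<Rightarrow> ennreal" assume v: "v \<in> borel_measurable borel"
    show "(\<integral>\<^sup>+z. ennreal (cmod (g z) powr p) \<partial>rad v) = (\<integral>\<^sup>+r. G r * v r * indicator {0<..<1} r \<partial>lborel)"
      unfolding nn_integral_rad[OF m v]
      by (intro nn_integral_cong) (auto simp: indicator_def G(2) mult_ac)
  qed
qed

lemma cmod_cnj_mult_less: "cmod z < 1 \<Longrightarrow> cmod \<zeta> < 1 \<Longrightarrow> cmod (cnj z * \<zeta>) < 1"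
  using mult_strict_mono'[of "cmod z" 1 "cmod \<zeta>" 1] by (simp add: norm_mult)

lemma one_minus_cnj_mult_nonzero: "cmod z < 1 \<Longrightarrow> cmod \<zeta> < 1 \<Longrightarrow> 1 - cnj z * \<zeta> \<noteq> 0"
  using cmod_cnj_mult_less[of z \<zeta>] by auto

section \<open>The kernel integrated against radial densities\<close>

context D_profile
begin

abbreviation smooth :: "real \<Rightarrow> ennreal" where "smooth \<equiv> \<lambda>r. ennreal (V r / (1 - r))"

lemma area_measurable [measurable]: "area \<in> borel_measurable borel"
  by measurable

lemma smooth_measurable [measurable]: "smooth \<in> borel_measurable borel"
  by measurable

text \<open>The factor (1 - |w|)^\<alpha> in the kernel bound is cancelled exactly by the mean of |1
  - w|^(-1 - \<alpha>), which is of order (1 - |w|)^(-\<alpha>). The exponent -1 alone would leave a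
  logarithm.\<close>

lemma \<Phi>_circle:
  "\<exists>K>0. \<forall>w. cmod w < 1 \<longrightarrow>
    (\<integral>\<^sup>+x. ennreal (cmod (\<Phi> 0 (w * circ x))) \<partial>unit_interval) \<le> ennreal (K / V (cmod w))"
proof -
  obtain K1 where K1: "K1 > 0" "\<And>w. cmod w < 1 \<Longrightarrow> cmod (\<Phi> 0 w) \<le> K1 * cmod (1 - w) powr (- 1) * ((1 - cmod w) / cmod (1 - w)) powr \<alpha> / V (cmod w)"
    using \<Phi>_bound[of 0] by auto
  have a: "1 + \<alpha> > 1" using \<alpha>_pos by simp
  obtain K2 where K2: "K2 > 0" "\<And>w. cmod w < 1 \<Longrightarrow>
    (\<integral>\<^sup>+x. ennreal (cmod (1 - w * circ x) powr (- (1 + \<alpha>))) \<partial>unit_interval) \<le> ennreal (K2 * (1 - cmod w) powr (1 - (1 + \<alpha>)))"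
    using nn_circle_integral_powr[OF a] by blast
  show ?thesis
  proof (intro exI[of _ "K1 * K2"] conjI allI impI)
    show "K1 * K2 > 0" using K1 K2 by simp
    fix w :: complex assume w: "cmod w < 1"
    have Vw: "V (cmod w) > 0" using w by (intro tail_pos) auto
    let ?c = "K1 * (1 - cmod w) powr \<alpha> / V (cmod w)"
    have c: "?c \<ge> 0" using K1 Vw by simp
    have "(\<integral>\<^sup>+x. ennreal (cmod (\<Phi> 0 (w * circ x))) \<partial>unit_interval)
      \<le> (\<integral>\<^sup>+x. ennreal ?c * ennreal (cmod (1 - w * circ x) powr (- (1 + \<alpha>))) \<partial>unit_interval)"
    proof (rule nn_integral_mono)
      fix x
      have n: "cmod (w * circ x) = cmod w" by (simp add: norm_mult)
      have "1 - cmod w \<le> cmod (1 - w * circ x)" using norm_triangle_ineq2[of 1 "w * circ x"] n by simp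
      then have "cmod (1 - w * circ x) > 0" using w by linarith
      moreover have "cmod (\<Phi> 0 (w * circ x)) \<le> K1 * cmod (1 - w * circ x) powr (- 1) * ((1 - cmod w) / cmod (1 - w * circ x)) powr \<alpha> / V (cmod w)"
        using K1(2)[of "w * circ x"] w n by simp
      moreover have "((1 - cmod w) / cmod (1 - w * circ x)) powr \<alpha> = (1 - cmod w) powr \<alpha> / cmod (1 - w * circ x) powr \<alpha>"
        by (rule powr_divide)
      moreover have "cmod (1 - w * circ x) powr (- (1 + \<alpha>)) = cmod (1 - w * circ x) powr (- 1) / cmod (1 - w * circ x) powr \<alpha>"
        by (simp only: minus_add_distrib powr_add powr_minus[of _ \<alpha>] divide_inverse)
      ultimately have "cmod (\<Phi> 0 (w * circ x)) \<le> ?c * cmod (1 - w * circ x) powr (- (1 + \<alpha>))"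
        by (simp add: mult_ac)
      then show "ennreal (cmod (\<Phi> 0 (w * circ x))) \<le> ennreal ?c * ennreal (cmod (1 - w * circ x) powr (- (1 + \<alpha>)))"
        using c by (simp add: ennreal_mult[symmetric] ennreal_leI)
    qed
    also have "\<dots> = ennreal ?c * (\<integral>\<^sup>+x. ennreal (cmod (1 - w * circ x) powr (- (1 + \<alpha>))) \<partial>unit_interval)"
      by (rule nn_integral_cmult) (intro measurable_unit_intervalI, measurable)
    also have "\<dots> \<le> ennreal ?c * ennreal (K2 * (1 - cmod w) powr (1 - (1 + \<alpha>)))"
      by (intro mult_left_mono K2 w) simp
    also have "\<dots> = ennreal (K1 * K2 / V (cmod w))"
    proof -
      have "(1 - cmod w) powr \<alpha> * (1 - cmod w) powr (1 - (1 + \<alpha>)) = 1"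
        using w by (simp add: powr_add[symmetric])
      then have "((1 - cmod w) powr \<alpha> * (1 - cmod w) powr (1 - (1 + \<alpha>))) * (K1 * K2 / V (cmod w)) = K1 * K2 / V (cmod w)"
        by (simp only: mult_1_left)
      then have "?c * (K2 * (1 - cmod w) powr (1 - (1 + \<alpha>))) = K1 * K2 / V (cmod w)"
        by (simp only: mult_ac times_divide_eq_right times_divide_eq_left)
      then show ?thesis using c K2(1) by (simp only: ennreal_mult'[symmetric])
    qed
    finally show "(\<integral>\<^sup>+x. ennreal (cmod (\<Phi> 0 (w * circ x))) \<partial>unit_interval) \<le> ennreal (K1 * K2 / V (cmod w))" .
  qed
qed

lemma \<Phi>_cont: "cmod z < 1 \<Longrightarrow> continuous_on (ball 0 1) (\<lambda>\<zeta>. \<Phi> n (cnj z * \<zeta>))"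
proof -
  assume z: "cmod z < 1"
  have "cnj z * \<zeta> \<in> ball 0 1" if "\<zeta> \<in> ball 0 1" for \<zeta>
    using z that cmod_cnj_mult_less[of z \<zeta>] by simp
  then show ?thesis
    by (intro continuous_on_compose2[OF holomorphic_on_imp_continuous_on[OF \<Phi>_holomorphic]] continuous_intros) auto
qed

text \<open>The density v is left arbitrary because Schur's test integrates the kernel in one
  variable against the smoothed weight and in the other against the weight itself.\<close>

lemma rad_kernel_bound:
  "\<exists>K>0. \<forall>v. v \<in> borel_measurable borel \<longrightarrow> (\<forall>\<delta> z. cmod z < 1 \<longrightarrow>
    (\<integral>\<^sup>+\<zeta>. ennreal (cmod (\<Phi> 0 (cnj z * \<zeta>)) * (1 - cmod \<zeta>) powr (- \<delta>)) \<partial>rad v)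
     \<le> ennreal K * (\<integral>\<^sup>+r. ennreal ((1 - r) powr (- \<delta>) / V (r * cmod z)) * v r * indicator {0<..<1} r \<partial>lborel))"
proof -
  obtain K where K: "K > 0" "\<And>w. cmod w < 1 \<Longrightarrow>
    (\<integral>\<^sup>+x. ennreal (cmod (\<Phi> 0 (w * circ x))) \<partial>unit_interval) \<le> ennreal (K / V (cmod w))"
    using \<Phi>_circle by blast
  show ?thesis
  proof (intro exI[of _ K] conjI K allI impI)
    fix v :: "real \<Rightarrow> ennreal" and \<delta> :: real and z :: complex
    assume v [measurable]: "v \<in> borel_measurable borel" and z: "cmod z < 1"
    have m: "(\<lambda>\<zeta>. ennreal (cmod (\<Phi> 0 (cnj z * \<zeta>)) * (1 - cmod \<zeta>) powr (- \<delta>))) \<in> borel_measurable (restrict_space borel (ball 0 1))"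
      by (intro measurable_compose[OF measurable_on_ball measurable_ennreal] continuous_intros \<Phi>_cont z) auto
    have "(\<integral>\<^sup>+\<zeta>. ennreal (cmod (\<Phi> 0 (cnj z * \<zeta>)) * (1 - cmod \<zeta>) powr (- \<delta>)) \<partial>rad v)
      = (\<integral>\<^sup>+r. v r * indicator {0<..<1} r * (\<integral>\<^sup>+x. ennreal (cmod (\<Phi> 0 (cnj z * (of_real r * circ x))) * (1 - cmod (of_real r * circ x)) powr (- \<delta>)) \<partial>unit_interval) \<partial>lborel)"
      by (rule nn_integral_rad[OF m v])
    also have "\<dots> \<le> (\<integral>\<^sup>+r. ennreal K * (ennreal ((1 - r) powr (- \<delta>) / V (r * cmod z)) * v r * indicator {0<..<1} r) \<partial>lborel)"
    proof (rule nn_integral_mono)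
      fix r :: real
      show "v r * indicator {0<..<1} r * (\<integral>\<^sup>+x. ennreal (cmod (\<Phi> 0 (cnj z * (of_real r * circ x))) * (1 - cmod (of_real r * circ x)) powr (- \<delta>)) \<partial>unit_interval)
        \<le> ennreal K * (ennreal ((1 - r) powr (- \<delta>) / V (r * cmod z)) * v r * indicator {0<..<1} r)"
      proof (cases "0 < r \<and> r < 1")
        case True
        define w where "w = cnj z * of_real r"
        have w: "cmod w = r * cmod z" using True by (simp add: w_def norm_mult)
        have w1: "cmod w < 1" unfolding w using True z mult_strict_mono'[of r 1 "cmod z" 1] by simp
        have Vw: "V (r * cmod z) > 0" using w1 True unfolding w by (intro tail_pos) auto
        have "(\<integral>\<^sup>+x. ennreal (cmod (\<Phi> 0 (cnj z * (of_real r * circ x))) * (1 - cmod (of_real r * circ x)) powr (- \<delta>)) \<partial>unit_interval)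
           = (\<integral>\<^sup>+x. ennreal ((1 - r) powr (- \<delta>)) * ennreal (cmod (\<Phi> 0 (w * circ x))) \<partial>unit_interval)"
          using True by (intro nn_integral_cong) (simp add: ennreal_mult[symmetric] norm_mult w_def mult_ac)
        also have "\<dots> = ennreal ((1 - r) powr (- \<delta>)) * (\<integral>\<^sup>+x. ennreal (cmod (\<Phi> 0 (w * circ x))) \<partial>unit_interval)"
        proof (rule nn_integral_cmult)
          have "continuous_on UNIV (\<lambda>x. \<Phi> 0 (w * circ x))"
            by (rule continuous_on_compose2[OF holomorphic_on_imp_continuous_on[OF \<Phi>_holomorphic]])
               (use w1 in \<open>auto intro!: continuous_intros simp: norm_mult\<close>)
          then show "(\<lambda>x. ennreal (cmod (\<Phi> 0 (w * circ x)))) \<in> borel_measurable unit_interval"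
            by (intro measurable_unit_intervalI measurable_compose[OF borel_measurable_continuous_onI measurable_ennreal] continuous_intros)
        qed
        also have "\<dots> \<le> ennreal ((1 - r) powr (- \<delta>)) * ennreal (K / V (cmod w))"
          by (intro mult_left_mono K w1) simp
        also have "\<dots> = ennreal K * ennreal ((1 - r) powr (- \<delta>) / V (r * cmod z))"
          using K Vw w by (simp add: ennreal_mult[symmetric] mult_ac)
        finally have "v r * (\<integral>\<^sup>+x. ennreal (cmod (\<Phi> 0 (cnj z * (of_real r * circ x))) * (1 - cmod (of_real r * circ x)) powr (- \<delta>)) \<partial>unit_interval)
          \<le> v r * (ennreal K * ennreal ((1 - r) powr (- \<delta>) / V (r * cmod z)))" by (rule mult_left_mono) simp
        then show ?thesis using True by (simp add: mult_ac)
      qed simp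
    qed
    also have "\<dots> = ennreal K * (\<integral>\<^sup>+r. ennreal ((1 - r) powr (- \<delta>) / V (r * cmod z)) * v r * indicator {0<..<1} r \<partial>lborel)"
      by (rule nn_integral_cmult) measurable
    finally show "(\<integral>\<^sup>+\<zeta>. ennreal (cmod (\<Phi> 0 (cnj z * \<zeta>)) * (1 - cmod \<zeta>) powr (- \<delta>)) \<partial>rad v)
     \<le> ennreal K * (\<integral>\<^sup>+r. ennreal ((1 - r) powr (- \<delta>) / V (r * cmod z)) * v r * indicator {0<..<1} r \<partial>lborel)" .
  qed
qed

lemma schur_smooth:
  assumes "0 < \<delta>" "\<delta> < \<alpha>"
  shows "\<exists>K>0. \<forall>z. cmod z < 1 \<longrightarrow>
    (\<integral>\<^sup>+\<zeta>. ennreal (cmod (\<Phi> 0 (cnj z * \<zeta>)) * (1 - cmod \<zeta>) powr (- \<delta>)) \<partial>rad smooth) \<le> ennreal (K * (1 - cmod z) powr (- \<delta>))"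
proof -
  obtain K1 where K1: "K1 > 0" "\<And>v \<delta> z. v \<in> borel_measurable borel \<Longrightarrow> cmod z < 1 \<Longrightarrow>
    (\<integral>\<^sup>+\<zeta>. ennreal (cmod (\<Phi> 0 (cnj z * \<zeta>)) * (1 - cmod \<zeta>) powr (- \<delta>)) \<partial>rad v)
     \<le> ennreal K1 * (\<integral>\<^sup>+r. ennreal ((1 - r) powr (- \<delta>) / V (r * cmod z)) * v r * indicator {0<..<1} r \<partial>lborel)"
    using rad_kernel_bound by blast
  obtain K2 where K2: "K2 > 0" "\<And>t. 0 \<le> t \<Longrightarrow> t < 1 \<Longrightarrow>
    (\<integral>\<^sup>+r. ennreal ((1 - r) powr (- \<delta>) / V (r * t)) * ennreal (V r / (1 - r)) * indicator {0<..<1} r \<partial>lborel)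
      \<le> ennreal (K2 * (1 - t) powr (- \<delta>))"
    using int_tail_test[OF assms] by blast
  show ?thesis
  proof (intro exI[of _ "K1 * K2"] conjI allI impI)
    fix z :: complex assume z: "cmod z < 1"
    have "(\<integral>\<^sup>+\<zeta>. ennreal (cmod (\<Phi> 0 (cnj z * \<zeta>)) * (1 - cmod \<zeta>) powr (- \<delta>)) \<partial>rad smooth)
      \<le> ennreal K1 * (\<integral>\<^sup>+r. ennreal ((1 - r) powr (- \<delta>) / V (r * cmod z)) * smooth r * indicator {0<..<1} r \<partial>lborel)"
      by (rule K1(2)[OF smooth_measurable z])
    also have "\<dots> \<le> ennreal K1 * ennreal (K2 * (1 - cmod z) powr (- \<delta>))"
      using z by (intro mult_left_mono K2) auto
    also have "\<dots> = ennreal (K1 * K2 * (1 - cmod z) powr (- \<delta>))"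
      using K1 K2 by (simp add: ennreal_mult[symmetric] mult.assoc)
    finally show "(\<integral>\<^sup>+\<zeta>. ennreal (cmod (\<Phi> 0 (cnj z * \<zeta>)) * (1 - cmod \<zeta>) powr (- \<delta>)) \<partial>rad smooth) \<le> ennreal (K1 * K2 * (1 - cmod z) powr (- \<delta>))" .
  qed (use K1 K2 in simp)
qed

lemma area_le: "0 < r \<Longrightarrow> r < 1 \<Longrightarrow> area r \<le> 2 * ennreal (u r)"
proof -
  assume r: "0 < r" "r < 1"
  have "2 * r * u r \<le> 2 * u r" using r by (intro mult_right_mono) auto
  then have "ennreal (2 * r * u r) \<le> ennreal (2 * u r)" by (rule ennreal_leI)
  then show ?thesis by (simp add: ennreal_mult)
qed

lemma schur_area:
  assumes "0 < \<delta>" "\<delta> < \<alpha>"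
  shows "\<exists>K>0. \<forall>z. cmod z < 1 \<longrightarrow>
    (\<integral>\<^sup>+\<zeta>. ennreal (cmod (\<Phi> 0 (cnj z * \<zeta>)) * (1 - cmod \<zeta>) powr (- \<delta>)) \<partial>rad area) \<le> ennreal (K * (1 - cmod z) powr (- \<delta>))"
proof -
  obtain K1 where K1: "K1 > 0" "\<And>v \<delta> z. v \<in> borel_measurable borel \<Longrightarrow> cmod z < 1 \<Longrightarrow>
    (\<integral>\<^sup>+\<zeta>. ennreal (cmod (\<Phi> 0 (cnj z * \<zeta>)) * (1 - cmod \<zeta>) powr (- \<delta>)) \<partial>rad v)
     \<le> ennreal K1 * (\<integral>\<^sup>+r. ennreal ((1 - r) powr (- \<delta>) / V (r * cmod z)) * v r * indicator {0<..<1} r \<partial>lborel)"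
    using rad_kernel_bound by blast
  obtain K2 where K2: "K2 > 0" "\<And>t. 0 \<le> t \<Longrightarrow> t < 1 \<Longrightarrow>
    (\<integral>\<^sup>+r. ennreal ((1 - r) powr (- \<delta>) / V (r * t)) * ennreal (u r) * indicator {0<..<1} r \<partial>lborel)
      \<le> ennreal (K2 * (1 - t) powr (- \<delta>))"
    using int_u_test[OF assms] by blast
  show ?thesis
  proof (intro exI[of _ "K1 * (2 * K2)"] conjI allI impI)
    fix z :: complex assume z: "cmod z < 1"
    have "(\<integral>\<^sup>+\<zeta>. ennreal (cmod (\<Phi> 0 (cnj z * \<zeta>)) * (1 - cmod \<zeta>) powr (- \<delta>)) \<partial>rad area)
      \<le> ennreal K1 * (\<integral>\<^sup>+r. ennreal ((1 - r) powr (- \<delta>) / V (r * cmod z)) * area r * indicator {0<..<1} r \<partial>lborel)"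
      by (rule K1(2)[OF area_measurable z])
    also have "\<dots> \<le> ennreal K1 * (\<integral>\<^sup>+r. 2 * (ennreal ((1 - r) powr (- \<delta>) / V (r * cmod z)) * ennreal (u r) * indicator {0<..<1} r) \<partial>lborel)"
    proof (intro mult_left_mono nn_integral_mono)
      fix r :: real
      show "ennreal ((1 - r) powr (- \<delta>) / V (r * cmod z)) * area r * indicator {0<..<1} r
        \<le> 2 * (ennreal ((1 - r) powr (- \<delta>) / V (r * cmod z)) * ennreal (u r) * indicator {0<..<1} r)"
        using mult_left_mono[OF area_le[of r], of "ennreal ((1 - r) powr (- \<delta>) / V (r * cmod z))"]
        by (cases "0 < r \<and> r < 1") (auto simp: mult_ac)
    qed simp
    also have "\<dots> = ennreal K1 * (2 * (\<integral>\<^sup>+r. ennreal ((1 - r) powr (- \<delta>) / V (r * cmod z)) * ennreal (u r) * indicator {0<..<1} r \<partial>lborel))"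
      by (subst nn_integral_cmult) auto
    also have "\<dots> \<le> ennreal K1 * (2 * ennreal (K2 * (1 - cmod z) powr (- \<delta>)))"
      using z by (intro mult_left_mono K2) auto
    also have "\<dots> = ennreal (K1 * (2 * K2) * (1 - cmod z) powr (- \<delta>))"
      using K1 K2 by (simp add: ennreal_mult mult.assoc)
    finally show "(\<integral>\<^sup>+\<zeta>. ennreal (cmod (\<Phi> 0 (cnj z * \<zeta>)) * (1 - cmod \<zeta>) powr (- \<delta>)) \<partial>rad area) \<le> ennreal (K1 * (2 * K2) * (1 - cmod z) powr (- \<delta>))" .
  qed (use K1 K2 in simp)
qed

lemma rad_area_powr:
  assumes s: "s - 1 > \<beta>"
  shows "\<exists>K>0. \<forall>z. cmod z < 1 \<longrightarrow>
    (\<integral>\<^sup>+\<zeta>. ennreal (cmod (1 - cnj z * \<zeta>) powr (- s)) \<partial>rad area) \<le> ennreal (K * (V (cmod z) * (1 - cmod z) powr (1 - s)))"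
proof -
  have s1: "s > 1" using s \<beta>_ge_1 by simp
  obtain K1 where K1: "K1 > 0" "\<And>w. cmod w < 1 \<Longrightarrow>
    (\<integral>\<^sup>+x. ennreal (cmod (1 - w * circ x) powr (- s)) \<partial>unit_interval) \<le> ennreal (K1 * (1 - cmod w) powr (1 - s))"
    using nn_circle_integral_powr[OF s1] by blast
  obtain K2 where K2: "K2 > 0" "\<And>t. 0 \<le> t \<Longrightarrow> t < 1 \<Longrightarrow>
    (\<integral>\<^sup>+r. ennreal ((1 - r * t) powr (- (s - 1))) * ennreal (u r) * indicator {0<..<1} r \<partial>lborel)
      \<le> ennreal (K2 * (V t * (1 - t) powr (- (s - 1))))"
    using int_u_bound[OF s] by blast
  show ?thesis
  proof (intro exI[of _ "2 * K1 * K2"] conjI allI impI)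
    fix z :: complex assume z: "cmod z < 1"
    have nz: "1 - cnj z * \<zeta> \<noteq> 0" if "\<zeta> \<in> ball 0 1" for \<zeta>
      using one_minus_cnj_mult_nonzero[OF z] that by simp
    have m: "(\<lambda>\<zeta>. ennreal (cmod (1 - cnj z * \<zeta>) powr (- s))) \<in> borel_measurable (restrict_space borel (ball 0 1))"
      using nz by (intro measurable_compose[OF measurable_on_ball measurable_ennreal] continuous_on_powr continuous_intros) auto
    have "(\<integral>\<^sup>+\<zeta>. ennreal (cmod (1 - cnj z * \<zeta>) powr (- s)) \<partial>rad area)
      = (\<integral>\<^sup>+r. area r * indicator {0<..<1} r * (\<integral>\<^sup>+x. ennreal (cmod (1 - cnj z * (of_real r * circ x)) powr (- s)) \<partial>unit_interval) \<partial>lborel)"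
      by (rule nn_integral_rad[OF m area_measurable])
    also have "\<dots> \<le> (\<integral>\<^sup>+r. ennreal (2 * K1) * (ennreal ((1 - r * cmod z) powr (- (s - 1))) * ennreal (u r) * indicator {0<..<1} r) \<partial>lborel)"
    proof (rule nn_integral_mono)
      fix r :: real
      show "area r * indicator {0<..<1} r * (\<integral>\<^sup>+x. ennreal (cmod (1 - cnj z * (of_real r * circ x)) powr (- s)) \<partial>unit_interval)
        \<le> ennreal (2 * K1) * (ennreal ((1 - r * cmod z) powr (- (s - 1))) * ennreal (u r) * indicator {0<..<1} r)"
      proof (cases "0 < r \<and> r < 1")
        case True
        define w where "w = cnj z * of_real r"
        have w: "cmod w = r * cmod z" using True by (simp add: w_def norm_mult)
        have w1: "cmod w < 1" unfolding w using True z mult_strict_mono'[of r 1 "cmod z" 1] by simp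
        have "area r * (\<integral>\<^sup>+x. ennreal (cmod (1 - cnj z * (of_real r * circ x)) powr (- s)) \<partial>unit_interval)
          \<le> (2 * ennreal (u r)) * ennreal (K1 * (1 - cmod w) powr (1 - s))"
          using area_le[of r] K1(2)[OF w1] True by (intro mult_mono) (auto simp: w_def mult.assoc)
        also have "\<dots> = ennreal (2 * K1) * (ennreal ((1 - r * cmod z) powr (- (s - 1))) * ennreal (u r))"
          using K1 by (simp add: w ennreal_mult mult_ac)
        finally show ?thesis using True by simp
      qed simp
    qed
    also have "\<dots> = ennreal (2 * K1) * (\<integral>\<^sup>+r. ennreal ((1 - r * cmod z) powr (- (s - 1))) * ennreal (u r) * indicator {0<..<1} r \<partial>lborel)"
      by (rule nn_integral_cmult) measurable
    also have "\<dots> \<le> ennreal (2 * K1) * ennreal (K2 * (V (cmod z) * (1 - cmod z) powr (- (s - 1))))"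
      using z by (intro mult_left_mono K2) auto
    also have "\<dots> = ennreal (2 * K1 * K2 * (V (cmod z) * (1 - cmod z) powr (1 - s)))"
      using K1 K2 by (simp add: ennreal_mult[symmetric] mult.assoc)
    finally show "(\<integral>\<^sup>+\<zeta>. ennreal (cmod (1 - cnj z * \<zeta>) powr (- s)) \<partial>rad area) \<le> ennreal (2 * K1 * K2 * (V (cmod z) * (1 - cmod z) powr (1 - s)))" .
  qed (use K1 K2 in simp)
qed

text \<open>Here the gain of order \<alpha> is simply bounded by 1, since the remaining power of |1
  - cnj z \<zeta>| already satisfies the condition of \<open>rad_area_powr\<close>. As |cnj z
  \<zeta>| \<le> |z|, the factor 1 / V can be taken at |z| and leaves the integral.\<close>

lemma rad_area_\<Phi>:
  assumes q: "q > 0" and s: "(real (Suc n) - real m) * q - 1 > \<beta>"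
  shows "\<exists>K>0. \<forall>z. cmod z < 1 \<longrightarrow>
    (\<integral>\<^sup>+\<zeta>. ennreal ((cmod (1 - cnj z * \<zeta>) ^ m * cmod (\<Phi> n (cnj z * \<zeta>))) powr q) \<partial>rad area)
      \<le> ennreal (K * (V (cmod z) powr (1 - q) * (1 - cmod z) powr (1 - (real (Suc n) - real m) * q)))"
proof -
  define a where "a = (real (Suc n) - real m) * q"
  obtain K1 where K1: "K1 > 0" "\<And>w. cmod w < 1 \<Longrightarrow>
     cmod (\<Phi> n w) \<le> K1 * cmod (1 - w) powr (- real (Suc n)) * ((1 - cmod w) / cmod (1 - w)) powr \<alpha> / V (cmod w)"
    using \<Phi>_bound[of n] by blast
  obtain K2 where K2: "K2 > 0" "\<And>z. cmod z < 1 \<Longrightarrow>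
    (\<integral>\<^sup>+\<zeta>. ennreal (cmod (1 - cnj z * \<zeta>) powr (- a)) \<partial>rad area) \<le> ennreal (K2 * (V (cmod z) * (1 - cmod z) powr (1 - a)))"
    using rad_area_powr[of a] s unfolding a_def by blast
  show ?thesis
  proof (intro exI[of _ "K1 powr q * K2"] conjI allI impI)
    fix z :: complex assume z: "cmod z < 1"
    have Vz: "V (cmod z) > 0" using z by (intro tail_pos) auto
    let ?c = "(K1 / V (cmod z)) powr q"
    have pt: "(cmod (1 - cnj z * \<zeta>) ^ m * cmod (\<Phi> n (cnj z * \<zeta>))) powr q \<le> ?c * cmod (1 - cnj z * \<zeta>) powr (- a)" if \<zeta>: "\<zeta> \<in> ball 0 1" for \<zeta>
    proof -
      define w where "w = cnj z * \<zeta>"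
      have w: "cmod w < 1" "cmod w \<le> cmod z"
        using z \<zeta> cmod_cnj_mult_less[of z \<zeta>] by (auto simp: w_def norm_mult mult_left_le)
      have "1 - cmod w \<le> cmod (1 - w)" using norm_triangle_ineq2[of 1 w] by simp
      then have pos: "cmod (1 - w) > 0" using w by linarith
      have d: "(1 - cmod w) / cmod (1 - w) \<le> 1" using pos norm_triangle_ineq2[of 1 w] by simp
      have "cmod (\<Phi> n w) \<le> K1 * cmod (1 - w) powr (- real (Suc n)) * ((1 - cmod w) / cmod (1 - w)) powr \<alpha> / V (cmod w)"
        by (rule K1(2)[OF w(1)])
      also have "\<dots> \<le> K1 * cmod (1 - w) powr (- real (Suc n)) * 1 / V (cmod z)"
        using K1 w Vz d \<alpha>_pos V_antimono[OF norm_ge_zero w(2)]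
        by (intro frac_le mult_left_mono powr_le1) auto
      finally have "cmod (1 - w) ^ m * cmod (\<Phi> n w) \<le> cmod (1 - w) ^ m * (K1 / V (cmod z) * cmod (1 - w) powr (- real (Suc n)))"
        by (intro mult_left_mono) auto
      also have "\<dots> = K1 / V (cmod z) * cmod (1 - w) powr (- (real (Suc n) - real m))"
      proof -
        have "cmod (1 - w) ^ m * cmod (1 - w) powr (- real (Suc n)) = cmod (1 - w) powr (real m + - real (Suc n))"
          using pos by (simp only: powr_add powr_realpow)
        also have "real m + - real (Suc n) = - (real (Suc n) - real m)" by simp
        finally show ?thesis by (simp add: mult_ac)
      qed
      finally have "(cmod (1 - w) ^ m * cmod (\<Phi> n w)) powr q \<le> (K1 / V (cmod z) * cmod (1 - w) powr (- (real (Suc n) - real m))) powr q"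
        using q by (intro powr_mono2) auto
      also have "\<dots> = ?c * cmod (1 - w) powr (- a)"
      proof -
        have e: "- (real (Suc n) - real m) * q = - a" unfolding a_def by (rule mult_minus_left)
        have "(K1 / V (cmod z) * cmod (1 - w) powr (- (real (Suc n) - real m))) powr q
            = ?c * (cmod (1 - w) powr (- (real (Suc n) - real m))) powr q"
          using K1(1) Vz by (subst powr_mult) auto
        then show ?thesis by (simp only: powr_powr e)
      qed
      finally show ?thesis by (simp add: w_def)
    qed
    have nz: "1 - cnj z * \<zeta> \<noteq> 0" if "\<zeta> \<in> ball 0 1" for \<zeta>
      using one_minus_cnj_mult_nonzero[OF z] that by simp
    have "(\<lambda>\<zeta>. ennreal (cmod (1 - cnj z * \<zeta>) powr (- a))) \<in> borel_measurable (restrict_space borel (ball 0 1))"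
      using nz by (intro measurable_compose[OF measurable_on_ball measurable_ennreal] continuous_on_powr continuous_intros) auto
    then have m: "(\<lambda>\<zeta>. ennreal (cmod (1 - cnj z * \<zeta>) powr (- a))) \<in> borel_measurable (rad area)"
      by (subst measurable_cong_sets[OF sets_rad refl])
    have "(\<integral>\<^sup>+\<zeta>. ennreal ((cmod (1 - cnj z * \<zeta>) ^ m * cmod (\<Phi> n (cnj z * \<zeta>))) powr q) \<partial>rad area)
      \<le> (\<integral>\<^sup>+\<zeta>. ennreal ?c * ennreal (cmod (1 - cnj z * \<zeta>) powr (- a)) \<partial>rad area)"
      using pt by (intro nn_integral_mono) (simp add: ennreal_mult[symmetric] ennreal_leI)
    also have "\<dots> = ennreal ?c * (\<integral>\<^sup>+\<zeta>. ennreal (cmod (1 - cnj z * \<zeta>) powr (- a)) \<partial>rad area)"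
      by (rule nn_integral_cmult[OF m])
    also have "\<dots> \<le> ennreal ?c * ennreal (K2 * (V (cmod z) * (1 - cmod z) powr (1 - a)))"
      by (intro mult_left_mono K2 z) simp
    also have "\<dots> = ennreal (K1 powr q * K2 * (V (cmod z) powr (1 - q) * (1 - cmod z) powr (1 - a)))"
    proof -
      have "?c * V (cmod z) = K1 powr q * V (cmod z) powr (1 - q)"
        using K1 Vz by (simp add: powr_divide powr_diff)
      moreover have "?c * (K2 * (V (cmod z) * (1 - cmod z) powr (1 - a))) = (?c * V (cmod z)) * (K2 * (1 - cmod z) powr (1 - a))"
        by (simp only: mult_ac)
      ultimately have "?c * (K2 * (V (cmod z) * (1 - cmod z) powr (1 - a))) = K1 powr q * K2 * (V (cmod z) powr (1 - q) * (1 - cmod z) powr (1 - a))"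
        by (simp only: mult_ac)
      then show ?thesis using K2 by (simp only: ennreal_mult'[symmetric] powr_ge_zero)
    qed
    finally show "(\<integral>\<^sup>+\<zeta>. ennreal ((cmod (1 - cnj z * \<zeta>) ^ m * cmod (\<Phi> n (cnj z * \<zeta>))) powr q) \<partial>rad area)
      \<le> ennreal (K1 powr q * K2 * (V (cmod z) powr (1 - q) * (1 - cmod z) powr (1 - (real (Suc n) - real m) * q)))"
      by (simp add: a_def)
  qed (use K1 K2 in simp)
qed

lemma smooth_le_area:
  "\<exists>K>0. \<forall>g p. g holomorphic_on ball 0 1 \<longrightarrow> p > 0 \<longrightarrow>
    (\<integral>\<^sup>+z. ennreal (cmod (g z) powr p) \<partial>rad smooth) \<le> ennreal K * (\<integral>\<^sup>+z. ennreal (cmod (g z) powr p) \<partial>rad area)"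
proof -
  obtain K where K: "K > 0" "\<And>G :: real \<Rightarrow> ennreal. G \<in> borel_measurable borel \<Longrightarrow>
      (\<And>r s. 0 < r \<Longrightarrow> r \<le> s \<Longrightarrow> s < 1 \<Longrightarrow> G r \<le> G s) \<Longrightarrow>
      (\<integral>\<^sup>+r. G r * ennreal (V r / (1 - r)) * indicator {0<..<1} r \<partial>lborel)
        \<le> ennreal K * (\<integral>\<^sup>+r. G r * ennreal (u r) * indicator {0<..<1} r \<partial>lborel)"
    by (rule tail_le_u) blast
  show ?thesis
  proof (intro exI[of _ "K * (1 + C * 2 powr \<beta>)"] conjI allI impI)
    show "0 < K * (1 + C * 2 powr \<beta>)" using K C_ge_1 by (simp add: add_pos_nonneg)
    fix g :: "complex \<Rightarrow> complex" and p :: real assume g: "g holomorphic_on ball 0 1" and p: "p > 0"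
    show "(\<integral>\<^sup>+z. ennreal (cmod (g z) powr p) \<partial>rad smooth) \<le> ennreal (K * (1 + C * 2 powr \<beta>)) * (\<integral>\<^sup>+z. ennreal (cmod (g z) powr p) \<partial>rad area)"
    proof (rule holomorphic_means[OF g p])
    fix G :: "real \<Rightarrow> ennreal" assume G: "G \<in> borel_measurable borel"
      "\<And>r s. 0 < r \<Longrightarrow> r \<le> s \<Longrightarrow> s < 1 \<Longrightarrow> G r \<le> G s"
      "\<And>v. v \<in> borel_measurable borel \<Longrightarrow>
        (\<integral>\<^sup>+z. ennreal (cmod (g z) powr p) \<partial>rad v) = (\<integral>\<^sup>+r. G r * v r * indicator {0<..<1} r \<partial>lborel)"
    have "(\<integral>\<^sup>+z. ennreal (cmod (g z) powr p) \<partial>rad smooth) = (\<integral>\<^sup>+r. G r * ennreal (V r / (1 - r)) * indicator {0<..<1} r \<partial>lborel)"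
      by (rule G(3)[OF smooth_measurable])
    also have "\<dots> \<le> ennreal K * (\<integral>\<^sup>+r. G r * ennreal (u r) * indicator {0<..<1} r \<partial>lborel)"
      by (rule K(2)[OF G(1,2)])
    also have "\<dots> \<le> ennreal K * (ennreal (1 + C * 2 powr \<beta>) * (\<integral>\<^sup>+r. G r * ennreal (2 * r * u r) * indicator {0<..<1} r \<partial>lborel))"
      by (intro mult_left_mono u_le_area G(1,2)) auto
    also have "\<dots> = ennreal (K * (1 + C * 2 powr \<beta>)) * (\<integral>\<^sup>+z. ennreal (cmod (g z) powr p) \<partial>rad area)"
      using K C_ge_1 by (simp add: G(3) ennreal_mult mult.assoc)
    finally show "(\<integral>\<^sup>+z. ennreal (cmod (g z) powr p) \<partial>rad smooth) \<le> ennreal (K * (1 + C * 2 powr \<beta>)) * (\<integral>\<^sup>+z. ennreal (cmod (g z) powr p) \<partial>rad area)" .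
    qed
  qed
qed

end

section \<open>The Bergman pairing and the small Hankel operator\<close>

context D_profile
begin

text \<open>Sub-mean values over the disc of radius S = (1 - |z|) / 2 around z. On that disc the
  smoothed density is bounded below by a multiple of V(|z|) / (1 - |z|), which the weight itself
  need not be; \<open>smooth_le_area\<close> then returns to the weight.\<close>

lemma pointwise_growth:
  "\<exists>K>0. \<forall>g p z. g holomorphic_on ball 0 1 \<longrightarrow> p > 0 \<longrightarrow> cmod z < 1 \<longrightarrow>
    ennreal (cmod (g z) powr p * (V (cmod z) * (1 - cmod z))) \<le> ennreal K * (\<integral>\<^sup>+z. ennreal (cmod (g z) powr p) \<partial>rad area)"
proof -
  obtain K where K: "K > 0" "\<And>g p. g holomorphic_on ball 0 1 \<Longrightarrow> p > 0 \<Longrightarrow>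
    (\<integral>\<^sup>+z. ennreal (cmod (g z) powr p) \<partial>rad smooth) \<le> ennreal K * (\<integral>\<^sup>+z. ennreal (cmod (g z) powr p) \<partial>rad area)"
    using smooth_le_area by blast
  define B where "B = C * 2 powr \<beta>"
  have B: "B \<ge> 1" unfolding B_def using C_ge_1 \<beta>_ge_1 mult_mono[of 1 C 1 "2 powr \<beta>"] ge_one_powr_ge_zero[of 2 \<beta>] by auto
  show ?thesis
  proof (intro exI[of _ "12 * B * K"] conjI allI impI)
    show "12 * B * K > 0" using B K by simp
    fix g :: "complex \<Rightarrow> complex" and p :: real and z :: complex
    assume g: "g holomorphic_on ball 0 1" and p: "p > 0" and z: "cmod z < 1"
    define S where "S = (1 - cmod z) / 2"
    have S: "S > 0" "cmod z + S < 1" using z by (auto simp: S_def field_simps)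
    have Vz: "V (cmod z) > 0" using z by (intro tail_pos) auto
    have in_ball: "z + y \<in> ball 0 1" if "cmod y \<le> S" for y
      using norm_triangle_ineq[of z y] that S by simp
    have gc: "continuous_on (ball 0 1) (\<lambda>\<zeta>. cmod (g \<zeta>) powr p)"
      by (intro continuous_intros holomorphic_on_imp_continuous_on g p)
    have m: "(\<lambda>\<zeta>. ennreal (cmod (g \<zeta>) powr p)) \<in> borel_measurable (restrict_space borel (ball 0 1))"
      by (rule measurable_compose[OF measurable_on_ball[OF gc] measurable_ennreal])
    define h where "h = (\<lambda>\<zeta>. ennreal (cmod (g \<zeta>) powr p) * indicator (ball 0 1) \<zeta>)"
    have [measurable]: "h \<in> borel_measurable borel"
      using m unfolding h_def by (subst (asm) borel_measurable_restrict_space_iff_ennreal) auto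
    define H where "H = (\<lambda>\<zeta>. h \<zeta> * indicator (cball z S) \<zeta>)"
    have [measurable]: "H \<in> borel_measurable borel"
      unfolding H_def by (intro borel_measurable_times_ennreal borel_measurable_indicator) auto
    have "ennreal (pi * S\<^sup>2 * cmod (g z) powr p) = ennreal (cmod (g z) powr p) * ennreal (pi * S\<^sup>2 - pi * 0\<^sup>2)"
      by (simp add: ennreal_mult[symmetric] mult_ac)
    also have "ennreal (pi * S\<^sup>2 - pi * 0\<^sup>2) = (\<integral>\<^sup>+r. ennreal (2 * pi * r) * indicator {0..S} r \<partial>lborel)"
    proof (rule nn_integral_FTC_Icc[symmetric])
      show "((\<lambda>x. pi * x\<^sup>2) has_real_derivative 2 * pi * x) (at x)" for x
        by (auto intro!: derivative_eq_intros)
    qed (use S in auto)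
    also have "ennreal (cmod (g z) powr p) * \<dots> = (\<integral>\<^sup>+r. ennreal (cmod (g z) powr p) * (ennreal (2 * pi * r) * indicator {0..S} r) \<partial>lborel)"
      by (rule nn_integral_cmult[symmetric]) measurable
    also have "\<dots> \<le> (\<integral>\<^sup>+r. ennreal (2 * pi * r) * indicator {0..} r * (\<integral>\<^sup>+x. H (z + of_real r * circ x) \<partial>unit_interval) \<partial>lborel)"
    proof (rule nn_integral_mono)
      fix r :: real
      show "ennreal (cmod (g z) powr p) * (ennreal (2 * pi * r) * indicator {0..S} r)
        \<le> ennreal (2 * pi * r) * indicator {0..} r * (\<integral>\<^sup>+x. H (z + of_real r * circ x) \<partial>unit_interval)"
      proof (cases "0 \<le> r \<and> r \<le> S")
        case True
        have gz: "g holomorphic_on ball z (1 - cmod z)"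
          using g by (rule holomorphic_on_subset) (auto simp: dist_norm intro!: order_le_less_trans[OF norm_triangle_sub[of _ z]] simp: norm_minus_commute)
        have "ennreal (cmod (g z) powr p) = (\<integral>\<^sup>+x. ennreal (cmod (g (z + of_real 0 * circ x)) powr p) \<partial>unit_interval)"
          by simp
        also have "\<dots> \<le> (\<integral>\<^sup>+x. ennreal (cmod (g (z + of_real r * circ x)) powr p) \<partial>unit_interval)"
          using True S by (intro nn_circle_means_mono[OF gz p]) auto
        also have "\<dots> = (\<integral>\<^sup>+x. H (z + of_real r * circ x) \<partial>unit_interval)"
        proof (rule nn_integral_cong)
          fix x
          have "cmod (of_real r * circ x) \<le> S" using True by (simp add: norm_mult)
          then show "ennreal (cmod (g (z + of_real r * circ x)) powr p) = H (z + of_real r * circ x)"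
            using in_ball[of "of_real r * circ x"] by (simp add: H_def h_def dist_norm)
        qed
        finally have "ennreal (2 * pi * r) * ennreal (cmod (g z) powr p) \<le> ennreal (2 * pi * r) * (\<integral>\<^sup>+x. H (z + of_real r * circ x) \<partial>unit_interval)"
          by (rule mult_left_mono) simp
        then show ?thesis using True by (simp add: mult_ac)
      qed simp
    qed
    \<comment> \<open>The disc is described by polar coordinates around z, where sub-mean values are
      available, then translated and described by polar coordinates around 0, where the density is
      radial.\<close>
    also have "\<dots> = (\<integral>\<^sup>+y. H (z + y) \<partial>lborel)"
      by (rule nn_integral_polar[symmetric]) measurable
    also have "\<dots> = (\<integral>\<^sup>+\<zeta>. H \<zeta> \<partial>distr lborel borel ((+) z))"
      by (rule nn_integral_distr[symmetric]) measurable
    also have "\<dots> = (\<integral>\<^sup>+\<zeta>. H \<zeta> \<partial>lborel)" by (simp only: lborel_distr_plus)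
    also have "\<dots> = (\<integral>\<^sup>+r. ennreal (2 * pi * r) * indicator {0..} r * (\<integral>\<^sup>+x. H (of_real r * circ x) \<partial>unit_interval) \<partial>lborel)"
      by (rule nn_integral_polar) measurable
    \<comment> \<open>Radii that meet the disc satisfy | r - |z| | \<le> S; there V(|z|) \<le> B V r
      and 1 - r \<le> 3 (1 - |z|) / 2, and these two facts make up the constant.\<close>
    also have "\<dots> \<le> (\<integral>\<^sup>+r. ennreal (2 * pi * (B * (3 * (1 - cmod z) / 2) / V (cmod z))) * (smooth r * indicator {0<..<1} r * (\<integral>\<^sup>+x. ennreal (cmod (g (of_real r * circ x)) powr p) \<partial>unit_interval)) \<partial>lborel)"
    proof (rule nn_integral_mono)
      fix r :: real
      let ?I = "\<integral>\<^sup>+x. H (of_real r * circ x) \<partial>unit_interval" and ?J = "\<integral>\<^sup>+x. ennreal (cmod (g (of_real r * circ x)) powr p) \<partial>unit_interval"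
      show "ennreal (2 * pi * r) * indicator {0..} r * ?I \<le> ennreal (2 * pi * (B * (3 * (1 - cmod z) / 2) / V (cmod z))) * (smooth r * indicator {0<..<1} r * ?J)"
      proof (cases "0 < r \<and> \<bar>r - cmod z\<bar> \<le> S")
        case True
        have rS: "r \<le> cmod z + S" "cmod z \<le> r + S"
          using True abs_ge_self[of "r - cmod z"] abs_ge_minus_self[of "r - cmod z"] by linarith+
        have r: "0 < r" "r < 1" "1 - r \<le> 3 * (1 - cmod z) / 2" "(1 - cmod z) / 2 \<le> 1 - r"
        proof -
          show "0 < r" using True by simp
          show "r < 1" using rS(1) S(2) by linarith
          show "1 - r \<le> 3 * (1 - cmod z) / 2" using rS(2) unfolding S_def by (simp add: field_simps)
          show "(1 - cmod z) / 2 \<le> 1 - r" using rS(1) unfolding S_def by (simp add: field_simps)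
        qed
        have IJ: "?I \<le> ?J"
          by (intro nn_integral_mono) (auto simp: H_def h_def indicator_def)
        have "V (cmod z) \<le> B * V r"
        proof (cases "r \<le> cmod z")
          case True
          have "V (cmod z) \<le> 1 * V r" using True r by (simp add: V_antimono)
          also have "\<dots> \<le> B * V r" using B by (intro mult_right_mono) auto
          finally show ?thesis .
        next
          case False
          have "V (cmod z) \<le> C * ((1 - cmod z) / (1 - r)) powr \<beta> * V r" using False r by (intro lower) auto
          also have "\<dots> \<le> C * 2 powr \<beta> * V r"
            using C_ge_1 \<beta>_ge_1 r z by (intro mult_right_mono mult_left_mono powr_mono2) (auto simp: field_simps)
          finally show ?thesis by (simp add: B_def)
        qed
        then have "1 \<le> B * V r / V (cmod z)" using Vz by simp
        moreover have "1 \<le> (3 * (1 - cmod z) / 2) / (1 - r)" using r by simp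
        ultimately have "1 * 1 \<le> (B * V r / V (cmod z)) * ((3 * (1 - cmod z) / 2) / (1 - r))" by (intro mult_mono) auto
        then have "r \<le> (B * (3 * (1 - cmod z) / 2) / V (cmod z)) * (V r / (1 - r))"
        proof -
          have e: "(B * x / y) * (d / s) = (B * d / y) * (x / s)" for x y d s :: real by simp
          show ?thesis using r(2) \<open>1 * 1 \<le> _\<close> unfolding e by linarith
        qed
        then have "2 * pi * r \<le> 2 * pi * ((B * (3 * (1 - cmod z) / 2) / V (cmod z)) * (V r / (1 - r)))" by (intro mult_left_mono) auto
        also have "\<dots> = 2 * pi * (B * (3 * (1 - cmod z) / 2) / V (cmod z)) * (V r / (1 - r))" by (simp only: mult.assoc)
        finally have "ennreal (2 * pi * r) \<le> ennreal (2 * pi * (B * (3 * (1 - cmod z) / 2) / V (cmod z))) * smooth r"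
          using B z Vz r by (subst ennreal_mult[symmetric]) (auto intro!: ennreal_leI)
        from mult_mono[OF this IJ] show ?thesis using r by (simp add: mult.assoc)
      next
        case False
        then consider "r \<le> 0" | "0 < r" "\<bar>r - cmod z\<bar> > S" by linarith
        then show ?thesis
        proof cases
          case 1
          then show ?thesis by (cases "r = 0") auto
        next
          case 2
          have "H (of_real r * circ x) = 0" for x
          proof -
            have "\<bar>r - cmod z\<bar> \<le> cmod (of_real r * circ x - z)"
              using norm_triangle_ineq3[of "of_real r * circ x" z] 2 by (simp add: norm_mult)
            then have "of_real r * circ x \<notin> cball z S" using 2 by (simp add: dist_norm norm_minus_commute)
            then show ?thesis by (simp add: H_def)
          qed
          then show ?thesis by simp
        qed
      qed
    qed
    also have "\<dots> = ennreal (2 * pi * (B * (3 * (1 - cmod z) / 2) / V (cmod z))) * (\<integral>\<^sup>+\<zeta>. ennreal (cmod (g \<zeta>) powr p) \<partial>rad smooth)"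
    proof -
      have "(\<integral>\<^sup>+x. ennreal (cmod (g (of_real r * circ x)) powr p) * indicator (ball 0 1) (of_real r * circ x) \<partial>unit_interval)
         = (\<integral>\<^sup>+x. ennreal (cmod (g (of_real r * circ x)) powr p) \<partial>unit_interval)" if "0 < r" "r < 1" for r
        using that by (intro nn_integral_cong) (simp add: norm_mult)
      then have eq: "smooth r * indicator {0<..<1} r * (\<integral>\<^sup>+x. ennreal (cmod (g (of_real r * circ x)) powr p) \<partial>unit_interval)
        = smooth r * indicator {0<..<1} r * (\<integral>\<^sup>+x. ennreal (cmod (g (of_real r * circ x)) powr p) * indicator (ball 0 1) (of_real r * circ x) \<partial>unit_interval)" for r
        by (cases "0 < r \<and> r < 1") auto
      show ?thesis
        unfolding nn_integral_rad[OF m smooth_measurable] eq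
        by (rule nn_integral_cmult) (use measurable_circle_integral[OF m] in measurable)
    qed
    also have "\<dots> \<le> ennreal (2 * pi * (B * (3 * (1 - cmod z) / 2) / V (cmod z))) * (ennreal K * (\<integral>\<^sup>+\<zeta>. ennreal (cmod (g \<zeta>) powr p) \<partial>rad area))"
      by (intro mult_left_mono K g p) simp
    finally have main: "ennreal (pi * S\<^sup>2 * cmod (g z) powr p)
      \<le> ennreal (2 * pi * (B * (3 * (1 - cmod z) / 2) / V (cmod z))) * (ennreal K * (\<integral>\<^sup>+\<zeta>. ennreal (cmod (g \<zeta>) powr p) \<partial>rad area))" .
    define k where "k = V (cmod z) * (1 - cmod z) / (pi * S\<^sup>2)"
    have k: "k \<ge> 0" using z by (simp add: k_def)
    have "ennreal (cmod (g z) powr p * (V (cmod z) * (1 - cmod z))) = ennreal k * ennreal (pi * S\<^sup>2 * cmod (g z) powr p)"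
      using S k by (simp add: ennreal_mult'[symmetric] k_def)
    also have "\<dots> \<le> ennreal k * (ennreal (2 * pi * (B * (3 * (1 - cmod z) / 2) / V (cmod z))) * (ennreal K * (\<integral>\<^sup>+\<zeta>. ennreal (cmod (g \<zeta>) powr p) \<partial>rad area)))"
      by (intro mult_left_mono main) simp
    also have "\<dots> = ennreal (12 * B * K) * (\<integral>\<^sup>+\<zeta>. ennreal (cmod (g \<zeta>) powr p) \<partial>rad area)"
    proof -
      define d where "d = 1 - cmod z"
      have d: "d > 0" using z by (simp add: d_def)
      have "k * (2 * pi * (B * (3 * (1 - cmod z) / 2) / V (cmod z))) = 12 * B"
        unfolding k_def S_def d_def[symmetric] using d Vz by (simp add: field_simps power2_eq_square)
      moreover have "ennreal k * (ennreal a * (ennreal K * I)) = ennreal (k * a * K) * I" if "a \<ge> 0" for a I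
        using that k K(1) by (simp add: ennreal_mult mult.assoc)
      moreover have "0 \<le> 2 * pi * (B * (3 * (1 - cmod z) / 2) / V (cmod z))" using B z Vz by simp
      ultimately show ?thesis by simp
    qed
    finally show "ennreal (cmod (g z) powr p * (V (cmod z) * (1 - cmod z))) \<le> ennreal (12 * B * K) * (\<integral>\<^sup>+z. ennreal (cmod (g z) powr p) \<partial>rad area)" .
  qed
qed

end

section \<open>Pairings as series in Taylor coefficients\<close>

lemma measurable_rad_on_ball:
  fixes f :: "complex \<Rightarrow> 'a::topological_space"
  shows "continuous_on (ball 0 1) f \<Longrightarrow> f \<in> borel_measurable (rad v)"
  using measurable_on_ball[of f] by (subst measurable_cong_sets[OF sets_rad refl])

lemma integrable_rad_mult_bounded:
  fixes \<phi> h :: "complex \<Rightarrow> complex"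
  assumes \<phi>: "integrable (rad v) \<phi>" and h: "continuous_on (ball 0 1) h" "\<And>\<zeta>. \<zeta> \<in> ball 0 1 \<Longrightarrow> cmod (h \<zeta>) \<le> B"
  shows "integrable (rad v) (\<lambda>\<zeta>. \<phi> \<zeta> * h \<zeta>)"
proof (rule Bochner_Integration.integrable_bound)
  show "integrable (rad v) (\<lambda>\<zeta>. B * cmod (\<phi> \<zeta>))" using \<phi> by simp
  show "(\<lambda>\<zeta>. \<phi> \<zeta> * h \<zeta>) \<in> borel_measurable (rad v)"
    using borel_measurable_integrable[OF \<phi>] measurable_rad_on_ball[OF h(1), of v] by (rule borel_measurable_times)
  show "AE \<zeta> in rad v. norm (\<phi> \<zeta> * h \<zeta>) \<le> norm (B * cmod (\<phi> \<zeta>))"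
  proof (rule AE_I2)
    fix \<zeta> assume "\<zeta> \<in> space (rad v)"
    then have "\<zeta> \<in> ball 0 1" by simp
    then have "cmod (h \<zeta>) \<le> B" by (rule h(2))
    then have "cmod (\<phi> \<zeta>) * cmod (h \<zeta>) \<le> cmod (\<phi> \<zeta>) * B" "0 \<le> B"
      by (auto intro: mult_left_mono order_trans[OF norm_ge_zero])
    then show "norm (\<phi> \<zeta> * h \<zeta>) \<le> norm (B * cmod (\<phi> \<zeta>))" by (simp add: norm_mult mult.commute)
  qed
qed

text \<open>Absolute summability of the coefficients dominates the series uniformly on the disc by a
  multiple of |\<phi>|, which allows integration term by term.\<close>

lemma pairing_sums:
  fixes \<phi> h :: "complex \<Rightarrow> complex"
  assumes \<phi>: "integrable (rad v) \<phi>" and c: "summable (\<lambda>k. cmod (c k))"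
    and h: "\<And>\<zeta>. cmod \<zeta> < 1 \<Longrightarrow> (\<lambda>k. c k * \<zeta> ^ k) sums h \<zeta>"
  shows "(\<lambda>k. cnj (c k) * (LINT \<zeta>|rad v. \<phi> \<zeta> * cnj \<zeta> ^ k)) sums (LINT \<zeta>|rad v. \<phi> \<zeta> * cnj (h \<zeta>))"
proof -
  define f where "f = (\<lambda>k \<zeta>. \<phi> \<zeta> * cnj (c k * \<zeta> ^ k))"
  have le1: "cmod (\<zeta> ^ k) \<le> 1" if "\<zeta> \<in> ball 0 1" for \<zeta> :: complex and k
    using that by (simp add: norm_power power_le_one)
  have i0: "integrable (rad v) (\<lambda>\<zeta>. \<phi> \<zeta> * cnj \<zeta> ^ k)" for k
    by (rule integrable_rad_mult_bounded[OF \<phi>, where B = 1]) (auto intro!: continuous_intros simp: norm_power power_le_one)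
  have f_eq: "f k = (\<lambda>\<zeta>. cnj (c k) * (\<phi> \<zeta> * cnj \<zeta> ^ k))" for k by (simp add: f_def fun_eq_iff mult_ac)
  have i: "integrable (rad v) (f k)" for k unfolding f_eq using i0 by simp
  have nf: "cmod (f k \<zeta>) \<le> cmod (c k) * cmod (\<phi> \<zeta>)" if "\<zeta> \<in> ball 0 1" for k \<zeta>
    using le1[OF that, of k] mult_left_mono[of "cmod (\<zeta> ^ k)" 1 "cmod (c k) * cmod (\<phi> \<zeta>)"] by (simp add: f_def norm_mult norm_power mult_ac)
  have "(\<lambda>k. LINT \<zeta>|rad v. f k \<zeta>) sums (LINT \<zeta>|rad v. (\<Sum>k. f k \<zeta>))"
  proof (rule sums_integral[OF i])
    show "AE \<zeta> in rad v. summable (\<lambda>k. norm (f k \<zeta>))"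
    proof (rule AE_I2)
      fix \<zeta> assume "\<zeta> \<in> space (rad v)"
      then show "summable (\<lambda>k. norm (f k \<zeta>))"
        by (intro summable_comparison_test'[OF summable_mult2[OF c]]) (use nf in auto)
    qed
    show "summable (\<lambda>k. LINT \<zeta>|rad v. norm (f k \<zeta>))"
    proof (rule summable_comparison_test'[OF summable_mult2[OF c, of "LINT \<zeta>|rad v. cmod (\<phi> \<zeta>)"], where N = 0])
      fix k
      have "(LINT \<zeta>|rad v. norm (f k \<zeta>)) \<le> (LINT \<zeta>|rad v. cmod (c k) * cmod (\<phi> \<zeta>))"
        using i \<phi> nf by (intro integral_mono) auto
      then show "norm (LINT \<zeta>|rad v. norm (f k \<zeta>)) \<le> cmod (c k) * (LINT \<zeta>|rad v. cmod (\<phi> \<zeta>))"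
        by (simp add: integral_nonneg)
    qed
  qed
  moreover have "(LINT \<zeta>|rad v. f k \<zeta>) = cnj (c k) * (LINT \<zeta>|rad v. \<phi> \<zeta> * cnj \<zeta> ^ k)" for k
    unfolding f_eq using i0 by simp
  moreover have "(LINT \<zeta>|rad v. (\<Sum>k. f k \<zeta>)) = (LINT \<zeta>|rad v. \<phi> \<zeta> * cnj (h \<zeta>))"
  proof (rule Bochner_Integration.integral_cong[OF refl])
    fix \<zeta> assume "\<zeta> \<in> space (rad v)"
    then have "(\<lambda>k. cnj (c k * \<zeta> ^ k)) sums cnj (h \<zeta>)" using h[of \<zeta>] by (subst sums_cnj) simp
    then have "(\<lambda>k. f k \<zeta>) sums (\<phi> \<zeta> * cnj (h \<zeta>))" unfolding f_def by (rule sums_mult)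
    then show "(\<Sum>k. f k \<zeta>) = \<phi> \<zeta> * cnj (h \<zeta>)" by (rule sums_unique[symmetric])
  qed
  ultimately show ?thesis by simp
qed

text \<open>On each circle only the k-th Taylor coefficient survives, with a factor r^(2 k): one r^k
  from F and one from the monomial.\<close>

lemma coefficient_integral:
  assumes F: "F holomorphic_on ball 0 1" and i: "integrable (rad v) F" and v: "v \<in> borel_measurable borel"
    and fin: "(\<integral>\<^sup>+r. v r * indicator {0<..<1} r \<partial>lborel) < \<infinity>"
  shows "(LINT \<zeta>|rad v. F \<zeta> * cnj \<zeta> ^ k) = (deriv ^^ k) F 0 / fact k * of_real (moment v k)"
proof -
  let ?M = "density (restrict_space lborel {0<..<1::real}) v"
  have vm: "v \<in> borel_measurable (restrict_space lborel {0<..<1})"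
    using v by (intro measurable_restrict_space1) simp
  have "emeasure ?M (space ?M) = (\<integral>\<^sup>+r. v r * indicator {0<..<1} r \<partial>restrict_space lborel {0<..<1})"
    using vm by (simp add: emeasure_density space_restrict_space sets_restrict_space_iff)
  also have "\<dots> = (\<integral>\<^sup>+r. v r * indicator {0<..<1} r * indicator {0<..<1} r \<partial>lborel)"
    by (rule nn_integral_restrict_space) simp
  also have "\<dots> = (\<integral>\<^sup>+r. v r * indicator {0<..<1} r \<partial>lborel)"
    by (intro nn_integral_cong) (auto simp: indicator_def)
  finally interpret M: finite_measure ?M
    by (intro finite_measureI) (use fin in auto)
  interpret P: pair_sigma_finite ?M unit_interval ..
  let ?h = "\<lambda>p. (\<lambda>\<zeta>. F \<zeta> * cnj \<zeta> ^ k) (case p of (r, x) \<Rightarrow> of_real r * circ x)"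
  have m: "(\<lambda>\<zeta>. F \<zeta> * cnj \<zeta> ^ k) \<in> borel_measurable (restrict_space borel (ball 0 1))"
    by (intro measurable_on_ball continuous_intros holomorphic_on_imp_continuous_on F)
  have i': "integrable (rad v) (\<lambda>\<zeta>. F \<zeta> * cnj \<zeta> ^ k)"
    by (rule integrable_rad_mult_bounded[OF i, where B = 1]) (auto intro!: continuous_intros simp: norm_power power_le_one)
  have hi: "integrable (?M \<Otimes>\<^sub>M unit_interval) ?h"
    using i' unfolding rad_def by (subst (asm) integrable_distr_eq[OF measurable_polar m])
  have "(LINT \<zeta>|rad v. F \<zeta> * cnj \<zeta> ^ k) = (LINT p|(?M \<Otimes>\<^sub>M unit_interval). ?h p)"
    unfolding rad_def by (rule integral_distr[OF measurable_polar m])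
  also have "\<dots> = (LINT r|?M. LINT x|unit_interval. ?h (r, x))"
    by (rule P.integral_fst'[OF hi, symmetric])
  also have "\<dots> = (LINT r|?M. (deriv ^^ k) F 0 / fact k * of_real (r ^ (2 * k)))"
  proof (rule Bochner_Integration.integral_cong[OF refl])
    fix r assume "r \<in> space ?M"
    then have r: "0 < r" "r < 1" by (auto simp: space_restrict_space)
    have "(LINT x|unit_interval. ?h (r, x)) = (LINT x|unit_interval. of_real (r ^ k) * (F (0 + of_real r * circ x) * cnj (circ x) ^ k))"
      by (simp add: power_mult_distrib mult_ac)
    also have "\<dots> = of_real (r ^ k) * (of_real r ^ k * (deriv ^^ k) F 0 / fact k)"
      by (simp only: integral_mult_right_zero circle_coefficient[OF F r])
    also have "\<dots> = (deriv ^^ k) F 0 / fact k * of_real (r ^ (2 * k))"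
      by (simp add: mult_2 power_add)
    finally show "(LINT x|unit_interval. ?h (r, x)) = (deriv ^^ k) F 0 / fact k * of_real (r ^ (2 * k))" .
  qed
  also have "\<dots> = (deriv ^^ k) F 0 / fact k * of_real (LINT r|?M. r ^ (2 * k))"
    by (simp only: integral_mult_right_zero integral_complex_of_real)
  also have "(LINT r|?M. r ^ (2 * k)) = moment v k"
  proof -
    have pm: "(\<lambda>r. ennreal (r ^ (2 * k))) \<in> borel_measurable (restrict_space lborel {0<..<1})"
      by (rule measurable_restrict_space1) simp
    have "(LINT r|?M. r ^ (2 * k)) = enn2real (\<integral>\<^sup>+r. ennreal (r ^ (2 * k)) \<partial>?M)"
    proof (rule integral_eq_nn_integral)
      have "(\<lambda>r::real. r ^ (2 * k)) \<in> borel_measurable (restrict_space lborel {0<..<1})"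
        by (rule measurable_restrict_space1) simp
      then show "(\<lambda>r::real. r ^ (2 * k)) \<in> borel_measurable ?M" by simp
    qed simp
    also have "(\<integral>\<^sup>+r. ennreal (r ^ (2 * k)) \<partial>?M) = (\<integral>\<^sup>+r. v r * ennreal (r ^ (2 * k)) \<partial>restrict_space lborel {0<..<1})"
      by (rule nn_integral_density[OF vm pm])
    also have "\<dots> = (\<integral>\<^sup>+r. v r * ennreal (r ^ (2 * k)) * indicator {0<..<1} r \<partial>lborel)"
      by (rule nn_integral_restrict_space) simp
    finally show ?thesis by (simp add: moment_def mult_ac)
  qed
  finally show ?thesis .
qed

lemma power_series_coefficient:
  fixes f :: "complex \<Rightarrow> complex"
  assumes "\<And>z. cmod z < 1 \<Longrightarrow> (\<lambda>k. a k * z ^ k) sums f z"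
  shows "(deriv ^^ k) f 0 / fact k = a k"
proof -
  have "f has_fps_expansion Abs_fps a"
  proof (rule has_fps_expansionI)
    have "eventually (\<lambda>u::complex. u \<in> ball 0 1) (nhds 0)" by (rule eventually_nhds_in_open) auto
    then show "eventually (\<lambda>u. (\<lambda>n. fps_nth (Abs_fps a) n * u ^ n) sums f u) (nhds 0)"
      by eventually_elim (use assms in simp)
  qed
  from fps_nth_fps_expansion[OF this, of k] show ?thesis by simp
qed

locale D_weight = D_profile u C \<alpha> \<beta> for u C \<alpha> \<beta> +
  fixes w :: "complex \<Rightarrow> real"
  assumes weight: "radial_weight w"
    and hat_eq: "0 \<le> r \<Longrightarrow> r < 1 \<Longrightarrow> hat w (complex_of_real r) = tail u r"
    and distr_eq: "distr (density disc_area (\<lambda>z. ennreal (w z))) (restrict_space borel (ball 0 1)) (\<lambda>z. z)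
       = rad (\<lambda>r. ennreal (2 * r * u r))"
begin

section \<open>The weight as a radial measure and its reproducing kernel\<close>

lemma w_nonneg: "z \<in> ball 0 1 \<Longrightarrow> 0 \<le> w z"
  using weight unfolding radial_weight_def by blast

lemma w_measurable [measurable]: "w \<in> borel_measurable disc_area"
  using weight unfolding radial_weight_def by (blast intro: borel_measurable_integrable)

lemma hat_cmod: "cmod z < 1 \<Longrightarrow> hat w z = V (cmod z)"
  using hat_eq[of "cmod z"] by (simp add: hat_def)

lemma space_disc_area [simp]: "space disc_area = ball 0 1"
  by (simp add: disc_area_def space_restrict_space)

lemma id_measurable: "(\<lambda>z. z) \<in> disc_area \<rightarrow>\<^sub>M restrict_space borel (ball 0 1)"
proof (rule measurable_restrict_space2)
  have "(\<lambda>z. z) \<in> borel_measurable (lebesgue_on (ball (0::complex) 1))"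
    using id_borel_measurable_lebesgue_on unfolding id_def .
  then show "(\<lambda>z. z) \<in> borel_measurable disc_area" by (simp add: disc_area_def)
qed simp

lemma nn_integral_weight:
  assumes F: "F \<in> borel_measurable (restrict_space borel (ball 0 1))"
  shows "(\<integral>\<^sup>+z. F z * ennreal (w z) \<partial>disc_area) = (\<integral>\<^sup>+z. F z \<partial>rad area)"
proof -
  have F': "F \<in> borel_measurable disc_area" using measurable_compose[OF id_measurable F] .
  have "(\<integral>\<^sup>+z. F z \<partial>rad area) = (\<integral>\<^sup>+z. F z \<partial>density disc_area (\<lambda>z. ennreal (w z)))"
    unfolding distr_eq[symmetric] by (rule nn_integral_distr) (use id_measurable F in simp_all)
  also have "\<dots> = (\<integral>\<^sup>+z. ennreal (w z) * F z \<partial>disc_area)"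
    using F' by (intro nn_integral_density) auto
  finally show ?thesis by (simp add: mult.commute)
qed

lemma integral_weight:
  fixes F :: "complex \<Rightarrow> complex"
  assumes F: "F \<in> borel_measurable (restrict_space borel (ball 0 1))"
  shows "(LINT z|disc_area. F z * complex_of_real (w z)) = (LINT z|rad area. F z)"
proof -
  have F': "F \<in> borel_measurable disc_area" using measurable_compose[OF id_measurable F] .
  have "(LINT z|rad area. F z) = (LINT z|density disc_area (\<lambda>z. ennreal (w z)). F z)"
    unfolding distr_eq[symmetric] by (rule integral_distr) (use id_measurable F in simp_all)
  also have "\<dots> = (LINT z|disc_area. w z *\<^sub>R F z)"
    using F' w_nonneg by (intro integral_density) auto
  finally show ?thesis by (simp add: scaleR_conv_of_real mult.commute)
qed

lemma area_finite: "(\<integral>\<^sup>+r. area r * indicator {0<..<1} r \<partial>lborel) < \<infinity>"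
  using mixed_moment_nn[of 0 0] by simp

lemma Lp_norm_eq:
  assumes "continuous_on (ball 0 1) f" "p > 0"
  shows "Lp_norm p w f = ennreal_root p (\<integral>\<^sup>+z. ennreal (cmod (f z) powr p) \<partial>rad area)"
proof -
  have "(\<integral>\<^sup>+z. ennreal (cmod (f z) powr p) \<partial>rad area) = (\<integral>\<^sup>+z. ennreal (cmod (f z) powr p) * ennreal (w z) \<partial>disc_area)"
    using assms by (intro nn_integral_weight[symmetric] measurable_compose[OF measurable_on_ball measurable_ennreal] continuous_intros) auto
  also have "\<dots> = (\<integral>\<^sup>+z. ennreal (cmod (f z) powr p * w z) \<partial>disc_area)"
    by (intro nn_integral_cong) (use w_nonneg in \<open>auto simp: ennreal_mult\<close>)
  finally show ?thesis by (simp add: Lp_norm_def)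
qed

lemma finite_measure_area: "emeasure (rad area) (ball 0 1) < \<infinity>"
proof -
  have "emeasure (rad area) (ball 0 1) = (\<integral>\<^sup>+z. 1 \<partial>rad area)" by simp
  also have "\<dots> = (\<integral>\<^sup>+r. area r * indicator {0<..<1} r \<partial>lborel)"
    by (subst nn_integral_rad) auto
  finally show ?thesis using area_finite by simp
qed

sublocale area: finite_measure "rad area"
  by (rule finite_measureI) (use finite_measure_area in auto)

lemma integrable_area_iff:
  fixes f :: "complex \<Rightarrow> complex"
  assumes "continuous_on (ball 0 1) f"
  shows "integrable (rad area) f \<longleftrightarrow> (\<integral>\<^sup>+z. ennreal (cmod (f z)) \<partial>rad area) < \<infinity>"
  using measurable_rad_on_ball[OF assms] by (simp add: integrable_iff_bounded)

lemma integrable_area_of_powr: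
  fixes f :: "complex \<Rightarrow> complex"
  assumes f: "continuous_on (ball 0 1) f" and q: "q \<ge> 1" and fin: "(\<integral>\<^sup>+z. ennreal (cmod (f z) powr q) \<partial>rad area) < \<infinity>"
  shows "integrable (rad area) f"
  unfolding integrable_area_iff[OF f]
proof -
  have m: "(\<lambda>z. ennreal (cmod (f z) powr q)) \<in> borel_measurable (rad area)"
    using f q by (intro measurable_compose[OF measurable_rad_on_ball measurable_ennreal] continuous_intros) auto
  have "(\<integral>\<^sup>+z. ennreal (cmod (f z)) \<partial>rad area) \<le> (\<integral>\<^sup>+z. 1 + ennreal (cmod (f z) powr q) \<partial>rad area)"
  proof (rule nn_integral_mono)
    fix z
    have "cmod (f z) \<le> 1 + cmod (f z) powr q"
    proof (cases "cmod (f z) \<le> 1")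
      case False
      then have "cmod (f z) powr 1 \<le> cmod (f z) powr q" using q by (intro powr_mono) auto
      then show ?thesis using False by simp
    qed (simp add: add_increasing2)
    then have "ennreal (cmod (f z)) \<le> ennreal (1 + cmod (f z) powr q)" by (rule ennreal_leI)
    then show "ennreal (cmod (f z)) \<le> 1 + ennreal (cmod (f z) powr q)" by simp
  qed
  also have "\<dots> = emeasure (rad area) (ball 0 1) + (\<integral>\<^sup>+z. ennreal (cmod (f z) powr q) \<partial>rad area)"
    using m by (subst nn_integral_add) auto
  also have "\<dots> < \<infinity>" using fin finite_measure_area by simp
  finally show "(\<integral>\<^sup>+z. ennreal (cmod (f z)) \<partial>rad area) < \<infinity>" .
qed

lemma \<Phi>_coeffs_summable: "cmod z < 1 \<Longrightarrow> summable (\<lambda>k. cmod (of_real (coeff_\<Phi> n k) * cnj z ^ k))"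
  by (rule summable_\<Phi>) simp

lemma \<Phi>_cnj_sums:
  assumes "cmod z < 1" "cmod \<zeta> < 1"
  shows "(\<lambda>k. (of_real (coeff_\<Phi> n k) * cnj z ^ k) * \<zeta> ^ k) sums \<Phi> n (cnj z * \<zeta>)"
  using \<Phi>_sums[OF cmod_cnj_mult_less[OF assms], of n] by (simp add: power_mult_distrib mult.assoc)

lemma \<Phi>_bounded:
  assumes "cmod z < 1" "cmod \<zeta> < 1"
  shows "cmod (\<Phi> n (cnj z * \<zeta>)) \<le> (\<Sum>k. cmod (of_real (coeff_\<Phi> n k) * cnj z ^ k))"
proof -
  have "cmod (\<Sum>k. (of_real (coeff_\<Phi> n k) * cnj z ^ k) * \<zeta> ^ k) \<le> (\<Sum>k. cmod (of_real (coeff_\<Phi> n k) * cnj z ^ k))"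
  proof (rule norm_suminf_le[OF _ \<Phi>_coeffs_summable[OF assms(1)]])
    fix k
    have "cmod (\<zeta> ^ k) \<le> 1" using assms by (simp add: norm_power power_le_one)
    then show "cmod ((of_real (coeff_\<Phi> n k) * cnj z ^ k) * \<zeta> ^ k) \<le> cmod (of_real (coeff_\<Phi> n k) * cnj z ^ k)"
      unfolding norm_mult[of "of_real (coeff_\<Phi> n k) * cnj z ^ k"] by (intro mult_left_le) auto
  qed
  then show ?thesis using sums_unique[OF \<Phi>_cnj_sums[OF assms, of n]] by simp
qed

text \<open>The moments cancel against those in the coefficients of \<Phi>, and the Pochhammer
  factor (k + n)! / k! turns the Taylor coefficients of F into those of its n-th derivative.
  Integrability of F is enough, so the case n = 0 reproduces more than the functions of the Hilbert
  space.\<close>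

lemma pairing_\<Phi>:
  assumes F: "F holomorphic_on ball 0 1" and i: "integrable (rad area) F" and z: "cmod z < 1"
  shows "(LINT \<zeta>|rad area. F \<zeta> * cnj (\<zeta> ^ n * \<Phi> n (cnj z * \<zeta>))) = (deriv ^^ n) F z"
proof -
  \<comment> \<open>The factor \<zeta>^n moves the coefficients by n places; the first n of them
    vanish.\<close>
  define c where "c = (\<lambda>k. if k < n then 0 else of_real (coeff_\<Phi> n (k - n)) * cnj z ^ (k - n))"
  have c_shift: "(\<lambda>k. c (k + n)) = (\<lambda>k. of_real (coeff_\<Phi> n k) * cnj z ^ k)" by (simp add: c_def)
  have cs: "summable (\<lambda>k. cmod (c k))"
  proof -
    have "summable (\<lambda>k. cmod (c (k + n)))" using \<Phi>_coeffs_summable[OF z, of n] by (simp add: c_def)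
    then show ?thesis by (subst (asm) summable_iff_shift)
  qed
  have "(\<lambda>k. c k * \<zeta> ^ k) sums (\<zeta> ^ n * \<Phi> n (cnj z * \<zeta>))" if \<zeta>: "cmod \<zeta> < 1" for \<zeta>
  proof -
    have "(\<lambda>k. \<zeta> ^ n * ((of_real (coeff_\<Phi> n k) * cnj z ^ k) * \<zeta> ^ k)) sums (\<zeta> ^ n * \<Phi> n (cnj z * \<zeta>))"
      by (rule sums_mult[OF \<Phi>_cnj_sums[OF z \<zeta>]])
    also have "(\<lambda>k. \<zeta> ^ n * ((of_real (coeff_\<Phi> n k) * cnj z ^ k) * \<zeta> ^ k)) = (\<lambda>k. c (k + n) * \<zeta> ^ (k + n))"
      by (simp add: c_def power_add mult_ac)
    finally show ?thesis by (subst (asm) sums_zero_iff_shift) (auto simp: c_def)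
  qed
  from pairing_sums[OF i cs this]
  have "(\<lambda>k. cnj (c k) * ((deriv ^^ k) F 0 / fact k * of_real (moment area k))) sums (LINT \<zeta>|rad area. F \<zeta> * cnj (\<zeta> ^ n * \<Phi> n (cnj z * \<zeta>)))"
    by (simp only: coefficient_integral[OF F i area_measurable area_finite])
  then have "(\<lambda>k. cnj (c (k + n)) * ((deriv ^^ (k + n)) F 0 / fact (k + n) * of_real (moment area (k + n)))) sums (LINT \<zeta>|rad area. F \<zeta> * cnj (\<zeta> ^ n * \<Phi> n (cnj z * \<zeta>)))"
    by (subst sums_zero_iff_shift) (auto simp: c_def)
  also have "(\<lambda>k. cnj (c (k + n)) * ((deriv ^^ (k + n)) F 0 / fact (k + n) * of_real (moment area (k + n))))
    = (\<lambda>k. (deriv ^^ k) ((deriv ^^ n) F) 0 / fact k * (z - 0) ^ k)"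
  proof
    fix k
    have "pochhammer (1::real) (k + n) = pochhammer 1 k * pochhammer (1 + real k) n" by (rule pochhammer_product')
    then have p: "pochhammer (real k + 1) n = fact (k + n) / fact k"
      by (simp add: pochhammer_fact[symmetric] add.commute)
    have "cnj (c (k + n)) * of_real (moment area (k + n)) = of_real (fact (k + n) / fact k) * z ^ k"
      using \<mu>_pos[of "k + n"] by (simp add: c_def coeff_\<Phi>_def p \<mu>_eq_moment[symmetric])
    then have "cnj (c (k + n)) * ((deriv ^^ (k + n)) F 0 / fact (k + n) * of_real (moment area (k + n)))
      = of_real (fact (k + n) / fact k) * z ^ k * ((deriv ^^ (k + n)) F 0 / fact (k + n))"
    proof -
      have "cnj (c (k + n)) * (A * of_real (moment area (k + n))) = (cnj (c (k + n)) * of_real (moment area (k + n))) * A" for A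
        by (simp only: mult_ac)
      then show ?thesis by (simp only: \<open>cnj (c (k + n)) * of_real (moment area (k + n)) = of_real (fact (k + n) / fact k) * z ^ k\<close>)
    qed
    also have "\<dots> = (deriv ^^ (k + n)) F 0 / fact k * z ^ k" by simp
    finally show "cnj (c (k + n)) * ((deriv ^^ (k + n)) F 0 / fact (k + n) * of_real (moment area (k + n)))
      = (deriv ^^ k) ((deriv ^^ n) F) 0 / fact k * (z - 0) ^ k"
      by (simp add: funpow_add)
  qed
  finally have 1: "(\<lambda>k. (deriv ^^ k) ((deriv ^^ n) F) 0 / fact k * (z - 0) ^ k) sums (LINT \<zeta>|rad area. F \<zeta> * cnj (\<zeta> ^ n * \<Phi> n (cnj z * \<zeta>)))" .
  have "(deriv ^^ n) F holomorphic_on ball 0 1" by (intro holomorphic_higher_deriv F) auto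
  from holomorphic_power_series[OF this, of z] z
  have 2: "(\<lambda>k. (deriv ^^ k) ((deriv ^^ n) F) 0 / fact k * (z - 0) ^ k) sums (deriv ^^ n) F z" by simp
  from sums_unique2[OF 1 2] show ?thesis .
qed

lemma inner_L2_eq:
  assumes "continuous_on (ball 0 1) f" "continuous_on (ball 0 1) g"
  shows "inner_L2 w f g = (LINT \<zeta>|rad area. f \<zeta> * cnj (g \<zeta>))"
  unfolding inner_L2_def using assms by (intro integral_weight measurable_on_ball continuous_intros)

lemma bergman2_integrable:
  assumes "f \<in> bergman 2 w"
  shows "f holomorphic_on ball 0 1" "continuous_on (ball 0 1) f" "integrable (rad area) f"
proof -
  show h: "f holomorphic_on ball 0 1" using assms by (simp add: bergman_def)
  then show c: "continuous_on (ball 0 1) f" by (rule holomorphic_on_imp_continuous_on)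
  have "Lp_norm 2 w f < \<infinity>" using assms by (simp add: bergman_def)
  then have "(\<integral>\<^sup>+z. ennreal (cmod (f z) powr 2) \<partial>rad area) < \<infinity>"
    by (subst (asm) Lp_norm_eq[OF c]) (auto simp: ennreal_root_def less_top[symmetric] split: if_splits)
  then show "integrable (rad area) f" by (intro integrable_area_of_powr[OF c, of 2]) auto
qed

lemma \<Phi>_reproducing:
  assumes z: "cmod z < 1"
  shows "is_reproducing_kernel w z (\<lambda>\<zeta>. \<Phi> 0 (cnj z * \<zeta>))"
  unfolding is_reproducing_kernel_def
proof (intro conjI ballI)
  let ?K = "\<lambda>\<zeta>. \<Phi> 0 (cnj z * \<zeta>)"
  have c: "continuous_on (ball 0 1) ?K" by (rule \<Phi>_cont[OF z])
  have "?K holomorphic_on ball 0 1"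
    by (rule holomorphic_on_compose_gen[OF _ \<Phi>_holomorphic, unfolded o_def])
       (use cmod_cnj_mult_less[OF z] in \<open>auto intro!: holomorphic_intros\<close>)
  moreover have "Lp_norm 2 w ?K < \<infinity>"
  proof -
    let ?B = "\<Sum>k. cmod (of_real (coeff_\<Phi> 0 k) * cnj z ^ k)"
    have "(\<integral>\<^sup>+\<zeta>. ennreal (cmod (?K \<zeta>) powr 2) \<partial>rad area) \<le> (\<integral>\<^sup>+\<zeta>. ennreal (?B powr 2) \<partial>rad area)"
      using \<Phi>_bounded[OF z] by (intro nn_integral_mono ennreal_leI powr_mono2) auto
    also have "\<dots> < \<infinity>" using finite_measure_area by (simp add: ennreal_mult_less_top)
    finally have "(\<integral>\<^sup>+\<zeta>. ennreal (cmod (?K \<zeta>) powr 2) \<partial>rad area) < \<infinity>" .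
    then show ?thesis by (subst Lp_norm_eq[OF c]) (auto simp: ennreal_root_def)
  qed
  ultimately show "?K \<in> bergman 2 w" by (simp add: bergman_def)
  fix f assume f: "f \<in> bergman 2 w"
  note f' = bergman2_integrable[OF f]
  show "f z = inner_L2 w f ?K"
    unfolding inner_L2_eq[OF f'(2) c] using pairing_\<Phi>[OF f'(1,3) z, of 0] by simp
qed

text \<open>The choice operator returns some reproducing kernel. Its value at \<zeta> is obtained by
  pairing it with \<Phi> at \<zeta>, and the conjugate of this pairing is the value of \<Phi> at z,
  reproduced by the chosen kernel.\<close>

lemma kernel_eq:
  assumes z: "cmod z < 1" and \<zeta>: "cmod \<zeta> < 1"
  shows "kernel w z \<zeta> = \<Phi> 0 (cnj z * \<zeta>)"
proof -
  have rk: "is_reproducing_kernel w z (kernel w z)"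
    unfolding kernel_def by (rule someI[of "is_reproducing_kernel w z"]) (rule \<Phi>_reproducing[OF z])
  then have kb: "kernel w z \<in> bergman 2 w" by (simp add: is_reproducing_kernel_def)
  note R = \<Phi>_reproducing[OF \<zeta>]
  have Kb: "(\<lambda>x. \<Phi> 0 (cnj \<zeta> * x)) \<in> bergman 2 w" using R by (simp add: is_reproducing_kernel_def)
  have "kernel w z \<zeta> = inner_L2 w (kernel w z) (\<lambda>x. \<Phi> 0 (cnj \<zeta> * x))"
    using R kb by (simp add: is_reproducing_kernel_def)
  also have "\<dots> = cnj (inner_L2 w (\<lambda>x. \<Phi> 0 (cnj \<zeta> * x)) (kernel w z))"
    unfolding inner_L2_def by (subst Bochner_Integration.integral_cnj[symmetric]) (simp add: mult_ac)
  also have "inner_L2 w (\<lambda>x. \<Phi> 0 (cnj \<zeta> * x)) (kernel w z) = \<Phi> 0 (cnj \<zeta> * z)"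
    using rk Kb by (simp add: is_reproducing_kernel_def)
  also have "cnj (\<Phi> 0 (cnj \<zeta> * z)) = \<Phi> 0 (cnj z * \<zeta>)"
    using \<Phi>_cnj[OF cmod_cnj_mult_less[OF \<zeta> z], of 0] by (simp add: mult.commute)
  finally show ?thesis .
qed

lemma bergman1_log_integrable:
  assumes "f \<in> bergman1_log w"
  shows "f holomorphic_on ball 0 1" "integrable (rad area) f"
proof -
  show h: "f holomorphic_on ball 0 1" using assms by (simp add: bergman1_log_def)
  have c: "continuous_on (ball 0 1) f" by (rule holomorphic_on_imp_continuous_on[OF h])
  have "(\<integral>\<^sup>+z. ennreal (cmod (f z)) \<partial>rad area) = (\<integral>\<^sup>+z. ennreal (cmod (f z)) * ennreal (w z) \<partial>disc_area)"
    using c by (intro nn_integral_weight[symmetric] measurable_compose[OF measurable_on_ball measurable_ennreal] continuous_intros)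
  also have "\<dots> \<le> (\<integral>\<^sup>+z. ennreal (cmod (f z) * ln (exp 1 / (1 - cmod z)) * w z) \<partial>disc_area)"
  proof (rule nn_integral_mono)
    fix z assume "z \<in> space disc_area"
    then have z: "cmod z < 1" by simp
    have "ln (exp 1 / (1 - cmod z)) = 1 - ln (1 - cmod z)" using z by (simp add: ln_div)
    moreover have "ln (1 - cmod z) \<le> 0" using z by simp
    ultimately have "cmod (f z) * 1 \<le> cmod (f z) * ln (exp 1 / (1 - cmod z))" by (intro mult_left_mono) auto
    then have "cmod (f z) * w z \<le> cmod (f z) * ln (exp 1 / (1 - cmod z)) * w z"
      using w_nonneg[of z] z by (intro mult_right_mono) auto
    then show "ennreal (cmod (f z)) * ennreal (w z) \<le> ennreal (cmod (f z) * ln (exp 1 / (1 - cmod z)) * w z)"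
      using w_nonneg[of z] z by (simp add: ennreal_mult[symmetric] ennreal_leI)
  qed
  also have "\<dots> < \<infinity>" using assms by (simp add: bergman1_log_def)
  finally show "integrable (rad area) f" unfolding integrable_area_iff[OF c] .
qed

text \<open>The operator with the explicit kernel and a radial Borel measure. In this form it is
  visibly a power series in z, because the conjugate of \<Phi> at cnj z \<zeta> is one.\<close>

definition hankel :: "(complex \<Rightarrow> complex) \<Rightarrow> (complex \<Rightarrow> complex) \<Rightarrow> complex \<Rightarrow> complex" where
  "hankel f g z = (LINT \<zeta>|rad area. f \<zeta> * cnj (g \<zeta>) * cnj (\<Phi> 0 (cnj z * \<zeta>)))"

section \<open>The Hankel operator as an analytic function\<close>

context
  fixes f g :: "complex \<Rightarrow> complex"
  assumes f: "f holomorphic_on ball 0 1" and fi: "integrable (rad area) f" and g: "g \<in> H_infinity"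
begin

lemma g_holomorphic: "g holomorphic_on ball 0 1" and g_continuous: "continuous_on (ball 0 1) g"
  using g by (auto simp: H_infinity_def holomorphic_on_imp_continuous_on)

lemma f_continuous: "continuous_on (ball 0 1) f"
  using f by (rule holomorphic_on_imp_continuous_on)

lemma fg_integrable: "integrable (rad area) (\<lambda>\<zeta>. f \<zeta> * cnj (g \<zeta>))"
proof -
  obtain B where "\<forall>x\<in>g ` ball 0 1. norm x \<le> B"
    using g unfolding H_infinity_def bounded_iff by blast
  then show ?thesis
    by (intro integrable_rad_mult_bounded[OF fi, where B = B]) (auto intro!: continuous_intros g_continuous)
qed

lemma small_hankel_eq: "cmod z < 1 \<Longrightarrow> small_hankel w f g z = hankel f g z"
proof -
  assume z: "cmod z < 1"
  have "small_hankel w f g z = (LINT \<zeta>|disc_area. (f \<zeta> * cnj (g \<zeta>) * cnj (\<Phi> 0 (cnj z * \<zeta>))) * complex_of_real (w \<zeta>))"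
    unfolding small_hankel_def using z by (intro Bochner_Integration.integral_cong refl) (simp add: kernel_eq)
  also have "\<dots> = hankel f g z"
    unfolding hankel_def
    by (intro integral_weight measurable_on_ball continuous_intros \<Phi>_cont z f_continuous g_continuous)
  finally show ?thesis .
qed

lemma hankel_sums:
  assumes z: "cmod z < 1"
  shows "(\<lambda>k. (LINT \<zeta>|rad area. f \<zeta> * cnj (g \<zeta>) * cnj \<zeta> ^ k) / of_real (\<mu> k) * z ^ k) sums hankel f g z"
proof -
  have "(\<lambda>k. cnj (of_real (coeff_\<Phi> 0 k) * cnj z ^ k) * (LINT \<zeta>|rad area. f \<zeta> * cnj (g \<zeta>) * cnj \<zeta> ^ k)) sums hankel f g z"
    unfolding hankel_def by (rule pairing_sums[OF fg_integrable \<Phi>_coeffs_summable[OF z] \<Phi>_cnj_sums[OF z]])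
  then show ?thesis by (simp add: coeff_\<Phi>_def mult_ac)
qed

lemma hankel_holomorphic: "hankel f g holomorphic_on ball 0 1"
  by (rule power_series_holomorphic[where a = "\<lambda>k. (LINT \<zeta>|rad area. f \<zeta> * cnj (g \<zeta>) * cnj \<zeta> ^ k) / of_real (\<mu> k)"])
     (use hankel_sums in auto)

text \<open>The k-th coefficient of \<open>hankel f g\<close> is the pairing of f cnj g with
  \<zeta>^k divided by the k-th moment, and pairing with \<zeta>^k multiplies by that moment again.
  The radius R > 1 makes the coefficients of h absolutely summable.\<close>

lemma hankel_pairing:
  assumes i: "integrable (rad area) (hankel f g)" and R: "R > 1" and h: "h holomorphic_on ball 0 R"
  shows "(LINT \<zeta>|rad area. hankel f g \<zeta> * cnj (h \<zeta>)) = (LINT \<zeta>|rad area. f \<zeta> * cnj (g \<zeta> * h \<zeta>))"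
proof -
  define c where "c = (\<lambda>k. (deriv ^^ k) h 0 / fact k)"
  have s: "(\<lambda>k. c k * \<zeta> ^ k) sums h \<zeta>" if "cmod \<zeta> < R" for \<zeta>
    using holomorphic_power_series[OF h, of \<zeta>] that by (simp add: c_def)
  have cs: "summable (\<lambda>k. cmod (c k))"
  proof -
    have "summable (\<lambda>k. c k * (of_real ((1 + R) / 2)) ^ k)"
      using s[of "of_real ((1 + R) / 2)"] R by (simp add: sums_iff abs_if del: of_real_divide)
    then have "summable (\<lambda>k. norm (c k * 1 ^ k))"
      by (rule powser_insidea) (use R in \<open>simp add: abs_if del: of_real_divide\<close>)
    then show ?thesis by simp
  qed
  have s': "(\<lambda>k. c k * \<zeta> ^ k) sums h \<zeta>" if "cmod \<zeta> < 1" for \<zeta> using s[of \<zeta>] that R by simp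
  have 1: "(\<lambda>k. cnj (c k) * (LINT \<zeta>|rad area. hankel f g \<zeta> * cnj \<zeta> ^ k)) sums (LINT \<zeta>|rad area. hankel f g \<zeta> * cnj (h \<zeta>))"
    by (rule pairing_sums[OF i cs s'])
  have 2: "(\<lambda>k. cnj (c k) * (LINT \<zeta>|rad area. f \<zeta> * cnj (g \<zeta>) * cnj \<zeta> ^ k)) sums (LINT \<zeta>|rad area. f \<zeta> * cnj (g \<zeta>) * cnj (h \<zeta>))"
    by (rule pairing_sums[OF fg_integrable cs s'])
  have "(LINT \<zeta>|rad area. hankel f g \<zeta> * cnj \<zeta> ^ k) = (LINT \<zeta>|rad area. f \<zeta> * cnj (g \<zeta>) * cnj \<zeta> ^ k)" for k
    using coefficient_integral[OF hankel_holomorphic i area_measurable area_finite, of k]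
      power_series_coefficient[OF hankel_sums, of k] \<mu>_pos[of k]
    by (simp add: \<mu>_eq_moment[symmetric])
  with 1 2 show ?thesis by (simp add: sums_unique2 mult.assoc)
qed

end

end

lemma class_D_weight:
  assumes "w \<in> class_D"
  obtains u C \<alpha> \<beta> where "D_weight u C \<alpha> \<beta> w"
proof -
  have w: "radial_weight w" using assms by (simp add: class_D_def D_hat_def)
  show ?thesis
  proof (rule class_D_profile[OF assms])
    fix u C \<alpha> \<beta>
    assume "D_profile u C \<alpha> \<beta>"
      "\<And>r. 0 \<le> r \<Longrightarrow> r < 1 \<Longrightarrow> hat w (complex_of_real r) = tail u r"
      "distr (density disc_area (\<lambda>z. ennreal (w z))) (restrict_space borel (ball 0 1)) (\<lambda>z. z) = rad (\<lambda>r. ennreal (2 * r * u r))"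
    then show thesis using w by (intro that[of u C \<alpha> \<beta>]) (simp add: D_weight_def D_weight_axioms_def)
  qed
qed

section \<open>Radial derivatives and integrated weights\<close>

text \<open>Young's inequality with constant 1 and a free threshold: either a \<le> t, or a / t
  \<ge> 1 and multiplying a by its power q - 1 only enlarges it.\<close>

lemma young_shift:
  fixes a t q :: real
  assumes "0 \<le> a" "0 < t" "1 < q"
  shows "a \<le> t + a powr q * t powr (1 - q)"
proof (cases "a \<le> t")
  case False
  then have a: "t < a" "0 < a" using assms by auto
  have "1 \<le> (a / t) powr (q - 1)" using a assms by (intro ge_one_powr_ge_zero) auto
  then have "a * 1 \<le> a * (a / t) powr (q - 1)" using a by (intro mult_left_mono) auto
  also have "\<dots> = a powr q * t powr (1 - q)"
    using a assms by (simp add: powr_divide powr_diff)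
  finally show ?thesis using assms by simp
qed (simp add: add_increasing2)

text \<open>Turns a family of Young-type bounds into a bound of Hoelder type; it serves both Schur's
  test and \<open>holder_root_bound\<close>. The first conclusion is separate because
  \<open>enn2real\<close> sends an infinite I to 0, where the second one would say nothing.\<close>

lemma optimize_parameter:
  fixes I Q :: ennreal and P q :: real
  assumes q: "1 < q" and P: "0 < P"
    and le: "\<And>\<tau>. 0 < \<tau> \<Longrightarrow> I \<le> ennreal (\<tau> * P) + ennreal (\<tau> powr (1 - q)) * Q"
  shows "I \<noteq> \<infinity> \<or> Q = \<infinity>" "ennreal (enn2real I powr q) \<le> ennreal (2 powr q * P powr (q - 1)) * Q"
proof -
  show fin: "I \<noteq> \<infinity> \<or> Q = \<infinity>"
  proof (rule ccontr)
    assume "\<not> (I \<noteq> \<infinity> \<or> Q = \<infinity>)"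
    then have "I = \<infinity>" "Q \<noteq> \<infinity>" by auto
    then have "I = \<infinity>" "Q < \<infinity>" by (simp_all add: less_top[symmetric])
    have "ennreal (1 * P) + ennreal (1 powr (1 - q)) * Q < \<infinity>"
      using \<open>Q < \<infinity>\<close> by (simp add: ennreal_mult_less_top)
    then have "I < \<infinity>" by (rule le_less_trans[OF le[OF zero_less_one]])
    then show False using \<open>I = \<infinity>\<close> by simp
  qed
  show "ennreal (enn2real I powr q) \<le> ennreal (2 powr q * P powr (q - 1)) * Q"
  proof (cases "Q = \<infinity>")
    case True
    then show ?thesis using P by (simp add: ennreal_mult_top)
  next
    case False
    then obtain i where i: "I = ennreal i" "0 \<le> i" using fin by (cases I) auto
    obtain y where y: "Q = ennreal y" "0 \<le> y" using False by (cases Q) auto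
    have le': "i \<le> \<tau> * P + \<tau> powr (1 - q) * y" if "\<tau> > 0" for \<tau>
    proof -
      have "ennreal i \<le> ennreal (\<tau> * P + \<tau> powr (1 - q) * y)"
        using le[OF that] i y P that by (simp add: ennreal_mult)
      then show ?thesis using that P y by (subst (asm) ennreal_le_iff) auto
    qed
    have "i powr q \<le> 2 powr q * P powr (q - 1) * y"
    proof (cases "y = 0")
      case True
      have "i \<le> 0"
      proof (rule field_le_epsilon)
        fix e :: real assume "e > 0"
        then show "i \<le> 0 + e" using le'[of "e / P"] P True by simp
      qed
      then show ?thesis using i y q by simp
    next
      case False
      then have y0: "y > 0" using y by simp
      \<comment> \<open>The value at which the two terms of the bound are equal.\<close>
      define \<tau> where "\<tau> = (y / P) powr (1 / q)"
      have \<tau>: "\<tau> > 0" using y0 P by (simp add: \<tau>_def)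
      have "\<tau> powr q = y / P" using y0 P q by (simp add: \<tau>_def powr_powr)
      then have "\<tau> powr (1 - q) * y = \<tau> * P" using \<tau> P y0 by (simp add: powr_diff field_simps)
      then have "i \<le> 2 * (\<tau> * P)" using le'[OF \<tau>] by linarith
      then have "i powr q \<le> (2 * (\<tau> * P)) powr q" using i q by (intro powr_mono2) auto
      also have "\<dots> = 2 powr q * (\<tau> powr q * P powr q)" using \<tau> P by (simp add: powr_mult)
      also have "\<tau> powr q * P powr q = P powr (q - 1) * y"
        using P y0 by (simp add: \<open>\<tau> powr q = y / P\<close> powr_diff)
      finally show ?thesis by simp
    qed
    then show ?thesis using i y P by (simp add: ennreal_mult[symmetric] ennreal_leI)
  qed
qed

lemma ennreal_root_le_iff:
  assumes "p > 0" "c \<ge> 0"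
  shows "ennreal_root p x \<le> ennreal c \<longleftrightarrow> x \<le> ennreal (c powr p)"
proof (cases x)
  case (real r)
  have "ennreal_root p x \<le> ennreal c \<longleftrightarrow> r powr (1 / p) \<le> c"
    using real assms by (simp add: ennreal_root_def)
  also have "\<dots> \<longleftrightarrow> r \<le> c powr p"
  proof
    assume "r powr (1 / p) \<le> c"
    then have "(r powr (1 / p)) powr p \<le> c powr p" using assms by (intro powr_mono2) auto
    then show "r \<le> c powr p" using real assms by (simp add: powr_powr)
  next
    assume "r \<le> c powr p"
    then have "r powr (1 / p) \<le> (c powr p) powr (1 / p)" using assms real by (intro powr_mono2) auto
    then show "r powr (1 / p) \<le> c" using assms by (simp add: powr_powr)
  qed
  also have "\<dots> \<longleftrightarrow> x \<le> ennreal (c powr p)" using real by (simp add: ennreal_le_iff)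
  finally show ?thesis .
qed (simp add: ennreal_root_def top_unique)

text \<open>The derivative of z F(z). Unlike the derivative of F it is diagonal on the powers of z,
  and its eigenvalues k + 1 do not vanish.\<close>

definition radial_deriv :: "(complex \<Rightarrow> complex) \<Rightarrow> complex \<Rightarrow> complex" where
  "radial_deriv F z = F z + z * deriv F z"

lemma radial_deriv_holomorphic:
  "F holomorphic_on ball 0 1 \<Longrightarrow> radial_deriv F holomorphic_on ball 0 1"
  unfolding radial_deriv_def[abs_def] by (intro holomorphic_intros holomorphic_deriv) auto

lemma radial_deriv_power_holomorphic:
  "F holomorphic_on ball 0 1 \<Longrightarrow> (radial_deriv ^^ n) F holomorphic_on ball 0 1"
  by (induction n) (auto intro: radial_deriv_holomorphic)

lemma higher_deriv_radial_deriv: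
  assumes F: "F holomorphic_on ball 0 1" and z: "cmod z < 1"
  shows "(deriv ^^ j) (radial_deriv F) z = (of_nat j + 1) * (deriv ^^ j) F z + z * (deriv ^^ Suc j) F z"
  using z
proof (induction j arbitrary: z)
  case 0
  then show ?case by (simp add: radial_deriv_def)
next
  case (Suc j)
  have h: "(deriv ^^ k) F holomorphic_on ball 0 1" for k
    by (intro holomorphic_higher_deriv F) auto
  have d: "((deriv ^^ k) F has_field_derivative (deriv ^^ Suc k) F z) (at z)" for k
    using holomorphic_derivI[OF h, of z k] Suc.prems by simp
  have "(deriv ^^ Suc j) (radial_deriv F) z = deriv (\<lambda>z. (of_nat j + 1) * (deriv ^^ j) F z + z * (deriv ^^ Suc j) F z) z"
  proof -
    have "deriv ((deriv ^^ j) (radial_deriv F)) z = deriv (\<lambda>z. (of_nat j + 1) * (deriv ^^ j) F z + z * (deriv ^^ Suc j) F z) z"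
    proof (rule complex_derivative_transform_within_open)
      show "(deriv ^^ j) (radial_deriv F) holomorphic_on ball 0 1"
        by (intro holomorphic_higher_deriv radial_deriv_holomorphic F) auto
      show "(\<lambda>z. (of_nat j + 1) * (deriv ^^ j) F z + z * (deriv ^^ Suc j) F z) holomorphic_on ball 0 1"
        by (intro holomorphic_intros h)
    qed (use Suc in auto)
    then show ?thesis by simp
  qed
  also have "\<dots> = (of_nat j + 1) * (deriv ^^ Suc j) F z + (1 * (deriv ^^ Suc j) F z + (deriv ^^ Suc (Suc j)) F z * z)"
    by (intro DERIV_imp_deriv derivative_intros d DERIV_cmult DERIV_add DERIV_mult DERIV_ident)
  finally show ?case by (simp add: algebra_simps)
qed

lemma radial_deriv_power_bound:
  "\<exists>D>0. \<forall>F. F holomorphic_on ball 0 1 \<longrightarrow> (\<forall>z. cmod z < 1 \<longrightarrow>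
     cmod ((radial_deriv ^^ n) F z) \<le> D * (\<Sum>j\<le>n. cmod ((deriv ^^ j) F z)))"
proof (induction n)
  case 0
  show ?case by (intro exI[of _ 1]) auto
next
  case (Suc n)
  then obtain D where D: "D > 0" "\<And>F z. F holomorphic_on ball 0 1 \<Longrightarrow> cmod z < 1 \<Longrightarrow>
     cmod ((radial_deriv ^^ n) F z) \<le> D * (\<Sum>j\<le>n. cmod ((deriv ^^ j) F z))" by blast
  show ?case
  proof (intro exI[of _ "D * (real n + 2)"] conjI allI impI)
    show "0 < D * (real n + 2)" using D by simp
    fix F z assume F: "F holomorphic_on ball 0 1" and z: "cmod (z::complex) < 1"
    have "cmod ((radial_deriv ^^ Suc n) F z) = cmod ((radial_deriv ^^ n) (radial_deriv F) z)"
      by (simp only: funpow_swap1 funpow.simps o_apply)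
    also have "\<dots> \<le> D * (\<Sum>j\<le>n. cmod ((deriv ^^ j) (radial_deriv F) z))"
      by (intro D radial_deriv_holomorphic F z)
    also have "\<dots> \<le> D * (\<Sum>j\<le>n. (real n + 1) * cmod ((deriv ^^ j) F z) + cmod ((deriv ^^ Suc j) F z))"
    proof (intro mult_left_mono sum_mono)
      fix j assume j: "j \<in> {..n}"
      have "cmod ((deriv ^^ j) (radial_deriv F) z) \<le> cmod ((of_nat j + 1) * (deriv ^^ j) F z) + cmod (z * (deriv ^^ Suc j) F z)"
        unfolding higher_deriv_radial_deriv[OF F z] by (rule norm_triangle_ineq)
      also have "\<dots> \<le> (real n + 1) * cmod ((deriv ^^ j) F z) + 1 * cmod ((deriv ^^ Suc j) F z)"
      proof -
        have "cmod (of_nat j + 1) = real j + 1" by (metis norm_of_nat of_nat_1 of_nat_add)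
        then show ?thesis unfolding norm_mult using j z by (intro add_mono mult_right_mono) auto
      qed
      finally show "cmod ((deriv ^^ j) (radial_deriv F) z) \<le> (real n + 1) * cmod ((deriv ^^ j) F z) + cmod ((deriv ^^ Suc j) F z)" by simp
    qed (use D in simp)
    also have "\<dots> = D * ((real n + 1) * (\<Sum>j\<le>n. cmod ((deriv ^^ j) F z)) + (\<Sum>j\<le>n. cmod ((deriv ^^ Suc j) F z)))"
      by (simp only: sum.distrib sum_distrib_left)
    also have "\<dots> \<le> D * ((real n + 1) * (\<Sum>j\<le>Suc n. cmod ((deriv ^^ j) F z)) + (\<Sum>j\<le>Suc n. cmod ((deriv ^^ j) F z)))"
    proof (intro mult_left_mono add_mono)
      show "(\<Sum>j\<le>n. cmod ((deriv ^^ j) F z)) \<le> (\<Sum>j\<le>Suc n. cmod ((deriv ^^ j) F z))" by simp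
      show "(\<Sum>j\<le>n. cmod ((deriv ^^ Suc j) F z)) \<le> (\<Sum>j\<le>Suc n. cmod ((deriv ^^ j) F z))"
        by (subst sum.atMost_Suc_shift) simp
    qed (use D in simp_all)
    finally show "cmod ((radial_deriv ^^ Suc n) F z) \<le> D * (real n + 2) * (\<Sum>j\<le>Suc n. cmod ((deriv ^^ j) F z))"
      by (simp add: algebra_simps)
  qed
qed

lemma radial_deriv_power_coefficient:
  assumes F: "F holomorphic_on ball 0 1"
  shows "(deriv ^^ k) ((radial_deriv ^^ n) F) 0 = (of_nat k + 1) ^ n * (deriv ^^ k) F 0"
proof (induction n)
  case (Suc n)
  have "(deriv ^^ k) ((radial_deriv ^^ Suc n) F) 0 = (of_nat k + 1) * (deriv ^^ k) ((radial_deriv ^^ n) F) 0"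
    using higher_deriv_radial_deriv[OF radial_deriv_power_holomorphic[OF F, of n], of 0 k] by simp
  then show ?case using Suc by simp
qed simp

text \<open>Each integration divides the \<open>k\<close>-th moment by \<open>k + 1\<close>, matching \<^const>\<open>radial_deriv\<close>, which
  multiplies the \<open>k\<close>-th Taylor coefficient by \<open>k + 1\<close>.\<close>

primrec integrated_density :: "(real \<Rightarrow> ennreal) \<Rightarrow> nat \<Rightarrow> real \<Rightarrow> ennreal" where
  "integrated_density v 0 = v"
| "integrated_density v (Suc j) =
     (\<lambda>r. ennreal (2 * r) * (\<integral>\<^sup>+x. ennreal (1 / x\<^sup>2) * integrated_density v j x * indicator {r..<1} x \<partial>lborel))"

lemma integrated_density_measurable:
  assumes [measurable]: "v \<in> borel_measurable borel"
  shows "integrated_density v j \<in> borel_measurable borel"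
proof (induction j)
  case (Suc j)
  note Suc[measurable]
  have "(\<lambda>r. \<integral>\<^sup>+x. (if r \<le> x \<and> x < 1 then ennreal (1 / x\<^sup>2) * integrated_density v j x else 0) \<partial>lborel) \<in> borel_measurable borel"
    by measurable
  moreover have "(\<integral>\<^sup>+x. ennreal (1 / x\<^sup>2) * integrated_density v j x * indicator {r..<1} x \<partial>lborel) =
     (\<integral>\<^sup>+x. (if r \<le> x \<and> x < 1 then ennreal (1 / x\<^sup>2) * integrated_density v j x else 0) \<partial>lborel)" for r :: real
    by (intro nn_integral_cong) (auto simp: indicator_def)
  ultimately show ?case by (simp del: mult_indicator_subset)
qed simp

text \<open>After exchanging the integrals, 2 r^(2 k + 1) integrates over [0, x] to x^(2 k + 2) / (k
  + 1), and the factor 1 / x^2 in the density restores x^(2 k). The factor 2 r outside the inner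
  integral is the Jacobian of the disc.\<close>

lemma integrated_density_Suc_moment:
  assumes v: "v \<in> borel_measurable borel"
  shows "(\<integral>\<^sup>+r. ennreal (r ^ (2 * k)) * integrated_density v (Suc j) r * indicator {0<..<1} r \<partial>lborel)
    = ennreal (1 / (real k + 1)) * (\<integral>\<^sup>+r. ennreal (r ^ (2 * k)) * integrated_density v j r * indicator {0<..<1} r \<partial>lborel)"
proof -
  note integrated_density_measurable[OF v, measurable]
  define H where "H = (\<lambda>r x. if 0 < r \<and> r \<le> x \<and> x < 1 then ennreal (2 * r ^ (2 * k + 1)) * (ennreal (1 / x\<^sup>2) * integrated_density v j x) else 0)"
  have [measurable]: "(\<lambda>(r, x). H r x) \<in> borel_measurable (borel \<Otimes>\<^sub>M borel)" unfolding H_def by measurable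
  have "(\<integral>\<^sup>+r. ennreal (r ^ (2 * k)) * integrated_density v (Suc j) r * indicator {0<..<1} r \<partial>lborel)
    = (\<integral>\<^sup>+r. \<integral>\<^sup>+x. H r x \<partial>lborel \<partial>lborel)"
  proof (rule nn_integral_cong)
    fix r :: real
    show "ennreal (r ^ (2 * k)) * integrated_density v (Suc j) r * indicator {0<..<1} r = (\<integral>\<^sup>+x. H r x \<partial>lborel)"
    proof (cases "0 < r \<and> r < 1")
      case True
      have "(\<integral>\<^sup>+x. H r x \<partial>lborel) = (\<integral>\<^sup>+x. ennreal (2 * r ^ (2 * k + 1)) * (ennreal (1 / x\<^sup>2) * integrated_density v j x * indicator {r..<1} x) \<partial>lborel)"
        using True by (intro nn_integral_cong) (auto simp: H_def indicator_def)
      also have "\<dots> = ennreal (2 * r ^ (2 * k + 1)) * (\<integral>\<^sup>+x. ennreal (1 / x\<^sup>2) * integrated_density v j x * indicator {r..<1} x \<partial>lborel)"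
        by (rule nn_integral_cmult) measurable
      also have "ennreal (2 * r ^ (2 * k + 1)) = ennreal (r ^ (2 * k)) * ennreal (2 * r)"
        using True by (simp add: ennreal_mult[symmetric] mult_ac)
      finally show ?thesis using True by (simp add: mult.assoc)
    next
      case False
      have "H r x = 0" for x using False by (auto simp: H_def)
      then show ?thesis using False by auto
    qed
  qed
  also have "\<dots> = (\<integral>\<^sup>+x. \<integral>\<^sup>+r. H r x \<partial>lborel \<partial>lborel)"
    by (rule lborel_pair.Fubini') simp
  also have "\<dots> = (\<integral>\<^sup>+x. ennreal (1 / (real k + 1)) * (ennreal (x ^ (2 * k)) * integrated_density v j x * indicator {0<..<1} x) \<partial>lborel)"
  proof (rule nn_integral_cong)
    fix x :: real
    show "(\<integral>\<^sup>+r. H r x \<partial>lborel) = ennreal (1 / (real k + 1)) * (ennreal (x ^ (2 * k)) * integrated_density v j x * indicator {0<..<1} x)"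
    proof (cases "0 < x \<and> x < 1")
      case True
      let ?y = "ennreal (1 / x\<^sup>2) * integrated_density v j x"
      have "AE r in lborel. H r x = ?y * (ennreal (2 * r ^ (2 * k + 1)) * indicator {0..x} r)"
        using AE_lborel_singleton[of "0::real"] by eventually_elim (use True in \<open>auto simp: H_def indicator_def mult_ac\<close>)
      then have "(\<integral>\<^sup>+r. H r x \<partial>lborel) = (\<integral>\<^sup>+r. ?y * (ennreal (2 * r ^ (2 * k + 1)) * indicator {0..x} r) \<partial>lborel)"
        by (rule nn_integral_cong_AE)
      also have "\<dots> = ?y * (\<integral>\<^sup>+r. ennreal (2 * r ^ (2 * k + 1)) * indicator {0..x} r \<partial>lborel)"
        by (rule nn_integral_cmult) measurable
      also have "(\<integral>\<^sup>+r. ennreal (2 * r ^ (2 * k + 1)) * indicator {0..x} r \<partial>lborel)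
        = ennreal (x ^ (2 * k + 2) / (real k + 1) - 0 ^ (2 * k + 2) / (real k + 1))"
      proof (rule nn_integral_FTC_Icc)
        fix r :: real assume "r \<in> {0..x}"
        have "((\<lambda>r. r ^ (2 * k + 2)) has_real_derivative real (2 * k + 2) * r ^ (2 * k + 1)) (at r)"
          using DERIV_pow[of "2 * k + 2" r] by simp
        from DERIV_cdivide[OF this, of "real k + 1"]
        show "((\<lambda>r. r ^ (2 * k + 2) / (real k + 1)) has_real_derivative 2 * r ^ (2 * k + 1)) (at r)"
        proof (rule DERIV_cong)
          have e: "real (2 * k + 2) = 2 * (real k + 1)" by simp
          have c: "2 * a * x / a = 2 * x" if "a \<noteq> 0" for a x :: real using that by simp
          show "real (2 * k + 2) * r ^ (2 * k + 1) / (real k + 1) = 2 * r ^ (2 * k + 1)"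
            unfolding e by (rule c) linarith
        qed
      qed (use True in auto)
      also have "?y * ennreal (x ^ (2 * k + 2) / (real k + 1) - 0 ^ (2 * k + 2) / (real k + 1)) = integrated_density v j x * (ennreal (1 / x\<^sup>2) * ennreal (x ^ (2 * k + 2) / (real k + 1)))"
        by (simp add: mult_ac)
      also have "ennreal (1 / x\<^sup>2) * ennreal (x ^ (2 * k + 2) / (real k + 1)) = ennreal (1 / (real k + 1)) * ennreal (x ^ (2 * k))"
        using True by (simp add: ennreal_mult[symmetric] power_add power2_eq_square)
      finally show ?thesis using True by (simp add: mult_ac)
    next
      case False
      have "H r x = 0" for r using False by (auto simp: H_def)
      then show ?thesis using False by auto
    qed
  qed
  also have "\<dots> = ennreal (1 / (real k + 1)) * (\<integral>\<^sup>+r. ennreal (r ^ (2 * k)) * integrated_density v j r * indicator {0<..<1} r \<partial>lborel)"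
    by (rule nn_integral_cmult) measurable
  finally show ?thesis .
qed

lemma integrated_density_moment:
  assumes v: "v \<in> borel_measurable borel"
  shows "moment (integrated_density v n) k = moment v k / (real k + 1) ^ n"
proof (induction n)
  case (Suc n)
  have "moment (integrated_density v (Suc n)) k = (1 / (real k + 1)) * moment (integrated_density v n) k"
    unfolding moment_def integrated_density_Suc_moment[OF v] by (simp add: enn2real_mult)
  then show ?case using Suc by (simp add: mult.commute)
qed simp

lemma integrated_density_finite:
  assumes v: "v \<in> borel_measurable borel" and fin: "(\<integral>\<^sup>+r. v r * indicator {0<..<1} r \<partial>lborel) < \<infinity>"
  shows "(\<integral>\<^sup>+r. integrated_density v n r * indicator {0<..<1} r \<partial>lborel) < \<infinity>"
proof (induction n)
  case (Suc n)
  then show ?case using integrated_density_Suc_moment[OF v, of 0 n] by simp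
qed (use fin in simp)

context D_profile
begin

text \<open>The first integration replaces the weight by its tail, since the factors 2 r, 1 / x^2
  and 2 x combine to 4 r / x \<le> 4. Every further one gains 1 - r, because 2 r times the integral
  of 1 / x^2 over [r, 1] equals 2 (1 - r).\<close>

lemma integrated_density_bound:
  "\<exists>K>0. \<forall>r. 0 < r \<and> r < 1 \<longrightarrow> integrated_density area (Suc j) r \<le> ennreal (K * (1 - r) ^ j * V r)"
proof (induction j)
  case 0
  show ?case
  proof (intro exI[of _ 4] conjI allI impI)
    fix r :: real assume r: "0 < r \<and> r < 1"
    have "integrated_density area (Suc 0) r = (\<integral>\<^sup>+x. ennreal (2 * r) * (ennreal (1 / x\<^sup>2) * area x * indicator {r..<1} x) \<partial>lborel)"
      by (simp add: nn_integral_cmult)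
    also have "\<dots> \<le> (\<integral>\<^sup>+x. ennreal 4 * (ennreal (u x) * indicator {r..<1} x) \<partial>lborel)"
    proof (rule nn_integral_mono)
      fix x :: real
      show "ennreal (2 * r) * (ennreal (1 / x\<^sup>2) * area x * indicator {r..<1} x) \<le> ennreal 4 * (ennreal (u x) * indicator {r..<1} x)"
      proof (cases "r \<le> x \<and> x < 1")
        case True
        have "2 * r * (1 / x\<^sup>2 * (2 * x * u x)) = 4 * (r / x) * u x"
          using True r by (simp add: power2_eq_square)
        also have "\<dots> \<le> 4 * 1 * u x" using True r by (intro mult_right_mono mult_left_mono) auto
        finally show ?thesis using True r
          by (simp add: ennreal_mult[symmetric] ennreal_leI del: ennreal_numeral)
      qed simp
    qed
    also have "\<dots> = ennreal (4 * (1 - r) ^ 0 * V r)"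
      using r by (subst nn_integral_cmult) (auto simp: V_nn ennreal_mult)
    finally show "integrated_density area (Suc 0) r \<le> ennreal (4 * (1 - r) ^ 0 * V r)" .
  qed simp
next
  case (Suc j)
  then obtain K where K: "K > 0" "\<And>r. 0 < r \<Longrightarrow> r < 1 \<Longrightarrow> integrated_density area (Suc j) r \<le> ennreal (K * (1 - r) ^ j * V r)"
    by blast
  show ?case
  proof (intro exI[of _ "2 * K"] conjI allI impI)
    fix r :: real assume r: "0 < r \<and> r < 1"
    let ?c = "K * (1 - r) ^ j * V r"
    have c: "?c \<ge> 0" using K r by simp
    have "(\<integral>\<^sup>+x. ennreal (1 / x\<^sup>2) * integrated_density area (Suc j) x * indicator {r..<1} x \<partial>lborel)
      \<le> (\<integral>\<^sup>+x. ennreal ?c * (ennreal (1 / x\<^sup>2) * indicator {r..1} x) \<partial>lborel)"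
    proof (rule nn_integral_mono)
      fix x :: real
      show "ennreal (1 / x\<^sup>2) * integrated_density area (Suc j) x * indicator {r..<1} x \<le> ennreal ?c * (ennreal (1 / x\<^sup>2) * indicator {r..1} x)"
      proof (cases "r \<le> x \<and> x < 1")
        case True
        have "K * (1 - x) ^ j * V x \<le> ?c"
          using True r K by (intro mult_mono power_mono V_antimono) auto
        then have "integrated_density area (Suc j) x \<le> ennreal ?c"
          using K(2)[of x] True r by (meson ennreal_leI order_trans less_le_trans)
        then have "ennreal (1 / x\<^sup>2) * integrated_density area (Suc j) x \<le> ennreal (1 / x\<^sup>2) * ennreal ?c"
          by (rule mult_left_mono) simp
        then show ?thesis using True by (simp add: mult.commute)
      qed simp
    qed
    also have "\<dots> = ennreal ?c * (\<integral>\<^sup>+x. ennreal (1 / x\<^sup>2) * indicator {r..1} x \<partial>lborel)"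
      by (rule nn_integral_cmult) measurable
    also have "(\<integral>\<^sup>+x. ennreal (1 / x\<^sup>2) * indicator {r..1} x \<partial>lborel) = ennreal ((- (1 / 1)) - (- (1 / r)))"
    proof (rule nn_integral_FTC_Icc)
      fix x assume "x \<in> {r..1}"
      then show "((\<lambda>x. - (1 / x)) has_real_derivative 1 / x\<^sup>2) (at x)"
        using r by (auto intro!: derivative_eq_intros simp: power2_eq_square)
    qed (use r in auto)
    finally have I: "(\<integral>\<^sup>+x. ennreal (1 / x\<^sup>2) * integrated_density area (Suc j) x * indicator {r..<1} x \<partial>lborel) \<le> ennreal ?c * ennreal ((- (1 / 1)) - (- (1 / r)))" .
    have "integrated_density area (Suc (Suc j)) r = ennreal (2 * r) * (\<integral>\<^sup>+x. ennreal (1 / x\<^sup>2) * integrated_density area (Suc j) x * indicator {r..<1} x \<partial>lborel)"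
      by (subst integrated_density.simps(2)) (rule refl)
    also have "\<dots> \<le> ennreal (2 * r) * (ennreal ?c * ennreal ((- (1 / 1)) - (- (1 / r))))"
      by (intro mult_left_mono I) simp
    also have "\<dots> = ennreal (2 * r * (?c * ((- (1 / 1)) - (- (1 / r)))))"
      using r c by (simp add: ennreal_mult'[symmetric] ennreal_mult''[symmetric])
    also have "2 * r * (?c * ((- (1 / 1)) - (- (1 / r)))) = 2 * K * (1 - r) ^ Suc j * V r"
      using r by (simp add: field_simps)
    finally show "integrated_density area (Suc (Suc j)) r \<le> ennreal (2 * K * (1 - r) ^ Suc j * V r)" .
  qed (use K in simp)
qed

end

context D_weight
begin

text \<open>Coefficientwise the factor (k + 1)^n from the derivative cancels against the moments of
  the integrated density. As G is merely bounded, its Taylor coefficients need not be summable; the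
  identity is proved for the dilations G(\<rho> \<zeta>) and passed to the limit \<rho> to 1 by
  dominated convergence.\<close>

lemma pairing_radial_deriv:
  assumes f: "f holomorphic_on ball 0 1" and fi: "integrable (rad area) f"
    and ri: "integrable (rad (integrated_density area n)) ((radial_deriv ^^ n) f)"
    and G: "G holomorphic_on ball 0 1" and Gb: "\<And>\<zeta>. cmod \<zeta> < 1 \<Longrightarrow> cmod (G \<zeta>) \<le> B"
  shows "(LINT \<zeta>|rad area. f \<zeta> * cnj (G \<zeta>)) = (LINT \<zeta>|rad (integrated_density area n). (radial_deriv ^^ n) f \<zeta> * cnj (G \<zeta>))"
proof -
  let ?v = "integrated_density area n" and ?Rf = "(radial_deriv ^^ n) f"
  note vm = integrated_density_measurable[OF area_measurable, of n]
  note vf = integrated_density_finite[OF area_measurable area_finite, of n]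
  have Gc: "continuous_on (ball 0 1) G" using G by (rule holomorphic_on_imp_continuous_on)
  define \<rho> where "\<rho> = (\<lambda>m. real m / (real m + 1))"
  have \<rho>: "0 \<le> \<rho> m" "\<rho> m < 1" for m by (auto simp: \<rho>_def)
  have \<rho>lim: "\<rho> \<longlonglongrightarrow> 1"
  proof -
    have "(\<lambda>m. 1 - 1 / (real m + 1)) \<longlonglongrightarrow> 1 - 0"
      using LIMSEQ_ignore_initial_segment[OF lim_1_over_n[where 'a = real], of 1]
      by (intro tendsto_diff tendsto_const) (simp add: add.commute)
    moreover have "(\<lambda>m. 1 - 1 / (real m + 1)) = \<rho>" by (auto simp: \<rho>_def field_simps)
    ultimately show ?thesis by simp
  qed
  have eq: "(LINT \<zeta>|rad area. f \<zeta> * cnj (G (of_real (\<rho> m) * \<zeta>))) = (LINT \<zeta>|rad ?v. ?Rf \<zeta> * cnj (G (of_real (\<rho> m) * \<zeta>)))" for m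
  proof -
    define c where "c = (\<lambda>k. (deriv ^^ k) G 0 / fact k * of_real (\<rho> m) ^ k)"
    have s: "(\<lambda>k. c k * \<zeta> ^ k) sums G (of_real (\<rho> m) * \<zeta>)" if "cmod \<zeta> < 1" for \<zeta>
    proof -
      have "cmod (of_real (\<rho> m) * \<zeta>) < 1"
        using that \<rho>[of m] mult_strict_mono'[of "\<rho> m" 1 "cmod \<zeta>" 1] by (simp add: norm_mult)
      then show ?thesis
        using holomorphic_power_series[OF G, of "of_real (\<rho> m) * \<zeta>"] by (simp add: c_def power_mult_distrib mult.assoc)
    qed
    have cs: "summable (\<lambda>k. cmod (c k))"
    proof -
      define x where "x = (1 + \<rho> m) / 2"
      have x: "0 \<le> x" "\<rho> m < x" "x < 1" using \<rho>[of m] by (auto simp: x_def)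
      have "summable (\<lambda>k. (deriv ^^ k) G 0 / fact k * of_real x ^ k)"
        using holomorphic_power_series[OF G, of "of_real x"] x by (auto simp: sums_iff)
      then have "summable (\<lambda>k. norm ((deriv ^^ k) G 0 / fact k * of_real (\<rho> m) ^ k))"
        by (rule powser_insidea) (use x \<rho>[of m] in simp)
      then show ?thesis by (simp add: c_def)
    qed
    have 1: "(\<lambda>k. cnj (c k) * ((deriv ^^ k) f 0 / fact k * of_real (moment area k))) sums (LINT \<zeta>|rad area. f \<zeta> * cnj (G (of_real (\<rho> m) * \<zeta>)))"
      using pairing_sums[OF fi cs s] by (simp only: coefficient_integral[OF f fi area_measurable area_finite])
    have 2: "(\<lambda>k. cnj (c k) * ((deriv ^^ k) ?Rf 0 / fact k * of_real (moment ?v k))) sums (LINT \<zeta>|rad ?v. ?Rf \<zeta> * cnj (G (of_real (\<rho> m) * \<zeta>)))"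
      using pairing_sums[OF ri cs s]
      by (simp only: coefficient_integral[OF radial_deriv_power_holomorphic[OF f] ri vm vf])
    have "(deriv ^^ k) ?Rf 0 / fact k * of_real (moment ?v k) = (deriv ^^ k) f 0 / fact k * of_real (moment area k)" for k
    proof -
      have "(of_nat k + 1 :: complex) \<noteq> 0"
        by (metis of_nat_Suc of_nat_eq_0_iff add.commute nat.distinct(1))
      moreover have "complex_of_real (moment ?v k) = of_real (moment area k) / (of_nat k + 1) ^ n"
        by (simp add: integrated_density_moment[OF area_measurable])
      ultimately show ?thesis by (simp add: radial_deriv_power_coefficient[OF f])
    qed
    with 2 have "(\<lambda>k. cnj (c k) * ((deriv ^^ k) f 0 / fact k * of_real (moment area k))) sums (LINT \<zeta>|rad ?v. ?Rf \<zeta> * cnj (G (of_real (\<rho> m) * \<zeta>)))"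
      by (simp only:)
    with 1 show ?thesis by (rule sums_unique2)
  qed
  have lim: "(\<lambda>m. LINT \<zeta>|rad v. \<phi> \<zeta> * cnj (G (of_real (\<rho> m) * \<zeta>))) \<longlonglongrightarrow> (LINT \<zeta>|rad v. \<phi> \<zeta> * cnj (G \<zeta>))"
    if \<phi>: "integrable (rad v) \<phi>" for \<phi> v
  proof (rule integral_dominated_convergence[where w = "\<lambda>\<zeta>. B * cmod (\<phi> \<zeta>)"])
    have in_ball: "of_real (\<rho> m) * \<zeta> \<in> ball 0 1" if "\<zeta> \<in> ball 0 1" for \<zeta> :: complex and m
      using that \<rho>[of m] mult_strict_mono'[of "\<rho> m" 1 "cmod \<zeta>" 1] by (simp add: norm_mult)
    show "(\<lambda>\<zeta>. \<phi> \<zeta> * cnj (G \<zeta>)) \<in> borel_measurable (rad v)"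
      by (rule borel_measurable_times[OF borel_measurable_integrable[OF \<phi>] measurable_rad_on_ball]) (intro continuous_intros Gc)
    show "(\<lambda>\<zeta>. \<phi> \<zeta> * cnj (G (of_real (\<rho> m) * \<zeta>))) \<in> borel_measurable (rad v)" for m
    proof (rule borel_measurable_times[OF borel_measurable_integrable[OF \<phi>] measurable_rad_on_ball])
      have "continuous_on (ball 0 1) (\<lambda>\<zeta>. G (of_real (\<rho> m) * \<zeta>))"
        by (rule continuous_on_compose2[OF Gc]) (use in_ball in \<open>auto intro!: continuous_intros\<close>)
      then show "continuous_on (ball 0 1) (\<lambda>\<zeta>. cnj (G (of_real (\<rho> m) * \<zeta>)))" by (intro continuous_intros)
    qed
    show "integrable (rad v) (\<lambda>\<zeta>. B * cmod (\<phi> \<zeta>))" using \<phi> by simp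
    show "AE \<zeta> in rad v. (\<lambda>m. \<phi> \<zeta> * cnj (G (of_real (\<rho> m) * \<zeta>))) \<longlonglongrightarrow> \<phi> \<zeta> * cnj (G \<zeta>)"
    proof (rule AE_I2)
      fix \<zeta> assume "\<zeta> \<in> space (rad v)"
      then have \<zeta>: "\<zeta> \<in> ball 0 1" by simp
      then have "isCont G \<zeta>" using Gc by (simp add: continuous_on_eq_continuous_at)
      moreover have "(\<lambda>m. of_real (\<rho> m) * \<zeta>) \<longlonglongrightarrow> of_real 1 * \<zeta>"
        by (intro tendsto_intros \<rho>lim)
      ultimately have "(\<lambda>m. G (of_real (\<rho> m) * \<zeta>)) \<longlonglongrightarrow> G \<zeta>"
        by (intro isCont_tendsto_compose[where g = G]) simp_all
      then show "(\<lambda>m. \<phi> \<zeta> * cnj (G (of_real (\<rho> m) * \<zeta>))) \<longlonglongrightarrow> \<phi> \<zeta> * cnj (G \<zeta>)"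
        by (rule tendsto_mult[OF tendsto_const tendsto_cnj])
    qed
    show "AE \<zeta> in rad v. norm (\<phi> \<zeta> * cnj (G (of_real (\<rho> m) * \<zeta>))) \<le> B * cmod (\<phi> \<zeta>)" for m
    proof (rule AE_I2)
      fix \<zeta> assume "\<zeta> \<in> space (rad v)"
      then have "cmod (G (of_real (\<rho> m) * \<zeta>)) \<le> B" using in_ball[of \<zeta> m] by (intro Gb) simp
      then have "cmod (\<phi> \<zeta>) * cmod (G (of_real (\<rho> m) * \<zeta>)) \<le> cmod (\<phi> \<zeta>) * B" by (rule mult_left_mono) simp
      then show "norm (\<phi> \<zeta> * cnj (G (of_real (\<rho> m) * \<zeta>))) \<le> B * cmod (\<phi> \<zeta>)"
        by (simp only: norm_mult complex_mod_cnj mult.commute[of B])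
    qed
  qed
  show ?thesis
    using lim[OF fi] lim[OF ri] unfolding eq by (rule LIMSEQ_unique)
qed

end

section \<open>Sufficiency\<close>

lemma measurable_circle_map:
  assumes "0 < r" "r < 1"
  shows "(\<lambda>x. of_real r * circ x) \<in> unit_interval \<rightarrow>\<^sub>M restrict_space borel (ball 0 1)"
proof (rule measurable_restrict_space2)
  have "circ \<in> borel_measurable unit_interval" by (intro measurable_unit_intervalI) simp
  then show "(\<lambda>x. of_real r * circ x) \<in> borel_measurable unit_interval" by simp
qed (use assms in \<open>auto simp: norm_mult\<close>)

text \<open>Compares integrals against different densities circle by circle. The origin is left out
  because the bounds on the integrated density are stated for positive radii.\<close>

lemma nn_integral_rad_transfer:
  assumes F: "F1 \<in> borel_measurable (restrict_space borel (ball 0 1))" "F2 \<in> borel_measurable (restrict_space borel (ball 0 1))"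
    and v: "v1 \<in> borel_measurable borel" "v2 \<in> borel_measurable borel"
    and le: "\<And>z. 0 < cmod z \<Longrightarrow> cmod z < 1 \<Longrightarrow> F1 z * v1 (cmod z) \<le> F2 z * (v2 (cmod z) :: ennreal)"
  shows "(\<integral>\<^sup>+z. F1 z \<partial>rad v1) \<le> (\<integral>\<^sup>+z. F2 z \<partial>rad v2)"
  unfolding nn_integral_rad[OF F(1) v(1)] nn_integral_rad[OF F(2) v(2)]
proof (rule nn_integral_mono)
  fix r :: real
  show "v1 r * indicator {0<..<1} r * (\<integral>\<^sup>+x. F1 (of_real r * circ x) \<partial>unit_interval)
     \<le> v2 r * indicator {0<..<1} r * (\<integral>\<^sup>+x. F2 (of_real r * circ x) \<partial>unit_interval)"
  proof (cases "0 < r \<and> r < 1")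
    case True
    have m: "(\<lambda>x. F1 (of_real r * circ x)) \<in> borel_measurable unit_interval" "(\<lambda>x. F2 (of_real r * circ x)) \<in> borel_measurable unit_interval"
      using True by (auto intro: measurable_compose[OF measurable_circle_map F(1)] measurable_compose[OF measurable_circle_map F(2)])
    have "v1 r * (\<integral>\<^sup>+x. F1 (of_real r * circ x) \<partial>unit_interval) = (\<integral>\<^sup>+x. v1 r * F1 (of_real r * circ x) \<partial>unit_interval)"
      by (rule nn_integral_cmult[OF m(1), symmetric])
    also have "\<dots> \<le> (\<integral>\<^sup>+x. v2 r * F2 (of_real r * circ x) \<partial>unit_interval)"
    proof (rule nn_integral_mono)
      fix x
      have "cmod (of_real r * circ x) = r" using True by (simp add: norm_mult)
      then show "v1 r * F1 (of_real r * circ x) \<le> v2 r * F2 (of_real r * circ x)"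
        using le[of "of_real r * circ x"] True by (simp add: mult.commute)
    qed
    also have "\<dots> = v2 r * (\<integral>\<^sup>+x. F2 (of_real r * circ x) \<partial>unit_interval)"
      by (rule nn_integral_cmult[OF m(2)])
    finally show ?thesis using True by simp
  qed simp
qed

lemma measurable_ennreal_powr:
  fixes h :: "'a \<Rightarrow> real"
  assumes [measurable]: "h \<in> borel_measurable M"
  shows "(\<lambda>x. ennreal (h x powr a)) \<in> borel_measurable M"
  by measurable

lemma id_measurable_rad: "(\<lambda>z. z) \<in> borel_measurable (rad v)"
  by (intro measurable_rad_on_ball continuous_intros)

lemma cmod_measurable_on_ball: "cmod \<in> borel_measurable (restrict_space borel (ball 0 1))"
  by (intro measurable_on_ball continuous_intros)

section \<open>The maximal Bergman projection\<close>

context D_weight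
begin

lemma smooth_finite: "(\<integral>\<^sup>+r. smooth r * indicator {0<..<1} r \<partial>lborel) < \<infinity>"
proof -
  obtain K where "K > 0" "\<And>t. 0 \<le> t \<Longrightarrow> t < 1 \<Longrightarrow>
    (\<integral>\<^sup>+r. ennreal ((1 - r * t) powr (- (\<beta> + 1))) * ennreal (V r / (1 - r)) * indicator {0<..<1} r \<partial>lborel)
      \<le> ennreal (K * (V t * (1 - t) powr (- (\<beta> + 1))))"
    using int_tail_bound[of "\<beta> + 1"] by auto
  from this(2)[of 0] have "(\<integral>\<^sup>+r. smooth r * indicator {0<..<1} r \<partial>lborel) \<le> ennreal (K * V 0)" by simp
  then show ?thesis by (rule le_less_trans) simp
qed

lemma finite_measure_smooth: "emeasure (rad smooth) (ball 0 1) < \<infinity>"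
proof -
  have "emeasure (rad smooth) (ball 0 1) = (\<integral>\<^sup>+z. 1 \<partial>rad smooth)" by simp
  also have "\<dots> = (\<integral>\<^sup>+r. smooth r * indicator {0<..<1} r \<partial>lborel)"
    by (subst nn_integral_rad) auto
  finally show ?thesis using smooth_finite by simp
qed

sublocale smooth: finite_measure "rad smooth"
  by (rule finite_measureI) (use finite_measure_smooth in auto)

lemma \<Phi>_swap: "cmod z < 1 \<Longrightarrow> cmod \<zeta> < 1 \<Longrightarrow> cmod (\<Phi> n (cnj z * \<zeta>)) = cmod (\<Phi> n (cnj \<zeta> * z))"
  using \<Phi>_cnj[OF cmod_cnj_mult_less[of \<zeta> z], of n] by (simp add: mult.commute)

text \<open>Schur's test for the maximal Bergman projection, with a power of \<open>1 - \<bar>\<zeta>\<bar>\<close> as test function.\<close>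

lemma schur_test:
  assumes q: "1 < q"
  shows "\<exists>K>0. \<forall>U F. U \<in> borel_measurable (restrict_space borel (ball 0 1)) \<longrightarrow> (\<forall>\<zeta>. 0 \<le> U \<zeta>) \<longrightarrow>
    (\<forall>z. cmod z < 1 \<longrightarrow> ennreal (cmod (F z)) \<le> (\<integral>\<^sup>+\<zeta>. ennreal (cmod (\<Phi> 0 (cnj z * \<zeta>)) * U \<zeta>) \<partial>rad smooth)) \<longrightarrow>
    (\<integral>\<^sup>+z. ennreal (cmod (F z) powr q) \<partial>rad area) \<le> ennreal K * (\<integral>\<^sup>+\<zeta>. ennreal (U \<zeta> powr q) \<partial>rad smooth)"
proof -
  \<comment> \<open>With \<delta> q = \<alpha> / 2, both \<delta> and \<epsilon> = \<delta> (q - 1)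
    lie strictly between 0 and \<alpha>, as the two Schur integrals require. The exponent \<epsilon>
    is the one produced by raising the test function to the power 1 - q.\<close>
  define \<delta> where "\<delta> = \<alpha> / (2 * q)"
  define \<epsilon> where "\<epsilon> = \<delta> * (q - 1)"
  have \<delta>: "0 < \<delta>" "\<delta> < \<alpha>" using \<alpha>_pos q by (auto simp: \<delta>_def field_simps)
  have \<epsilon>: "0 < \<epsilon>" "\<epsilon> < \<alpha>"
  proof -
    show "0 < \<epsilon>" using \<delta> q by (simp add: \<epsilon>_def)
    have "\<epsilon> \<le> \<delta> * q" using \<delta> by (simp add: \<epsilon>_def)
    also have "\<dots> = \<alpha> / 2" using q by (simp add: \<delta>_def)
    finally show "\<epsilon> < \<alpha>" using \<alpha>_pos by simp
  qed
  obtain K1 where K1: "K1 > 0" "\<And>z. cmod z < 1 \<Longrightarrow>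
    (\<integral>\<^sup>+\<zeta>. ennreal (cmod (\<Phi> 0 (cnj z * \<zeta>)) * (1 - cmod \<zeta>) powr (- \<delta>)) \<partial>rad smooth) \<le> ennreal (K1 * (1 - cmod z) powr (- \<delta>))"
    using schur_smooth[OF \<delta>] by blast
  obtain K2 where K2: "K2 > 0" "\<And>z. cmod z < 1 \<Longrightarrow>
    (\<integral>\<^sup>+\<zeta>. ennreal (cmod (\<Phi> 0 (cnj z * \<zeta>)) * (1 - cmod \<zeta>) powr (- \<epsilon>)) \<partial>rad area) \<le> ennreal (K2 * (1 - cmod z) powr (- \<epsilon>))"
    using schur_area[OF \<epsilon>] by blast
  define c where "c = 2 powr q * K1 powr (q - 1)"
  have c: "c > 0" using K1 by (simp add: c_def)
  interpret P: pair_sigma_finite "rad area" "rad smooth" ..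
  show ?thesis
  proof (intro exI[of _ "c * K2"] conjI allI impI)
    show "0 < c * K2" using c K2 by simp
    fix U :: "complex \<Rightarrow> real" and F :: "complex \<Rightarrow> complex"
    assume Um: "U \<in> borel_measurable (restrict_space borel (ball 0 1))" and U0: "\<forall>\<zeta>. 0 \<le> U \<zeta>"
      and Fle: "\<forall>z. cmod z < 1 \<longrightarrow> ennreal (cmod (F z)) \<le> (\<integral>\<^sup>+\<zeta>. ennreal (cmod (\<Phi> 0 (cnj z * \<zeta>)) * U \<zeta>) \<partial>rad smooth)"
    have Um' [measurable]: "U \<in> borel_measurable (rad v)" for v
      using Um by (subst measurable_cong_sets[OF sets_rad refl])
    have cm [measurable]: "cmod \<in> borel_measurable (rad v)" for v
      by (intro measurable_rad_on_ball continuous_intros)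
    have \<Phi>m: "(\<lambda>\<zeta>. cmod (\<Phi> 0 (cnj z * \<zeta>))) \<in> borel_measurable (rad v)" if "cmod z < 1" for z v
      using that by (intro measurable_rad_on_ball continuous_intros \<Phi>_cont)
    have \<Phi>2: "(\<lambda>p. cmod (\<Phi> 0 (cnj (fst p) * snd p))) \<in> borel_measurable (rad area \<Otimes>\<^sub>M rad smooth)"
    proof -
      have 1: "(\<lambda>p. cnj (fst p) * snd p) \<in> rad area \<Otimes>\<^sub>M rad smooth \<rightarrow>\<^sub>M restrict_space borel (ball 0 1)"
      proof (rule measurable_restrict_space2)
        show "(\<lambda>p. cnj (fst p) * snd p) \<in> space (rad area \<Otimes>\<^sub>M rad smooth) \<rightarrow> ball 0 1"
          using cmod_cnj_mult_less by (auto simp: space_pair_measure)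
        have a: "(\<lambda>p. fst p) \<in> borel_measurable (rad area \<Otimes>\<^sub>M rad smooth)"
          by (rule measurable_compose[OF measurable_fst id_measurable_rad])
        have b: "(\<lambda>p. snd p) \<in> borel_measurable (rad area \<Otimes>\<^sub>M rad smooth)"
          by (rule measurable_compose[OF measurable_snd id_measurable_rad])
        have "cnj \<in> borel_measurable borel" by (intro borel_measurable_continuous_onI continuous_intros)
        from measurable_compose[OF a this] b
        show "(\<lambda>p. cnj (fst p) * snd p) \<in> borel_measurable (rad area \<Otimes>\<^sub>M rad smooth)"
          by (rule borel_measurable_times)
      qed
      have "(\<lambda>w. cmod (\<Phi> 0 w)) \<in> borel_measurable (restrict_space borel (ball 0 1))"
        by (intro measurable_on_ball continuous_intros holomorphic_on_imp_continuous_on \<Phi>_holomorphic)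
      from measurable_compose[OF 1 this] show ?thesis .
    qed
    define W where "W = (\<lambda>\<zeta>. U \<zeta> powr q * (1 - cmod \<zeta>) powr \<epsilon>)"
    have W0: "0 \<le> W \<zeta>" for \<zeta> by (simp add: W_def)
    have Wm [measurable]: "W \<in> borel_measurable (rad v)" for v unfolding W_def by measurable
    have pm: "(\<lambda>\<zeta>. (1 - cmod \<zeta>) powr a) \<in> borel_measurable (rad v)" for a v by measurable
    have m\<Phi>: "(\<lambda>\<zeta>. ennreal (cmod (\<Phi> 0 (cnj z * \<zeta>)) * h \<zeta>)) \<in> borel_measurable (rad v)"
      if "cmod z < 1" "h \<in> borel_measurable (rad v)" for z h v
      by (intro measurable_compose[OF _ measurable_ennreal] borel_measurable_times \<Phi>m that)
    have pt: "ennreal (cmod (F z) powr q) \<le> (\<integral>\<^sup>+\<zeta>. ennreal c * ennreal (cmod (\<Phi> 0 (cnj z * \<zeta>)) * W \<zeta> * (1 - cmod z) powr (- \<epsilon>)) \<partial>rad smooth)"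
      if z: "cmod z < 1" for z
    proof -
      let ?I = "\<integral>\<^sup>+\<zeta>. ennreal (cmod (\<Phi> 0 (cnj z * \<zeta>)) * U \<zeta>) \<partial>rad smooth"
      let ?Q = "\<integral>\<^sup>+\<zeta>. ennreal (cmod (\<Phi> 0 (cnj z * \<zeta>)) * W \<zeta>) \<partial>rad smooth"
      define P where "P = K1 * (1 - cmod z) powr (- \<delta>)"
      have P: "P > 0" using K1 z by (simp add: P_def)
      have le: "?I \<le> ennreal (\<tau> * P) + ennreal (\<tau> powr (1 - q)) * ?Q" if \<tau>: "\<tau> > 0" for \<tau>
      proof -
        have "?I \<le> (\<integral>\<^sup>+\<zeta>. ennreal \<tau> * ennreal (cmod (\<Phi> 0 (cnj z * \<zeta>)) * (1 - cmod \<zeta>) powr (- \<delta>))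
            + ennreal (\<tau> powr (1 - q)) * ennreal (cmod (\<Phi> 0 (cnj z * \<zeta>)) * W \<zeta>) \<partial>rad smooth)"
        proof (rule nn_integral_mono)
          fix \<zeta> assume "\<zeta> \<in> space (rad smooth)"
          then have \<zeta>: "cmod \<zeta> < 1" by simp
          \<comment> \<open>The threshold in Young's inequality is a multiple of the test function:
            the first term becomes the first Schur integral, the second one carries the weight (1 -
            |\<zeta>|)^\<epsilon> collected in \<open>W\<close>.\<close>
          define t where "t = \<tau> * (1 - cmod \<zeta>) powr (- \<delta>)"
          have t: "t > 0" using \<tau> \<zeta> by (simp add: t_def)
          have "U \<zeta> \<le> t + U \<zeta> powr q * t powr (1 - q)" using U0 t q by (intro young_shift) auto
          also have "t powr (1 - q) = \<tau> powr (1 - q) * (1 - cmod \<zeta>) powr \<epsilon>"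
            using \<tau> \<zeta> by (simp add: t_def powr_mult powr_powr \<epsilon>_def algebra_simps)
          finally have "cmod (\<Phi> 0 (cnj z * \<zeta>)) * U \<zeta> \<le> cmod (\<Phi> 0 (cnj z * \<zeta>)) * (t + U \<zeta> powr q * (\<tau> powr (1 - q) * (1 - cmod \<zeta>) powr \<epsilon>))"
            by (rule mult_left_mono) simp
          also have "\<dots> = \<tau> * (cmod (\<Phi> 0 (cnj z * \<zeta>)) * (1 - cmod \<zeta>) powr (- \<delta>)) + \<tau> powr (1 - q) * (cmod (\<Phi> 0 (cnj z * \<zeta>)) * W \<zeta>)"
            by (simp add: t_def W_def algebra_simps)
          finally show "ennreal (cmod (\<Phi> 0 (cnj z * \<zeta>)) * U \<zeta>) \<le> ennreal \<tau> * ennreal (cmod (\<Phi> 0 (cnj z * \<zeta>)) * (1 - cmod \<zeta>) powr (- \<delta>))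
            + ennreal (\<tau> powr (1 - q)) * ennreal (cmod (\<Phi> 0 (cnj z * \<zeta>)) * W \<zeta>)"
            using \<tau> W0 by (simp add: ennreal_mult[symmetric] ennreal_plus[symmetric] ennreal_leI del: ennreal_plus)
        qed
        also have "\<dots> = ennreal \<tau> * (\<integral>\<^sup>+\<zeta>. ennreal (cmod (\<Phi> 0 (cnj z * \<zeta>)) * (1 - cmod \<zeta>) powr (- \<delta>)) \<partial>rad smooth) + ennreal (\<tau> powr (1 - q)) * ?Q"
          by (simp only: nn_integral_add nn_integral_cmult borel_measurable_times_ennreal borel_measurable_const m\<Phi>[OF z pm] m\<Phi>[OF z Wm])
        also have "\<dots> \<le> ennreal \<tau> * ennreal P + ennreal (\<tau> powr (1 - q)) * ?Q"
          unfolding P_def by (intro add_right_mono mult_left_mono K1 z) simp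
        finally show ?thesis using \<tau> P by (simp add: ennreal_mult)
      qed
      note opt = optimize_parameter[OF q P le]
      have eq: "(\<integral>\<^sup>+\<zeta>. ennreal c * ennreal (cmod (\<Phi> 0 (cnj z * \<zeta>)) * W \<zeta> * (1 - cmod z) powr (- \<epsilon>)) \<partial>rad smooth) = ennreal (2 powr q * P powr (q - 1)) * ?Q"
      proof -
        have "2 powr q * P powr (q - 1) = c * (1 - cmod z) powr (- \<epsilon>)"
          using K1 z by (simp add: P_def c_def powr_mult powr_powr \<epsilon>_def)
        moreover have "(\<integral>\<^sup>+\<zeta>. ennreal c * ennreal (cmod (\<Phi> 0 (cnj z * \<zeta>)) * W \<zeta> * (1 - cmod z) powr (- \<epsilon>)) \<partial>rad smooth)
          = (\<integral>\<^sup>+\<zeta>. ennreal (c * (1 - cmod z) powr (- \<epsilon>)) * ennreal (cmod (\<Phi> 0 (cnj z * \<zeta>)) * W \<zeta>) \<partial>rad smooth)"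
          using c W0 by (intro nn_integral_cong) (simp add: ennreal_mult[symmetric] mult_ac)
        ultimately show ?thesis by (simp only: nn_integral_cmult m\<Phi>[OF z Wm])
      qed
      \<comment> \<open>An infinite integral has to be treated apart, since \<open>enn2real\<close>
        would turn it into 0; in that case the right side is infinite as well.\<close>
      show ?thesis
      proof (cases "?I = \<infinity>")
        case True
        then have "?Q = \<infinity>" using opt(1) by simp
        then show ?thesis unfolding eq using P by (simp add: ennreal_mult_top)
      next
        case False
        then have I: "ennreal (enn2real ?I) = ?I" by (simp add: less_top)
        have "ennreal (cmod (F z)) \<le> ennreal (enn2real ?I)" unfolding I using Fle z by (elim allE impE)
        then have "cmod (F z) \<le> enn2real ?I" by (subst (asm) ennreal_le_iff) (rule enn2real_nonneg)
        then have "cmod (F z) powr q \<le> enn2real ?I powr q" using q by (intro powr_mono2) auto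
        then have "ennreal (cmod (F z) powr q) \<le> ennreal (enn2real ?I powr q)" by (rule ennreal_leI)
        also have "\<dots> \<le> ennreal (2 powr q * P powr (q - 1)) * ?Q" by (rule opt(2))
        finally show ?thesis unfolding eq .
      qed
    qed
    have "(\<integral>\<^sup>+z. ennreal (cmod (F z) powr q) \<partial>rad area)
      \<le> (\<integral>\<^sup>+z. \<integral>\<^sup>+\<zeta>. ennreal c * ennreal (cmod (\<Phi> 0 (cnj z * \<zeta>)) * W \<zeta> * (1 - cmod z) powr (- \<epsilon>)) \<partial>rad smooth \<partial>rad area)"
      by (intro nn_integral_mono pt) simp
    also have "\<dots> = (\<integral>\<^sup>+\<zeta>. \<integral>\<^sup>+z. ennreal c * ennreal (cmod (\<Phi> 0 (cnj z * \<zeta>)) * W \<zeta> * (1 - cmod z) powr (- \<epsilon>)) \<partial>rad area \<partial>rad smooth)"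
    proof (rule P.Fubini'[symmetric])
      have "(\<lambda>p. ennreal c * ennreal (cmod (\<Phi> 0 (cnj (fst p) * snd p)) * W (snd p) * (1 - cmod (fst p)) powr (- \<epsilon>))) \<in> borel_measurable (rad area \<Otimes>\<^sub>M rad smooth)"
        by (intro borel_measurable_times_ennreal measurable_compose[OF _ measurable_ennreal] borel_measurable_times \<Phi>2
            measurable_compose[OF measurable_snd Wm] measurable_compose[OF measurable_fst pm] borel_measurable_const)
      then show "(\<lambda>(z, \<zeta>). ennreal c * ennreal (cmod (\<Phi> 0 (cnj z * \<zeta>)) * W \<zeta> * (1 - cmod z) powr (- \<epsilon>))) \<in> borel_measurable (rad area \<Otimes>\<^sub>M rad smooth)"
        by (simp add: case_prod_unfold)
    qed
    also have "\<dots> \<le> (\<integral>\<^sup>+\<zeta>. ennreal (c * K2) * ennreal (U \<zeta> powr q) \<partial>rad smooth)"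
    proof (rule nn_integral_mono)
      fix \<zeta> assume "\<zeta> \<in> space (rad smooth)"
      then have \<zeta>: "cmod \<zeta> < 1" by simp
      \<comment> \<open>The modulus of the kernel is symmetric in z and \<zeta>, so the inner
        integral is the second Schur integral with the roles exchanged. Its power (1 -
        |\<zeta>|)^(-\<epsilon>) cancels the one in \<open>W\<close>.\<close>
      have "(\<integral>\<^sup>+z. ennreal c * ennreal (cmod (\<Phi> 0 (cnj z * \<zeta>)) * W \<zeta> * (1 - cmod z) powr (- \<epsilon>)) \<partial>rad area)
        = (\<integral>\<^sup>+z. ennreal (c * W \<zeta>) * ennreal (cmod (\<Phi> 0 (cnj \<zeta> * z)) * (1 - cmod z) powr (- \<epsilon>)) \<partial>rad area)"
        using c W0 \<Phi>_swap[OF _ \<zeta>] by (intro nn_integral_cong) (simp add: ennreal_mult[symmetric] mult_ac)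
      also have "\<dots> = ennreal (c * W \<zeta>) * (\<integral>\<^sup>+z. ennreal (cmod (\<Phi> 0 (cnj \<zeta> * z)) * (1 - cmod z) powr (- \<epsilon>)) \<partial>rad area)"
        by (rule nn_integral_cmult[OF m\<Phi>[OF \<zeta> pm]])
      also have "\<dots> \<le> ennreal (c * W \<zeta>) * ennreal (K2 * (1 - cmod \<zeta>) powr (- \<epsilon>))"
        by (intro mult_left_mono K2 \<zeta>) simp
      also have "\<dots> = ennreal ((c * W \<zeta>) * (K2 * (1 - cmod \<zeta>) powr (- \<epsilon>)))"
        using c K2 W0 by (simp add: ennreal_mult[symmetric])
      also have "(c * W \<zeta>) * (K2 * (1 - cmod \<zeta>) powr (- \<epsilon>)) = c * K2 * U \<zeta> powr q"
      proof -
        have "(1 - cmod \<zeta>) powr \<epsilon> * (1 - cmod \<zeta>) powr (- \<epsilon>) = 1" using \<zeta> by (simp add: powr_minus)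
        moreover have "(c * W \<zeta>) * (K2 * (1 - cmod \<zeta>) powr (- \<epsilon>)) = c * K2 * U \<zeta> powr q * ((1 - cmod \<zeta>) powr \<epsilon> * (1 - cmod \<zeta>) powr (- \<epsilon>))"
          unfolding W_def by (simp only: mult_ac)
        ultimately show ?thesis by (simp only: mult_1_right)
      qed
      finally show "(\<integral>\<^sup>+z. ennreal c * ennreal (cmod (\<Phi> 0 (cnj z * \<zeta>)) * W \<zeta> * (1 - cmod z) powr (- \<epsilon>)) \<partial>rad area) \<le> ennreal (c * K2) * ennreal (U \<zeta> powr q)"
        using c K2 by (simp add: ennreal_mult)
    qed
    also have "\<dots> = ennreal (c * K2) * (\<integral>\<^sup>+\<zeta>. ennreal (U \<zeta> powr q) \<partial>rad smooth)"
      by (rule nn_integral_cmult) measurable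
    finally show "(\<integral>\<^sup>+z. ennreal (cmod (F z) powr q) \<partial>rad area) \<le> ennreal (c * K2) * (\<integral>\<^sup>+\<zeta>. ennreal (U \<zeta> powr q) \<partial>rad smooth)" .
  qed
qed

lemma H_infinity_finite:
  assumes g: "g \<in> H_infinity" and p: "p > 0"
  shows "(\<integral>\<^sup>+z. ennreal (cmod (g z) powr p) \<partial>rad area) < \<infinity>"
proof -
  obtain B where B: "\<forall>x\<in>g ` ball 0 1. norm x \<le> B"
    using g unfolding H_infinity_def bounded_iff by blast
  have "(\<integral>\<^sup>+z. ennreal (cmod (g z) powr p) \<partial>rad area) \<le> (\<integral>\<^sup>+z. ennreal (B powr p) \<partial>rad area)"
    using B p by (intro nn_integral_mono ennreal_leI powr_mono2) auto
  also have "\<dots> < \<infinity>" using finite_measure_area by (simp add: ennreal_mult_less_top)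
  finally show ?thesis .
qed

lemma Lp_norm_ennreal:
  assumes "continuous_on (ball 0 1) f" "p > 0" "(\<integral>\<^sup>+z. ennreal (cmod (f z) powr p) \<partial>rad area) = ennreal I" "0 \<le> I"
  shows "Lp_norm p w f = ennreal (I powr (1 / p))"
  using assms by (simp add: Lp_norm_eq ennreal_root_def)

end

section \<open>Two weights and the multiplier X\<close>

locale two_weights = om: D_weight uo Co ao bo \<omega> + nu: D_weight un Cn an bn \<nu>
  for uo Co ao bo \<omega> un Cn an bn \<nu> +
  fixes p q :: real
  assumes p_pos: "0 < p" and p_le_q: "p \<le> q" and q_gt_1: "1 < q"
begin

definition X :: "real \<Rightarrow> real" where
  "X r = (om.V r * (1 - r)) powr (1 / p) / (nu.V r * (1 - r)) powr (1 / q)"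

lemma X_pos: "0 \<le> r \<Longrightarrow> r < 1 \<Longrightarrow> 0 < X r"
  using om.tail_pos[of r] nu.tail_pos[of r] by (simp add: X_def)

lemma X_measurable [measurable]: "X \<in> borel_measurable borel"
  unfolding X_def[abs_def] by measurable

lemma X_measurable_ball: "(\<lambda>z. X (cmod z)) \<in> borel_measurable (restrict_space borel (ball 0 1))"
  by (rule measurable_compose[OF cmod_measurable_on_ball X_measurable])

lemma X_integral:
  "\<exists>K>0. \<forall>g I. g holomorphic_on ball 0 1 \<longrightarrow> 0 \<le> I \<longrightarrow> (\<integral>\<^sup>+z. ennreal (cmod (g z) powr p) \<partial>rad om.area) \<le> ennreal I \<longrightarrow>
    (\<integral>\<^sup>+z. ennreal ((cmod (g z) * X (cmod z)) powr q) \<partial>rad nu.smooth) \<le> ennreal (K * I powr (q / p))"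
proof -
  have q: "q > 0" using q_gt_1 by simp
  obtain K1 where K1: "K1 > 0" "\<And>g p z. g holomorphic_on ball 0 1 \<Longrightarrow> p > 0 \<Longrightarrow> cmod z < 1 \<Longrightarrow>
    ennreal (cmod (g z) powr p * (om.V (cmod z) * (1 - cmod z))) \<le> ennreal K1 * (\<integral>\<^sup>+z. ennreal (cmod (g z) powr p) \<partial>rad om.area)"
    using om.pointwise_growth by blast
  obtain K2 where K2: "K2 > 0" "\<And>g p. g holomorphic_on ball 0 1 \<Longrightarrow> p > 0 \<Longrightarrow>
    (\<integral>\<^sup>+z. ennreal (cmod (g z) powr p) \<partial>rad om.smooth) \<le> ennreal K2 * (\<integral>\<^sup>+z. ennreal (cmod (g z) powr p) \<partial>rad om.area)"
    using om.smooth_le_area by blast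
  define s where "s = q / p - 1"
  have s: "s \<ge> 0" using p_pos p_le_q by (simp add: s_def)
  show ?thesis
  proof (intro exI[of _ "K1 powr s * K2"] conjI allI impI)
    show "0 < K1 powr s * K2" using K1 K2 by simp
    fix g :: "complex \<Rightarrow> complex" and I :: real
    assume g: "g holomorphic_on ball 0 1" and I: "0 \<le> I" and gI: "(\<integral>\<^sup>+z. ennreal (cmod (g z) powr p) \<partial>rad om.area) \<le> ennreal I"
    have gc: "continuous_on (ball 0 1) g" by (rule holomorphic_on_imp_continuous_on[OF g])
    have gm: "(\<lambda>z. cmod (g z)) \<in> borel_measurable (restrict_space borel (ball 0 1))"
      by (intro measurable_on_ball continuous_intros gc)
    have m1: "(\<lambda>z. ennreal ((cmod (g z) * X (cmod z)) powr q)) \<in> borel_measurable (restrict_space borel (ball 0 1))"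
      by (intro measurable_ennreal_powr borel_measurable_times gm X_measurable_ball)
    have m2: "(\<lambda>z. ennreal ((K1 * I) powr s) * ennreal (cmod (g z) powr p)) \<in> borel_measurable (restrict_space borel (ball 0 1))"
      by (intro borel_measurable_times_ennreal measurable_ennreal_powr gm) simp
    have m3: "(\<lambda>z. ennreal (cmod (g z) powr p)) \<in> borel_measurable (rad om.smooth)"
      by (intro measurable_compose[OF measurable_rad_on_ball measurable_ennreal] continuous_intros gc p_pos)
    have "(\<integral>\<^sup>+z. ennreal ((cmod (g z) * X (cmod z)) powr q) \<partial>rad nu.smooth) \<le> (\<integral>\<^sup>+z. ennreal ((K1 * I) powr s) * ennreal (cmod (g z) powr p) \<partial>rad om.smooth)"
    proof (rule nn_integral_rad_transfer[OF m1 m2 nu.smooth_measurable om.smooth_measurable])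
      fix z :: complex assume z: "0 < cmod z" "cmod z < 1"
      define a d W V where "a = cmod (g z)" and "d = 1 - cmod z" and "W = om.V (cmod z)" and "V = nu.V (cmod z)"
      have pos: "a \<ge> 0" "d > 0" "W > 0" "V > 0"
        using z om.tail_pos[of "cmod z"] nu.tail_pos[of "cmod z"] by (auto simp: a_def d_def W_def V_def)
      have "ennreal (a powr p * (W * d)) \<le> ennreal K1 * ennreal I"
        unfolding a_def d_def W_def by (rule order_trans[OF K1(2)[OF g p_pos z(2)] mult_left_mono[OF gI]]) simp
      then have growth: "a powr p * (W * d) \<le> K1 * I"
        using K1 I by (simp add: ennreal_mult[symmetric] ennreal_le_iff)
      have Xq: "(a * X (cmod z)) powr q = a powr q * ((W * d) powr (q / p) / (V * d))"
      proof -
        have "X (cmod z) = (W * d) powr (1 / p) / (V * d) powr (1 / q)" by (simp add: X_def W_def V_def d_def)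
        then show ?thesis using pos p_pos q by (simp add: powr_mult powr_divide powr_powr)
      qed
      have "(a * X (cmod z)) powr q * (V / d) = a powr q * (W * d) powr (q / p) / d\<^sup>2"
        unfolding Xq using pos by (simp add: power2_eq_square)
      \<comment> \<open>One factor |g|^p is kept for integration against the smoothed form of
        \<omega>. The excess power s = q / p - 1, nonnegative because p \<le> q, falls on the
        quantity controlled by pointwise growth.\<close>
      also have "\<dots> = (a powr p * (W * d)) powr s * (a powr p * (W / d))"
      proof (cases "a = 0")
        case False
        then have a: "a > 0" using pos by simp
        have "(a powr p * (W * d)) powr s * (a powr p * (W / d)) = (a powr p) powr s * (W * d) powr s * (a powr p * (W / d))"
          using a pos by (simp add: powr_mult)
        also have "\<dots> = ((a powr p) powr s * a powr p) * ((W * d) powr s * (W * d)) / d\<^sup>2"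
          using pos by (simp add: power2_eq_square)
        also have "(W * d) powr s * (W * d) = (W * d) powr (q / p)"
          using pos by (simp add: s_def powr_diff)
        also have "(a powr p) powr s * a powr p = a powr q"
          using p_pos by (simp add: powr_powr powr_add[symmetric] s_def algebra_simps)
        finally show ?thesis by simp
      qed (use q p_pos in simp)
      also have "\<dots> \<le> (K1 * I) powr s * (a powr p * (W / d))"
        using growth pos s by (intro mult_right_mono powr_mono2) auto
      finally have "(a * X (cmod z)) powr q * (V / d) \<le> (K1 * I) powr s * a powr p * (W / d)" by (simp only: mult.assoc)
      then show "ennreal ((cmod (g z) * X (cmod z)) powr q) * nu.smooth (cmod z) \<le> ennreal ((K1 * I) powr s) * ennreal (cmod (g z) powr p) * om.smooth (cmod z)"
        using pos by (simp add: ennreal_mult[symmetric] ennreal_leI a_def[symmetric] d_def[symmetric] W_def[symmetric] V_def[symmetric])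
    qed
    also have "\<dots> = ennreal ((K1 * I) powr s) * (\<integral>\<^sup>+z. ennreal (cmod (g z) powr p) \<partial>rad om.smooth)"
      by (rule nn_integral_cmult[OF m3])
    also have "\<dots> \<le> ennreal ((K1 * I) powr s) * (ennreal K2 * ennreal I)"
      by (intro mult_left_mono order_trans[OF K2(2)[OF g p_pos] mult_left_mono[OF gI]]) simp_all
    also have "\<dots> = ennreal (K1 powr s * K2 * I powr (q / p))"
    proof -
      have "I powr s * I = I powr (q / p)"
        using I p_pos q by (cases "I = 0") (simp_all add: s_def powr_diff)
      moreover have "(K1 * I) powr s * (K2 * I) = K1 powr s * K2 * (I powr s * I)"
        using K1 I by (simp add: powr_mult)
      ultimately show ?thesis using K2 I by (simp add: ennreal_mult[symmetric])
    qed
    finally show "(\<integral>\<^sup>+z. ennreal ((cmod (g z) * X (cmod z)) powr q) \<partial>rad nu.smooth) \<le> ennreal (K1 powr s * K2 * I powr (q / p))" .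
  qed
qed

text \<open>The case g = 1 of \<open>X_integral\<close>. It makes the iterated radial derivative of
  f integrable against the integrated weight, as \<open>pairing_radial_deriv\<close>
  demands.\<close>

lemma X_integrable: "(\<integral>\<^sup>+z. ennreal (X (cmod z)) \<partial>rad nu.smooth) < \<infinity>"
proof -
  have one: "(\<lambda>_::complex. 1::complex) \<in> H_infinity" by (auto simp: H_infinity_def bounded_iff)
  obtain I where I: "(\<integral>\<^sup>+z. ennreal (cmod (1::complex) powr p) \<partial>rad om.area) = ennreal I" "0 \<le> I"
    using om.H_infinity_finite[OF one p_pos] by (cases "\<integral>\<^sup>+z. ennreal (cmod (1::complex) powr p) \<partial>rad om.area") auto
  obtain K where K: "\<And>g I. g holomorphic_on ball 0 1 \<Longrightarrow> 0 \<le> I \<Longrightarrow> (\<integral>\<^sup>+z. ennreal (cmod (g z) powr p) \<partial>rad om.area) \<le> ennreal I \<Longrightarrow>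
    (\<integral>\<^sup>+z. ennreal ((cmod (g z) * X (cmod z)) powr q) \<partial>rad nu.smooth) \<le> ennreal (K * I powr (q / p))"
    using X_integral by blast
  have "(\<integral>\<^sup>+z. ennreal ((cmod 1 * X (cmod z)) powr q) \<partial>rad nu.smooth) \<le> ennreal (K * I powr (q / p))"
    by (rule K) (use I in auto)
  then have Xq: "(\<integral>\<^sup>+z. ennreal (X (cmod z) powr q) \<partial>rad nu.smooth) < \<infinity>"
    by (simp add: le_less_trans)
  have m: "(\<lambda>z. ennreal (X (cmod z) powr q)) \<in> borel_measurable (rad nu.smooth)"
    using X_measurable_ball by (subst measurable_cong_sets[OF sets_rad refl]) (rule measurable_ennreal_powr)
  have "(\<integral>\<^sup>+z. ennreal (X (cmod z)) \<partial>rad nu.smooth) \<le> (\<integral>\<^sup>+z. 1 + ennreal (X (cmod z) powr q) \<partial>rad nu.smooth)"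
  proof (rule nn_integral_mono)
    fix z :: complex assume "z \<in> space (rad nu.smooth)"
    then have "0 \<le> X (cmod z)" using X_pos[of "cmod z"] by simp
    then have "X (cmod z) \<le> 1 + X (cmod z) powr q * 1 powr (1 - q)" using q_gt_1 by (intro young_shift) auto
    then have "ennreal (X (cmod z)) \<le> ennreal (1 + X (cmod z) powr q)" by (intro ennreal_leI) simp
    then show "ennreal (X (cmod z)) \<le> 1 + ennreal (X (cmod z) powr q)" by simp
  qed
  also have "\<dots> = emeasure (rad nu.smooth) (ball 0 1) + (\<integral>\<^sup>+z. ennreal (X (cmod z) powr q) \<partial>rad nu.smooth)"
    using m by (subst nn_integral_add) auto
  also have "\<dots> < \<infinity>" using Xq nu.finite_measure_smooth by simp
  finally show ?thesis .
qed

lemma small_hankel_continuous: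
  assumes f: "f \<in> bergman1_log \<nu>" and g: "g \<in> H_infinity"
  shows "continuous_on (ball 0 1) (small_hankel \<nu> f g)"
proof -
  note f' = nu.bergman1_log_integrable[OF f]
  have "continuous_on (ball 0 1) (nu.hankel f g)"
    by (rule holomorphic_on_imp_continuous_on[OF nu.hankel_holomorphic[OF f' g]])
  then show ?thesis
    by (rule continuous_on_eq) (use nu.small_hankel_eq[OF f' g] in auto)
qed

lemma small_hankel_integral:
  assumes f: "f \<in> bergman1_log \<nu>" and g: "g \<in> H_infinity"
  shows "(\<integral>\<^sup>+z. ennreal (cmod (small_hankel \<nu> f g z) powr q) \<partial>rad nu.area) = (\<integral>\<^sup>+z. ennreal (cmod (nu.hankel f g z) powr q) \<partial>rad nu.area)"
  by (intro nn_integral_cong) (use nu.small_hankel_eq[OF nu.bergman1_log_integrable[OF f] g] in auto)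

text \<open>All derivatives up to order m + 1 enter with the same majorant, because the iterated
  radial derivative is a combination of all of them. The order is a successor since only after one
  integration is the density bounded pointwise.\<close>

lemma sufficiency_core:
  "\<exists>K>0. \<forall>f\<in>bergman1_log \<nu>. \<forall>A\<ge>0.
    (\<forall>z. cmod z < 1 \<longrightarrow> (\<forall>j\<le>Suc m. cmod ((deriv ^^ j) f z) \<le> A * (X (cmod z) / (1 - cmod z) ^ Suc m))) \<longrightarrow>
    (\<forall>g\<in>H_infinity. Lp_norm q \<nu> (small_hankel \<nu> f g) \<le> ennreal (K * A) * Lp_norm p \<omega> g)"
proof -
  define n where "n = Suc m"
  have q: "q > 0" using q_gt_1 by simp
  from radial_deriv_power_bound[of n] obtain D where D_pos: "D > 0"
    and D_all: "\<forall>F. F holomorphic_on ball 0 1 \<longrightarrow> (\<forall>z. cmod z < 1 \<longrightarrow>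
     cmod ((radial_deriv ^^ n) F z) \<le> D * (\<Sum>j\<le>n. cmod ((deriv ^^ j) F z)))"
    by (elim exE conjE) (rule that)
  note D = D_pos D_all[rule_format]
  from nu.integrated_density_bound[of m] obtain c where c_pos: "c > 0"
    and c_all: "\<forall>r. 0 < r \<and> r < 1 \<longrightarrow> integrated_density nu.area n r \<le> ennreal (c * (1 - r) ^ m * nu.V r)"
    unfolding n_def[symmetric] by (elim exE conjE) (rule that)
  note c = c_pos c_all[rule_format, OF conjI]
  from nu.schur_test[OF q_gt_1] obtain K3 where K3_pos: "K3 > 0"
    and K3_all: "\<forall>U F. U \<in> borel_measurable (restrict_space borel (ball 0 1)) \<longrightarrow> (\<forall>\<zeta>. 0 \<le> U \<zeta>) \<longrightarrow>
    (\<forall>z. cmod z < 1 \<longrightarrow> ennreal (cmod (F z)) \<le> (\<integral>\<^sup>+\<zeta>. ennreal (cmod (nu.\<Phi> 0 (cnj z * \<zeta>)) * U \<zeta>) \<partial>rad nu.smooth)) \<longrightarrow>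
    (\<integral>\<^sup>+z. ennreal (cmod (F z) powr q) \<partial>rad nu.area) \<le> ennreal K3 * (\<integral>\<^sup>+\<zeta>. ennreal (U \<zeta> powr q) \<partial>rad nu.smooth)"
    by (elim exE conjE) (rule that)
  note K3 = K3_pos K3_all[THEN spec, THEN spec, THEN mp, THEN mp, THEN mp]
  from X_integral obtain K4 where K4_pos: "K4 > 0"
    and K4_all: "\<forall>g I. g holomorphic_on ball 0 1 \<longrightarrow> 0 \<le> I \<longrightarrow> (\<integral>\<^sup>+z. ennreal (cmod (g z) powr p) \<partial>rad om.area) \<le> ennreal I \<longrightarrow>
    (\<integral>\<^sup>+z. ennreal ((cmod (g z) * X (cmod z)) powr q) \<partial>rad nu.smooth) \<le> ennreal (K4 * I powr (q / p))"
    by (elim exE conjE) (rule that)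
  note K4 = K4_pos K4_all[rule_format]
  define c' where "c' = D * (real n + 1) * c"
  have c': "c' > 0" using D c by (simp add: c'_def)
  define K where "K = c' * (K3 * K4) powr (1 / q)"
  let ?v = "integrated_density nu.area n"
  note vm = integrated_density_measurable[OF nu.area_measurable, of n]
  show ?thesis unfolding n_def[symmetric]
  proof (intro exI[of _ K] conjI ballI allI impI)
    show "K > 0" using c' K3 K4 by (simp add: K_def)
    fix f A g
    assume f: "f \<in> bergman1_log \<nu>" and A: "A \<ge> (0::real)" and g: "g \<in> H_infinity"
      and fA: "\<forall>z. cmod z < 1 \<longrightarrow> (\<forall>j\<le>n. cmod ((deriv ^^ j) f z) \<le> A * (X (cmod z) / (1 - cmod z) ^ n))"
    note f' = nu.bergman1_log_integrable[OF f]
    let ?R = "(radial_deriv ^^ n) f"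
    have Rc: "continuous_on (ball 0 1) ?R"
      by (rule holomorphic_on_imp_continuous_on[OF radial_deriv_power_holomorphic[OF f'(1)]])
    have Rm: "(\<lambda>z. cmod (?R z)) \<in> borel_measurable (restrict_space borel (ball 0 1))"
      by (intro measurable_on_ball continuous_intros Rc)
    have R: "cmod (?R z) \<le> D * (real n + 1) * A * (X (cmod z) / (1 - cmod z) ^ n)" if z: "cmod z < 1" for z
    proof -
      have "cmod (?R z) \<le> D * (\<Sum>j\<le>n. cmod ((deriv ^^ j) f z))" by (rule D(2)[OF f'(1) z])
      also have "\<dots> \<le> D * (\<Sum>j\<le>n. A * (X (cmod z) / (1 - cmod z) ^ n))"
        using D fA z by (intro mult_left_mono sum_mono) auto
      finally show ?thesis by (simp add: algebra_simps)
    qed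
    \<comment> \<open>The majorant contributes (1 - r)^(-m - 1) and the integrated density V r (1 -
      r)^m; together they give X times the smoothed weight, whatever m is.\<close>
    have dens: "ennreal (cmod (?R z)) * ?v (cmod z) \<le> ennreal (c' * A * X (cmod z)) * nu.smooth (cmod z)"
      if z: "0 < cmod z" "cmod z < 1" for z
    proof -
      define d where "d = 1 - cmod z"
      have d: "d > 0" using z by (simp add: d_def)
      have Xz: "X (cmod z) > 0" using z by (intro X_pos) auto
      have "ennreal (cmod (?R z)) * ?v (cmod z) \<le> ennreal (D * (real n + 1) * A * (X (cmod z) / d ^ n)) * ennreal (c * d ^ m * nu.V (cmod z))"
        using R[OF z(2)] c(2)[OF z] unfolding d_def by (intro mult_mono ennreal_leI) auto
      also have "\<dots> = ennreal ((D * (real n + 1) * A * (X (cmod z) / d ^ n)) * (c * d ^ m * nu.V (cmod z)))"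
        using D A Xz d c by (intro ennreal_mult[symmetric]) auto
      also have "(D * (real n + 1) * A * (X (cmod z) / d ^ n)) * (c * d ^ m * nu.V (cmod z)) = c' * A * X (cmod z) * (nu.V (cmod z) / d)"
        using d by (simp add: c'_def n_def)
      also have "ennreal \<dots> = ennreal (c' * A * X (cmod z)) * nu.smooth (cmod z)"
        using c' A Xz d unfolding d_def by (intro ennreal_mult) auto
      finally show ?thesis .
    qed
    have XmB: "(\<lambda>z. ennreal (c' * A * X (cmod z))) \<in> borel_measurable (restrict_space borel (ball 0 1))"
      by (intro measurable_compose[OF _ measurable_ennreal] borel_measurable_times X_measurable_ball borel_measurable_const)
    have ri: "integrable (rad ?v) ?R"
    proof -
      have "(\<integral>\<^sup>+z. ennreal (cmod (?R z)) \<partial>rad ?v) \<le> (\<integral>\<^sup>+z. ennreal (c' * A * X (cmod z)) \<partial>rad nu.smooth)"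
        by (rule nn_integral_rad_transfer[OF measurable_compose[OF Rm measurable_ennreal] XmB vm nu.smooth_measurable dens])
      also have "\<dots> = (\<integral>\<^sup>+z. ennreal (c' * A) * ennreal (X (cmod z)) \<partial>rad nu.smooth)"
        using c' A by (intro nn_integral_cong ennreal_mult') simp
      also have "\<dots> = ennreal (c' * A) * (\<integral>\<^sup>+z. ennreal (X (cmod z)) \<partial>rad nu.smooth)"
      proof (rule nn_integral_cmult)
        show "(\<lambda>z. ennreal (X (cmod z))) \<in> borel_measurable (rad nu.smooth)"
          using measurable_compose[OF X_measurable_ball measurable_ennreal] by (subst measurable_cong_sets[OF sets_rad refl])
      qed
      also have "\<dots> < \<infinity>" using X_integrable by (simp add: ennreal_mult_less_top)
      finally show ?thesis using measurable_rad_on_ball[OF Rc, of ?v] by (simp add: integrable_iff_bounded)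
    qed
    note gh = nu.g_holomorphic[OF f' g] and gc = nu.g_continuous[OF f' g]
    obtain Bg where Bg: "\<forall>x\<in>g ` ball 0 1. norm x \<le> Bg"
      using g unfolding H_infinity_def bounded_iff by blast
    define U where "U = (\<lambda>\<zeta>. c' * A * (cmod (g \<zeta>) * \<bar>X (cmod \<zeta>)\<bar>))"
    have Um: "U \<in> borel_measurable (restrict_space borel (ball 0 1))"
      unfolding U_def by (intro borel_measurable_times borel_measurable_abs X_measurable_ball measurable_on_ball continuous_intros gc borel_measurable_const)
    have bound: "ennreal (cmod (nu.hankel f g z)) \<le> (\<integral>\<^sup>+\<zeta>. ennreal (cmod (nu.\<Phi> 0 (cnj z * \<zeta>)) * U \<zeta>) \<partial>rad nu.smooth)"
      if z: "cmod z < 1" for z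
    proof -
      let ?G = "\<lambda>\<zeta>. g \<zeta> * nu.\<Phi> 0 (cnj z * \<zeta>)"
      let ?B = "Bg * (\<Sum>k. cmod (of_real (nu.coeff_\<Phi> 0 k) * cnj z ^ k))"
      have Gh: "?G holomorphic_on ball 0 1"
      proof (intro holomorphic_intros gh)
        show "(\<lambda>\<zeta>. nu.\<Phi> 0 (cnj z * \<zeta>)) holomorphic_on ball 0 1"
          using nu.\<Phi>_reproducing[OF z] by (simp add: is_reproducing_kernel_def bergman_def)
      qed
      have GB: "cmod (?G \<zeta>) \<le> ?B" if "cmod \<zeta> < 1" for \<zeta>
      proof -
        have 1: "cmod (g \<zeta>) \<le> Bg" using Bg that by auto
        have 2: "0 \<le> Bg" using 1 norm_ge_zero[of "g \<zeta>"] by linarith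
        show ?thesis unfolding norm_mult[of "g \<zeta>"] by (rule mult_mono[OF 1 nu.\<Phi>_bounded[OF z that] 2 norm_ge_zero])
      qed
      have Gc: "continuous_on (ball 0 1) ?G" by (rule holomorphic_on_imp_continuous_on[OF Gh])
      have "nu.hankel f g z = (LINT \<zeta>|rad nu.area. f \<zeta> * cnj (?G \<zeta>))"
        by (simp add: nu.hankel_def mult.assoc)
      also have "\<dots> = (LINT \<zeta>|rad ?v. ?R \<zeta> * cnj (?G \<zeta>))"
        by (rule nu.pairing_radial_deriv[OF f' ri Gh GB])
      finally have "nu.hankel f g z = (LINT \<zeta>|rad ?v. ?R \<zeta> * cnj (?G \<zeta>))" .
      moreover have "integrable (rad ?v) (\<lambda>\<zeta>. ?R \<zeta> * cnj (?G \<zeta>))"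
        by (rule integrable_rad_mult_bounded[OF ri, where B = ?B]) (use GB Gc in \<open>auto intro!: continuous_intros simp del: complex_cnj_mult\<close>)
      ultimately have "ennreal (cmod (nu.hankel f g z)) \<le> (\<integral>\<^sup>+\<zeta>. ennreal (cmod (?R \<zeta> * cnj (?G \<zeta>))) \<partial>rad ?v)"
        using integral_norm_bound_ennreal by metis
      also have "\<dots> \<le> (\<integral>\<^sup>+\<zeta>. ennreal (cmod (nu.\<Phi> 0 (cnj z * \<zeta>)) * U \<zeta>) \<partial>rad nu.smooth)"
      proof (rule nn_integral_rad_transfer[OF _ _ vm nu.smooth_measurable])
        show "(\<lambda>\<zeta>. ennreal (cmod (?R \<zeta> * cnj (?G \<zeta>)))) \<in> borel_measurable (restrict_space borel (ball 0 1))"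
          by (intro measurable_compose[OF measurable_on_ball measurable_ennreal] continuous_intros Rc Gc gc nu.\<Phi>_cont z)
        show "(\<lambda>\<zeta>. ennreal (cmod (nu.\<Phi> 0 (cnj z * \<zeta>)) * U \<zeta>)) \<in> borel_measurable (restrict_space borel (ball 0 1))"
          by (intro measurable_compose[OF _ measurable_ennreal] borel_measurable_times Um measurable_on_ball continuous_intros nu.\<Phi>_cont z)
        fix \<zeta> assume \<zeta>: "0 < cmod \<zeta>" "cmod (\<zeta>::complex) < 1"
        have X0: "0 < X (cmod \<zeta>)" using \<zeta> by (intro X_pos) auto
        have "ennreal (cmod (?R \<zeta> * cnj (?G \<zeta>))) * ?v (cmod \<zeta>) = ennreal (cmod (?G \<zeta>)) * (ennreal (cmod (?R \<zeta>)) * ?v (cmod \<zeta>))"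
          unfolding norm_mult[of "?R \<zeta>"] complex_mod_cnj by (simp add: ennreal_mult mult_ac)
        also have "\<dots> \<le> ennreal (cmod (?G \<zeta>)) * (ennreal (c' * A * X (cmod \<zeta>)) * nu.smooth (cmod \<zeta>))"
          by (intro mult_left_mono dens \<zeta>) simp
        also have "\<dots> = ennreal (cmod (nu.\<Phi> 0 (cnj z * \<zeta>)) * U \<zeta>) * nu.smooth (cmod \<zeta>)"
        proof -
          have "ennreal (cmod (?G \<zeta>)) * ennreal (c' * A * X (cmod \<zeta>)) = ennreal (cmod (nu.\<Phi> 0 (cnj z * \<zeta>)) * U \<zeta>)"
            using c' A X0 by (subst ennreal_mult[symmetric]) (auto simp: U_def norm_mult mult_ac)
          then show ?thesis by (simp only: mult.assoc[symmetric])
        qed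
        finally show "ennreal (cmod (?R \<zeta> * cnj (?G \<zeta>))) * ?v (cmod \<zeta>) \<le> ennreal (cmod (nu.\<Phi> 0 (cnj z * \<zeta>)) * U \<zeta>) * nu.smooth (cmod \<zeta>)" .
      qed
      finally show ?thesis .
    qed
    obtain I where I: "(\<integral>\<^sup>+z. ennreal (cmod (g z) powr p) \<partial>rad om.area) = ennreal I" "0 \<le> I"
      using om.H_infinity_finite[OF g p_pos] by (cases "\<integral>\<^sup>+z. ennreal (cmod (g z) powr p) \<partial>rad om.area") auto
    have "(\<integral>\<^sup>+z. ennreal (cmod (nu.hankel f g z) powr q) \<partial>rad nu.area) \<le> ennreal K3 * (\<integral>\<^sup>+\<zeta>. ennreal (U \<zeta> powr q) \<partial>rad nu.smooth)"
      using c' A bound by (intro K3(2) Um) (auto simp: U_def)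
    also have "(\<integral>\<^sup>+\<zeta>. ennreal (U \<zeta> powr q) \<partial>rad nu.smooth) = (\<integral>\<^sup>+\<zeta>. ennreal ((c' * A) powr q) * ennreal ((cmod (g \<zeta>) * X (cmod \<zeta>)) powr q) \<partial>rad nu.smooth)"
    proof (rule nn_integral_cong)
      fix \<zeta> assume "\<zeta> \<in> space (rad nu.smooth)"
      then have "0 < X (cmod \<zeta>)" by (intro X_pos) auto
      then show "ennreal (U \<zeta> powr q) = ennreal ((c' * A) powr q) * ennreal ((cmod (g \<zeta>) * X (cmod \<zeta>)) powr q)"
        using c' A unfolding U_def by (subst powr_mult) (auto simp: ennreal_mult[symmetric])
    qed
    also have "\<dots> = ennreal ((c' * A) powr q) * (\<integral>\<^sup>+\<zeta>. ennreal ((cmod (g \<zeta>) * X (cmod \<zeta>)) powr q) \<partial>rad nu.smooth)"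
    proof (rule nn_integral_cmult)
      have "(\<lambda>\<zeta>. ennreal ((cmod (g \<zeta>) * X (cmod \<zeta>)) powr q)) \<in> borel_measurable (restrict_space borel (ball 0 1))"
        by (intro measurable_ennreal_powr borel_measurable_times X_measurable_ball measurable_on_ball continuous_intros gc)
      then show "(\<lambda>\<zeta>. ennreal ((cmod (g \<zeta>) * X (cmod \<zeta>)) powr q)) \<in> borel_measurable (rad nu.smooth)"
        by (subst measurable_cong_sets[OF sets_rad refl])
    qed
    also have "ennreal K3 * \<dots> \<le> ennreal K3 * (ennreal ((c' * A) powr q) * ennreal (K4 * I powr (q / p)))"
      by (intro mult_left_mono K4(2)[OF gh I(2)]) (simp_all add: I)
    also have "\<dots> = ennreal ((K * A * I powr (1 / p)) powr q)"
    proof -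
      have "(K * A * I powr (1 / p)) powr q = K powr q * A powr q * I powr (q / p)"
        using c' K3 K4 A I by (simp add: K_def powr_mult powr_powr)
      also have "K powr q = c' powr q * (K3 * K4)"
        using c' K3 K4 q by (simp add: K_def powr_mult powr_powr)
      finally have "(K * A * I powr (1 / p)) powr q = K3 * ((c' * A) powr q * (K4 * I powr (q / p)))"
        using c' A by (simp add: powr_mult mult_ac)
      then show ?thesis using K3 K4 by (simp add: ennreal_mult[symmetric])
    qed
    finally have main: "(\<integral>\<^sup>+z. ennreal (cmod (nu.hankel f g z) powr q) \<partial>rad nu.area) \<le> ennreal ((K * A * I powr (1 / p)) powr q)" .
    have K0: "K \<ge> 0" using c' by (simp add: K_def)
    have "Lp_norm q \<nu> (small_hankel \<nu> f g) \<le> ennreal (K * A * I powr (1 / p))"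
      unfolding nu.Lp_norm_eq[OF small_hankel_continuous[OF f g] q] small_hankel_integral[OF f g]
      using main K0 A q by (subst ennreal_root_le_iff) auto
    also have "\<dots> = ennreal (K * A) * Lp_norm p \<omega> g"
      unfolding om.Lp_norm_ennreal[OF gc p_pos I] using K0 A by (intro ennreal_mult) auto
    finally show "Lp_norm q \<nu> (small_hankel \<nu> f g) \<le> ennreal (K * A) * Lp_norm p \<omega> g" .
  qed
qed

end

section \<open>Necessity and the characterisation\<close>

text \<open>Hoelder's inequality up to a factor 2, from a pointwise application of
  \<open>young_shift\<close> followed by optimisation of \<tau>. The right factor is measured by its
  integral, the left one by its norm J.\<close>

lemma holder_root_bound:
  fixes a b :: "'a \<Rightarrow> real"
  assumes q: "1 < q" and [measurable]: "a \<in> borel_measurable M" "b \<in> borel_measurable M"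
    and nonneg: "\<And>x. 0 \<le> a x" "\<And>x. 0 \<le> b x"
    and b: "(\<integral>\<^sup>+x. ennreal (b x powr (q / (q - 1))) \<partial>M) \<le> ennreal P" and P: "0 < P"
    and a: "(\<integral>\<^sup>+x. ennreal (a x powr q) \<partial>M) \<le> ennreal (J powr q)" and J: "0 \<le> J"
  shows "(\<integral>\<^sup>+x. ennreal (a x * b x) \<partial>M) \<le> ennreal (2 * P powr ((q - 1) / q) * J)"
proof -
  let ?I = "\<integral>\<^sup>+x. ennreal (a x * b x) \<partial>M"
  let ?Q = "\<integral>\<^sup>+x. ennreal (a x powr q) \<partial>M"
  have le: "?I \<le> ennreal (\<tau> * P) + ennreal (\<tau> powr (1 - q)) * ?Q" if \<tau>: "\<tau> > 0" for \<tau>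
  proof -
    have "?I \<le> (\<integral>\<^sup>+x. ennreal \<tau> * ennreal (b x powr (q / (q - 1))) + ennreal (\<tau> powr (1 - q)) * ennreal (a x powr q) \<partial>M)"
    proof (rule nn_integral_mono)
      fix x
      have "a x * b x \<le> \<tau> * b x powr (q / (q - 1)) + \<tau> powr (1 - q) * a x powr q"
      proof (cases "b x = 0")
        case False
        then have bx: "b x > 0" using nonneg(2)[of x] by simp
        \<comment> \<open>With this threshold t b = \<tau> b^(q / (q - 1)) and t^(1 - q) b =
          \<tau>^(1 - q), so the two variables separate.\<close>
        define t where "t = \<tau> * b x powr (1 / (q - 1))"
        have t: "t > 0" using \<tau> bx by (simp add: t_def)
        have "a x * b x \<le> (t + a x powr q * t powr (1 - q)) * b x"
          using young_shift[OF nonneg(1) t q] bx by (intro mult_right_mono) auto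
        also have "\<dots> = t * b x + a x powr q * (t powr (1 - q) * b x)" by (simp add: algebra_simps)
        also have "t * b x = \<tau> * b x powr (q / (q - 1))"
        proof -
          have "q / (q - 1) = 1 / (q - 1) + 1" using q by (simp add: field_simps)
          then have "b x powr (q / (q - 1)) = b x powr (1 / (q - 1)) * b x" using bx by (simp add: powr_add)
          then show ?thesis by (simp add: t_def)
        qed
        also have "t powr (1 - q) * b x = \<tau> powr (1 - q)"
        proof -
          have e: "1 / (q - 1) * (1 - q) = - 1" using q by (simp add: divide_simps)
          have "t powr (1 - q) = \<tau> powr (1 - q) * (b x powr (1 / (q - 1))) powr (1 - q)"
            unfolding t_def by (rule powr_mult)
          also have "(b x powr (1 / (q - 1))) powr (1 - q) = b x powr (- 1)" by (simp only: powr_powr e)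
          finally show ?thesis using bx by (simp add: powr_minus)
        qed
        finally show ?thesis by (simp add: mult.commute)
      qed (use \<tau> in simp)
      then show "ennreal (a x * b x) \<le> ennreal \<tau> * ennreal (b x powr (q / (q - 1))) + ennreal (\<tau> powr (1 - q)) * ennreal (a x powr q)"
        using \<tau> by (simp add: ennreal_mult[symmetric] ennreal_plus[symmetric] ennreal_leI del: ennreal_plus)
    qed
    also have "\<dots> = ennreal \<tau> * (\<integral>\<^sup>+x. ennreal (b x powr (q / (q - 1))) \<partial>M) + ennreal (\<tau> powr (1 - q)) * ?Q"
      by (simp add: nn_integral_add nn_integral_cmult)
    also have "\<dots> \<le> ennreal \<tau> * ennreal P + ennreal (\<tau> powr (1 - q)) * ?Q"
      by (intro add_right_mono mult_left_mono b) simp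
    finally show ?thesis using \<tau> P by (simp add: ennreal_mult)
  qed
  note opt = optimize_parameter[OF q P le]
  have "?Q \<noteq> \<infinity>" using a by (auto simp: top_unique)
  then have fin: "?I \<noteq> \<infinity>" using opt(1) by auto
  have "ennreal (enn2real ?I powr q) \<le> ennreal (2 powr q * P powr (q - 1)) * ennreal (J powr q)"
    by (rule order_trans[OF opt(2) mult_left_mono[OF a zero_le]])
  also have "\<dots> = ennreal ((2 * P powr ((q - 1) / q) * J) powr q)"
    using q P J by (simp add: powr_mult powr_powr ennreal_mult[symmetric])
  finally have "enn2real ?I powr q \<le> (2 * P powr ((q - 1) / q) * J) powr q"
    by (subst (asm) ennreal_le_iff) simp_all
  then have "enn2real ?I \<le> 2 * P powr ((q - 1) / q) * J"
  proof (rule contrapos_pp)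
    assume "\<not> enn2real ?I \<le> 2 * P powr ((q - 1) / q) * J"
    then have "(2 * P powr ((q - 1) / q) * J) powr q < enn2real ?I powr q"
      using q P J by (intro powr_less_mono2) auto
    then show "\<not> enn2real ?I powr q \<le> (2 * P powr ((q - 1) / q) * J) powr q" by simp
  qed
  then have "ennreal (enn2real ?I) \<le> ennreal (2 * P powr ((q - 1) / q) * J)" by (rule ennreal_leI)
  then show ?thesis using fin by (simp add: less_top)
qed

section \<open>Test functions and lower bounds for the operator norm\<close>

lemma inverse_power_in_H_infinity:
  assumes z: "cmod z < 1"
  shows "(\<lambda>\<zeta>. 1 / (1 - cnj z * \<zeta>) ^ k) \<in> H_infinity"
  unfolding H_infinity_def bounded_iff
proof (intro CollectI conjI exI[of _ "1 / (1 - cmod z) ^ k"] ballI)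
  show "(\<lambda>\<zeta>. 1 / (1 - cnj z * \<zeta>) ^ k) holomorphic_on ball 0 1"
    using one_minus_cnj_mult_nonzero[OF z] by (intro holomorphic_intros) auto
  fix y assume "y \<in> (\<lambda>\<zeta>. 1 / (1 - cnj z * \<zeta>) ^ k) ` ball 0 1"
  then obtain \<zeta> where \<zeta>: "cmod \<zeta> < 1" and y: "y = 1 / (1 - cnj z * \<zeta>) ^ k" by auto
  have "cmod (cnj z * \<zeta>) \<le> cmod z * 1" unfolding norm_mult complex_mod_cnj using \<zeta> by (intro mult_left_mono) auto
  then have "1 - cmod z \<le> cmod (1 - cnj z * \<zeta>)" using norm_triangle_ineq2[of 1 "cnj z * \<zeta>"] by simp
  then have "(1 - cmod z) ^ k \<le> cmod (1 - cnj z * \<zeta>) ^ k" using z by (intro power_mono) auto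
  then show "cmod y \<le> 1 / (1 - cmod z) ^ k" unfolding y norm_divide norm_power using z
    by (intro frac_le) auto
qed

context two_weights
begin

abbreviation hankel_estimate :: "(complex \<Rightarrow> complex) \<Rightarrow> real \<Rightarrow> bool" where
  "hankel_estimate f C \<equiv> \<forall>g\<in>H_infinity. Lp_norm q \<nu> (small_hankel \<nu> f g) \<le> ennreal C * Lp_norm p \<omega> g"

text \<open>Only the easy half of duality: by \<open>hankel_pairing\<close> the left side is the
  pairing of the operator applied to g with h, to which Hoelder's inequality applies.\<close>

lemma pairing_bound:
  assumes f: "f \<in> bergman1_log \<nu>" and C0: "0 \<le> C0" "hankel_estimate f C0"
    and g: "g \<in> H_infinity" and gI: "(\<integral>\<^sup>+\<zeta>. ennreal (cmod (g \<zeta>) powr p) \<partial>rad om.area) \<le> ennreal I" "0 \<le> I"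
    and R: "1 < R" and h: "h holomorphic_on ball 0 R"
    and hP: "(\<integral>\<^sup>+\<zeta>. ennreal (cmod (h \<zeta>) powr (q / (q - 1))) \<partial>rad nu.area) \<le> ennreal P" "0 < P"
  shows "cmod (LINT \<zeta>|rad nu.area. f \<zeta> * cnj (g \<zeta> * h \<zeta>)) \<le> 2 * P powr ((q - 1) / q) * (C0 * I powr (1 / p))"
proof -
  note f' = nu.bergman1_log_integrable[OF f]
  note gc = nu.g_continuous[OF f' g]
  have q: "q > 0" using q_gt_1 by simp
  have "Lp_norm p \<omega> g \<le> ennreal (I powr (1 / p))"
    unfolding om.Lp_norm_eq[OF gc p_pos] using gI p_pos by (subst ennreal_root_le_iff) (auto simp: powr_powr)
  then have "ennreal C0 * Lp_norm p \<omega> g \<le> ennreal C0 * ennreal (I powr (1 / p))" by (rule mult_left_mono[OF _ zero_le])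
  then have "Lp_norm q \<nu> (small_hankel \<nu> f g) \<le> ennreal C0 * ennreal (I powr (1 / p))"
    by (rule order_trans[OF C0(2)[THEN bspec, OF g]])
  also have "\<dots> = ennreal (C0 * I powr (1 / p))" using C0 by (simp add: ennreal_mult)
  finally have Fq: "(\<integral>\<^sup>+z. ennreal (cmod (nu.hankel f g z) powr q) \<partial>rad nu.area) \<le> ennreal ((C0 * I powr (1 / p)) powr q)"
    unfolding nu.Lp_norm_eq[OF small_hankel_continuous[OF f g] q] small_hankel_integral[OF f g]
    using q C0 by (subst (asm) ennreal_root_le_iff) auto
  have Fc: "continuous_on (ball 0 1) (nu.hankel f g)"
    by (rule holomorphic_on_imp_continuous_on[OF nu.hankel_holomorphic[OF f' g]])
  have hc: "continuous_on (ball 0 1) h"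
    by (rule continuous_on_subset[OF holomorphic_on_imp_continuous_on[OF h]]) (use R in auto)
  have Fi: "integrable (rad nu.area) (nu.hankel f g)"
    using q_gt_1 le_less_trans[OF Fq ennreal_less_top] by (intro nu.integrable_area_of_powr[OF Fc, of q]) auto
  have hc': "continuous_on (cball 0 1) h"
    by (rule continuous_on_subset[OF holomorphic_on_imp_continuous_on[OF h]]) (use R in auto)
  have "bounded (h ` cball 0 1)" by (rule compact_imp_bounded[OF compact_continuous_image[OF hc' compact_cball]])
  then obtain B where B: "\<forall>y\<in>h ` cball 0 1. cmod y \<le> B" unfolding bounded_iff ..
  have i: "integrable (rad nu.area) (\<lambda>\<zeta>. nu.hankel f g \<zeta> * cnj (h \<zeta>))"
  proof (rule integrable_rad_mult_bounded[OF Fi, where B = B])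
    show "continuous_on (ball 0 1) (\<lambda>\<zeta>. cnj (h \<zeta>))" by (intro continuous_intros hc)
    show "cmod (cnj (h \<zeta>)) \<le> B" if "\<zeta> \<in> ball 0 1" for \<zeta> using B that by simp
  qed
  have m: "(\<lambda>\<zeta>. cmod (nu.hankel f g \<zeta>)) \<in> borel_measurable (rad nu.area)" "(\<lambda>\<zeta>. cmod (h \<zeta>)) \<in> borel_measurable (rad nu.area)"
    by (intro measurable_rad_on_ball continuous_intros Fc hc)+
  have "ennreal (cmod (LINT \<zeta>|rad nu.area. nu.hankel f g \<zeta> * cnj (h \<zeta>))) \<le> (\<integral>\<^sup>+\<zeta>. ennreal (cmod (nu.hankel f g \<zeta> * cnj (h \<zeta>))) \<partial>rad nu.area)"
    by (rule integral_norm_bound_ennreal[OF i])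
  also have "\<dots> = (\<integral>\<^sup>+\<zeta>. ennreal (cmod (nu.hankel f g \<zeta>) * cmod (h \<zeta>)) \<partial>rad nu.area)"
    by (simp only: norm_mult complex_mod_cnj)
  also have "\<dots> \<le> ennreal (2 * P powr ((q - 1) / q) * (C0 * I powr (1 / p)))"
    by (rule holder_root_bound[OF q_gt_1 m _ _ hP Fq]) (use C0 in auto)
  finally show ?thesis
    unfolding nu.hankel_pairing[OF f' g Fi R h] using C0 by (subst (asm) ennreal_le_iff) auto
qed

text \<open>Here a counts the powers of 1 / |1 - cnj z \<zeta>| in h and b those in g. Since a + b =
  n + 1 for the test functions, the last power of d is d^(-n), and the other factors form X.\<close>

lemma test_function_exponents:
  assumes pos: "0 < d" "0 < W" "0 < V" "0 < K1" "0 < K2"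
  shows "2 * (K2 * (V powr (1 - q / (q - 1)) * d powr (1 - a * (q / (q - 1))))) powr ((q - 1) / q) *
      (C0 * (K1 * (W * d powr (1 - b * p))) powr (1 / p))
    = 2 * K2 powr ((q - 1) / q) * K1 powr (1 / p) * C0 * ((W * d) powr (1 / p) / (V * d) powr (1 / q) * d powr (1 - a - b))"
proof -
  have e: "(1 - q / (q - 1)) * ((q - 1) / q) = - 1 / q" "(1 - a * (q / (q - 1))) * ((q - 1) / q) = - 1 / q + (1 - a)"
    using q_gt_1 by (simp_all add: field_simps)
  have e': "(1 - b * p) * (1 / p) = 1 / p + (- b)" using p_pos by (simp add: field_simps)
  have "(K2 * (V powr (1 - q / (q - 1)) * d powr (1 - a * (q / (q - 1))))) powr ((q - 1) / q)
    = K2 powr ((q - 1) / q) * (V powr (- 1 / q) * (d powr (- 1 / q) * d powr (1 - a)))"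
    using pos by (simp only: powr_mult powr_powr e powr_add)
  also have "V powr (- 1 / q) * (d powr (- 1 / q) * d powr (1 - a)) = d powr (1 - a) / (V * d) powr (1 / q)"
    using pos by (simp add: powr_mult powr_minus_divide)
  finally have 1: "(K2 * (V powr (1 - q / (q - 1)) * d powr (1 - a * (q / (q - 1))))) powr ((q - 1) / q)
    = K2 powr ((q - 1) / q) * (d powr (1 - a) / (V * d) powr (1 / q))" .
  have 2: "(K1 * (W * d powr (1 - b * p))) powr (1 / p) = K1 powr (1 / p) * ((W * d) powr (1 / p) * d powr (- b))"
    using pos by (simp only: powr_mult powr_powr e' powr_add mult.assoc)
  have 3: "d powr (1 - a - b) = d powr (1 - a) * d powr (- b)"
    by (simp add: powr_add[symmetric])
  show ?thesis unfolding 1 2 3 by simp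
qed

text \<open>The singularity of \<Phi> n, of order n + 1, is divided between g and h. The M powers
  given to g satisfy the condition for its integral against \<omega>, and the n + 1 - M powers left
  to h, at least bn + 1, satisfy the one for \<nu> with the conjugate exponent.\<close>

lemma derivative_necessary:
  assumes M: "real M * p - 1 > bo" and n: "real M + bn \<le> real n"
  shows "\<exists>K>0. \<forall>f\<in>bergman1_log \<nu>. \<forall>C0\<ge>0. hankel_estimate f C0 \<longrightarrow>
    (\<forall>z. cmod z < 1 \<longrightarrow> cmod ((deriv ^^ n) f z) \<le> K * C0 * (X (cmod z) / (1 - cmod z) ^ n))"
proof -
  define q' where "q' = q / (q - 1)"
  define a where "a = real (Suc n) - real M"
  have q': "q' > 1" using q_gt_1 by (simp add: q'_def field_simps)
  have a: "a \<ge> bn + 1" using n by (simp add: a_def)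
  have "a * 1 < a * q'" using a nu.\<beta>_ge_1 q' by (intro mult_strict_left_mono) auto
  then have aq: "(real (Suc n) - real M) * q' - 1 > bn" using a by (simp add: a_def)
  have q'0: "q' > 0" using q' by simp
  from om.rad_area_powr[OF M] obtain K1 where K1: "K1 > 0"
    and K1b: "\<forall>z. cmod z < 1 \<longrightarrow>
      (\<integral>\<^sup>+\<zeta>. ennreal (cmod (1 - cnj z * \<zeta>) powr (- (real M * p))) \<partial>rad om.area) \<le> ennreal (K1 * (om.V (cmod z) * (1 - cmod z) powr (1 - real M * p)))"
    by (elim exE conjE) (rule that)
  from nu.rad_area_\<Phi>[OF q'0 aq] obtain K2 where K2: "K2 > 0"
    and K2b: "\<forall>z. cmod z < 1 \<longrightarrow>
    (\<integral>\<^sup>+\<zeta>. ennreal ((cmod (1 - cnj z * \<zeta>) ^ M * cmod (nu.\<Phi> n (cnj z * \<zeta>))) powr q') \<partial>rad nu.area)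
      \<le> ennreal (K2 * (nu.V (cmod z) powr (1 - q') * (1 - cmod z) powr (1 - (real (Suc n) - real M) * q')))"
    by (elim exE conjE) (rule that)
  define K where "K = 2 * K2 powr ((q - 1) / q) * K1 powr (1 / p)"
  show ?thesis
  proof (intro exI[of _ K] conjI ballI allI impI)
    show "K > 0" using K1 K2 by (simp add: K_def)
    fix f C0 z
    assume f: "f \<in> bergman1_log \<nu>" and C0: "(0::real) \<le> C0" "hankel_estimate f C0" and z: "cmod z < 1"
    note f' = nu.bergman1_log_integrable[OF f]
    define d W V where "d = 1 - cmod z" and "W = om.V (cmod z)" and "V = nu.V (cmod z)"
    have pos: "0 < d" "0 < W" "0 < V" using z om.tail_pos[of "cmod z"] nu.tail_pos[of "cmod z"] by (auto simp: d_def W_def V_def)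
    define g where "g = (\<lambda>\<zeta>. 1 / (1 - cnj z * \<zeta>) ^ M)"
    define h where "h = (\<lambda>\<zeta>. \<zeta> ^ n * ((1 - cnj z * \<zeta>) ^ M * nu.\<Phi> n (cnj z * \<zeta>)))"
    define I where "I = K1 * (W * d powr (1 - real M * p))"
    define P where "P = K2 * (V powr (1 - q') * d powr (1 - a * q'))"
    have g: "g \<in> H_infinity" unfolding g_def by (rule inverse_power_in_H_infinity[OF z])
    have gI: "(\<integral>\<^sup>+\<zeta>. ennreal (cmod (g \<zeta>) powr p) \<partial>rad om.area) \<le> ennreal I"
    proof -
      have "(\<integral>\<^sup>+\<zeta>. ennreal (cmod (g \<zeta>) powr p) \<partial>rad om.area) = (\<integral>\<^sup>+\<zeta>. ennreal (cmod (1 - cnj z * \<zeta>) powr (- (real M * p))) \<partial>rad om.area)"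
      proof (rule nn_integral_cong)
        fix \<zeta> assume "\<zeta> \<in> space (rad om.area)"
        then have x: "cmod (1 - cnj z * \<zeta>) > 0" using one_minus_cnj_mult_nonzero[OF z, of \<zeta>] by simp
        have "cmod (g \<zeta>) = cmod (1 - cnj z * \<zeta>) powr (- real M)"
          unfolding g_def norm_divide norm_power using x by (simp add: powr_minus_divide powr_realpow)
        then show "ennreal (cmod (g \<zeta>) powr p) = ennreal (cmod (1 - cnj z * \<zeta>) powr (- (real M * p)))"
          by (simp add: powr_powr)
      qed
      also have "\<dots> \<le> ennreal I" using K1b[rule_format, OF z] by (simp add: I_def d_def W_def)
      finally show ?thesis .
    qed
    have hP: "(\<integral>\<^sup>+\<zeta>. ennreal (cmod (h \<zeta>) powr (q / (q - 1))) \<partial>rad nu.area) \<le> ennreal P"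
    proof -
      have "(\<integral>\<^sup>+\<zeta>. ennreal (cmod (h \<zeta>) powr q') \<partial>rad nu.area)
        \<le> (\<integral>\<^sup>+\<zeta>. ennreal ((cmod (1 - cnj z * \<zeta>) ^ M * cmod (nu.\<Phi> n (cnj z * \<zeta>))) powr q') \<partial>rad nu.area)"
      proof (intro nn_integral_mono ennreal_leI powr_mono2)
        fix \<zeta> assume "\<zeta> \<in> space (rad nu.area)"
        then have "cmod \<zeta> ^ n \<le> 1" by (intro power_le_one) auto
        then show "cmod (h \<zeta>) \<le> cmod (1 - cnj z * \<zeta>) ^ M * cmod (nu.\<Phi> n (cnj z * \<zeta>))"
          unfolding h_def norm_mult[of "\<zeta> ^ n"] norm_mult[of "_ ^ M"] norm_power by (intro mult_left_le_one_le) auto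
      qed (use q' in auto)
      also have "\<dots> \<le> ennreal P" using K2b[rule_format, OF z] by (simp add: P_def a_def d_def V_def)
      finally show ?thesis by (simp add: q'_def)
    qed
    \<comment> \<open>Larger than 1, while |z| R < 1 keeps cnj z \<zeta> inside the disc where
      \<Phi> is analytic.\<close>
    define R where "R = 2 / (1 + cmod z)"
    have "1 + cmod z > 0" using norm_ge_zero[of z] by linarith
    then have R: "R > 1" using z by (simp add: R_def)
    have hh: "h holomorphic_on ball 0 R"
    proof -
      have "(nu.\<Phi> n \<circ> (\<lambda>\<zeta>. cnj z * \<zeta>)) holomorphic_on ball 0 R"
      proof (rule holomorphic_on_compose_gen[OF _ nu.\<Phi>_holomorphic])
        show "(\<lambda>\<zeta>. cnj z * \<zeta>) holomorphic_on ball 0 R" by (intro holomorphic_intros)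
        show "(\<lambda>\<zeta>. cnj z * \<zeta>) ` ball 0 R \<subseteq> ball 0 1"
        proof (rule image_subsetI)
          fix \<zeta> :: complex assume "\<zeta> \<in> ball 0 R"
          then have "cmod (cnj z * \<zeta>) \<le> cmod z * R" unfolding norm_mult complex_mod_cnj by (intro mult_left_mono) auto
          also have "\<dots> < 1" using z \<open>1 + cmod z > 0\<close> by (simp add: R_def)
          finally show "cnj z * \<zeta> \<in> ball 0 1" by simp
        qed
      qed
      then have "(\<lambda>\<zeta>. nu.\<Phi> n (cnj z * \<zeta>)) holomorphic_on ball 0 R" by (simp add: o_def)
      then show ?thesis unfolding h_def by (intro holomorphic_intros)
    qed
    have "(LINT \<zeta>|rad nu.area. f \<zeta> * cnj (g \<zeta> * h \<zeta>)) = (LINT \<zeta>|rad nu.area. f \<zeta> * cnj (\<zeta> ^ n * nu.\<Phi> n (cnj z * \<zeta>)))"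
    proof (rule Bochner_Integration.integral_cong[OF refl])
      fix \<zeta> assume "\<zeta> \<in> space (rad nu.area)"
      then have x: "1 - cnj z * \<zeta> \<noteq> 0" using one_minus_cnj_mult_nonzero[OF z, of \<zeta>] by simp
      have "g \<zeta> * h \<zeta> = \<zeta> ^ n * nu.\<Phi> n (cnj z * \<zeta>)" using x by (simp add: g_def h_def)
      then show "f \<zeta> * cnj (g \<zeta> * h \<zeta>) = f \<zeta> * cnj (\<zeta> ^ n * nu.\<Phi> n (cnj z * \<zeta>))" by (simp only:)
    qed
    also have "\<dots> = (deriv ^^ n) f z" by (rule nu.pairing_\<Phi>[OF f' z])
    finally have eq: "(deriv ^^ n) f z = (LINT \<zeta>|rad nu.area. f \<zeta> * cnj (g \<zeta> * h \<zeta>))" ..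
    have I0: "0 \<le> I" and P0: "0 < P" using K1 K2 pos by (simp_all add: I_def P_def)
    have "cmod ((deriv ^^ n) f z) \<le> 2 * P powr ((q - 1) / q) * (C0 * I powr (1 / p))"
      unfolding eq by (rule pairing_bound[OF f C0 g gI I0 R hh hP P0])
    also have "\<dots> = K * C0 * ((W * d) powr (1 / p) / (V * d) powr (1 / q) * d powr (1 - a - real M))"
      unfolding P_def I_def q'_def K_def by (rule test_function_exponents[OF pos K1 K2])
    also have "d powr (1 - a - real M) = 1 / d ^ n"
    proof -
      have "1 - a - real M = - real n" by (simp add: a_def)
      then show ?thesis using pos by (simp add: powr_minus_divide powr_realpow)
    qed
    finally show "cmod ((deriv ^^ n) f z) \<le> K * C0 * (X (cmod z) / (1 - cmod z) ^ n)"
      by (simp add: X_def W_def V_def d_def)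
  qed
qed

lemma coefficients_necessary:
  "\<exists>K>0. \<forall>f\<in>bergman1_log \<nu>. \<forall>C0\<ge>0. hankel_estimate f C0 \<longrightarrow> cmod ((deriv ^^ j) f 0) \<le> K * C0"
proof -
  have one: "(\<lambda>_. 1) \<in> H_infinity" by (auto simp: H_infinity_def bounded_iff)
  define I where "I = enn2real (emeasure (rad om.area) (ball 0 1))"
  define P where "P = enn2real (emeasure (rad nu.area) (ball 0 1)) + 1"
  have I: "emeasure (rad om.area) (ball 0 1) = ennreal I" "0 \<le> I"
    using om.finite_measure_area by (simp_all add: I_def less_top)
  have P: "emeasure (rad nu.area) (ball 0 1) \<le> ennreal P" "0 < P"
  proof -
    have "emeasure (rad nu.area) (ball 0 1) = ennreal (P - 1)"
      using nu.finite_measure_area by (simp add: P_def less_top)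
    then show "emeasure (rad nu.area) (ball 0 1) \<le> ennreal P" by (simp add: ennreal_leI)
    show "0 < P" unfolding P_def by (intro add_nonneg_pos enn2real_nonneg) simp
  qed
  define K where "K = fact j / nu.\<mu> j * (2 * P powr ((q - 1) / q) * I powr (1 / p)) + 1"
  show ?thesis
  proof (intro exI[of _ K] conjI ballI allI impI)
    have "0 \<le> fact j / nu.\<mu> j * (2 * P powr ((q - 1) / q) * I powr (1 / p))"
      using nu.\<mu>_pos[of j] by simp
    then show "K > 0" unfolding K_def by linarith
    fix f C0 assume f: "f \<in> bergman1_log \<nu>" and C0: "(0::real) \<le> C0" "hankel_estimate f C0"
    note f' = nu.bergman1_log_integrable[OF f]
    have gI: "(\<integral>\<^sup>+\<zeta>. ennreal (cmod 1 powr p) \<partial>rad om.area) \<le> ennreal I" using I by simp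
    have hP: "(\<integral>\<^sup>+\<zeta>. ennreal (cmod (\<zeta> ^ j) powr (q / (q - 1))) \<partial>rad nu.area) \<le> ennreal P"
    proof -
      have "(\<integral>\<^sup>+\<zeta>. ennreal (cmod (\<zeta> ^ j) powr (q / (q - 1))) \<partial>rad nu.area) \<le> (\<integral>\<^sup>+\<zeta>. 1 \<partial>rad nu.area)"
      proof (rule nn_integral_mono)
        fix \<zeta> assume "\<zeta> \<in> space (rad nu.area)"
        then have "cmod (\<zeta> ^ j) \<le> 1" unfolding norm_power by (intro power_le_one) auto
        then have "cmod (\<zeta> ^ j) powr (q / (q - 1)) \<le> 1 powr (q / (q - 1))" using q_gt_1 by (intro powr_mono2) auto
        then show "ennreal (cmod (\<zeta> ^ j) powr (q / (q - 1))) \<le> 1" by (simp add: ennreal_le_1)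
      qed
      also have "\<dots> \<le> ennreal P" using P by simp
      finally show ?thesis .
    qed
    have h: "(\<lambda>\<zeta>. \<zeta> ^ j) holomorphic_on ball 0 2" by (intro holomorphic_intros)
    have "cmod (LINT \<zeta>|rad nu.area. f \<zeta> * cnj (1 * \<zeta> ^ j)) \<le> 2 * P powr ((q - 1) / q) * (C0 * I powr (1 / p))"
      by (rule pairing_bound[OF f C0 one gI I(2) _ h hP P(2)]) simp
    also have "(LINT \<zeta>|rad nu.area. f \<zeta> * cnj (1 * \<zeta> ^ j)) = (deriv ^^ j) f 0 / fact j * of_real (nu.\<mu> j)"
      using coefficient_integral[OF f' nu.area_measurable nu.area_finite, of j] by (simp add: nu.\<mu>_eq_moment)
    finally have "cmod ((deriv ^^ j) f 0) * nu.\<mu> j / fact j \<le> 2 * P powr ((q - 1) / q) * (C0 * I powr (1 / p))"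
      using nu.\<mu>_pos[of j] by (simp add: norm_mult norm_divide)
    then have "cmod ((deriv ^^ j) f 0) \<le> fact j / nu.\<mu> j * (2 * P powr ((q - 1) / q) * (C0 * I powr (1 / p)))"
      using nu.\<mu>_pos[of j] by (simp add: field_simps)
    also have "\<dots> = (K - 1) * C0" by (simp add: K_def)
    also have "\<dots> \<le> K * C0" using C0 by (intro mult_right_mono) auto
    finally show "cmod ((deriv ^^ j) f 0) \<le> K * C0" .
  qed
qed

lemma coefficient_sum_necessary:
  "\<exists>K>0. \<forall>f\<in>bergman1_log \<nu>. \<forall>C0\<ge>0. hankel_estimate f C0 \<longrightarrow> (\<Sum>j<n. cmod ((deriv ^^ j) f 0)) \<le> K * C0"
proof (induction n)
  case 0
  show ?case by (intro exI[of _ 1]) auto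
next
  case (Suc n)
  then obtain K1 where K1: "K1 > 0" "\<forall>f\<in>bergman1_log \<nu>. \<forall>C0\<ge>0. hankel_estimate f C0 \<longrightarrow> (\<Sum>j<n. cmod ((deriv ^^ j) f 0)) \<le> K1 * C0"
    by (elim exE conjE) (rule that)
  from coefficients_necessary[of n] obtain K2 where K2: "K2 > 0" "\<forall>f\<in>bergman1_log \<nu>. \<forall>C0\<ge>0. hankel_estimate f C0 \<longrightarrow> cmod ((deriv ^^ n) f 0) \<le> K2 * C0"
    by (elim exE conjE) (rule that)
  show ?case
  proof (intro exI[of _ "K1 + K2"] conjI ballI allI impI)
    show "0 < K1 + K2" using K1(1) K2(1) by simp
    fix f C0 assume *: "f \<in> bergman1_log \<nu>" "(0::real) \<le> C0" "hankel_estimate f C0"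
    have "(\<Sum>j<n. cmod ((deriv ^^ j) f 0)) \<le> K1 * C0" by (rule K1(2)[rule_format, OF *(1,2)]) (use *(3) in blast)
    moreover have "cmod ((deriv ^^ n) f 0) \<le> K2 * C0" by (rule K2(2)[rule_format, OF *(1,2)]) (use *(3) in blast)
    ultimately show "(\<Sum>j<Suc n. cmod ((deriv ^^ j) f 0)) \<le> (K1 + K2) * C0" by (simp add: distrib_right)
  qed
qed

text \<open>With \<rho> = (1 - r) / (1 - t), the numerator of X may shrink from r to t by at most a
  multiple of \<rho>^((bo + 1) / p), while (1 - t)^(-n) grows by \<rho>^n. The denominator of X
  decreases, which only helps.\<close>

lemma X_almost_increasing:
  assumes n: "bo + 1 \<le> real n * p"
  shows "\<exists>c>0. \<forall>r t. 0 \<le> r \<and> r \<le> t \<and> t < 1 \<longrightarrow> X r / (1 - r) ^ n \<le> c * (X t / (1 - t) ^ n)"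
proof (intro exI[of _ "Co powr (1 / p)"] conjI allI impI)
  show "0 < Co powr (1 / p)" using om.C_ge_1 by simp
  fix r t :: real assume "0 \<le> r \<and> r \<le> t \<and> t < 1"
  then have rt: "0 \<le> r" "r \<le> t" "t < 1" by auto
  define a b \<rho> where "a = 1 - r" and "b = 1 - t" and "\<rho> = a / b"
  have ab: "0 < b" "b \<le> a" "0 < a" using rt by (auto simp: a_def b_def)
  have \<rho>: "1 \<le> \<rho>" using ab by (simp add: \<rho>_def)
  have pos: "0 < om.V r" "0 < om.V t" "0 < nu.V r" "0 < nu.V t"
    using rt by (auto intro!: om.tail_pos nu.tail_pos)
  have "om.V r * a \<le> Co * \<rho> powr bo * om.V t * a"
    using om.lower[OF rt] ab by (intro mult_right_mono) (auto simp: \<rho>_def a_def b_def)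
  also have "\<dots> = Co * (\<rho> powr (bo + 1) * (om.V t * b))"
    using ab \<rho> by (simp add: powr_add \<rho>_def)
  finally have "(om.V r * a) powr (1 / p) \<le> (Co * (\<rho> powr (bo + 1) * (om.V t * b))) powr (1 / p)"
    using pos ab p_pos by (intro powr_mono2) auto
  also have "\<dots> = Co powr (1 / p) * (\<rho> powr ((bo + 1) / p) * (om.V t * b) powr (1 / p))"
    using om.C_ge_1 pos ab \<rho> by (simp add: powr_mult powr_powr)
  also have "\<dots> \<le> Co powr (1 / p) * (\<rho> ^ n * (om.V t * b) powr (1 / p))"
  proof (intro mult_left_mono mult_right_mono)
    have "(bo + 1) / p \<le> real n" using n p_pos by (simp add: field_simps)
    then have "\<rho> powr ((bo + 1) / p) \<le> \<rho> powr real n" using \<rho> by (intro powr_mono) auto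
    then show "\<rho> powr ((bo + 1) / p) \<le> \<rho> ^ n" using \<rho> by (simp add: powr_realpow)
  qed auto
  finally have 1: "(om.V r * a) powr (1 / p) \<le> Co powr (1 / p) * (\<rho> ^ n * (om.V t * b) powr (1 / p))" .
  have "nu.V t * b \<le> nu.V r * a"
    using nu.V_antimono[OF rt(1,2)] ab pos by (intro mult_mono) auto
  then have 2: "(nu.V t * b) powr (1 / q) \<le> (nu.V r * a) powr (1 / q)"
    using q_gt_1 pos ab by (intro powr_mono2) auto
  have "X r / a ^ n \<le> Co powr (1 / p) * (\<rho> ^ n * (om.V t * b) powr (1 / p)) / (nu.V t * b) powr (1 / q) / a ^ n"
    unfolding X_def a_def[symmetric] using 1 2 pos ab \<rho> by (intro divide_right_mono frac_le) auto
  also have "\<dots> = Co powr (1 / p) * (X t / b ^ n)"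
    unfolding X_def b_def[symmetric] \<rho>_def using ab by (simp add: power_divide)
  finally show "X r / (1 - r) ^ n \<le> Co powr (1 / p) * (X t / (1 - t) ^ n)" by (simp add: a_def b_def)
qed

text \<open>k is the number of orders gone down from n. Each step applies the mean value inequality
  on the disc of radius |z|, where \<open>X_almost_increasing\<close> replaces the majorant by a
  multiple of its value at |z|. No power of 1 - |z| is gained, and none is required by
  \<open>sufficiency_core\<close>.\<close>

lemma lower_derivatives_bound:
  assumes n: "bo + 1 \<le> real n * p"
  shows "\<exists>K>0. \<forall>f A. f holomorphic_on ball 0 1 \<longrightarrow> 0 \<le> A \<longrightarrow>
    (\<forall>z. cmod z < 1 \<longrightarrow> cmod ((deriv ^^ n) f z) \<le> A * (X (cmod z) / (1 - cmod z) ^ n)) \<longrightarrow>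
    (\<forall>j<n. cmod ((deriv ^^ j) f 0) \<le> A) \<longrightarrow>
    (\<forall>z. cmod z < 1 \<longrightarrow> (\<forall>j\<le>n. n \<le> j + k \<longrightarrow> cmod ((deriv ^^ j) f z) \<le> K * A * (X (cmod z) / (1 - cmod z) ^ n)))"
proof (induction k)
  case 0
  show ?case by (intro exI[of _ 1]) auto
next
  case (Suc k)
  define Y where "Y r = X r / (1 - r) ^ n" for r
  have Y_pos: "0 < Y r" if "0 \<le> r" "r < 1" for r using X_pos[OF that] that by (simp add: Y_def)
  from X_almost_increasing[OF n] obtain c where c: "c > 0"
    and c_all: "\<forall>r t. 0 \<le> r \<and> r \<le> t \<and> t < 1 \<longrightarrow> X r / (1 - r) ^ n \<le> c * (X t / (1 - t) ^ n)"
    by (elim exE conjE) (rule that)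
  have Y: "Y r \<le> c * Y t" if "0 \<le> r" "r \<le> t" "t < 1" for r t
    using c_all[rule_format, of r t] that by (simp add: Y_def)
  from Suc obtain K where K: "K > 0" and K_all: "\<forall>f A. f holomorphic_on ball 0 1 \<longrightarrow> 0 \<le> A \<longrightarrow>
    (\<forall>z. cmod z < 1 \<longrightarrow> cmod ((deriv ^^ n) f z) \<le> A * Y (cmod z)) \<longrightarrow>
    (\<forall>j<n. cmod ((deriv ^^ j) f 0) \<le> A) \<longrightarrow>
    (\<forall>z. cmod z < 1 \<longrightarrow> (\<forall>j\<le>n. n \<le> j + k \<longrightarrow> cmod ((deriv ^^ j) f z) \<le> K * A * Y (cmod z)))"
    by (elim exE conjE) (rule that, assumption, unfold Y_def)
  have Y0: "Y 0 > 0" by (rule Y_pos) auto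
  \<comment> \<open>The last summand bounds the increment from 0 to z, the middle one the value at
    0, which is charged to Y(|z|) through Y 0 \<le> c Y(|z|).\<close>
  define K' where "K' = K + c * (1 / Y 0 + K)"
  have K': "K \<le> K'" using K c Y0 by (simp add: K'_def)
  show ?case unfolding Y_def[symmetric]
  proof (intro exI[of _ K'] conjI allI impI)
    show "K' > 0" using K K' by simp
    fix f A z j
    assume f: "f holomorphic_on ball 0 1" and A: "(0::real) \<le> A"
      and top: "\<forall>z. cmod z < 1 \<longrightarrow> cmod ((deriv ^^ n) f z) \<le> A * Y (cmod z)"
      and origin: "\<forall>j<n. cmod ((deriv ^^ j) f 0) \<le> A"
      and z: "cmod z < 1" and j: "j \<le> n" "n \<le> j + Suc k"
    have IH: "cmod ((deriv ^^ i) f w) \<le> K * A * Y (cmod w)" if "cmod w < 1" "i \<le> n" "n \<le> i + k" for i w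
      by (rule K_all[rule_format, OF f A _ _ that]) (use top origin in auto)
    have Yz: "Y (cmod z) > 0" using z by (intro Y_pos) auto
    show "cmod ((deriv ^^ j) f z) \<le> K' * A * Y (cmod z)"
    proof (cases "n \<le> j + k")
      case True
      have "cmod ((deriv ^^ j) f z) \<le> K * A * Y (cmod z)" by (rule IH[OF z j(1) True])
      also have "\<dots> \<le> K' * A * Y (cmod z)" using K' A Yz by (intro mult_right_mono) auto
      finally show ?thesis .
    next
      case False
      then have j': "j < n" "Suc j \<le> n" "n \<le> Suc j + k" using j by auto
      define B where "B = K * A * (c * Y (cmod z))"
      have B: "B \<ge> 0" using K A c Yz by (simp add: B_def)
      have "cmod ((deriv ^^ j) f z - (deriv ^^ j) f 0) \<le> B * cmod (z - 0)"
      proof (rule field_differentiable_bound[OF convex_cball[of 0 "cmod z"]])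
        fix w :: complex assume w: "w \<in> cball 0 (cmod z)"
        then have w1: "w \<in> ball 0 1" "cmod w < 1" using z by auto
        show "((deriv ^^ j) f has_field_derivative (deriv ^^ Suc j) f w) (at w within cball 0 (cmod z))"
          by (rule has_field_derivative_at_within[OF has_field_derivative_higher_deriv[OF f open_ball w1(1)]])
        have "cmod ((deriv ^^ Suc j) f w) \<le> K * A * Y (cmod w)" by (rule IH[OF w1(2) j'(2,3)])
        also have "\<dots> \<le> B" unfolding B_def using w z K A by (intro mult_left_mono Y) auto
        finally show "cmod ((deriv ^^ Suc j) f w) \<le> B" .
      qed auto
      also have "\<dots> \<le> B" using B z by (simp add: mult_left_le)
      finally have 1: "cmod ((deriv ^^ j) f z - (deriv ^^ j) f 0) \<le> B" .
      have "Y 0 \<le> c * Y (cmod z)" using z by (intro Y) auto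
      then have "1 \<le> c * Y (cmod z) / Y 0" using Y0 by simp
      then have "A * 1 \<le> A * (c * Y (cmod z) / Y 0)" using A by (intro mult_left_mono)
      then have 2: "cmod ((deriv ^^ j) f 0) \<le> A * (c * Y (cmod z) / Y 0)" using origin[rule_format, OF j'(1)] by linarith
      have "cmod ((deriv ^^ j) f z) \<le> B + A * (c * Y (cmod z) / Y 0)"
        using norm_triangle_sub[of "(deriv ^^ j) f z" "(deriv ^^ j) f 0"] 1 2 by linarith
      also have "\<dots> = (K' - K) * A * Y (cmod z)" by (simp add: B_def K'_def algebra_simps)
      also have "\<dots> \<le> K' * A * Y (cmod z)" using K A Yz by (intro mult_right_mono) auto
      finally show ?thesis .
    qed
  qed
qed

lemma derivative_sufficient:
  assumes n: "bo + 1 \<le> real n * p" "1 \<le> n"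
  shows "\<exists>K>0. \<forall>f\<in>bergman1_log \<nu>. \<forall>A\<ge>0.
    (\<forall>z. cmod z < 1 \<longrightarrow> cmod ((deriv ^^ n) f z) \<le> A * (X (cmod z) / (1 - cmod z) ^ n)) \<longrightarrow>
    (\<forall>j<n. cmod ((deriv ^^ j) f 0) \<le> A) \<longrightarrow> hankel_estimate f (K * A)"
proof -
  obtain m where m: "n = Suc m" using n(2) by (cases n) auto
  from sufficiency_core[of m] obtain K1 where K1: "K1 > 0" and K1_all: "\<forall>f\<in>bergman1_log \<nu>. \<forall>A\<ge>0.
    (\<forall>z. cmod z < 1 \<longrightarrow> (\<forall>j\<le>n. cmod ((deriv ^^ j) f z) \<le> A * (X (cmod z) / (1 - cmod z) ^ n))) \<longrightarrow>
    hankel_estimate f (K1 * A)"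
    by (elim exE conjE) (rule that, assumption, unfold m)
  \<comment> \<open>Going down n orders reaches every derivative, the function itself
    included.\<close>
  from lower_derivatives_bound[OF n(1), of n] obtain K2 where K2: "K2 > 0"
    and K2_all: "\<forall>f A. f holomorphic_on ball 0 1 \<longrightarrow> 0 \<le> A \<longrightarrow>
    (\<forall>z. cmod z < 1 \<longrightarrow> cmod ((deriv ^^ n) f z) \<le> A * (X (cmod z) / (1 - cmod z) ^ n)) \<longrightarrow>
    (\<forall>j<n. cmod ((deriv ^^ j) f 0) \<le> A) \<longrightarrow>
    (\<forall>z. cmod z < 1 \<longrightarrow> (\<forall>j\<le>n. n \<le> j + n \<longrightarrow> cmod ((deriv ^^ j) f z) \<le> K2 * A * (X (cmod z) / (1 - cmod z) ^ n)))"
    by (elim exE conjE) (rule that)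
  show ?thesis
  proof (intro exI[of _ "K1 * K2"] conjI ballI allI impI)
    show "0 < K1 * K2" using K1 K2 by simp
    fix f A g assume f: "f \<in> bergman1_log \<nu>" and A: "(0::real) \<le> A"
      and top: "\<forall>z. cmod z < 1 \<longrightarrow> cmod ((deriv ^^ n) f z) \<le> A * (X (cmod z) / (1 - cmod z) ^ n)"
      and origin: "\<forall>j<n. cmod ((deriv ^^ j) f 0) \<le> A" and g: "g \<in> H_infinity"
    have A': "0 \<le> K2 * A" using A K2 by simp
    have "hankel_estimate f (K1 * (K2 * A))"
    proof (rule K1_all[THEN bspec, OF f, THEN spec, THEN mp, THEN mp, OF A'], intro allI impI)
      fix z j assume z: "cmod z < 1" and j: "j \<le> n"
      show "cmod ((deriv ^^ j) f z) \<le> K2 * A * (X (cmod z) / (1 - cmod z) ^ n)"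
        by (rule K2_all[THEN spec, THEN spec, THEN mp, THEN mp, THEN mp, THEN mp, THEN spec, THEN mp, THEN spec, THEN mp, THEN mp,
              OF nu.bergman1_log_integrable(1)[OF f] A top origin z j]) simp
    qed
    then show "Lp_norm q \<nu> (small_hankel \<nu> f g) \<le> ennreal (K1 * K2 * A) * Lp_norm p \<omega> g"
      using g by (simp add: mult.assoc)
  qed
qed

section \<open>From estimates to the supremum and the operator norm\<close>

lemma deriv_sup_le_iff:
  "deriv_sup p \<omega> q \<nu> n f \<le> ennreal A \<longleftrightarrow>
    (\<forall>z. cmod z < 1 \<longrightarrow> cmod ((deriv ^^ n) f z) \<le> A * (X (cmod z) / (1 - cmod z) ^ n))" if A: "0 \<le> A"
proof -
  have key: "ennreal (cmod ((deriv ^^ n) f z) * (1 - cmod z) ^ n *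
        ((hat \<nu> z * (1 - cmod z)) powr (1 / q) / (hat \<omega> z * (1 - cmod z)) powr (1 / p))) \<le> ennreal A
      \<longleftrightarrow> cmod ((deriv ^^ n) f z) \<le> A * (X (cmod z) / (1 - cmod z) ^ n)" if z: "cmod z < 1" for z
  proof -
    have X: "X (cmod z) > 0" using z by (intro X_pos) auto
    have d: "(1 - cmod z) ^ n > 0" using z by simp
    have E: "(hat \<nu> z * (1 - cmod z)) powr (1 / q) / (hat \<omega> z * (1 - cmod z)) powr (1 / p) = 1 / X (cmod z)"
      by (simp add: om.hat_cmod[OF z] nu.hat_cmod[OF z] X_def)
    show ?thesis unfolding E using A X d by (simp add: ennreal_le_iff field_simps)
  qed
  show ?thesis unfolding deriv_sup_def SUP_le_iff by (simp only: Ball_def mem_ball_0 key cong: imp_cong)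
qed

lemma necessary:
  assumes M: "real M * p - 1 > bo" and n: "real M + bn \<le> real n"
  shows "\<exists>K>0. \<forall>f\<in>bergman1_log \<nu>. \<forall>C0\<ge>0. hankel_estimate f C0 \<longrightarrow>
    deriv_sup p \<omega> q \<nu> n f + ennreal (\<Sum>j<n. cmod ((deriv ^^ j) f 0)) \<le> ennreal (K * C0)"
proof -
  from derivative_necessary[OF M n] obtain K1 where K1: "K1 > 0"
    and K1_all: "\<forall>f\<in>bergman1_log \<nu>. \<forall>C0\<ge>0. hankel_estimate f C0 \<longrightarrow>
    (\<forall>z. cmod z < 1 \<longrightarrow> cmod ((deriv ^^ n) f z) \<le> K1 * C0 * (X (cmod z) / (1 - cmod z) ^ n))"
    by (elim exE conjE) (rule that)
  from coefficient_sum_necessary[of n] obtain K2 where K2: "K2 > 0"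
    and K2_all: "\<forall>f\<in>bergman1_log \<nu>. \<forall>C0\<ge>0. hankel_estimate f C0 \<longrightarrow> (\<Sum>j<n. cmod ((deriv ^^ j) f 0)) \<le> K2 * C0"
    by (elim exE conjE) (rule that)
  show ?thesis
  proof (intro exI[of _ "K1 + K2"] conjI ballI allI impI)
    show "0 < K1 + K2" using K1 K2 by simp
    fix f C0 assume f: "f \<in> bergman1_log \<nu>" and C0: "(0::real) \<le> C0" "hankel_estimate f C0"
    have nonneg: "0 \<le> K1 * C0" "0 \<le> K2 * C0" using K1 K2 C0 by simp_all
    have "deriv_sup p \<omega> q \<nu> n f \<le> ennreal (K1 * C0)"
      unfolding deriv_sup_le_iff[OF nonneg(1)] by (rule K1_all[THEN bspec, OF f, THEN spec, THEN mp, THEN mp, OF C0])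
    moreover have "ennreal (\<Sum>j<n. cmod ((deriv ^^ j) f 0)) \<le> ennreal (K2 * C0)"
      by (rule ennreal_leI[OF K2_all[THEN bspec, OF f, THEN spec, THEN mp, THEN mp, OF C0]])
    ultimately have "deriv_sup p \<omega> q \<nu> n f + ennreal (\<Sum>j<n. cmod ((deriv ^^ j) f 0)) \<le> ennreal (K1 * C0) + ennreal (K2 * C0)"
      by (rule add_mono)
    also have "\<dots> = ennreal ((K1 + K2) * C0)" using nonneg by (simp add: distrib_right)
    finally show "deriv_sup p \<omega> q \<nu> n f + ennreal (\<Sum>j<n. cmod ((deriv ^^ j) f 0)) \<le> ennreal ((K1 + K2) * C0)" .
  qed
qed

lemma sufficient:
  assumes n: "bo + 1 \<le> real n * p" "1 \<le> n"
  shows "\<exists>K>0. \<forall>f\<in>bergman1_log \<nu>. \<forall>A\<ge>0.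
    deriv_sup p \<omega> q \<nu> n f + ennreal (\<Sum>j<n. cmod ((deriv ^^ j) f 0)) \<le> ennreal A \<longrightarrow> hankel_estimate f (K * A)"
proof -
  from derivative_sufficient[OF n] obtain K where K: "K > 0"
    and K_all: "\<forall>f\<in>bergman1_log \<nu>. \<forall>A\<ge>0.
    (\<forall>z. cmod z < 1 \<longrightarrow> cmod ((deriv ^^ n) f z) \<le> A * (X (cmod z) / (1 - cmod z) ^ n)) \<longrightarrow>
    (\<forall>j<n. cmod ((deriv ^^ j) f 0) \<le> A) \<longrightarrow> hankel_estimate f (K * A)"
    by (elim exE conjE) (rule that)
  have "hankel_estimate f (K * A)" if f: "f \<in> bergman1_log \<nu>" and A: "0 \<le> A"
    and le: "deriv_sup p \<omega> q \<nu> n f + ennreal (\<Sum>j<n. cmod ((deriv ^^ j) f 0)) \<le> ennreal A" for f A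
  proof (rule K_all[THEN bspec, OF f, THEN spec, THEN mp, THEN mp, THEN mp, OF A])
    have "deriv_sup p \<omega> q \<nu> n f + 0 \<le> ennreal A" by (rule order_trans[OF add_left_mono[OF zero_le] le])
    then have "deriv_sup p \<omega> q \<nu> n f \<le> ennreal A" by simp
    then show "\<forall>z. cmod z < 1 \<longrightarrow> cmod ((deriv ^^ n) f z) \<le> A * (X (cmod z) / (1 - cmod z) ^ n)"
      unfolding deriv_sup_le_iff[OF A] .
    have "0 + ennreal (\<Sum>j<n. cmod ((deriv ^^ j) f 0)) \<le> ennreal A" by (rule order_trans[OF add_right_mono[OF zero_le] le])
    then have sum: "(\<Sum>j<n. cmod ((deriv ^^ j) f 0)) \<le> A" using A by (simp add: ennreal_le_iff)
    show "\<forall>j<n. cmod ((deriv ^^ j) f 0) \<le> A"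
    proof (intro allI impI)
      fix j assume "j < n"
      then have "cmod ((deriv ^^ j) f 0) \<le> (\<Sum>j<n. cmod ((deriv ^^ j) f 0))" by (intro member_le_sum) auto
      then show "cmod ((deriv ^^ j) f 0) \<le> A" using sum by simp
    qed
  qed
  then show ?thesis using K by (intro exI[of _ K] conjI ballI allI impI) simp_all
qed

lemma hankel_estimate_mono: "hankel_estimate f C1 \<Longrightarrow> C1 \<le> C2 \<Longrightarrow> hankel_estimate f C2"
  by (blast intro: order_trans mult_right_mono ennreal_leI zero_le)

lemma hankel_characterisation:
  assumes K1: "K1 > 0" and nec: "\<And>C0. 0 \<le> C0 \<Longrightarrow> hankel_estimate f C0 \<Longrightarrow> b \<le> ennreal (K1 * C0)"
    and K2: "K2 > 0" and suf: "\<And>A. 0 \<le> A \<Longrightarrow> b \<le> ennreal A \<Longrightarrow> hankel_estimate f (K2 * A)"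
  shows "hankel_bounded p \<omega> q \<nu> f \<longleftrightarrow> b < \<infinity>"
    and "ennreal (1 / (K1 + K2)) * hankel_norm p \<omega> q \<nu> f \<le> b"
    and "b \<le> ennreal (K1 + K2) * hankel_norm p \<omega> q \<nu> f"
proof -
  have adm: "hankel_estimate f (K2 * B + e)" if "b = ennreal B" "0 \<le> B" "0 < e" for B e
    using hankel_estimate_mono[OF suf[OF that(2)], of "K2 * B + e"] that by simp
  show "hankel_bounded p \<omega> q \<nu> f \<longleftrightarrow> b < \<infinity>"
  proof
    assume "hankel_bounded p \<omega> q \<nu> f"
    then obtain C0 where "C0 > 0" "hankel_estimate f C0" unfolding hankel_bounded_def by (elim exE conjE) (rule that)
    then have "b \<le> ennreal (K1 * C0)" by (intro nec) auto
    then show "b < \<infinity>" by (rule le_less_trans) simp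
  next
    assume "b < \<infinity>"
    then obtain B where B: "b = ennreal B" "0 \<le> B" by (cases b) auto
    have "K2 * B + 1 > 0" using K2 B by (intro add_nonneg_pos) auto
    then show "hankel_bounded p \<omega> q \<nu> f" unfolding hankel_bounded_def
      using adm[OF B zero_less_one] by (intro exI[of _ "K2 * B + 1"] conjI)
  qed
  show "ennreal (1 / (K1 + K2)) * hankel_norm p \<omega> q \<nu> f \<le> b"
  proof (cases "b = \<infinity>")
    case False
    then obtain B where B: "b = ennreal B" "0 \<le> B" by (cases b) auto
    have "hankel_norm p \<omega> q \<nu> f \<le> ennreal (K2 * B)"
    proof (rule ennreal_le_epsilon)
      fix e :: real assume e: "0 < e"
      have "K2 * B + e > 0" using K2 B e by (intro add_nonneg_pos) auto
      then have "hankel_norm p \<omega> q \<nu> f \<le> ennreal (K2 * B + e)"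
        unfolding hankel_norm_def by (intro Inf_lower) (use adm[OF B e] in auto)
      then show "hankel_norm p \<omega> q \<nu> f \<le> ennreal (K2 * B) + ennreal e" using K2 B e by simp
    qed
    then have "ennreal (1 / (K1 + K2)) * hankel_norm p \<omega> q \<nu> f \<le> ennreal (1 / (K1 + K2)) * ennreal (K2 * B)"
      by (rule mult_left_mono[OF _ zero_le])
    also have "\<dots> = ennreal (K2 / (K1 + K2) * B)" using K1 K2 B by (simp add: ennreal_mult[symmetric])
    also have "\<dots> \<le> b" unfolding B(1) using K1 K2 B by (intro ennreal_leI mult_left_le_one_le) auto
    finally show ?thesis .
  qed simp
  have "ennreal (1 / (K1 + K2)) * b \<le> hankel_norm p \<omega> q \<nu> f"
    unfolding hankel_norm_def
  proof (rule Inf_greatest)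
    fix s assume "s \<in> {ennreal C |C. 0 < C \<and> hankel_estimate f C}"
    then obtain C0 where s: "s = ennreal C0" and C0: "C0 > 0" "hankel_estimate f C0" by blast
    have "ennreal (1 / (K1 + K2)) * b \<le> ennreal (1 / (K1 + K2)) * ennreal (K1 * C0)"
      using nec[OF less_imp_le[OF C0(1)] C0(2)] by (rule mult_left_mono[OF _ zero_le])
    also have "\<dots> = ennreal (K1 / (K1 + K2) * C0)" using K1 K2 C0 by (simp add: ennreal_mult[symmetric])
    also have "\<dots> \<le> s" unfolding s using K1 K2 C0 by (intro ennreal_leI mult_left_le_one_le) auto
    finally show "ennreal (1 / (K1 + K2)) * b \<le> s" .
  qed
  then have "ennreal (K1 + K2) * (ennreal (1 / (K1 + K2)) * b) \<le> ennreal (K1 + K2) * hankel_norm p \<omega> q \<nu> f"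
    by (rule mult_left_mono[OF _ zero_le])
  also have "ennreal (K1 + K2) * (ennreal (1 / (K1 + K2)) * b) = b"
  proof -
    have "ennreal (K1 + K2) * ennreal (1 / (K1 + K2)) = 1"
      using K1 K2 by (simp add: ennreal_mult[symmetric] del: ennreal_plus)
    then show ?thesis by (simp only: mult.assoc[symmetric] mult_1_left)
  qed
  finally show "b \<le> ennreal (K1 + K2) * hankel_norm p \<omega> q \<nu> f" .
qed

lemma small_hankel_theorem:
  "\<exists>N::nat.
    (\<forall>f\<in>bergman1_log \<nu>.
       (hankel_bounded p \<omega> q \<nu> f \<longleftrightarrow> (\<exists>n\<ge>N. deriv_sup p \<omega> q \<nu> n f < \<infinity>)) \<and>
       (hankel_bounded p \<omega> q \<nu> f \<longleftrightarrow> (\<forall>n\<ge>N. deriv_sup p \<omega> q \<nu> n f < \<infinity>))) \<and>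
    (\<forall>n\<ge>N. comparable_on (bergman1_log \<nu>)
       (\<lambda>f. hankel_norm p \<omega> q \<nu> f)
       (\<lambda>f. deriv_sup p \<omega> q \<nu> n f + ennreal (\<Sum>j<n. cmod ((deriv ^^ j) f 0))))"
proof -
  \<comment> \<open>M p \<ge> bo + 2 gives the strict inequality M p - 1 > bo for the test functions
    and, for n \<ge> M, the condition of \<open>X_almost_increasing\<close>. In N the second summand
    provides n \<ge> M + bn, and the summand 1 gives n \<ge> 1, so that n is a successor.\<close>
  define M where "M = nat \<lceil>(bo + 2) / p\<rceil>"
  define N where "N = M + nat \<lceil>bn\<rceil> + 1"
  have "(bo + 2) / p \<le> real M" unfolding M_def by (rule real_nat_ceiling_ge)
  then have Mp: "bo + 2 \<le> real M * p" using p_pos by (simp add: pos_divide_le_eq)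
  have "bn \<le> real (nat \<lceil>bn\<rceil>)" by (rule real_nat_ceiling_ge)
  then have n_large: "real M + bn \<le> real n" if "N \<le> n" for n using that by (simp add: N_def)
  have n_ge_1: "1 \<le> n" if "N \<le> n" for n using that by (simp add: N_def)
  have np: "bo + 1 \<le> real n * p" if "N \<le> n" for n
  proof -
    have "real M * p \<le> real n * p" using that p_pos by (intro mult_right_mono) (auto simp: N_def)
    then show ?thesis using Mp by simp
  qed
  have M': "real M * p - 1 > bo" using Mp by simp
  let ?b = "\<lambda>n f. deriv_sup p \<omega> q \<nu> n f + ennreal (\<Sum>j<n. cmod ((deriv ^^ j) f 0))"
  have main: "(\<forall>f\<in>bergman1_log \<nu>. hankel_bounded p \<omega> q \<nu> f \<longleftrightarrow> deriv_sup p \<omega> q \<nu> n f < \<infinity>) \<and>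
    comparable_on (bergman1_log \<nu>) (\<lambda>f. hankel_norm p \<omega> q \<nu> f) (?b n)" if n: "N \<le> n" for n
  proof -
    from necessary[OF M' n_large[OF n]] obtain K1 where K1: "K1 > 0"
      and K1_all: "\<forall>f\<in>bergman1_log \<nu>. \<forall>C0\<ge>0. hankel_estimate f C0 \<longrightarrow> ?b n f \<le> ennreal (K1 * C0)"
      by (elim exE conjE) (rule that)
    from sufficient[OF np[OF n] n_ge_1[OF n]] obtain K2 where K2: "K2 > 0"
      and K2_all: "\<forall>f\<in>bergman1_log \<nu>. \<forall>A\<ge>0. ?b n f \<le> ennreal A \<longrightarrow> hankel_estimate f (K2 * A)"
      by (elim exE conjE) (rule that)
    note char = hankel_characterisation[OF K1 K1_all[THEN bspec, THEN spec, THEN mp, THEN mp] K2 K2_all[THEN bspec, THEN spec, THEN mp, THEN mp]]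
    show ?thesis
    proof (intro conjI ballI)
      fix f assume f: "f \<in> bergman1_log \<nu>"
      have "hankel_bounded p \<omega> q \<nu> f \<longleftrightarrow> ?b n f < \<infinity>" by (rule char(1)[OF f _ _ f])
      \<comment> \<open>The sum over the derivatives at 0 is finite and does not affect finiteness
        of the total.\<close>
      then show "hankel_bounded p \<omega> q \<nu> f \<longleftrightarrow> deriv_sup p \<omega> q \<nu> n f < \<infinity>" by simp
    next
      show "comparable_on (bergman1_log \<nu>) (\<lambda>f. hankel_norm p \<omega> q \<nu> f) (?b n)"
        unfolding comparable_on_def
      proof (intro exI[of _ "K1 + K2"] conjI ballI)
        show "0 < K1 + K2" using K1 K2 by simp
        fix f assume f: "f \<in> bergman1_log \<nu>"
        show "ennreal (1 / (K1 + K2)) * hankel_norm p \<omega> q \<nu> f \<le> ?b n f" by (rule char(2)[OF f _ _ f])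
        show "?b n f \<le> ennreal (K1 + K2) * hankel_norm p \<omega> q \<nu> f" by (rule char(3)[OF f _ _ f])
      qed
    qed
  qed
  show ?thesis
  proof (intro exI[of _ N] conjI ballI allI impI)
    fix f assume f: "f \<in> bergman1_log \<nu>"
    have eq: "hankel_bounded p \<omega> q \<nu> f \<longleftrightarrow> deriv_sup p \<omega> q \<nu> n f < \<infinity>" if "N \<le> n" for n
      using main[OF that] f by blast
    show "hankel_bounded p \<omega> q \<nu> f \<longleftrightarrow> (\<exists>n\<ge>N. deriv_sup p \<omega> q \<nu> n f < \<infinity>)"
      using eq by blast
    show "hankel_bounded p \<omega> q \<nu> f \<longleftrightarrow> (\<forall>n\<ge>N. deriv_sup p \<omega> q \<nu> n f < \<infinity>)"
      using eq by blast
  next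
    fix n assume "N \<le> n"
    from main[OF this] show "comparable_on (bergman1_log \<nu>) (\<lambda>f. hankel_norm p \<omega> q \<nu> f) (?b n)" ..
  qed
qed

end

theorem theorem3:
  fixes p q :: real and \<omega> \<nu> :: "complex \<Rightarrow> real"
  assumes "0 < p" and "p \<le> q" and "1 < q"
    and "\<omega> \<in> class_D" and "\<nu> \<in> class_D"
  shows "\<exists>N::nat.
    (\<forall>f\<in>bergman1_log \<nu>.
       (hankel_bounded p \<omega> q \<nu> f \<longleftrightarrow> (\<exists>n\<ge>N. deriv_sup p \<omega> q \<nu> n f < \<infinity>)) \<and>
       (hankel_bounded p \<omega> q \<nu> f \<longleftrightarrow> (\<forall>n\<ge>N. deriv_sup p \<omega> q \<nu> n f < \<infinity>))) \<and>
    (\<forall>n\<ge>N. comparable_on (bergman1_log \<nu>)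
       (\<lambda>f. hankel_norm p \<omega> q \<nu> f)
       (\<lambda>f. deriv_sup p \<omega> q \<nu> n f + ennreal (\<Sum>j<n. cmod ((deriv ^^ j) f 0))))"
proof -
  obtain uo Co ao bo where om: "D_weight uo Co ao bo \<omega>" using class_D_weight[OF assms(4)] .
  obtain un Cn an bn where nu: "D_weight un Cn an bn \<nu>" using class_D_weight[OF assms(5)] .
  have "two_weights uo Co ao bo \<omega> un Cn an bn \<nu> p q"
    using om nu assms by (intro two_weights.intro two_weights_axioms.intro)
  then show ?thesis by (rule two_weights.small_hankel_theorem)
qed

end
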